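(* Let $A$ be a regular weak multiplier bialgebra over a field $k$ with a left and right full comultiplication, possessing an antipode $S$. Any left $A$-comodule $V$ (with structure maps $\lambda,\varrho:A\otimes V\to A\otimes V$) is a right $A$-comodule as well with the structure maps $$\lambda^S:V\otimes A\to V\otimes A,\quad v\otimes S(b)a\mapsto((V\otimes S)\varrho^{21}(v\otimes b))(1\otimes a),$$ $$\varrho^S:V\otimes A\to V\otimes A,\quad v\otimes aS(b)\mapsto(1\otimes a)((V\otimes S)\lambda^{21}(v\otimes b)).$$ This is the object map of a functor, acting on the morphisms as the identity map, from the category of left $A$-comodules to the category of right $A$-comodules.
   Context: Conventions. All vector spaces are over a field $k$; $\otimes$ is $\otimes_k$; the identity map of a space $V$ is also denoted by $V$; composition is juxtaposition; $\mathsf{Lin}(V,W)$ is the space of linear maps; $\mathsf{tw}$ is the flip; $\langle\ldots\rangle$ denotes linear span. For a linear map $f:V\otimes W\to V'\otimes W'$ put $f^{21}=\mathsf{tw}f\mathsf{tw}:W\otimes V\to W'\otimes V'$ and $f^{13}=(V'\otimes\mathsf{tw})(f\otimes Z)(V\otimes\mathsf{tw}):V\otimes Z\otimes W\to V'\otimes Z\otimes W'$ for any space $Z$. An associative, possibly non-unital algebra $A$ with multiplication $\mu$ is idempotent if $\mu:A\otimes A\to A$ is surjective, and non-degenerate if each of ($ab=0\ \forall b\in A$) and ($ba=0\ \forall b\in A$) implies $a=0$. For such $A$, $\mathbb M(A)$ is the multiplier algebra of pairs $(\lambda,\varrho)$ of linear maps $A\to A$ with $a\lambda(b)=\varrho(a)b$;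 it is unital and contains $A$ as a two-sided ideal via $(\lambda,\varrho)a=\lambda(a)$, $a(\lambda,\varrho)=\varrho(a)$. A regular weak multiplier bialgebra is an idempotent non-degenerate $k$-algebra $A$ with linear maps $E_1,E_2,T_1,T_2,T_3,T_4:A\otimes A\to A\otimes A$ and $\epsilon:A\to k$ such that for all $a,b,c,d\in A$: (i) $(a\otimes b)E_1(c\otimes d)=E_2(a\otimes b)(c\otimes d)$; (ii) $E_1^2=E_1$; (iii) $(T_2\otimes A)(A\otimes T_1)=(A\otimes T_1)(T_2\otimes A)$; (iv) $(\epsilon\otimes A)T_1=\mu=(A\otimes\epsilon)T_2$; (v) $(\mu\otimes A)T_1^{13}(A\otimes T_1)=T_1(\mu\otimes A)$; (vi) $\langle T_1(a\otimes c)(b\otimes 1)\mid a,b,c\in A\rangle=\langle E_1(b\otimes c)\mid b,c\in A\rangle$ and $\langle(1\otimes c)T_2(b\otimes a)\mid a,b,c\in A\rangle=\langle E_2(b\otimes c)\mid b,c\in A\rangle$; (vii) $(E_1\otimes A)(A\otimes T_1)=(A\otimes T_1)(E_1\otimes A)$ and $(E_2\otimes A)(A\otimes T_2)=(A\otimes T_2)E_2^{13}$; (viii) $(\epsilon\otimes A)((1\otimes a)E_1(b\otimes c))=(\epsilon\otimes A)(T_1(a\otimes c)(b\otimes1))$ and $(\epsilon\otimes A)(E_2(a\otimes b)(1\otimes c))=(\epsilon\otimes A)((1\otimes b)T_2(a\otimes c))$; (ix) $(1\otimes a)T_1(c\otimes b)=T_3(c\otimes a)(1\otimes b)$ and $T_2(a\otimes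 c)(b\otimes1)=(a\otimes1)T_4(b\otimes c)$. Maps $A\to\mathbb M(A)$: $\overline\sqcap^L(a)b=(\epsilon\otimes A)T_2(a\otimes b)$, $b\overline\sqcap^L(a)=(\epsilon\otimes A)E_2(a\otimes b)$; $\overline\sqcap^R(a)b=(A\otimes\epsilon)E_1(b\otimes a)$, $b\overline\sqcap^R(a)=(A\otimes\epsilon)T_1(b\otimes a)$. The comultiplication is right full if $A=\langle(A\otimes\omega)T_1(a\otimes b)\mid a,b\in A,\ \omega\in\mathsf{Lin}(A,k)\rangle$ and left full if $A=\langle(\omega\otimes A)T_2(a\otimes b)\mid a,b\in A,\ \omega\in\mathsf{Lin}(A,k)\rangle$. Antipode. Let $G_1,G_2:A\otimes A\to A\otimes A$ be the (well-defined, idempotent) linear maps $G_1(a\otimes bc)=(a\otimes1)((\overline\sqcap^R\otimes A)\mathsf{tw}T_4(c\otimes b))$ and $G_2(ab\otimes c)=((A\otimes\overline\sqcap^L)\mathsf{tw}T_3(b\otimes a))(1\otimes c)$. $A$ possesses an antipode if there are linear maps $R_1,R_2:A\otimes A\to A\otimes A$ with $R_iT_i=G_i$, $T_iR_i=E_i$, $R_iT_iR_i=R_i$ for $i=1,2$; these are unique, and the antipode is the linear map $S:A\to\mathbb M(A)$ with $S(a)b=(\epsilon\otimes A)R_1(a\otimes b)$ and $bS(a)=(A\otimes\epsilon)R_2(b\otimes a)$. For left and right full comultiplication, $A$ is spanned by the elements $S(b)a$, and also by the elements $aS(b)$ ($a,b\in A$). A right $A$-comodule is a vector space $V$ with linear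 maps $\lambda,\varrho:V\otimes A\to V\otimes A$ such that $(1\otimes a)\lambda(v\otimes b)=\varrho(v\otimes a)(1\otimes b)$ for all $v\in V$, $a,b\in A$, $(\lambda\otimes A)\lambda^{13}(V\otimes E_1)=(\lambda\otimes A)\lambda^{13}$ and $(\lambda\otimes A)\lambda^{13}(V\otimes T_1)=(V\otimes T_1)(\lambda\otimes A)$. A morphism $f:V\to V'$ is a linear map with $\lambda'(f\otimes A)=(f\otimes A)\lambda$. A left $A$-comodule is a vector space $V$ with linear maps $\lambda,\varrho:A\otimes V\to A\otimes V$ such that $(a\otimes1)\lambda(b\otimes v)=\varrho(a\otimes v)(b\otimes1)$ for all $v\in V$, $a,b\in A$, $(A\otimes\lambda)\lambda^{13}(E_1\otimes V)=(A\otimes\lambda)\lambda^{13}$ and $(A\otimes\lambda)\lambda^{13}(T_1\otimes V)=(T_1\otimes V)\lambda^{13}$. A morphism $f:V\to V'$ is a linear map with $\lambda'(A\otimes f)=(A\otimes f)\lambda$ (equivalently $\varrho'(A\otimes f)=(A\otimes f)\varrho$). *)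

theory Defs
  imports Complex_Main "HOL-Library.Function_Algebras" "HOL-Library.FuncSet"
begin

section \<open>Vector spaces and linear maps\<close>

text \<open>
  A vector space is given by a scalar multiplication on an ambient abelian group together with
  a subspace of it. Taking \<open>pts X = UNIV\<close> one obtains every vector space carried by a type;
  the subspaces are needed because tensor products cannot be turned into types of their own.
\<close>

record ('k, 'v) space =
  scl :: "'k \<Rightarrow> 'v \<Rightarrow> 'v"
  pts :: "'v set"

definition vspace :: "('k::field, 'v::ab_group_add) space \<Rightarrow> bool" where
  "vspace X \<longleftrightarrow> vector_space (scl X) \<and> module.subspace (scl X) (pts X)"

definition ground :: "('k::field, 'k) space" where
  "ground = \<lparr>scl = (*), pts = UNIV\<rparr>"

definition is_linear ::
  "('k::field, 'v::ab_group_add) space \<Rightarrow> ('k, 'w::ab_group_add) space \<Rightarrow> ('v \<Rightarrow> 'w) \<Rightarrow> bool" where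
  "is_linear X Y f \<longleftrightarrow>
     (\<forall>x\<in>pts X. f x \<in> pts Y) \<and>
     (\<forall>x\<in>pts X. \<forall>y\<in>pts X. f (x + y) = f x + f y) \<and>
     (\<forall>c. \<forall>x\<in>pts X. f (scl X c x) = scl Y c (f x))"

text \<open>Requiring extensionality makes equality in \<open>Lin X Y\<close> the equality of linear maps.\<close>

definition Lin ::
  "('k::field, 'v::ab_group_add) space \<Rightarrow> ('k, 'w::ab_group_add) space \<Rightarrow> ('v \<Rightarrow> 'w) set" where
  "Lin X Y = {f. is_linear X Y f} \<inter> extensional (pts X)"

definition is_bilinear ::
  "('k::field, 'v::ab_group_add) space \<Rightarrow> ('k, 'w::ab_group_add) space \<Rightarrow>
   ('k, 'z::ab_group_add) space \<Rightarrow> ('v \<Rightarrow> 'w \<Rightarrow> 'z) \<Rightarrow> bool" where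
  "is_bilinear X Y Z h \<longleftrightarrow>
     (\<forall>x\<in>pts X. is_linear Y Z (h x)) \<and> (\<forall>y\<in>pts Y. is_linear X Z (\<lambda>x. h x y))"

section \<open>Tensor products\<close>

text \<open>
  The elementary tensor \<open>x \<otimes> y\<close> is realized as evaluation at \<open>(x, y)\<close> of bilinear forms on
  \<open>X \<times> Y\<close>, and \<open>X \<otimes> Y\<close> as the span of the elementary tensors. That this has the universal
  property of the tensor product is proved in \<open>tensor_universal\<close> below.
\<close>

type_synonym ('k, 'v, 'w) tensor = "('v \<Rightarrow> 'w \<Rightarrow> 'k) \<Rightarrow> 'k"

definition pure ::
  "('k::field, 'v::ab_group_add) space \<Rightarrow> ('k, 'w::ab_group_add) space \<Rightarrow>
   'v \<Rightarrow> 'w \<Rightarrow> ('k, 'v, 'w) tensor" where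
  "pure X Y v w = (\<lambda>\<beta>. if is_bilinear X Y ground \<beta> then \<beta> v w else 0)"

abbreviation pure_mixfix (\<open>(_ \<otimes>\<^bsub>_,_\<^esub> _)\<close> [71, 0, 0, 71] 70) where
  "x \<otimes>\<^bsub>X,Y\<^esub> y \<equiv> pure X Y x y"

definition tscale :: "'k::field \<Rightarrow> ('b \<Rightarrow> 'k) \<Rightarrow> 'b \<Rightarrow> 'k" where
  "tscale c t = (\<lambda>\<beta>. c * t \<beta>)"

definition tensor_space ::
  "('k::field, 'v::ab_group_add) space \<Rightarrow> ('k, 'w::ab_group_add) space \<Rightarrow>
   ('k, ('k, 'v, 'w) tensor) space" (infixl \<open>\<odot>\<close> 75) where
  "X \<odot> Y = \<lparr>scl = tscale, pts = module.span tscale {x \<otimes>\<^bsub>X,Y\<^esub> y | x y. x \<in> pts X \<and> y \<in> pts Y}\<rparr>"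

lemma vector_space_tscale: "vector_space (tscale :: 'k::field \<Rightarrow> ('b \<Rightarrow> 'k) \<Rightarrow> 'b \<Rightarrow> 'k)"
  by unfold_locales (auto simp: tscale_def fun_eq_iff algebra_simps)

interpretation ts: vector_space "tscale :: 'k::field \<Rightarrow> ('b \<Rightarrow> 'k) \<Rightarrow> 'b \<Rightarrow> 'k"
  by (rule vector_space_tscale)

lemma scl_tensor_space [simp]: "scl (X \<odot> Y) = tscale"
  by (simp add: tensor_space_def)

lemma vspace_tensor_space [simp]: "vspace (X \<odot> Y)"
  by (simp add: vspace_def tensor_space_def vector_space_tscale)

lemma pure_in_tensor_space:
  "x \<in> pts X \<Longrightarrow> y \<in> pts Y \<Longrightarrow> x \<otimes>\<^bsub>X,Y\<^esub> y \<in> pts (X \<odot> Y)"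
  by (auto simp: tensor_space_def intro: ts.span_base)

lemma vspace_ground [simp]: "vspace ground"
proof -
  interpret vector_space "(*) :: 'a::field \<Rightarrow> 'a \<Rightarrow> 'a"
    by unfold_locales (auto simp: algebra_simps)
  show ?thesis by (simp add: vspace_def ground_def vector_space_axioms)
qed

lemma vspace_closed:
  assumes "vspace X"
  shows "0 \<in> pts X" "x \<in> pts X \<Longrightarrow> y \<in> pts X \<Longrightarrow> x + y \<in> pts X"
    "x \<in> pts X \<Longrightarrow> scl X c x \<in> pts X" "x \<in> pts X \<Longrightarrow> y \<in> pts X \<Longrightarrow> x - y \<in> pts X"
proof -
  interpret vector_space "scl X" using assms by (simp add: vspace_def)
  have s: "subspace (pts X)" using assms by (simp add: vspace_def)
  show "0 \<in> pts X" "x \<in> pts X \<Longrightarrow> y \<in> pts X \<Longrightarrow> x + y \<in> pts X"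
    "x \<in> pts X \<Longrightarrow> scl X c x \<in> pts X" "x \<in> pts X \<Longrightarrow> y \<in> pts X \<Longrightarrow> x - y \<in> pts X"
    using s by (auto intro: subspace_0 subspace_add subspace_scale subspace_diff)
qed

lemma tensor_induct [consumes 1, case_names pure zero add scale]:
  assumes "t \<in> pts (X \<odot> Y)"
    and pure: "\<And>x y. x \<in> pts X \<Longrightarrow> y \<in> pts Y \<Longrightarrow> P (x \<otimes>\<^bsub>X,Y\<^esub> y)"
    and zero: "P 0"
    and add: "\<And>s t. s \<in> pts (X \<odot> Y) \<Longrightarrow> t \<in> pts (X \<odot> Y) \<Longrightarrow> P s \<Longrightarrow> P t \<Longrightarrow> P (s + t)"
    and scale: "\<And>c t. t \<in> pts (X \<odot> Y) \<Longrightarrow> P t \<Longrightarrow> P (tscale c t)"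
  shows "P t"
proof -
  have "t \<in> pts (X \<odot> Y) \<and> P t"
    using assms(1)[unfolded tensor_space_def, simplified]
  proof (induction rule: ts.span_induct_alt)
    case base
    show ?case using zero vspace_closed(1)[OF vspace_tensor_space[of X Y]] by blast
  next
    case (step c x y)
    then obtain a b where ab: "x = a \<otimes>\<^bsub>X,Y\<^esub> b" "a \<in> pts X" "b \<in> pts Y" by blast
    have "x \<in> pts (X \<odot> Y)" "P x" using ab pure pure_in_tensor_space by blast+
    moreover from this have "tscale c x \<in> pts (X \<odot> Y)"
      using vspace_closed(3)[OF vspace_tensor_space[of X Y], of x c] by simp
    ultimately show ?case
      using step.IH scale add vspace_closed(2)[OF vspace_tensor_space[of X Y]] by blast
  qed
  then show ?thesis by blast
qed

lemma separating_functional: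
  assumes Z: "vspace Z" and z: "z \<noteq> 0"
  shows "\<exists>\<phi>. is_linear Z ground \<phi> \<and> \<phi> z \<noteq> 0"
proof -
  interpret vector_space "scl Z" using Z by (simp add: vspace_def)
  have ind: "independent {z}" using z by (simp add: dependent_single)
  define B where "B = extend_basis {z}"
  have B: "independent B" "span B = UNIV" "z \<in> B"
    using independent_extend_basis[OF ind] span_extend_basis[OF ind]
      extend_basis_superset[OF ind] by (auto simp: B_def)
  define \<phi> where "\<phi> = (\<lambda>x. representation B x z)"
  have "is_linear Z ground \<phi>"
    using B by (auto simp: is_linear_def ground_def \<phi>_def representation_add representation_scale)
  moreover have "\<phi> z \<noteq> 0" using B by (simp add: \<phi>_def representation_basis)
  ultimately show ?thesis by blast
qed

lemma functionals_separate:
  assumes Z: "vspace Z" and "z \<in> pts Z" "z' \<in> pts Z"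
    and eq: "\<And>\<phi>. is_linear Z ground \<phi> \<Longrightarrow> \<phi> z = \<phi> z'"
  shows "z = z'"
proof (rule ccontr)
  assume "z \<noteq> z'"
  then obtain \<phi> where \<phi>: "is_linear Z ground \<phi>" "\<phi> (z - z') \<noteq> 0"
    using separating_functional[OF Z, of "z - z'"] by auto
  have "\<phi> ((z - z') + z') = \<phi> (z - z') + \<phi> z'"
    using \<phi>(1) vspace_closed(4)[OF Z assms(2,3)] assms(3) unfolding is_linear_def by blast
  with eq[OF \<phi>(1)] \<phi>(2) show False by simp
qed

text \<open>The universal property; \<open>X\<close> and \<open>Y\<close> need no hypothesis for this.\<close>

theorem tensor_universal:
  fixes X :: "('k::field, 'v::ab_group_add) space" and Y :: "('k, 'w::ab_group_add) space"
    and Z :: "('k, 'z::ab_group_add) space"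
  assumes Z: "vspace Z" and h: "is_bilinear X Y Z h"
  shows "\<exists>!f. f \<in> Lin (X \<odot> Y) Z \<and> (\<forall>x\<in>pts X. \<forall>y\<in>pts Y. f (x \<otimes>\<^bsub>X,Y\<^esub> y) = h x y)"
proof -
  define ev where "ev t \<phi> = t (\<lambda>x y. \<phi> (h x y))" for t :: "('k, 'v, 'w) tensor" and \<phi> :: "'z \<Rightarrow> 'k"
  define R where "R t z \<longleftrightarrow> z \<in> pts Z \<and> (\<forall>\<phi>. is_linear Z ground \<phi> \<longrightarrow> \<phi> z = ev t \<phi>)" for t z
  have R_unique: "z = z'" if "R t z" "R t z'" for t z z'
    using that by (intro functionals_separate[OF Z, of z z']) (auto simp: R_def)
  have R_pure: "R (x \<otimes>\<^bsub>X,Y\<^esub> y) (h x y)" if "x \<in> pts X" "y \<in> pts Y" for x y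
  proof -
    have "is_bilinear X Y ground (\<lambda>x y. \<phi> (h x y))" if "is_linear Z ground \<phi>" for \<phi>
      using that h by (auto simp: is_bilinear_def is_linear_def)
    then show ?thesis
      using h that by (auto simp: R_def ev_def pure_def is_bilinear_def is_linear_def)
  qed
  have R_add: "R (s + t) (y + z)" if "R s y" "R t z" for s t y z
    using that vspace_closed(2)[OF Z] by (auto simp: R_def ev_def is_linear_def)
  have R_scale: "R (tscale c t) (scl Z c z)" if "R t z" for c t z
    using that vspace_closed(3)[OF Z] by (auto simp: R_def ev_def is_linear_def tscale_def ground_def)
  have R_zero: "R 0 0"
  proof -
    have "\<phi> 0 = 0" if "is_linear Z ground \<phi>" for \<phi>
    proof -
      have "\<phi> (0 + 0) = \<phi> 0 + \<phi> 0" using that vspace_closed(1)[OF Z] unfolding is_linear_def by blast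
      then show ?thesis unfolding add_0 using add_cancel_right_right[of "\<phi> 0" "\<phi> 0"] by blast
    qed
    then show ?thesis using vspace_closed(1)[OF Z] by (auto simp: R_def ev_def)
  qed
  have R_ex: "\<exists>z. R t z" if "t \<in> pts (X \<odot> Y)" for t
    using that by (induction rule: tensor_induct) (blast intro: R_pure R_zero R_add R_scale)+
  define f where "f = restrict (\<lambda>t. THE z. R t z) (pts (X \<odot> Y))"
  have f: "f t = z" if "t \<in> pts (X \<odot> Y)" "R t z" for t z
    using that R_unique by (auto simp: f_def)
  have Rf: "R t (f t)" if "t \<in> pts (X \<odot> Y)" for t
    using R_ex[OF that] f[OF that] by auto
  have "f \<in> Lin (X \<odot> Y) Z"
    unfolding Lin_def is_linear_def
  proof (intro IntI CollectI conjI ballI allI)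
    show "f \<in> extensional (pts (X \<odot> Y))" by (simp add: f_def)
  next
    fix t assume t: "t \<in> pts (X \<odot> Y)"
    show "f t \<in> pts Z" using Rf[OF t] by (simp add: R_def)
    fix c
    show "f (scl (X \<odot> Y) c t) = scl Z c (f t)"
      using f[OF vspace_closed(3)[OF vspace_tensor_space t]] R_scale[OF Rf[OF t]] by simp
  next
    fix s t assume st: "s \<in> pts (X \<odot> Y)" "t \<in> pts (X \<odot> Y)"
    show "f (s + t) = f s + f t"
      using f[OF vspace_closed(2)[OF vspace_tensor_space st]] R_add[OF Rf[OF st(1)] Rf[OF st(2)]]
      by simp
  qed
  moreover have "\<forall>x\<in>pts X. \<forall>y\<in>pts Y. f (x \<otimes>\<^bsub>X,Y\<^esub> y) = h x y"
    using f R_pure pure_in_tensor_space by blast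
  moreover have "g = f"
    if g: "g \<in> Lin (X \<odot> Y) Z" "\<forall>x\<in>pts X. \<forall>y\<in>pts Y. g (x \<otimes>\<^bsub>X,Y\<^esub> y) = h x y" for g
  proof
    fix t
    show "g t = f t"
    proof (cases "t \<in> pts (X \<odot> Y)")
      case True
      have "R t (g t)"
        using True
      proof (induction rule: tensor_induct)
        case (pure x y)
        then show ?case using g(2) R_pure by simp
      next
        case zero
        have "g (0 + 0) = g 0 + g 0"
          using g(1) vspace_closed(1)[OF vspace_tensor_space[of X Y]]
          unfolding Lin_def is_linear_def by blast
        then have "g 0 = 0" unfolding add_0 using add_cancel_right_right[of "g 0" "g 0"] by blast
        then show ?case using R_zero by metis
      next
        case (add s t)
        have "g (s + t) = g s + g t" using g(1) add(1,2) by (simp add: Lin_def is_linear_def)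
        then show ?case using R_add[OF add(3,4)] by metis
      next
        case (scale c t)
        have "g (tscale c t) = scl Z c (g t)" using g(1) scale(1) by (simp add: Lin_def is_linear_def)
        then show ?case using R_scale[OF scale(2)] by metis
      qed
      then show ?thesis using f True by simp
    next
      case False
      then show ?thesis using g(1) by (auto simp: Lin_def f_def extensional_def)
    qed
  qed
  ultimately show ?thesis by blast
qed

definition lift ::
  "('k::field, 'v::ab_group_add) space \<Rightarrow> ('k, 'w::ab_group_add) space \<Rightarrow>
   ('k, 'z::ab_group_add) space \<Rightarrow> ('v \<Rightarrow> 'w \<Rightarrow> 'z) \<Rightarrow> ('k, 'v, 'w) tensor \<Rightarrow> 'z" where
  "lift X Y Z h =
     (THE f. f \<in> Lin (X \<odot> Y) Z \<and> (\<forall>x\<in>pts X. \<forall>y\<in>pts Y. f (x \<otimes>\<^bsub>X,Y\<^esub> y) = h x y))"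

text \<open>\<open>tmap X Y X' Y' f g\<close> is \<open>f \<otimes> g : X \<otimes> Y \<rightarrow> X' \<otimes> Y'\<close>.\<close>

definition tmap ::
  "('k::field, 'v::ab_group_add) space \<Rightarrow> ('k, 'w::ab_group_add) space \<Rightarrow>
   ('k, 'v'::ab_group_add) space \<Rightarrow> ('k, 'w'::ab_group_add) space \<Rightarrow>
   ('v \<Rightarrow> 'v') \<Rightarrow> ('w \<Rightarrow> 'w') \<Rightarrow> ('k, 'v, 'w) tensor \<Rightarrow> ('k, 'v', 'w') tensor" where
  "tmap X Y X' Y' f g = lift X Y (X' \<odot> Y') (\<lambda>x y. f x \<otimes>\<^bsub>X',Y'\<^esub> g y)"

definition flip ::
  "('k::field, 'v::ab_group_add) space \<Rightarrow> ('k, 'w::ab_group_add) space \<Rightarrow>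
   ('k, 'v, 'w) tensor \<Rightarrow> ('k, 'w, 'v) tensor" where
  "flip X Y = lift X Y (Y \<odot> X) (\<lambda>x y. y \<otimes>\<^bsub>Y,X\<^esub> x)"

text \<open>\<open>contr1 X Y \<omega>\<close> is \<open>\<omega> \<otimes> Y : X \<otimes> Y \<rightarrow> Y\<close> and \<open>contr2 X Y \<omega>\<close> is \<open>X \<otimes> \<omega> : X \<otimes> Y \<rightarrow> X\<close>.\<close>

definition contr1 ::
  "('k::field, 'v::ab_group_add) space \<Rightarrow> ('k, 'w::ab_group_add) space \<Rightarrow>
   ('v \<Rightarrow> 'k) \<Rightarrow> ('k, 'v, 'w) tensor \<Rightarrow> 'w" where
  "contr1 X Y \<omega> = lift X Y Y (\<lambda>x y. scl Y (\<omega> x) y)"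

definition contr2 ::
  "('k::field, 'v::ab_group_add) space \<Rightarrow> ('k, 'w::ab_group_add) space \<Rightarrow>
   ('w \<Rightarrow> 'k) \<Rightarrow> ('k, 'v, 'w) tensor \<Rightarrow> 'v" where
  "contr2 X Y \<omega> = lift X Y X (\<lambda>x y. scl X (\<omega> y) x)"

text \<open>Triple tensor products are bracketed to the left: \<open>X \<otimes> Y \<otimes> Z\<close> is \<open>X \<odot> Y \<odot> Z = (X \<odot> Y) \<odot> Z\<close>.\<close>

definition assoc ::
  "('k::field, 'v::ab_group_add) space \<Rightarrow> ('k, 'w::ab_group_add) space \<Rightarrow> ('k, 'z::ab_group_add) space \<Rightarrow>
   ('k, ('k, 'v, 'w) tensor, 'z) tensor \<Rightarrow> ('k, 'v, ('k, 'w, 'z) tensor) tensor" where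
  "assoc X Y Z = lift (X \<odot> Y) Z (X \<odot> (Y \<odot> Z))
     (\<lambda>t z. lift X Y (X \<odot> (Y \<odot> Z)) (\<lambda>x y. x \<otimes>\<^bsub>X,Y \<odot> Z\<^esub> (y \<otimes>\<^bsub>Y,Z\<^esub> z)) t)"

definition unassoc ::
  "('k::field, 'v::ab_group_add) space \<Rightarrow> ('k, 'w::ab_group_add) space \<Rightarrow> ('k, 'z::ab_group_add) space \<Rightarrow>
   ('k, 'v, ('k, 'w, 'z) tensor) tensor \<Rightarrow> ('k, ('k, 'v, 'w) tensor, 'z) tensor" where
  "unassoc X Y Z = lift X (Y \<odot> Z) (X \<odot> Y \<odot> Z)
     (\<lambda>x t. lift Y Z (X \<odot> Y \<odot> Z) (\<lambda>y z. (x \<otimes>\<^bsub>X,Y\<^esub> y) \<otimes>\<^bsub>X \<odot> Y,Z\<^esub> z) t)"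

text \<open>\<open>tail X Y Z Y' Z' f\<close> is \<open>X \<otimes> f : X \<otimes> Y \<otimes> Z \<rightarrow> X \<otimes> Y' \<otimes> Z'\<close> for \<open>f : Y \<otimes> Z \<rightarrow> Y' \<otimes> Z'\<close>.\<close>

definition tail ::
  "('k::field, 'v::ab_group_add) space \<Rightarrow> ('k, 'w::ab_group_add) space \<Rightarrow> ('k, 'z::ab_group_add) space \<Rightarrow>
   ('k, 'w'::ab_group_add) space \<Rightarrow> ('k, 'z'::ab_group_add) space \<Rightarrow>
   (('k, 'w, 'z) tensor \<Rightarrow> ('k, 'w', 'z') tensor) \<Rightarrow>
   ('k, ('k, 'v, 'w) tensor, 'z) tensor \<Rightarrow> ('k, ('k, 'v, 'w') tensor, 'z') tensor" where
  "tail X Y Z Y' Z' f t =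
     unassoc X Y' Z' (tmap X (Y \<odot> Z) X (Y' \<odot> Z') (\<lambda>x. x) f (assoc X Y Z t))"

text \<open>
  The endomorphisms \<open>f \<otimes> Z\<close>, \<open>X \<otimes> f\<close> and \<open>f\<^sup>1\<^sup>3\<close> of \<open>X \<otimes> Y \<otimes> Z\<close> given by an endomorphism \<open>f\<close> of
  \<open>X \<otimes> Y\<close>, of \<open>Y \<otimes> Z\<close> and of \<open>X \<otimes> Z\<close>, respectively.
\<close>

definition leg12 ::
  "('k::field, 'v::ab_group_add) space \<Rightarrow> ('k, 'w::ab_group_add) space \<Rightarrow> ('k, 'z::ab_group_add) space \<Rightarrow>
   (('k, 'v, 'w) tensor \<Rightarrow> ('k, 'v, 'w) tensor) \<Rightarrow>
   ('k, ('k, 'v, 'w) tensor, 'z) tensor \<Rightarrow> ('k, ('k, 'v, 'w) tensor, 'z) tensor" where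
  "leg12 X Y Z f = tmap (X \<odot> Y) Z (X \<odot> Y) Z f (\<lambda>z. z)"

definition leg23 ::
  "('k::field, 'v::ab_group_add) space \<Rightarrow> ('k, 'w::ab_group_add) space \<Rightarrow> ('k, 'z::ab_group_add) space \<Rightarrow>
   (('k, 'w, 'z) tensor \<Rightarrow> ('k, 'w, 'z) tensor) \<Rightarrow>
   ('k, ('k, 'v, 'w) tensor, 'z) tensor \<Rightarrow> ('k, ('k, 'v, 'w) tensor, 'z) tensor" where
  "leg23 X Y Z f = tail X Y Z Y Z f"

definition leg13 ::
  "('k::field, 'v::ab_group_add) space \<Rightarrow> ('k, 'w::ab_group_add) space \<Rightarrow> ('k, 'z::ab_group_add) space \<Rightarrow>
   (('k, 'v, 'z) tensor \<Rightarrow> ('k, 'v, 'z) tensor) \<Rightarrow>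
   ('k, ('k, 'v, 'w) tensor, 'z) tensor \<Rightarrow> ('k, ('k, 'v, 'w) tensor, 'z) tensor" where
  "leg13 X Y Z f t = tail X Z Y Y Z (flip Z Y) (leg12 X Z Y f (tail X Y Z Z Y (flip Y Z) t))"

text \<open>\<open>f\<^sup>2\<^sup>1 : Y \<otimes> X \<rightarrow> Y \<otimes> X\<close> for an endomorphism \<open>f\<close> of \<open>X \<otimes> Y\<close>.\<close>

definition swap21 ::
  "('k::field, 'v::ab_group_add) space \<Rightarrow> ('k, 'w::ab_group_add) space \<Rightarrow>
   (('k, 'v, 'w) tensor \<Rightarrow> ('k, 'v, 'w) tensor) \<Rightarrow> ('k, 'w, 'v) tensor \<Rightarrow> ('k, 'w, 'v) tensor" where
  "swap21 X Y f t = flip X Y (f (flip Y X t))"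

section \<open>Regular weak multiplier bialgebras\<close>

record ('k, 'a) wmb_data =
  alg :: "('k, 'a) space"
  E1 :: "('k, 'a, 'a) tensor \<Rightarrow> ('k, 'a, 'a) tensor"
  E2 :: "('k, 'a, 'a) tensor \<Rightarrow> ('k, 'a, 'a) tensor"
  T1 :: "('k, 'a, 'a) tensor \<Rightarrow> ('k, 'a, 'a) tensor"
  T2 :: "('k, 'a, 'a) tensor \<Rightarrow> ('k, 'a, 'a) tensor"
  T3 :: "('k, 'a, 'a) tensor \<Rightarrow> ('k, 'a, 'a) tensor"
  T4 :: "('k, 'a, 'a) tensor \<Rightarrow> ('k, 'a, 'a) tensor"
  eps :: "'a \<Rightarrow> 'k"

text \<open>
  The class \<open>ring\<close> provides an associative multiplication without unit. Left and right
  multiplication in the legs of a tensor is written with \<open>tmap\<close>: for instance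
  \<open>(a \<otimes> 1) t\<close> is \<open>((a * _) \<otimes> id) t\<close>, abbreviated \<open>tt ((*) a) (\<lambda>y. y) t\<close>.
\<close>

locale wmb =
  fixes H :: "('k::field, 'a::ring) wmb_data"
begin

abbreviation "A \<equiv> alg H"
abbreviation pureA (infixl \<open>\<otimes>\<close> 70) where "a \<otimes> b \<equiv> a \<otimes>\<^bsub>A,A\<^esub> b"
abbreviation "tt f g \<equiv> tmap A A A A f g"
abbreviation "tw \<equiv> flip A A"
abbreviation "eps_id \<equiv> contr1 A A (eps H)"
abbreviation "id_eps \<equiv> contr2 A A (eps H)"

definition mult :: "('k, 'a, 'a) tensor \<Rightarrow> 'a" where
  "mult = lift A A A (*)"

definition mult_id :: "('k, ('k, 'a, 'a) tensor, 'a) tensor \<Rightarrow> ('k, 'a, 'a) tensor" where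
  "mult_id = tmap (A \<odot> A) A A A mult (\<lambda>z. z)"

definition multipliers :: "(('a \<Rightarrow> 'a) \<times> ('a \<Rightarrow> 'a)) set" where
  "multipliers = {(l, r). l \<in> Lin A A \<and> r \<in> Lin A A \<and> (\<forall>a b. a * l b = r a * b)}"

text \<open>For a multiplier \<open>m\<close> and \<open>a\<close> in the algebra, \<open>m a\<close> and \<open>a m\<close>.\<close>

definition lact :: "('a \<Rightarrow> 'a) \<times> ('a \<Rightarrow> 'a) \<Rightarrow> 'a \<Rightarrow> 'a" where
  "lact m a = fst m a"

definition ract :: "'a \<Rightarrow> ('a \<Rightarrow> 'a) \<times> ('a \<Rightarrow> 'a) \<Rightarrow> 'a" where
  "ract a m = snd m a"

definition sqcapL :: "'a \<Rightarrow> ('a \<Rightarrow> 'a) \<times> ('a \<Rightarrow> 'a)" where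
  "sqcapL a = (\<lambda>b. eps_id (T2 H (a \<otimes> b)), \<lambda>b. eps_id (E2 H (a \<otimes> b)))"

definition sqcapR :: "'a \<Rightarrow> ('a \<Rightarrow> 'a) \<times> ('a \<Rightarrow> 'a)" where
  "sqcapR a = (\<lambda>b. id_eps (E1 H (b \<otimes> a)), \<lambda>b. id_eps (T1 H (b \<otimes> a)))"

definition right_full :: bool where
  "right_full \<longleftrightarrow>
     module.span (scl A) {contr2 A A \<omega> (T1 H (a \<otimes> b)) | a b \<omega>. \<omega> \<in> Lin A ground} = UNIV"

definition left_full :: bool where
  "left_full \<longleftrightarrow>
     module.span (scl A) {contr1 A A \<omega> (T2 H (a \<otimes> b)) | a b \<omega>. \<omega> \<in> Lin A ground} = UNIV"

text \<open>
  The map \<open>(a \<otimes> 1) ((\<Sqinter> \<otimes> A) t)\<close> for \<open>\<Sqinter> : A \<rightarrow> M(A)\<close> takes values in \<open>A \<otimes> A\<close>; it is written as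
  \<open>(a \<Sqinter>(_) \<otimes> A) t\<close>, so that no tensor product with the multiplier algebra is needed. The same is
  done below with the antipode in place of \<open>\<Sqinter>\<close>. Since the algebra is idempotent, at most one linear
  map satisfies \<open>is_G1\<close>, and likewise for \<open>is_G2\<close>.
\<close>

definition is_G1 :: "(('k, 'a, 'a) tensor \<Rightarrow> ('k, 'a, 'a) tensor) \<Rightarrow> bool" where
  "is_G1 G \<longleftrightarrow> G \<in> Lin (A \<odot> A) (A \<odot> A) \<and>
     (\<forall>a b c. G (a \<otimes> (b * c)) = tt (\<lambda>x. ract a (sqcapR x)) (\<lambda>y. y) (tw (T4 H (c \<otimes> b))))"

definition is_G2 :: "(('k, 'a, 'a) tensor \<Rightarrow> ('k, 'a, 'a) tensor) \<Rightarrow> bool" where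
  "is_G2 G \<longleftrightarrow> G \<in> Lin (A \<odot> A) (A \<odot> A) \<and>
     (\<forall>a b c. G ((a * b) \<otimes> c) = tt (\<lambda>x. x) (\<lambda>y. lact (sqcapL y) c) (tw (T3 H (b \<otimes> a))))"

definition antipode :: "('a \<Rightarrow> ('a \<Rightarrow> 'a) \<times> ('a \<Rightarrow> 'a)) \<Rightarrow> bool" where
  "antipode S \<longleftrightarrow>
     (\<forall>a. S a \<in> multipliers) \<and>
     (\<exists>R1\<in>Lin (A \<odot> A) (A \<odot> A). \<exists>R2\<in>Lin (A \<odot> A) (A \<odot> A). \<exists>G1 G2.
        is_G1 G1 \<and> is_G2 G2 \<and>
        (\<forall>t\<in>pts (A \<odot> A).
           R1 (T1 H t) = G1 t \<and> T1 H (R1 t) = E1 H t \<and> R1 (T1 H (R1 t)) = R1 t \<and>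
           R2 (T2 H t) = G2 t \<and> T2 H (R2 t) = E2 H t \<and> R2 (T2 H (R2 t)) = R2 t) \<and>
        (\<forall>a b. lact (S a) b = eps_id (R1 (a \<otimes> b)) \<and> ract b (S a) = id_eps (R2 (b \<otimes> a))))"

definition right_comodule ::
  "('k, 'v::ab_group_add) space \<Rightarrow> (('k, 'v, 'a) tensor \<Rightarrow> ('k, 'v, 'a) tensor) \<Rightarrow>
   (('k, 'v, 'a) tensor \<Rightarrow> ('k, 'v, 'a) tensor) \<Rightarrow> bool" where
  "right_comodule V lam rho \<longleftrightarrow>
     vspace V \<and> lam \<in> Lin (V \<odot> A) (V \<odot> A) \<and> rho \<in> Lin (V \<odot> A) (V \<odot> A) \<and>
     (\<forall>v\<in>pts V. \<forall>a b. tmap V A V A (\<lambda>x. x) ((*) a) (lam (v \<otimes>\<^bsub>V,A\<^esub> b))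
                     = tmap V A V A (\<lambda>x. x) (\<lambda>y. y * b) (rho (v \<otimes>\<^bsub>V,A\<^esub> a))) \<and>
     (\<forall>t\<in>pts (V \<odot> A \<odot> A).
        leg12 V A A lam (leg13 V A A lam (leg23 V A A (E1 H) t)) = leg12 V A A lam (leg13 V A A lam t)) \<and>
     (\<forall>t\<in>pts (V \<odot> A \<odot> A).
        leg12 V A A lam (leg13 V A A lam (leg23 V A A (T1 H) t)) = leg23 V A A (T1 H) (leg12 V A A lam t))"

definition left_comodule ::
  "('k, 'v::ab_group_add) space \<Rightarrow> (('k, 'a, 'v) tensor \<Rightarrow> ('k, 'a, 'v) tensor) \<Rightarrow>
   (('k, 'a, 'v) tensor \<Rightarrow> ('k, 'a, 'v) tensor) \<Rightarrow> bool" where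
  "left_comodule V lam rho \<longleftrightarrow>
     vspace V \<and> lam \<in> Lin (A \<odot> V) (A \<odot> V) \<and> rho \<in> Lin (A \<odot> V) (A \<odot> V) \<and>
     (\<forall>v\<in>pts V. \<forall>a b. tmap A V A V ((*) a) (\<lambda>x. x) (lam (b \<otimes>\<^bsub>A,V\<^esub> v))
                     = tmap A V A V (\<lambda>y. y * b) (\<lambda>x. x) (rho (a \<otimes>\<^bsub>A,V\<^esub> v))) \<and>
     (\<forall>t\<in>pts (A \<odot> A \<odot> V).
        leg23 A A V lam (leg13 A A V lam (leg12 A A V (E1 H) t)) = leg23 A A V lam (leg13 A A V lam t)) \<and>
     (\<forall>t\<in>pts (A \<odot> A \<odot> V).
        leg23 A A V lam (leg13 A A V lam (leg12 A A V (T1 H) t)) = leg12 A A V (T1 H) (leg13 A A V lam t))"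

text \<open>
  \<open>S(b) a\<close> is \<open>lact (S b) a\<close> and \<open>a S(b)\<close> is \<open>ract a (S b)\<close>; as these elements only span the algebra, it
  is part of the theorem that exactly one map satisfies each of the two specifications.
\<close>

definition is_lamS ::
  "('a \<Rightarrow> ('a \<Rightarrow> 'a) \<times> ('a \<Rightarrow> 'a)) \<Rightarrow> ('k, 'v::ab_group_add) space \<Rightarrow>
   (('k, 'a, 'v) tensor \<Rightarrow> ('k, 'a, 'v) tensor) \<Rightarrow> (('k, 'v, 'a) tensor \<Rightarrow> ('k, 'v, 'a) tensor) \<Rightarrow> bool" where
  "is_lamS S V rho L \<longleftrightarrow> L \<in> Lin (V \<odot> A) (V \<odot> A) \<and>
     (\<forall>v\<in>pts V. \<forall>a b. L (v \<otimes>\<^bsub>V,A\<^esub> lact (S b) a) =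
        tmap V A V A (\<lambda>x. x) (\<lambda>y. lact (S y) a) (swap21 A V rho (v \<otimes>\<^bsub>V,A\<^esub> b)))"

definition is_rhoS ::
  "('a \<Rightarrow> ('a \<Rightarrow> 'a) \<times> ('a \<Rightarrow> 'a)) \<Rightarrow> ('k, 'v::ab_group_add) space \<Rightarrow>
   (('k, 'a, 'v) tensor \<Rightarrow> ('k, 'a, 'v) tensor) \<Rightarrow> (('k, 'v, 'a) tensor \<Rightarrow> ('k, 'v, 'a) tensor) \<Rightarrow> bool" where
  "is_rhoS S V lam R \<longleftrightarrow> R \<in> Lin (V \<odot> A) (V \<odot> A) \<and>
     (\<forall>v\<in>pts V. \<forall>a b. R (v \<otimes>\<^bsub>V,A\<^esub> ract a (S b)) =
        tmap V A V A (\<lambda>x. x) (\<lambda>y. ract a (S y)) (swap21 A V lam (v \<otimes>\<^bsub>V,A\<^esub> b)))"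

definition lamS ::
  "('a \<Rightarrow> ('a \<Rightarrow> 'a) \<times> ('a \<Rightarrow> 'a)) \<Rightarrow> ('k, 'v::ab_group_add) space \<Rightarrow>
   (('k, 'a, 'v) tensor \<Rightarrow> ('k, 'a, 'v) tensor) \<Rightarrow> ('k, 'v, 'a) tensor \<Rightarrow> ('k, 'v, 'a) tensor" where
  "lamS S V rho = (THE L. is_lamS S V rho L)"

definition rhoS ::
  "('a \<Rightarrow> ('a \<Rightarrow> 'a) \<times> ('a \<Rightarrow> 'a)) \<Rightarrow> ('k, 'v::ab_group_add) space \<Rightarrow>
   (('k, 'a, 'v) tensor \<Rightarrow> ('k, 'a, 'v) tensor) \<Rightarrow> ('k, 'v, 'a) tensor \<Rightarrow> ('k, 'v, 'a) tensor" where
  "rhoS S V lam = (THE R. is_rhoS S V lam R)"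

end

locale regular_wmb = wmb H for H :: "('k::field, 'a::ring) wmb_data" +
  assumes alg_vspace: "vspace A" and alg_pts: "pts A = UNIV"
    and alg_scl: "scl A r (a * b) = scl A r a * b" "scl A r (a * b) = a * scl A r b"
    and idempotent: "mult ` pts (A \<odot> A) = UNIV"
    and nondegenerate: "(\<And>b. a * b = 0) \<Longrightarrow> a = 0" "(\<And>b. b * a = 0) \<Longrightarrow> a = 0"
    and linear_maps:
      "E1 H \<in> Lin (A \<odot> A) (A \<odot> A)" "E2 H \<in> Lin (A \<odot> A) (A \<odot> A)"
      "T1 H \<in> Lin (A \<odot> A) (A \<odot> A)" "T2 H \<in> Lin (A \<odot> A) (A \<odot> A)"
      "T3 H \<in> Lin (A \<odot> A) (A \<odot> A)" "T4 H \<in> Lin (A \<odot> A) (A \<odot> A)"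
      "eps H \<in> Lin A ground"
    and axiom_i: "tt ((*) a) ((*) b) (E1 H (c \<otimes> d)) = tt (\<lambda>x. x * c) (\<lambda>y. y * d) (E2 H (a \<otimes> b))"
    and axiom_ii: "t \<in> pts (A \<odot> A) \<Longrightarrow> E1 H (E1 H t) = E1 H t"
    and axiom_iii: "u \<in> pts (A \<odot> A \<odot> A) \<Longrightarrow>
      leg12 A A A (T2 H) (leg23 A A A (T1 H) u) = leg23 A A A (T1 H) (leg12 A A A (T2 H) u)"
    and axiom_iv: "t \<in> pts (A \<odot> A) \<Longrightarrow> eps_id (T1 H t) = mult t"
      "t \<in> pts (A \<odot> A) \<Longrightarrow> id_eps (T2 H t) = mult t"
    and axiom_v: "u \<in> pts (A \<odot> A \<odot> A) \<Longrightarrow>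
      mult_id (leg13 A A A (T1 H) (leg23 A A A (T1 H) u)) = T1 H (mult_id u)"
    and axiom_vi:
      "ts.span {tt (\<lambda>x. x * b) (\<lambda>y. y) (T1 H (a \<otimes> c)) | a b c. True} = ts.span {E1 H (b \<otimes> c) | b c. True}"
      "ts.span {tt (\<lambda>x. x) ((*) c) (T2 H (b \<otimes> a)) | a b c. True} = ts.span {E2 H (b \<otimes> c) | b c. True}"
    and axiom_vii:
      "u \<in> pts (A \<odot> A \<odot> A) \<Longrightarrow>
        leg12 A A A (E1 H) (leg23 A A A (T1 H) u) = leg23 A A A (T1 H) (leg12 A A A (E1 H) u)"
      "u \<in> pts (A \<odot> A \<odot> A) \<Longrightarrow>
        leg12 A A A (E2 H) (leg23 A A A (T2 H) u) = leg23 A A A (T2 H) (leg13 A A A (E2 H) u)"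
    and axiom_viii:
      "eps_id (tt (\<lambda>x. x) ((*) a) (E1 H (b \<otimes> c))) = eps_id (tt (\<lambda>x. x * b) (\<lambda>y. y) (T1 H (a \<otimes> c)))"
      "eps_id (tt (\<lambda>x. x) (\<lambda>y. y * c) (E2 H (a \<otimes> b))) = eps_id (tt (\<lambda>x. x) ((*) b) (T2 H (a \<otimes> c)))"
    and axiom_ix:
      "tt (\<lambda>x. x) ((*) a) (T1 H (c \<otimes> b)) = tt (\<lambda>x. x) (\<lambda>y. y * b) (T3 H (c \<otimes> a))"
      "tt (\<lambda>x. x * b) (\<lambda>y. y) (T2 H (a \<otimes> c)) = tt ((*) a) (\<lambda>y. y) (T4 H (b \<otimes> c))"

section \<open>Categories of comodules\<close>

record ('o, 'm) cat =
  Ob :: "'o set"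
  Hom :: "'o \<Rightarrow> 'o \<Rightarrow> 'm set"
  Ident :: "'o \<Rightarrow> 'm"
  Comp :: "'o \<Rightarrow> 'o \<Rightarrow> 'o \<Rightarrow> 'm \<Rightarrow> 'm \<Rightarrow> 'm"  \<comment> \<open>\<open>Comp C X Y Z g f\<close> is \<open>X \<rightarrow> Y \<rightarrow> Z\<close>\<close>

definition is_category :: "('o, 'm) cat \<Rightarrow> bool" where
  "is_category C \<longleftrightarrow>
     (\<forall>X\<in>Ob C. Ident C X \<in> Hom C X X) \<and>
     (\<forall>X\<in>Ob C. \<forall>Y\<in>Ob C. \<forall>Z\<in>Ob C. \<forall>f\<in>Hom C X Y. \<forall>g\<in>Hom C Y Z. Comp C X Y Z g f \<in> Hom C X Z) \<and>
     (\<forall>X\<in>Ob C. \<forall>Y\<in>Ob C. \<forall>f\<in>Hom C X Y.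
        Comp C X X Y f (Ident C X) = f \<and> Comp C X Y Y (Ident C Y) f = f) \<and>
     (\<forall>W\<in>Ob C. \<forall>X\<in>Ob C. \<forall>Y\<in>Ob C. \<forall>Z\<in>Ob C. \<forall>f\<in>Hom C W X. \<forall>g\<in>Hom C X Y. \<forall>h\<in>Hom C Y Z.
        Comp C W X Z (Comp C X Y Z h g) f = Comp C W Y Z h (Comp C W X Y g f))"

definition is_functor ::
  "('o, 'm) cat \<Rightarrow> ('p, 'n) cat \<Rightarrow> ('o \<Rightarrow> 'p) \<Rightarrow> ('o \<Rightarrow> 'o \<Rightarrow> 'm \<Rightarrow> 'n) \<Rightarrow> bool" where
  "is_functor C D F G \<longleftrightarrow>
     is_category C \<and> is_category D \<and>
     (\<forall>X\<in>Ob C. F X \<in> Ob D \<and> G X X (Ident C X) = Ident D (F X)) \<and>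
     (\<forall>X\<in>Ob C. \<forall>Y\<in>Ob C. \<forall>f\<in>Hom C X Y. G X Y f \<in> Hom D (F X) (F Y)) \<and>
     (\<forall>X\<in>Ob C. \<forall>Y\<in>Ob C. \<forall>Z\<in>Ob C. \<forall>f\<in>Hom C X Y. \<forall>g\<in>Hom C Y Z.
        G X Z (Comp C X Y Z g f) = Comp D (F X) (F Y) (F Z) (G Y Z g) (G X Y f))"

context wmb
begin

text \<open>
  The objects range over all comodules whose underlying vector space lives in the type \<open>'v\<close>,
  with an arbitrary scalar multiplication and carrier.
\<close>

definition left_comodules ::
  "(('k, 'v::ab_group_add) space \<times> (('k, 'a, 'v) tensor \<Rightarrow> ('k, 'a, 'v) tensor) \<times>
     (('k, 'a, 'v) tensor \<Rightarrow> ('k, 'a, 'v) tensor), 'v \<Rightarrow> 'v) cat" where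
  "left_comodules = \<lparr>
     Ob = {(V, lam, rho). left_comodule V lam rho},
     Hom = (\<lambda>(V, lam, rho) (V', lam', rho'). {f \<in> Lin V V'. \<forall>t\<in>pts (A \<odot> V).
              lam' (tmap A V A V' (\<lambda>y. y) f t) = tmap A V A V' (\<lambda>y. y) f (lam t)}),
     Ident = (\<lambda>(V, _, _). restrict (\<lambda>x. x) (pts V)),
     Comp = (\<lambda>(V, _, _) _ _ g f. compose (pts V) g f)\<rparr>"

definition right_comodules ::
  "(('k, 'v::ab_group_add) space \<times> (('k, 'v, 'a) tensor \<Rightarrow> ('k, 'v, 'a) tensor) \<times>
     (('k, 'v, 'a) tensor \<Rightarrow> ('k, 'v, 'a) tensor), 'v \<Rightarrow> 'v) cat" where
  "right_comodules = \<lparr>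
     Ob = {(V, lam, rho). right_comodule V lam rho},
     Hom = (\<lambda>(V, lam, rho) (V', lam', rho'). {f \<in> Lin V V'. \<forall>t\<in>pts (V \<odot> A).
              lam' (tmap V A V' A f (\<lambda>y. y) t) = tmap V A V' A f (\<lambda>y. y) (lam t)}),
     Ident = (\<lambda>(V, _, _). restrict (\<lambda>x. x) (pts V)),
     Comp = (\<lambda>(V, _, _) _ _ g f. compose (pts V) g f)\<rparr>"

end

end

theory Submission
  imports Defs
begin

text \<open>
  Write \<open>\<Delta>(a)\<close> for the multiplier of \<open>A \<otimes> A\<close> with \<open>T\<^sub>1(a \<otimes> b) = \<Delta>(a)(1 \<otimes> b)\<close> and
  \<open>T\<^sub>2(a \<otimes> b) = (a \<otimes> 1)\<Delta>(b)\<close>, write \<open>E\<close> for the idempotent with \<open>E\<^sub>1(t) = E t\<close> and \<open>E\<^sub>2(t) = t E\<close>,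
  and use Sweedler notation \<open>a\<^sub>1 \<otimes> a\<^sub>2\<close> for \<open>\<Delta>(a)\<close> whenever enough legs are covered by elements of
  \<open>A\<close>. If \<open>A\<close> were a unital Hopf algebra, the theorem would say that composing a coaction with the
  antipode turns left comodules into right ones. This holds because \<open>S\<close> reverses both products and
  coproducts. The same two properties are behind the general case, where nothing has a unit and
  \<open>E\<close> takes the place of \<open>1 \<otimes> 1\<close>.

  \<^bold>\<open>The antipode.\<close> Both \<open>T\<^sub>1\<close> and the idempotent \<open>R\<^sub>1 T\<^sub>1\<close> are left colinear, hence so is the
  quasi-inverse \<open>R\<^sub>1 = R\<^sub>1 T\<^sub>1 R\<^sub>1\<close> (\<open>R1_T2\<close>). This gives \<open>R\<^sub>1(b \<otimes> c) = b\<^sub>1 \<otimes> S(b\<^sub>2) c\<close>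
  (\<open>R1_left\<close>) and, since \<open>E = T\<^sub>1 R\<^sub>1\<close>, also \<open>E(c \<otimes> d) = c\<^sub>1 \<otimes> c\<^sub>2 S(c\<^sub>3) d\<close> (\<open>E1_left\<close>). From the
  latter and its mirror image, fullness of the comultiplication yields that \<open>A\<close> is spanned by the
  elements \<open>S(b) a\<close> and by the elements \<open>a S(b)\<close> (\<open>sl_total\<close>, \<open>sr_total\<close>). Anti-multiplicativity
  \<open>S(a b) = S(b) S(a)\<close> holds first for \<open>a = \<Sqinter>\<^sup>L(y)\<close>, with the barred \<open>\<Sqinter>\<^sup>L\<close> throughout, where \<open>S\<close>
  is known explicitly (\<open>sr_ll\<close>), and then in general (\<open>sl_antimult\<close>). Anti-comultiplicativity
  takes the covered form \<open>\<Delta>(S(a) x)(1 \<otimes> y) = S(a\<^sub>2) x\<^sub>1 \<otimes> S(a\<^sub>1) x\<^sub>2 y\<close> (\<open>T1_sl\<close>), and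
  \<open>(S \<otimes> S)(E\<^sup>2\<^sup>1) = E\<close> is available in the two forms \<open>S_op_E2\<close> and \<open>E1_S_T1\<close>.

  \<^bold>\<open>The twisted comodule.\<close> Multiplying the would-be value \<open>\<lambda>\<^sup>S(v \<otimes> S(b) a)\<close> by \<open>1 \<otimes> c S(d)\<close> from
  the left and using compatibility of \<open>\<lambda>\<close> and \<open>\<rho>\<close> together with anti-multiplicativity gives
  \<open>(1 \<otimes> c)((V \<otimes> S) \<lambda>\<^sup>2\<^sup>1(v \<otimes> d))(1 \<otimes> S(b) a)\<close> (\<open>S_lam_rho\<close>). This depends on \<open>S(b) a\<close> only through
  its value in \<open>A\<close>. As the elements \<open>c S(d)\<close> are jointly faithful, \<open>\<lambda>\<^sup>S\<close> is well defined
  (\<open>extend_from_spanning\<close>), and it is determined by \<open>(1 \<otimes> c S(d)) \<lambda>\<^sup>S(v \<otimes> x)\<close> (\<open>L_test\<close>). The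
  comodule axioms for \<open>\<lambda>\<^sup>S\<close> are verified after multiplication by \<open>c S(b) \<otimes> c' S(d)\<close> (\<open>L_E1\<close>,
  \<open>L_T1\<close>). What has to be compared are then bilinear forms in \<open>d \<otimes> b\<close> that do not change when
  \<open>d \<otimes> b\<close> is replaced by \<open>E(d \<otimes> b)\<close>. The range of \<open>E\<^sub>1\<close> is spanned by the elements \<open>\<Delta>(e)(d \<otimes> b)\<close>,
  so that one may argue with these (\<open>eq_if_E1_invariant\<close>), and there the comodule axioms of \<open>V\<close>
  combine the two coactions into one. A morphism commutes with \<open>\<lambda>\<close>, hence, by \<open>L_test\<close>, with
  \<open>\<lambda>\<^sup>S\<close>.

  \<^bold>\<open>Calculations.\<close> Every tensor is a finite sum of elementary tensors and is determined by its
  values on multilinear forms. Sweedler calculus is carried out on such sums: \<open>xs \<rhd> h\<close> is the sum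
  of the values of \<open>h\<close> over a list \<open>xs\<close> of pairs, \<open>t1 a b\<close> is such a list for \<open>T\<^sub>1(a \<otimes> b)\<close>, and a
  composition of maps on several legs becomes a nested sum. The role of division in computations
  with covered legs is played by the cancellation lemmas: an identity of tensors may be checked
  after applying a separating family of maps to one of the legs (\<open>cancel_middle\<close>).
\<close>

section \<open>Sums over tensors\<close>

definition ev :: "('v \<times> 'w) list \<Rightarrow> ('v \<Rightarrow> 'w \<Rightarrow> 'z::comm_monoid_add) \<Rightarrow> 'z" (infixr \<open>\<rhd>\<close> 60) where
  "xs \<rhd> h = (\<Sum>(p, q)\<leftarrow>xs. h p q)"

lemma ev_Nil [simp]: "[] \<rhd> h = 0"
  by (simp add: ev_def)

lemma ev_Cons [simp]: "(x # xs) \<rhd> h = h (fst x) (snd x) + (xs \<rhd> h)"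
  by (simp add: ev_def split_beta)

lemma ev_append [simp]: "(xs @ ys) \<rhd> h = (xs \<rhd> h) + (ys \<rhd> h)"
  by (simp add: ev_def)

lemma ev_cong [fundef_cong]:
  "xs = ys \<Longrightarrow> (\<And>p q. (p, q) \<in> set ys \<Longrightarrow> h p q = g p q) \<Longrightarrow> (xs \<rhd> h) = (ys \<rhd> g)"
  unfolding ev_def by (metis (mono_tags, lifting) case_prod_conv map_cong old.prod.exhaust)

lemma ev_zero [simp]: "xs \<rhd> (\<lambda>p q. 0) = 0"
  by (induction xs) auto

lemma ev_add: "xs \<rhd> (\<lambda>p q. h p q + g p q) = (xs \<rhd> h) + (xs \<rhd> g)"
  by (induction xs) (auto simp: add_ac)

lemma ev_mult_left: "xs \<rhd> (\<lambda>p q. (c::'b::semiring_0) * h p q) = c * (xs \<rhd> h)"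
  by (induction xs) (auto simp: distrib_left)

lemma ev_mult_right: "xs \<rhd> (\<lambda>p q. h p q * (c::'b::semiring_0)) = (xs \<rhd> h) * c"
  by (induction xs) (auto simp: distrib_right)

lemma ev_swap:
  "xs \<rhd> (\<lambda>p q. ys \<rhd> (\<lambda>r s. h p q r s)) = ys \<rhd> (\<lambda>r s. xs \<rhd> (\<lambda>p q. h p q r s))"
  by (induction xs) (auto simp: ev_add)

lemma ev_hom:
  assumes "f 0 = 0" "\<And>x y. f (x + y) = f x + f y"
  shows "f (xs \<rhd> h) = xs \<rhd> (\<lambda>p q. f (h p q))"
  by (induction xs) (auto simp: assms)

lemma is_linear_0:
  assumes "vspace X" "is_linear X Y f"
  shows "f 0 = 0"
proof -
  have "f (0 + 0) = f 0 + f 0"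
    using assms vspace_closed(1)[OF assms(1)] unfolding is_linear_def by blast
  then show ?thesis unfolding add_0 using add_cancel_right_right[of "f 0" "f 0"] by blast
qed

lemma ev_closed:
  assumes "vspace X" "\<And>p q. (p, q) \<in> set xs \<Longrightarrow> h p q \<in> pts X"
  shows "(xs \<rhd> h) \<in> pts X"
  using assms(2) by (induction xs) (auto intro: vspace_closed[OF assms(1)])

lemma ev_linear:
  assumes X: "vspace X" and f: "is_linear X Y f" and "\<And>p q. (p, q) \<in> set xs \<Longrightarrow> h p q \<in> pts X"
  shows "f (xs \<rhd> h) = xs \<rhd> (\<lambda>p q. f (h p q))"
  using assms(3)
proof (induction xs)
  case Nil
  then show ?case by (simp add: is_linear_0[OF X f])
next
  case (Cons x xs)
  have "h (fst x) (snd x) \<in> pts X" "(xs \<rhd> h) \<in> pts X"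
    using Cons.prems by (auto intro!: ev_closed[OF X])
  then show ?case using f Cons unfolding is_linear_def by simp
qed

lemma ev_apply: "(xs \<rhd> h) z = xs \<rhd> (\<lambda>p q. h p q z)"
  by (induction xs) auto

lemma pure_bilinear: "is_bilinear X Y (X \<odot> Y) (pure X Y)"
proof -
  have "is_linear Y (X \<odot> Y) (pure X Y x)" if "x \<in> pts X" for x
    unfolding is_linear_def
    using that pure_in_tensor_space[of _ X _ Y]
    by (auto simp: fun_eq_iff pure_def[of X Y] tscale_def is_bilinear_def is_linear_def ground_def
        simp del: if_split)
  moreover have "is_linear X (X \<odot> Y) (\<lambda>x. pure X Y x y)" if "y \<in> pts Y" for y
    unfolding is_linear_def
    using that pure_in_tensor_space[of _ X _ Y]
    by (auto simp: fun_eq_iff pure_def[of X Y] tscale_def is_bilinear_def is_linear_def ground_def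
        simp del: if_split)
  ultimately show ?thesis unfolding is_bilinear_def by blast
qed

text \<open>
  Some choice of elementary tensors with sum \<open>t\<close>. Only sums of bilinear expressions over
  \<open>tlist X Y t\<close> are ever formed, and these do not depend on the choice, by \<open>lift_ev\<close> and
  \<open>tensor_eval\<close>.
\<close>

definition tlist ::
  "('k::field, 'v::ab_group_add) space \<Rightarrow> ('k, 'w::ab_group_add) space \<Rightarrow> ('k, 'v, 'w) tensor \<Rightarrow>
   ('v \<times> 'w) list" where
  "tlist X Y t = (SOME xs. set xs \<subseteq> pts X \<times> pts Y \<and> t = (xs \<rhd> pure X Y))"

lemma tlist:
  assumes X: "vspace X" and t: "t \<in> pts (X \<odot> Y)"
  shows "set (tlist X Y t) \<subseteq> pts X \<times> pts Y" "tlist X Y t \<rhd> pure X Y = t"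
proof -
  have "\<exists>xs. set xs \<subseteq> pts X \<times> pts Y \<and> t = (xs \<rhd> pure X Y)"
    using t
  proof (induction rule: tensor_induct)
    case (pure x y)
    then show ?case by (intro exI[of _ "[(x, y)]"]) simp
  next
    case zero
    show ?case by (intro exI[of _ "[]"]) simp
  next
    case (add s t)
    then obtain xs ys where "set xs \<subseteq> pts X \<times> pts Y" "s = (xs \<rhd> pure X Y)"
      "set ys \<subseteq> pts X \<times> pts Y" "t = (ys \<rhd> pure X Y)" by blast
    then show ?case by (intro exI[of _ "xs @ ys"]) simp
  next
    case (scale c t)
    then obtain xs where xs: "set xs \<subseteq> pts X \<times> pts Y" "t = (xs \<rhd> pure X Y)" by blast
    have "tscale c (xs \<rhd> pure X Y) = map (\<lambda>(p, q). (scl X c p, q)) xs \<rhd> pure X Y"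
      using xs(1)
    proof (induction xs)
      case Nil
      show ?case by (simp add: fun_eq_iff tscale_def)
    next
      case (Cons x xs)
      obtain p q where x: "x = (p, q)" by (cases x)
      have "tscale c (p \<otimes>\<^bsub>X,Y\<^esub> q) = scl X c p \<otimes>\<^bsub>X,Y\<^esub> q"
        using pure_bilinear[of X Y] Cons.prems x by (simp add: is_bilinear_def is_linear_def)
      then show ?case using Cons x by (simp add: ts.scale_right_distrib del: plus_fun_apply)
    qed
    moreover have "set (map (\<lambda>(p, q). (scl X c p, q)) xs) \<subseteq> pts X \<times> pts Y"
      using xs(1) by (auto intro: vspace_closed(3)[OF X])
    ultimately show ?case using xs(2) by metis
  qed
  then have "set (tlist X Y t) \<subseteq> pts X \<times> pts Y \<and> t = (tlist X Y t \<rhd> pure X Y)"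
    unfolding tlist_def by (rule someI_ex)
  then show "set (tlist X Y t) \<subseteq> pts X \<times> pts Y" "tlist X Y t \<rhd> pure X Y = t" by auto
qed

lemma tlist_mem:
  assumes "vspace X" "t \<in> pts (X \<odot> Y)" "(p, q) \<in> set (tlist X Y t)"
  shows "p \<in> pts X" "q \<in> pts Y"
  using tlist(1)[OF assms(1,2)] assms(3) by auto

lemma tensor_eval:
  assumes X: "vspace X" and t: "t \<in> pts (X \<odot> Y)" and \<beta>: "is_bilinear X Y ground \<beta>"
  shows "t \<beta> = tlist X Y t \<rhd> \<beta>"
proof -
  have "t \<beta> = (tlist X Y t \<rhd> pure X Y) \<beta>" by (simp add: tlist(2)[OF X t])
  also have "\<dots> = tlist X Y t \<rhd> \<beta>"
    unfolding ev_apply using \<beta> by (simp add: pure_def)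
  finally show ?thesis .
qed

text \<open>
  By definition a tensor vanishes on functions that are not bilinear, so only bilinear forms
  matter.
\<close>

lemma tensor_eqI:
  assumes "s \<in> pts (X \<odot> Y)" "t \<in> pts (X \<odot> Y)"
    and "\<And>\<beta>. is_bilinear X Y ground \<beta> \<Longrightarrow> s \<beta> = t \<beta>"
  shows "s = t"
proof
  fix \<beta>
  have "u \<beta> = 0" if "u \<in> pts (X \<odot> Y)" "\<not> is_bilinear X Y ground \<beta>" for u
    using that(1) by (induction rule: tensor_induct) (auto simp: pure_def that(2) tscale_def)
  then show "s \<beta> = t \<beta>" using assms by metis
qed

lemma tlist_linear:
  assumes X: "vspace X" and f: "is_linear (X \<odot> Y) Z f" and t: "t \<in> pts (X \<odot> Y)"
  shows "f t = tlist X Y t \<rhd> (\<lambda>p q. f (p \<otimes>\<^bsub>X,Y\<^esub> q))"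
proof -
  have "f t = f (tlist X Y t \<rhd> pure X Y)" by (simp add: tlist(2)[OF X t])
  also have "\<dots> = tlist X Y t \<rhd> (\<lambda>p q. f (p \<otimes>\<^bsub>X,Y\<^esub> q))"
    by (rule ev_linear[OF vspace_tensor_space f])
      (auto intro!: pure_in_tensor_space dest: tlist_mem[OF X t])
  finally show ?thesis .
qed

lemma linear_eqI:
  assumes X: "vspace X" and f: "is_linear (X \<odot> Y) Z f" and g: "is_linear (X \<odot> Y) Z g"
    and eq: "\<And>x y. x \<in> pts X \<Longrightarrow> y \<in> pts Y \<Longrightarrow> f (x \<otimes>\<^bsub>X,Y\<^esub> y) = g (x \<otimes>\<^bsub>X,Y\<^esub> y)"
    and t: "t \<in> pts (X \<odot> Y)"
  shows "f t = g t"
  unfolding tlist_linear[OF X f t] tlist_linear[OF X g t]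
  by (rule ev_cong) (auto intro!: eq dest: tlist_mem[OF X t])

lemma LinD: "f \<in> Lin X Y \<Longrightarrow> is_linear X Y f"
  by (simp add: Lin_def)

lemma lift:
  assumes "vspace Z" "is_bilinear X Y Z h"
  shows lift_Lin: "lift X Y Z h \<in> Lin (X \<odot> Y) Z"
    and lift_pure: "x \<in> pts X \<Longrightarrow> y \<in> pts Y \<Longrightarrow> lift X Y Z h (x \<otimes>\<^bsub>X,Y\<^esub> y) = h x y"
  using theI'[OF tensor_universal[OF assms]] unfolding lift_def by blast+

lemma lift_ev:
  assumes "vspace X" "vspace Z" "is_bilinear X Y Z h" "t \<in> pts (X \<odot> Y)"
  shows "lift X Y Z h t = tlist X Y t \<rhd> h"
  unfolding tlist_linear[OF assms(1) LinD[OF lift_Lin[OF assms(2,3)]] assms(4)]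
  by (intro ev_cong refl lift_pure[OF assms(2,3)]) (auto dest: tlist_mem[OF assms(1,4)])

lemma is_linear_comp:
  "is_linear X Y f \<Longrightarrow> is_linear Y Z g \<Longrightarrow> is_linear X Z (\<lambda>x. g (f x))"
  by (auto simp: is_linear_def)

lemma is_linear_id [simp]: "is_linear X X (\<lambda>x. x)"
  by (simp add: is_linear_def)

lemma tmap_bilinear:
  assumes "is_linear X X' f" "is_linear Y Y' g"
  shows "is_bilinear X Y (X' \<odot> Y') (\<lambda>x y. f x \<otimes>\<^bsub>X',Y'\<^esub> g y)"
  using pure_bilinear[of X' Y'] assms unfolding is_bilinear_def is_linear_def by auto

lemma tmap:
  assumes "is_linear X X' f" "is_linear Y Y' g"
  shows tmap_Lin: "tmap X Y X' Y' f g \<in> Lin (X \<odot> Y) (X' \<odot> Y')"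
    and tmap_pure: "x \<in> pts X \<Longrightarrow> y \<in> pts Y \<Longrightarrow>
      tmap X Y X' Y' f g (x \<otimes>\<^bsub>X,Y\<^esub> y) = f x \<otimes>\<^bsub>X',Y'\<^esub> g y"
  unfolding tmap_def using lift[OF vspace_tensor_space tmap_bilinear[OF assms]] by blast+

lemma flip: "flip X Y \<in> Lin (X \<odot> Y) (Y \<odot> X)"
  "x \<in> pts X \<Longrightarrow> y \<in> pts Y \<Longrightarrow> flip X Y (x \<otimes>\<^bsub>X,Y\<^esub> y) = y \<otimes>\<^bsub>Y,X\<^esub> x"
proof -
  have "is_bilinear X Y (Y \<odot> X) (\<lambda>x y. y \<otimes>\<^bsub>Y,X\<^esub> x)"
    using pure_bilinear[of Y X] by (simp add: is_bilinear_def)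
  from lift[OF vspace_tensor_space this]
  show "flip X Y \<in> Lin (X \<odot> Y) (Y \<odot> X)"
    "x \<in> pts X \<Longrightarrow> y \<in> pts Y \<Longrightarrow> flip X Y (x \<otimes>\<^bsub>X,Y\<^esub> y) = y \<otimes>\<^bsub>Y,X\<^esub> x"
    unfolding flip_def by blast+
qed

lemma tmap_eval:
  assumes "vspace X" "vspace X'" "is_linear X X' f" "is_linear Y Y' g" "t \<in> pts (X \<odot> Y)"
    and \<beta>: "is_bilinear X' Y' ground \<beta>"
  shows "tmap X Y X' Y' f g t \<beta> = tlist X Y t \<rhd> (\<lambda>p q. \<beta> (f p) (g q))"
proof -
  have "tmap X Y X' Y' f g t = tlist X Y t \<rhd> (\<lambda>p q. f p \<otimes>\<^bsub>X',Y'\<^esub> g q)"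
    unfolding tmap_def
    by (rule lift_ev[OF assms(1) vspace_tensor_space tmap_bilinear[OF assms(3,4)] assms(5)])
  then show ?thesis using \<beta> by (simp add: ev_apply pure_def)
qed

lemma contr1_eval:
  assumes X: "vspace X" and Y: "vspace Y" and \<omega>: "is_linear X ground \<omega>"
    and \<phi>: "is_linear Y ground \<phi>" and t: "t \<in> pts (X \<odot> Y)"
  shows "contr1 X Y \<omega> t \<in> pts Y" "\<phi> (contr1 X Y \<omega> t) = tlist X Y t \<rhd> (\<lambda>p q. \<omega> p * \<phi> q)"
proof -
  interpret vector_space "scl Y" using Y by (simp add: vspace_def)
  have b: "is_bilinear X Y Y (\<lambda>x y. scl Y (\<omega> x) y)"
    using \<omega> vspace_closed[OF Y]
    by (auto simp: is_bilinear_def is_linear_def ground_def algebra_simps)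
  have eq: "contr1 X Y \<omega> t = tlist X Y t \<rhd> (\<lambda>x y. scl Y (\<omega> x) y)"
    unfolding contr1_def by (rule lift_ev[OF X Y b t])
  show "contr1 X Y \<omega> t \<in> pts Y"
    unfolding eq by (rule ev_closed[OF Y]) (auto intro!: vspace_closed[OF Y] dest: tlist_mem[OF X t])
  have "\<phi> (contr1 X Y \<omega> t) = tlist X Y t \<rhd> (\<lambda>x y. \<phi> (scl Y (\<omega> x) y))"
    unfolding eq by (rule ev_linear[OF Y \<phi>]) (auto intro!: vspace_closed[OF Y] dest: tlist_mem[OF X t])
  also have "\<dots> = tlist X Y t \<rhd> (\<lambda>p q. \<omega> p * \<phi> q)"
    by (rule ev_cong) (use \<phi> in \<open>auto simp: is_linear_def ground_def dest: tlist_mem[OF X t]\<close>)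
  finally show "\<phi> (contr1 X Y \<omega> t) = tlist X Y t \<rhd> (\<lambda>p q. \<omega> p * \<phi> q)" .
qed

lemma contr2_eval:
  assumes X: "vspace X" and \<omega>: "is_linear Y ground \<omega>"
    and \<phi>: "is_linear X ground \<phi>" and t: "t \<in> pts (X \<odot> Y)"
  shows "contr2 X Y \<omega> t \<in> pts X" "\<phi> (contr2 X Y \<omega> t) = tlist X Y t \<rhd> (\<lambda>p q. \<phi> p * \<omega> q)"
proof -
  interpret vector_space "scl X" using X by (simp add: vspace_def)
  have b: "is_bilinear X Y X (\<lambda>x y. scl X (\<omega> y) x)"
    using \<omega> vspace_closed[OF X]
    by (auto simp: is_bilinear_def is_linear_def ground_def algebra_simps)
  have eq: "contr2 X Y \<omega> t = tlist X Y t \<rhd> (\<lambda>x y. scl X (\<omega> y) x)"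
    unfolding contr2_def by (rule lift_ev[OF X X b t])
  show "contr2 X Y \<omega> t \<in> pts X"
    unfolding eq by (rule ev_closed[OF X]) (auto intro!: vspace_closed[OF X] dest: tlist_mem[OF X t])
  have "\<phi> (contr2 X Y \<omega> t) = tlist X Y t \<rhd> (\<lambda>x y. \<phi> (scl X (\<omega> y) x))"
    unfolding eq by (rule ev_linear[OF X \<phi>]) (auto intro!: vspace_closed[OF X] dest: tlist_mem[OF X t])
  also have "\<dots> = tlist X Y t \<rhd> (\<lambda>p q. \<phi> p * \<omega> q)"
    by (rule ev_cong) (use \<phi> in \<open>auto simp: is_linear_def ground_def dest: tlist_mem[OF X t]\<close>)
  finally show "\<phi> (contr2 X Y \<omega> t) = tlist X Y t \<rhd> (\<lambda>p q. \<phi> p * \<omega> q)" .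
qed

section \<open>Maps acting on two legs of a triple tensor product\<close>

lemma is_linear_pure1: "y \<in> pts Y \<Longrightarrow> is_linear X (X \<odot> Y) (\<lambda>x. x \<otimes>\<^bsub>X,Y\<^esub> y)"
  using pure_bilinear[of X Y] by (simp add: is_bilinear_def)

lemma is_linear_pure2: "x \<in> pts X \<Longrightarrow> is_linear Y (X \<odot> Y) (\<lambda>y. x \<otimes>\<^bsub>X,Y\<^esub> y)"
  using pure_bilinear[of X Y] by (simp add: is_bilinear_def)

lemma is_linear_ext: "is_linear X Y f \<Longrightarrow> vspace X \<Longrightarrow> (\<And>x. x \<in> pts X \<Longrightarrow> f x = g x) \<Longrightarrow> is_linear X Y g"
  unfolding is_linear_def using vspace_closed(2,3)[of X] by simp

lemma is_linear_scl: "vspace X \<Longrightarrow> is_linear X X (scl X c)"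
proof -
  assume X: "vspace X"
  interpret vector_space "scl X" using X by (simp add: vspace_def)
  show ?thesis using vspace_closed[OF X] by (simp add: is_linear_def algebra_simps)
qed

text \<open>A sum over a fixed tensor depends linearly on a parameter in the summands.\<close>

lemma is_linear_tlist:
  assumes X: "vspace X" and Z: "vspace Z" and W: "vspace W" and t: "t \<in> pts (X \<odot> Y)"
    and g: "\<And>x y. x \<in> pts X \<Longrightarrow> y \<in> pts Y \<Longrightarrow> is_linear Z W (\<lambda>z. g z x y)"
  shows "is_linear Z W (\<lambda>z. tlist X Y t \<rhd> g z)"
  unfolding is_linear_def
proof (intro conjI ballI allI)
  note mem = tlist_mem[OF X t]
  fix z assume z: "z \<in> pts Z"
  have gz: "g z p q \<in> pts W" if "(p, q) \<in> set (tlist X Y t)" for p q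
    using g[OF mem[OF that]] z by (auto simp: is_linear_def)
  show "(tlist X Y t \<rhd> g z) \<in> pts W" by (intro ev_closed[OF W] gz)
  show "(tlist X Y t \<rhd> g (scl Z c z)) = scl W c (tlist X Y t \<rhd> g z)" for c
    by (subst ev_linear[OF W is_linear_scl[OF W] gz], assumption, rule ev_cong)
       (use g[OF mem] z in \<open>auto simp: is_linear_def\<close>)
  show "(tlist X Y t \<rhd> g (z + z')) = (tlist X Y t \<rhd> g z) + (tlist X Y t \<rhd> g z')"
    if "z' \<in> pts Z" for z'
    unfolding ev_add[symmetric]
    by (rule ev_cong) (use g[OF mem] z that in \<open>auto simp: is_linear_def\<close>)
qed

lemma lift_linear_param:
  assumes X: "vspace X" and Z: "vspace Z" and W: "vspace W"
    and g: "\<And>z. z \<in> pts Z \<Longrightarrow> is_bilinear X Y W (g z)"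
    and g': "\<And>x y. x \<in> pts X \<Longrightarrow> y \<in> pts Y \<Longrightarrow> is_linear Z W (\<lambda>z. g z x y)"
    and t: "t \<in> pts (X \<odot> Y)"
  shows "is_linear Z W (\<lambda>z. lift X Y W (g z) t)"
  by (rule is_linear_ext[OF is_linear_tlist[OF X Z W t g'] Z])
    (simp_all add: lift_ev[OF X W g t])

lemma assoc:
  assumes X: "vspace X" and Z: "vspace Z"
  shows assoc_Lin: "assoc X Y Z \<in> Lin (X \<odot> Y \<odot> Z) (X \<odot> (Y \<odot> Z))"
    and assoc_pure: "x \<in> pts X \<Longrightarrow> y \<in> pts Y \<Longrightarrow> z \<in> pts Z \<Longrightarrow>
      assoc X Y Z ((x \<otimes>\<^bsub>X,Y\<^esub> y) \<otimes>\<^bsub>X \<odot> Y,Z\<^esub> z) = x \<otimes>\<^bsub>X,Y \<odot> Z\<^esub> (y \<otimes>\<^bsub>Y,Z\<^esub> z)"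
proof -
  define g where "g z = (\<lambda>x y. x \<otimes>\<^bsub>X,Y \<odot> Z\<^esub> (y \<otimes>\<^bsub>Y,Z\<^esub> z))" for z
  have g: "is_bilinear X Y (X \<odot> (Y \<odot> Z)) (g z)" if "z \<in> pts Z" for z
    unfolding is_bilinear_def g_def
    using that is_linear_comp[OF is_linear_pure1[OF that] is_linear_pure2]
    by (auto intro!: is_linear_pure1 pure_in_tensor_space)
  have gz: "is_linear Z (X \<odot> (Y \<odot> Z)) (\<lambda>z. g z x y)" if "x \<in> pts X" "y \<in> pts Y" for x y
    unfolding g_def using is_linear_comp[OF is_linear_pure2[OF that(2)] is_linear_pure2[OF that(1)]] .
  have b: "is_bilinear (X \<odot> Y) Z (X \<odot> (Y \<odot> Z)) (\<lambda>t z. lift X Y (X \<odot> (Y \<odot> Z)) (g z) t)"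
    unfolding is_bilinear_def
    using lift_linear_param[OF X Z vspace_tensor_space g gz] LinD[OF lift_Lin[OF vspace_tensor_space g]]
    by auto
  note l = lift[OF vspace_tensor_space b, folded g_def]
  show "assoc X Y Z \<in> Lin (X \<odot> Y \<odot> Z) (X \<odot> (Y \<odot> Z))"
    using l(1) unfolding assoc_def g_def .
  show "x \<in> pts X \<Longrightarrow> y \<in> pts Y \<Longrightarrow> z \<in> pts Z \<Longrightarrow>
      assoc X Y Z ((x \<otimes>\<^bsub>X,Y\<^esub> y) \<otimes>\<^bsub>X \<odot> Y,Z\<^esub> z) = x \<otimes>\<^bsub>X,Y \<odot> Z\<^esub> (y \<otimes>\<^bsub>Y,Z\<^esub> z)"
    using l(2)[of "x \<otimes>\<^bsub>X,Y\<^esub> y" z] lift_pure[OF vspace_tensor_space g, of z x y]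
    unfolding assoc_def g_def by (simp add: pure_in_tensor_space)
qed

lemma unassoc:
  assumes X: "vspace X" and Y: "vspace Y"
  shows unassoc_Lin: "unassoc X Y Z \<in> Lin (X \<odot> (Y \<odot> Z)) (X \<odot> Y \<odot> Z)"
    and unassoc_pure: "x \<in> pts X \<Longrightarrow> y \<in> pts Y \<Longrightarrow> z \<in> pts Z \<Longrightarrow>
      unassoc X Y Z (x \<otimes>\<^bsub>X,Y \<odot> Z\<^esub> (y \<otimes>\<^bsub>Y,Z\<^esub> z)) = (x \<otimes>\<^bsub>X,Y\<^esub> y) \<otimes>\<^bsub>X \<odot> Y,Z\<^esub> z"
proof -
  define g where "g x = (\<lambda>y z. (x \<otimes>\<^bsub>X,Y\<^esub> y) \<otimes>\<^bsub>X \<odot> Y,Z\<^esub> z)" for x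
  have g: "is_bilinear Y Z (X \<odot> Y \<odot> Z) (g x)" if "x \<in> pts X" for x
    unfolding is_bilinear_def g_def
    using that is_linear_comp[OF is_linear_pure2[OF that] is_linear_pure1]
    by (auto intro!: is_linear_pure2 pure_in_tensor_space)
  have gz: "is_linear X (X \<odot> Y \<odot> Z) (\<lambda>x. g x y z)" if "y \<in> pts Y" "z \<in> pts Z" for y z
    unfolding g_def using is_linear_comp[OF is_linear_pure1[OF that(1)] is_linear_pure1[OF that(2)]] .
  have b: "is_bilinear X (Y \<odot> Z) (X \<odot> Y \<odot> Z) (\<lambda>x t. lift Y Z (X \<odot> Y \<odot> Z) (g x) t)"
    unfolding is_bilinear_def
    using lift_linear_param[OF Y X vspace_tensor_space g gz] LinD[OF lift_Lin[OF vspace_tensor_space g]]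
    by auto
  note l = lift[OF vspace_tensor_space b, folded g_def]
  show "unassoc X Y Z \<in> Lin (X \<odot> (Y \<odot> Z)) (X \<odot> Y \<odot> Z)"
    using l(1) unfolding unassoc_def g_def .
  show "x \<in> pts X \<Longrightarrow> y \<in> pts Y \<Longrightarrow> z \<in> pts Z \<Longrightarrow>
      unassoc X Y Z (x \<otimes>\<^bsub>X,Y \<odot> Z\<^esub> (y \<otimes>\<^bsub>Y,Z\<^esub> z)) = (x \<otimes>\<^bsub>X,Y\<^esub> y) \<otimes>\<^bsub>X \<odot> Y,Z\<^esub> z"
    using l(2)[of x "y \<otimes>\<^bsub>Y,Z\<^esub> z"] lift_pure[OF vspace_tensor_space g, of x y z]
    unfolding unassoc_def g_def by (simp add: pure_in_tensor_space)
qed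

lemma tail:
  assumes X: "vspace X" and Y: "vspace Y" and Z: "vspace Z" and Y': "vspace Y'"
    and f: "f \<in> Lin (Y \<odot> Z) (Y' \<odot> Z')"
  shows tail_linear: "is_linear (X \<odot> Y \<odot> Z) (X \<odot> Y' \<odot> Z') (tail X Y Z Y' Z' f)"
    and tail_pure: "x \<in> pts X \<Longrightarrow> y \<in> pts Y \<Longrightarrow> z \<in> pts Z \<Longrightarrow>
      tail X Y Z Y' Z' f ((x \<otimes>\<^bsub>X,Y\<^esub> y) \<otimes>\<^bsub>X \<odot> Y,Z\<^esub> z) =
        tlist Y' Z' (f (y \<otimes>\<^bsub>Y,Z\<^esub> z)) \<rhd> (\<lambda>p q. (x \<otimes>\<^bsub>X,Y'\<^esub> p) \<otimes>\<^bsub>X \<odot> Y',Z'\<^esub> q)"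
proof -
  note t = tmap[OF is_linear_id[of X] LinD[OF f]]
  show "is_linear (X \<odot> Y \<odot> Z) (X \<odot> Y' \<odot> Z') (tail X Y Z Y' Z' f)"
    unfolding tail_def
    by (intro is_linear_comp[OF is_linear_comp[OF LinD[OF assoc_Lin[OF X Z]] LinD[OF t(1)]]
          LinD[OF unassoc_Lin[OF X Y']]])
  assume x: "x \<in> pts X" and y: "y \<in> pts Y" and z: "z \<in> pts Z"
  have f': "f (y \<otimes>\<^bsub>Y,Z\<^esub> z) \<in> pts (Y' \<odot> Z')"
    using LinD[OF f] pure_in_tensor_space[OF y z] by (simp add: is_linear_def)
  have l: "is_linear (Y' \<odot> Z') (X \<odot> Y' \<odot> Z') (\<lambda>w. unassoc X Y' Z' (x \<otimes>\<^bsub>X,Y' \<odot> Z'\<^esub> w))"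
    by (rule is_linear_comp[OF is_linear_pure2[OF x] LinD[OF unassoc_Lin[OF X Y']]])
  have "tail X Y Z Y' Z' f ((x \<otimes>\<^bsub>X,Y\<^esub> y) \<otimes>\<^bsub>X \<odot> Y,Z\<^esub> z) =
      unassoc X Y' Z' (x \<otimes>\<^bsub>X,Y' \<odot> Z'\<^esub> f (y \<otimes>\<^bsub>Y,Z\<^esub> z))"
    using x y z by (simp add: tail_def assoc_pure[OF X Z] t(2) pure_in_tensor_space)
  also have "\<dots> = tlist Y' Z' (f (y \<otimes>\<^bsub>Y,Z\<^esub> z)) \<rhd> (\<lambda>p q. (x \<otimes>\<^bsub>X,Y'\<^esub> p) \<otimes>\<^bsub>X \<odot> Y',Z'\<^esub> q)"
    unfolding tlist_linear[OF Y' l f']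
    by (intro ev_cong refl unassoc_pure[OF X Y' x]) (auto dest: tlist_mem[OF Y' f'])
  finally show "tail X Y Z Y' Z' f ((x \<otimes>\<^bsub>X,Y\<^esub> y) \<otimes>\<^bsub>X \<odot> Y,Z\<^esub> z) =
    tlist Y' Z' (f (y \<otimes>\<^bsub>Y,Z\<^esub> z)) \<rhd> (\<lambda>p q. (x \<otimes>\<^bsub>X,Y'\<^esub> p) \<otimes>\<^bsub>X \<odot> Y',Z'\<^esub> q)" .
qed

lemma leg23:
  assumes "vspace X" "vspace Y" "vspace Z" "f \<in> Lin (Y \<odot> Z) (Y \<odot> Z)"
  shows leg23_linear: "is_linear (X \<odot> Y \<odot> Z) (X \<odot> Y \<odot> Z) (leg23 X Y Z f)"
    and leg23_pure: "x \<in> pts X \<Longrightarrow> y \<in> pts Y \<Longrightarrow> z \<in> pts Z \<Longrightarrow>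
      leg23 X Y Z f ((x \<otimes>\<^bsub>X,Y\<^esub> y) \<otimes>\<^bsub>X \<odot> Y,Z\<^esub> z) =
        tlist Y Z (f (y \<otimes>\<^bsub>Y,Z\<^esub> z)) \<rhd> (\<lambda>p q. (x \<otimes>\<^bsub>X,Y\<^esub> p) \<otimes>\<^bsub>X \<odot> Y,Z\<^esub> q)"
  using tail[OF assms(1-3,2,4)] by (simp_all add: leg23_def[abs_def])

lemma leg12:
  assumes X: "vspace X" and f: "f \<in> Lin (X \<odot> Y) (X \<odot> Y)"
  shows leg12_linear: "is_linear (X \<odot> Y \<odot> Z) (X \<odot> Y \<odot> Z) (leg12 X Y Z f)"
    and leg12_pure: "x \<in> pts X \<Longrightarrow> y \<in> pts Y \<Longrightarrow> z \<in> pts Z \<Longrightarrow>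
      leg12 X Y Z f ((x \<otimes>\<^bsub>X,Y\<^esub> y) \<otimes>\<^bsub>X \<odot> Y,Z\<^esub> z) =
        tlist X Y (f (x \<otimes>\<^bsub>X,Y\<^esub> y)) \<rhd> (\<lambda>p q. (p \<otimes>\<^bsub>X,Y\<^esub> q) \<otimes>\<^bsub>X \<odot> Y,Z\<^esub> z)"
proof -
  note t = tmap[OF LinD[OF f] is_linear_id[of Z]]
  show "is_linear (X \<odot> Y \<odot> Z) (X \<odot> Y \<odot> Z) (leg12 X Y Z f)"
    unfolding leg12_def by (rule LinD[OF t(1)])
  assume x: "x \<in> pts X" and y: "y \<in> pts Y" and z: "z \<in> pts Z"
  have f': "f (x \<otimes>\<^bsub>X,Y\<^esub> y) \<in> pts (X \<odot> Y)"
    using LinD[OF f] pure_in_tensor_space[OF x y] by (simp add: is_linear_def)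
  show "leg12 X Y Z f ((x \<otimes>\<^bsub>X,Y\<^esub> y) \<otimes>\<^bsub>X \<odot> Y,Z\<^esub> z) =
        tlist X Y (f (x \<otimes>\<^bsub>X,Y\<^esub> y)) \<rhd> (\<lambda>p q. (p \<otimes>\<^bsub>X,Y\<^esub> q) \<otimes>\<^bsub>X \<odot> Y,Z\<^esub> z)"
    using tlist_linear[OF X is_linear_pure1[OF z] f'] x y z
    by (simp add: leg12_def t(2) pure_in_tensor_space)
qed

lemma leg13:
  assumes X: "vspace X" and Y: "vspace Y" and Z: "vspace Z" and f: "f \<in> Lin (X \<odot> Z) (X \<odot> Z)"
  shows leg13_linear: "is_linear (X \<odot> Y \<odot> Z) (X \<odot> Y \<odot> Z) (leg13 X Y Z f)"
    and leg13_pure: "x \<in> pts X \<Longrightarrow> y \<in> pts Y \<Longrightarrow> z \<in> pts Z \<Longrightarrow>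
      leg13 X Y Z f ((x \<otimes>\<^bsub>X,Y\<^esub> y) \<otimes>\<^bsub>X \<odot> Y,Z\<^esub> z) =
        tlist X Z (f (x \<otimes>\<^bsub>X,Z\<^esub> z)) \<rhd> (\<lambda>p q. (p \<otimes>\<^bsub>X,Y\<^esub> y) \<otimes>\<^bsub>X \<odot> Y,Z\<^esub> q)"
proof -
  have fl: "tail X Y' Z' Z' Y' (flip Y' Z') ((x \<otimes>\<^bsub>X,Y'\<^esub> y) \<otimes>\<^bsub>X \<odot> Y',Z'\<^esub> z) =
      (x \<otimes>\<^bsub>X,Z'\<^esub> z) \<otimes>\<^bsub>X \<odot> Z',Y'\<^esub> y"
    if "vspace Y'" "vspace Z'" "x \<in> pts X" "y \<in> pts Y'" "z \<in> pts Z'"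
    for Y' :: "('a, 'e::ab_group_add) space" and Z' :: "('a, 'f::ab_group_add) space" and x y z
    using that
    by (simp add: tail_def assoc_pure[OF X] unassoc_pure[OF X] flip(2)
        tmap_pure[OF is_linear_id LinD[OF flip(1)]] pure_in_tensor_space)
  note l = tail_linear[OF X Y Z Z flip(1)[of Y Z]] tail_linear[OF X Z Y Y flip(1)[of Z Y]]
  show "is_linear (X \<odot> Y \<odot> Z) (X \<odot> Y \<odot> Z) (leg13 X Y Z f)"
    unfolding leg13_def[abs_def]
    by (rule is_linear_comp[OF is_linear_comp[OF l(1) leg12_linear[OF X f]] l(2)])
  assume x: "x \<in> pts X" and y: "y \<in> pts Y" and z: "z \<in> pts Z"
  have f': "f (x \<otimes>\<^bsub>X,Z\<^esub> z) \<in> pts (X \<odot> Z)"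
    using LinD[OF f] pure_in_tensor_space[OF x z] by (simp add: is_linear_def)
  have "leg13 X Y Z f ((x \<otimes>\<^bsub>X,Y\<^esub> y) \<otimes>\<^bsub>X \<odot> Y,Z\<^esub> z) = tail X Z Y Y Z (flip Z Y)
     (tlist X Z (f (x \<otimes>\<^bsub>X,Z\<^esub> z)) \<rhd> (\<lambda>p q. (p \<otimes>\<^bsub>X,Z\<^esub> q) \<otimes>\<^bsub>X \<odot> Z,Y\<^esub> y))"
    using x y z by (simp add: leg13_def fl[OF Y Z] leg12_pure[OF X f])
  also have "\<dots> = tlist X Z (f (x \<otimes>\<^bsub>X,Z\<^esub> z)) \<rhd>
      (\<lambda>p q. tail X Z Y Y Z (flip Z Y) ((p \<otimes>\<^bsub>X,Z\<^esub> q) \<otimes>\<^bsub>X \<odot> Z,Y\<^esub> y))"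
    by (rule ev_linear[OF vspace_tensor_space l(2)])
      (auto intro!: pure_in_tensor_space y dest: tlist_mem[OF X f'])
  also have "\<dots> = tlist X Z (f (x \<otimes>\<^bsub>X,Z\<^esub> z)) \<rhd> (\<lambda>p q. (p \<otimes>\<^bsub>X,Y\<^esub> y) \<otimes>\<^bsub>X \<odot> Y,Z\<^esub> q)"
    by (intro ev_cong refl fl[OF Z Y]) (auto intro: y dest: tlist_mem[OF X f'])
  finally show "leg13 X Y Z f ((x \<otimes>\<^bsub>X,Y\<^esub> y) \<otimes>\<^bsub>X \<odot> Y,Z\<^esub> z) =
        tlist X Z (f (x \<otimes>\<^bsub>X,Z\<^esub> z)) \<rhd> (\<lambda>p q. (p \<otimes>\<^bsub>X,Y\<^esub> y) \<otimes>\<^bsub>X \<odot> Y,Z\<^esub> q)" .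
qed

definition is_trilinear ::
  "('k::field, 'v::ab_group_add) space \<Rightarrow> ('k, 'w::ab_group_add) space \<Rightarrow>
   ('k, 'z::ab_group_add) space \<Rightarrow> ('v \<Rightarrow> 'w \<Rightarrow> 'z \<Rightarrow> 'k) \<Rightarrow> bool" where
  "is_trilinear X Y Z h \<longleftrightarrow>
     (\<forall>x\<in>pts X. \<forall>y\<in>pts Y. is_linear Z ground (h x y)) \<and>
     (\<forall>x\<in>pts X. \<forall>z\<in>pts Z. is_linear Y ground (\<lambda>y. h x y z)) \<and>
     (\<forall>y\<in>pts Y. \<forall>z\<in>pts Z. is_linear X ground (\<lambda>x. h x y z))"

text \<open>
  The value of a tensor \<open>u\<close> in \<open>(X \<otimes> Y) \<otimes> Z\<close> on a trilinear form, with the bracketing undone.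
\<close>

definition eval3 ::
  "('k, ('k, 'v, 'w) tensor, 'z) tensor \<Rightarrow> ('v \<Rightarrow> 'w \<Rightarrow> 'z \<Rightarrow> 'k) \<Rightarrow> 'k" where
  "eval3 u h = u (\<lambda>w z. w (\<lambda>x y. h x y z))"

lemma pts_ground [simp]: "pts ground = UNIV" and scl_ground [simp]: "scl ground = (*)"
  by (simp_all add: ground_def)

lemma eval3_linear: "is_linear (X \<odot> Y \<odot> Z) ground (\<lambda>u. eval3 u h)"
  by (simp add: is_linear_def eval3_def tscale_def)

lemma eval3_bilinear:
  assumes X: "vspace X" and Z: "vspace Z" and h: "is_trilinear X Y Z h"
  shows "is_bilinear (X \<odot> Y) Z ground (\<lambda>w z. w (\<lambda>x y. h x y z))"
proof -
  have b: "is_bilinear X Y ground (\<lambda>x y. h x y z)" if "z \<in> pts Z" for z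
    using h that by (simp add: is_bilinear_def is_trilinear_def)
  have "is_linear Z ground (\<lambda>z. w (\<lambda>x y. h x y z))" if w: "w \<in> pts (X \<odot> Y)" for w
  proof -
    have "is_linear Z ground (\<lambda>z. tlist X Y w \<rhd> (\<lambda>x y. h x y z))"
      by (rule is_linear_tlist[OF X Z vspace_ground w])
        (use h in \<open>simp add: is_trilinear_def is_linear_def\<close>)
    then show ?thesis
      by (rule is_linear_ext) (simp_all add: Z tensor_eval[OF X w b])
  qed
  then show ?thesis by (simp add: is_bilinear_def is_linear_def tscale_def)
qed

lemma eval3_pure:
  assumes "vspace X" "vspace Z" "is_trilinear X Y Z h" "x \<in> pts X" "y \<in> pts Y" "z \<in> pts Z"
  shows "eval3 ((x \<otimes>\<^bsub>X,Y\<^esub> y) \<otimes>\<^bsub>X \<odot> Y,Z\<^esub> z) h = h x y z"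
  using eval3_bilinear[OF assms(1-3)] assms(3,6)
  by (simp add: eval3_def pure_def is_bilinear_def is_trilinear_def)

lemma linear_eqI3:
  assumes X: "vspace X" and f: "is_linear (X \<odot> Y \<odot> Z) W f" and g: "is_linear (X \<odot> Y \<odot> Z) W g"
    and eq: "\<And>x y z. x \<in> pts X \<Longrightarrow> y \<in> pts Y \<Longrightarrow> z \<in> pts Z \<Longrightarrow>
      f ((x \<otimes>\<^bsub>X,Y\<^esub> y) \<otimes>\<^bsub>X \<odot> Y,Z\<^esub> z) = g ((x \<otimes>\<^bsub>X,Y\<^esub> y) \<otimes>\<^bsub>X \<odot> Y,Z\<^esub> z)"
    and t: "t \<in> pts (X \<odot> Y \<odot> Z)"
  shows "f t = g t"
proof (rule linear_eqI[OF vspace_tensor_space f g _ t])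
  fix w z assume w: "w \<in> pts (X \<odot> Y)" and z: "z \<in> pts Z"
  show "f (w \<otimes>\<^bsub>X \<odot> Y,Z\<^esub> z) = g (w \<otimes>\<^bsub>X \<odot> Y,Z\<^esub> z)"
    by (rule linear_eqI[OF X is_linear_comp[OF is_linear_pure1[OF z] f]
          is_linear_comp[OF is_linear_pure1[OF z] g] eq[OF _ _ z] w])
qed

lemma eval3_eqI:
  assumes X: "vspace X" and Z: "vspace Z" and "u \<in> pts (X \<odot> Y \<odot> Z)" "v \<in> pts (X \<odot> Y \<odot> Z)"
    and eq: "\<And>h. is_trilinear X Y Z h \<Longrightarrow> eval3 u h = eval3 v h"
  shows "u = v"
proof (rule tensor_eqI[OF assms(3,4)])
  fix \<gamma> assume \<gamma>: "is_bilinear (X \<odot> Y) Z ground \<gamma>"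
  \<comment> \<open>The form on triples that corresponds to \<open>\<gamma>\<close>.\<close>
  define h where "h x y z = \<gamma> (x \<otimes>\<^bsub>X,Y\<^esub> y) z" for x y z
  have h: "is_trilinear X Y Z h"
    unfolding is_trilinear_def h_def
  proof (intro conjI ballI)
    fix x y z assume "x \<in> pts X" "y \<in> pts Y"
    then show "is_linear Z ground (\<lambda>z. \<gamma> (x \<otimes>\<^bsub>X,Y\<^esub> y) z)"
      using \<gamma> by (simp add: is_bilinear_def pure_in_tensor_space)
  next
    fix x z assume x: "x \<in> pts X" and "z \<in> pts Z"
    then have "is_linear (X \<odot> Y) ground (\<lambda>w. \<gamma> w z)" using \<gamma> by (simp add: is_bilinear_def)
    from is_linear_comp[OF is_linear_pure2[OF x] this]
    show "is_linear Y ground (\<lambda>y. \<gamma> (x \<otimes>\<^bsub>X,Y\<^esub> y) z)" .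
  next
    fix y z assume y: "y \<in> pts Y" and "z \<in> pts Z"
    then have "is_linear (X \<odot> Y) ground (\<lambda>w. \<gamma> w z)" using \<gamma> by (simp add: is_bilinear_def)
    from is_linear_comp[OF is_linear_pure1[OF y] this]
    show "is_linear X ground (\<lambda>x. \<gamma> (x \<otimes>\<^bsub>X,Y\<^esub> y) z)" .
  qed
  have "t \<gamma> = eval3 t h" if "t \<in> pts (X \<odot> Y \<odot> Z)" for t
  proof (rule linear_eqI3[OF X _ eval3_linear _ that])
    show "is_linear (X \<odot> Y \<odot> Z) ground (\<lambda>t. t \<gamma>)"
      by (simp add: is_linear_def tscale_def)
    fix x y z assume "x \<in> pts X" "y \<in> pts Y" "z \<in> pts Z"
    then show "((x \<otimes>\<^bsub>X,Y\<^esub> y) \<otimes>\<^bsub>X \<odot> Y,Z\<^esub> z) \<gamma> = eval3 ((x \<otimes>\<^bsub>X,Y\<^esub> y) \<otimes>\<^bsub>X \<odot> Y,Z\<^esub> z) h"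
      by (simp add: eval3_pure[OF X Z h]) (simp add: h_def pure_def \<gamma>)
  qed
  then show "u \<gamma> = v \<gamma>" using eq[OF h] assms(3,4) by simp
qed

lemma Lin_pure_closed:
  "f \<in> Lin (X \<odot> Y) (X' \<odot> Y') \<Longrightarrow> x \<in> pts X \<Longrightarrow> y \<in> pts Y \<Longrightarrow>
    f (x \<otimes>\<^bsub>X,Y\<^esub> y) \<in> pts (X' \<odot> Y')"
  using pure_in_tensor_space[of x X y Y] by (simp add: Lin_def is_linear_def)

lemma eval3_ev:
  assumes X: "vspace X" and Z: "vspace Z" and h: "is_trilinear X Y Z h"
    and "\<And>p q. (p, q) \<in> set xs \<Longrightarrow> f p q \<in> pts X \<and> g p q \<in> pts Y \<and> k p q \<in> pts Z"
  shows "eval3 (xs \<rhd> (\<lambda>p q. (f p q \<otimes>\<^bsub>X,Y\<^esub> g p q) \<otimes>\<^bsub>X \<odot> Y,Z\<^esub> k p q)) h =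
    xs \<rhd> (\<lambda>p q. h (f p q) (g p q) (k p q))"
proof -
  have "eval3 (xs \<rhd> (\<lambda>p q. (f p q \<otimes>\<^bsub>X,Y\<^esub> g p q) \<otimes>\<^bsub>X \<odot> Y,Z\<^esub> k p q)) h =
      xs \<rhd> (\<lambda>p q. eval3 ((f p q \<otimes>\<^bsub>X,Y\<^esub> g p q) \<otimes>\<^bsub>X \<odot> Y,Z\<^esub> k p q) h)"
    by (rule ev_linear[OF vspace_tensor_space[of "X \<odot> Y" Z] eval3_linear])
      (intro pure_in_tensor_space; simp add: assms(4))
  also have "\<dots> = xs \<rhd> (\<lambda>p q. h (f p q) (g p q) (k p q))"
    by (intro ev_cong refl eval3_pure[OF X Z h]) (simp_all add: assms(4))
  finally show ?thesis .
qed

lemma is_trilinear_leg12: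
  assumes X: "vspace X" and Y: "vspace Y" and Z: "vspace Z" and f: "f \<in> Lin (X \<odot> Y) (X \<odot> Y)"
    and h: "is_trilinear X Y Z h"
  shows "is_trilinear X Y Z (\<lambda>x y z. tlist X Y (f (x \<otimes>\<^bsub>X,Y\<^esub> y)) \<rhd> (\<lambda>p q. h p q z))"
proof -
  have b: "is_bilinear X Y ground (\<lambda>x y. h x y z)" if "z \<in> pts Z" for z
    using h that by (simp add: is_bilinear_def is_trilinear_def)
  note eval = tensor_eval[OF X Lin_pure_closed[OF f] b]
  have l: "is_linear (X \<odot> Y) ground (\<lambda>t. f t (\<lambda>x y. h x y z))" if "z \<in> pts Z" for z
    using LinD[OF f] by (simp add: is_linear_def tscale_def)
  show ?thesis
    unfolding is_trilinear_def
  proof (intro conjI ballI)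
    fix x y assume "x \<in> pts X" "y \<in> pts Y"
    then show "is_linear Z ground (\<lambda>z. tlist X Y (f (x \<otimes>\<^bsub>X,Y\<^esub> y)) \<rhd> (\<lambda>p q. h p q z))"
      by (intro is_linear_tlist[OF X Z vspace_ground Lin_pure_closed[OF f]])
        (use h in \<open>simp_all add: is_trilinear_def\<close>)
  next
    fix x z assume x: "x \<in> pts X" and z: "z \<in> pts Z"
    show "is_linear Y ground (\<lambda>y. tlist X Y (f (x \<otimes>\<^bsub>X,Y\<^esub> y)) \<rhd> (\<lambda>p q. h p q z))"
      by (rule is_linear_ext[OF is_linear_comp[OF is_linear_pure2[OF x] l[OF z]] Y])
        (simp add: eval x z)
  next
    fix y z assume y: "y \<in> pts Y" and z: "z \<in> pts Z"
    show "is_linear X ground (\<lambda>x. tlist X Y (f (x \<otimes>\<^bsub>X,Y\<^esub> y)) \<rhd> (\<lambda>p q. h p q z))"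
      by (rule is_linear_ext[OF is_linear_comp[OF is_linear_pure1[OF y] l[OF z]] X])
        (simp add: eval y z)
  qed
qed

lemma is_trilinear_perm:
  "is_trilinear X Y Z h \<Longrightarrow> is_trilinear Y Z X (\<lambda>y z x. h x y z)"
  "is_trilinear X Y Z h \<Longrightarrow> is_trilinear X Z Y (\<lambda>x z y. h x y z)"
  "is_trilinear X Y Z h \<Longrightarrow> is_trilinear Y X Z (\<lambda>y x z. h x y z)"
  by (simp_all add: is_trilinear_def)

lemma is_trilinear_leg23:
  assumes X: "vspace X" and Y: "vspace Y" and Z: "vspace Z" and f: "f \<in> Lin (Y \<odot> Z) (Y \<odot> Z)"
    and h: "is_trilinear X Y Z h"
  shows "is_trilinear X Y Z (\<lambda>x y z. tlist Y Z (f (y \<otimes>\<^bsub>Y,Z\<^esub> z)) \<rhd> (\<lambda>p q. h x p q))"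
  using is_trilinear_leg12[OF Y Z X f is_trilinear_perm(1)[OF h]]
  by (rule is_trilinear_perm(1)[OF is_trilinear_perm(1)])

lemma is_trilinear_leg13:
  assumes X: "vspace X" and Y: "vspace Y" and Z: "vspace Z" and f: "f \<in> Lin (X \<odot> Z) (X \<odot> Z)"
    and h: "is_trilinear X Y Z h"
  shows "is_trilinear X Y Z (\<lambda>x y z. tlist X Z (f (x \<otimes>\<^bsub>X,Z\<^esub> z)) \<rhd> (\<lambda>p q. h p y q))"
  using is_trilinear_leg12[OF X Z Y f is_trilinear_perm(2)[OF h]]
  by (rule is_trilinear_perm(2))

text \<open>
  Applying a map to two legs of a triple tensor amounts to substituting its Sweedler sum into the
  form on which the tensor is evaluated. Iterating this translates identities between maps on a
  triple tensor product into identities between nested sums.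
\<close>

lemma eval3_leg12:
  assumes X: "vspace X" and Y: "vspace Y" and Z: "vspace Z" and f: "f \<in> Lin (X \<odot> Y) (X \<odot> Y)"
    and h: "is_trilinear X Y Z h" and u: "u \<in> pts (X \<odot> Y \<odot> Z)"
  shows "eval3 (leg12 X Y Z f u) h =
    eval3 u (\<lambda>x y z. tlist X Y (f (x \<otimes>\<^bsub>X,Y\<^esub> y)) \<rhd> (\<lambda>p q. h p q z))"
proof (rule linear_eqI3[OF X is_linear_comp[OF leg12_linear[OF X f] eval3_linear] eval3_linear _ u])
  fix x y z assume xyz: "x \<in> pts X" "y \<in> pts Y" "z \<in> pts Z"
  show "eval3 (leg12 X Y Z f ((x \<otimes>\<^bsub>X,Y\<^esub> y) \<otimes>\<^bsub>X \<odot> Y,Z\<^esub> z)) h = eval3 ((x \<otimes>\<^bsub>X,Y\<^esub> y) \<otimes>\<^bsub>X \<odot> Y,Z\<^esub> z)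
      (\<lambda>x y z. tlist X Y (f (x \<otimes>\<^bsub>X,Y\<^esub> y)) \<rhd> (\<lambda>p q. h p q z))"
    unfolding eval3_pure[OF X Z is_trilinear_leg12[OF X Y Z f h] xyz] leg12_pure[OF X f xyz]
    by (rule eval3_ev[OF X Z h]) (use xyz tlist_mem[OF X Lin_pure_closed[OF f]] in blast)
qed

lemma eval3_leg23:
  assumes X: "vspace X" and Y: "vspace Y" and Z: "vspace Z" and f: "f \<in> Lin (Y \<odot> Z) (Y \<odot> Z)"
    and h: "is_trilinear X Y Z h" and u: "u \<in> pts (X \<odot> Y \<odot> Z)"
  shows "eval3 (leg23 X Y Z f u) h =
    eval3 u (\<lambda>x y z. tlist Y Z (f (y \<otimes>\<^bsub>Y,Z\<^esub> z)) \<rhd> (\<lambda>p q. h x p q))"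
proof (rule linear_eqI3[OF X is_linear_comp[OF leg23_linear[OF X Y Z f] eval3_linear] eval3_linear _ u])
  fix x y z assume xyz: "x \<in> pts X" "y \<in> pts Y" "z \<in> pts Z"
  note t = is_trilinear_leg23[OF X Y Z f h]
  show "eval3 (leg23 X Y Z f ((x \<otimes>\<^bsub>X,Y\<^esub> y) \<otimes>\<^bsub>X \<odot> Y,Z\<^esub> z)) h = eval3 ((x \<otimes>\<^bsub>X,Y\<^esub> y) \<otimes>\<^bsub>X \<odot> Y,Z\<^esub> z)
      (\<lambda>x y z. tlist Y Z (f (y \<otimes>\<^bsub>Y,Z\<^esub> z)) \<rhd> (\<lambda>p q. h x p q))"
    unfolding eval3_pure[OF X Z t xyz] leg23_pure[OF X Y Z f xyz]
    by (rule eval3_ev[OF X Z h]) (use xyz tlist_mem[OF Y Lin_pure_closed[OF f]] in blast)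
qed

lemma eval3_leg13:
  assumes X: "vspace X" and Y: "vspace Y" and Z: "vspace Z" and f: "f \<in> Lin (X \<odot> Z) (X \<odot> Z)"
    and h: "is_trilinear X Y Z h" and u: "u \<in> pts (X \<odot> Y \<odot> Z)"
  shows "eval3 (leg13 X Y Z f u) h =
    eval3 u (\<lambda>x y z. tlist X Z (f (x \<otimes>\<^bsub>X,Z\<^esub> z)) \<rhd> (\<lambda>p q. h p y q))"
proof (rule linear_eqI3[OF X is_linear_comp[OF leg13_linear[OF X Y Z f] eval3_linear] eval3_linear _ u])
  fix x y z assume xyz: "x \<in> pts X" "y \<in> pts Y" "z \<in> pts Z"
  note t = is_trilinear_leg13[OF X Y Z f h]
  show "eval3 (leg13 X Y Z f ((x \<otimes>\<^bsub>X,Y\<^esub> y) \<otimes>\<^bsub>X \<odot> Y,Z\<^esub> z)) h = eval3 ((x \<otimes>\<^bsub>X,Y\<^esub> y) \<otimes>\<^bsub>X \<odot> Y,Z\<^esub> z)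
      (\<lambda>x y z. tlist X Z (f (x \<otimes>\<^bsub>X,Z\<^esub> z)) \<rhd> (\<lambda>p q. h p y q))"
    unfolding eval3_pure[OF X Z t xyz] leg13_pure[OF X Y Z f xyz]
    by (rule eval3_ev[OF X Z h]) (use xyz tlist_mem[OF X Lin_pure_closed[OF f]] in blast)
qed

lemma leg_closed:
  "vspace X \<Longrightarrow> f \<in> Lin (X \<odot> Y) (X \<odot> Y) \<Longrightarrow> u \<in> pts (X \<odot> Y \<odot> Z) \<Longrightarrow>
    leg12 X Y Z f u \<in> pts (X \<odot> Y \<odot> Z)"
  "vspace X \<Longrightarrow> vspace Y \<Longrightarrow> vspace Z \<Longrightarrow> g \<in> Lin (Y \<odot> Z) (Y \<odot> Z) \<Longrightarrow> u \<in> pts (X \<odot> Y \<odot> Z) \<Longrightarrow>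
    leg23 X Y Z g u \<in> pts (X \<odot> Y \<odot> Z)"
  "vspace X \<Longrightarrow> vspace Y \<Longrightarrow> vspace Z \<Longrightarrow> k \<in> Lin (X \<odot> Z) (X \<odot> Z) \<Longrightarrow> u \<in> pts (X \<odot> Y \<odot> Z) \<Longrightarrow>
    leg13 X Y Z k u \<in> pts (X \<odot> Y \<odot> Z)"
  using leg12_linear[of X f Y Z] leg23_linear[of X Y Z g] leg13_linear[of X Y Z k]
  by (simp_all add: is_linear_def)

lemma eval3_cong:
  assumes X: "vspace X" and Z: "vspace Z" and h: "is_trilinear X Y Z h" "is_trilinear X Y Z h'"
    and eq: "\<And>x y z. x \<in> pts X \<Longrightarrow> y \<in> pts Y \<Longrightarrow> z \<in> pts Z \<Longrightarrow> h x y z = h' x y z"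
    and u: "u \<in> pts (X \<odot> Y \<odot> Z)"
  shows "eval3 u h = eval3 u h'"
  by (rule linear_eqI3[OF X eval3_linear eval3_linear _ u])
    (simp add: eval3_pure[OF X Z h(1)] eval3_pure[OF X Z h(2)] eq)

text \<open>
  In contrast to \<open>is_linear_tlist\<close>, the parameter sits in the tensor over which the sum is formed.
  The chosen list does not depend linearly on it, but the sum is the value of the map \<open>lift\<close> of
  \<open>h\<close>.
\<close>

lemma is_linear_tlist_pure:
  assumes X: "vspace X" and Y: "vspace Y" and X': "vspace X'" and W: "vspace W"
    and F: "F \<in> Lin (X \<odot> Y) (X' \<odot> Y')" and h: "is_bilinear X' Y' W h"
  shows "x \<in> pts X \<Longrightarrow> is_linear Y W (\<lambda>y. tlist X' Y' (F (x \<otimes>\<^bsub>X,Y\<^esub> y)) \<rhd> h)"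
    and "y \<in> pts Y \<Longrightarrow> is_linear X W (\<lambda>x. tlist X' Y' (F (x \<otimes>\<^bsub>X,Y\<^esub> y)) \<rhd> h)"
proof -
  note l = is_linear_comp[OF LinD[OF F] LinD[OF lift_Lin[OF W h]]]
  note ev = lift_ev[OF X' W h Lin_pure_closed[OF F]]
  show "is_linear Y W (\<lambda>y. tlist X' Y' (F (x \<otimes>\<^bsub>X,Y\<^esub> y)) \<rhd> h)" if x: "x \<in> pts X"
    by (rule is_linear_ext[OF is_linear_comp[OF is_linear_pure2[OF x] l] Y]) (rule ev[OF x])
  show "is_linear X W (\<lambda>x. tlist X' Y' (F (x \<otimes>\<^bsub>X,Y\<^esub> y)) \<rhd> h)" if y: "y \<in> pts Y"
    by (rule is_linear_ext[OF is_linear_comp[OF is_linear_pure1[OF y] l] X]) (rule ev[OF _ y])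
qed

section \<open>Cancellation in tensor products\<close>

text \<open>
  Expanding the first entries in a basis reduces the vanishing of a sum to that of the sums
  obtained by applying coordinate functionals.
\<close>

lemma leg_reduce:
  assumes P: "vspace P" and mem: "\<And>p w. (p, w) \<in> set zs \<Longrightarrow> p \<in> pts P"
    and h: "\<And>p w. (p, w) \<in> set zs \<Longrightarrow> is_linear P ground (\<lambda>p. h p w)"
    and zero: "\<And>\<omega> b. is_linear P ground \<omega> \<Longrightarrow> b \<in> pts P \<Longrightarrow> (\<Sum>(p, w)\<leftarrow>zs. \<omega> p * h b w) = 0"
  shows "(\<Sum>(p, w)\<leftarrow>zs. h p w) = 0"
proof -
  interpret vector_space "scl P" using P by (simp add: vspace_def)
  have sub: "subspace (pts P)" using P by (simp add: vspace_def)
  obtain B where B: "B \<subseteq> pts P" "independent B" "pts P \<subseteq> span B"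
    using maximal_independent_subset by blast
  define \<omega> where "\<omega> b = (\<lambda>p. representation B p b)" for b
  have \<omega>: "is_linear P ground (\<omega> b)" for b
    using B by (simp add: is_linear_def \<omega>_def representation_add representation_scale subset_iff)
  \<comment> \<open>The finitely many basis vectors that occur.\<close>
  define F where "F = (\<Union>(p, w)\<in>set zs. {b. \<omega> b p \<noteq> 0})"
  have fin: "finite F"
    unfolding F_def \<omega>_def by (auto intro!: finite_UN_I simp: finite_representation)
  have FB: "F \<subseteq> B" by (auto simp: F_def \<omega>_def dest: representation_ne_zero)
  have h_eq: "h p w = (\<Sum>b\<in>F. \<omega> b p * h b w)" if pw: "(p, w) \<in> set zs" for p w
  proof -
    have lin: "is_linear P ground (\<lambda>p. h p w)" using h[OF pw] .
    have "p \<in> span B" using mem[OF pw] B by auto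
    then have "p = (\<Sum>b | \<omega> b p \<noteq> 0. scl P (\<omega> b p) b)"
      using B sum_nonzero_representation_eq[of B p] by (simp add: \<omega>_def)
    also have "\<dots> = (\<Sum>b\<in>F. scl P (\<omega> b p) b)"
      by (rule sum.mono_neutral_left[OF fin]) (use pw in \<open>auto simp: F_def\<close>)
    finally have p: "p = (\<Sum>b\<in>F. scl P (\<omega> b p) b)" .
    have cl: "scl P c b \<in> pts P" if "b \<in> F" for b c
      using that FB B by (auto intro!: vspace_closed(3)[OF P])
    have "h (\<Sum>b\<in>F'. scl P (\<omega> b p) b) w = (\<Sum>b\<in>F'. \<omega> b p * h b w)" if "F' \<subseteq> F" for F'
      using finite_subset[OF that fin] that
    proof (induction F')
      case empty
      then show ?case using is_linear_0[OF P lin] by simp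
    next
      case (insert b F')
      have "(\<Sum>b\<in>F'. scl P (\<omega> b p) b) \<in> pts P"
        using insert.prems cl by (intro subspace_sum[OF sub]) auto
      then show ?case using insert lin cl[of b] FB B by (auto simp: is_linear_def)
    qed
    from this[of F] show ?thesis using p by simp
  qed
  have "(\<Sum>(p, w)\<leftarrow>zs. h p w) = (\<Sum>(p, w)\<leftarrow>zs. \<Sum>b\<in>F. \<omega> b p * h b w)"
    using h_eq by (intro arg_cong[of _ _ sum_list] map_cong) auto
  also have "\<dots> = (\<Sum>b\<in>F. \<Sum>(p, w)\<leftarrow>zs. \<omega> b p * h b w)"
    by (induction zs) (auto simp: sum.distrib)
  also have "\<dots> = 0" using zero[OF \<omega>] FB B by (intro sum.neutral) auto
  finally show ?thesis .
qed

text \<open>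
  A sum of elementary tensors in \<open>P \<otimes> X \<otimes> Q\<close>, seen as the function that evaluates it on forms.
  Stated this way, the property is visibly inherited by nested sums, whereas the lists behind them
  need never be written down.
\<close>

definition finite_sum ::
  "('k::field, 'p::ab_group_add) space \<Rightarrow> ('k, 'x::ab_group_add) space \<Rightarrow>
   ('k, 'q::ab_group_add) space \<Rightarrow> (('p \<Rightarrow> 'x \<Rightarrow> 'q \<Rightarrow> 'k) \<Rightarrow> 'k) \<Rightarrow> bool" where
  "finite_sum P X Q F \<longleftrightarrow> (\<exists>zs. set zs \<subseteq> UNIV \<times> pts P \<times> pts X \<times> pts Q \<and>
     (\<forall>h. F h = (\<Sum>(c, p, a, q)\<leftarrow>zs. c * h p a q)))"

lemma finite_sum_base:
  "p \<in> pts P \<Longrightarrow> a \<in> pts X \<Longrightarrow> q \<in> pts Q \<Longrightarrow> finite_sum P X Q (\<lambda>h. h p a q)"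
  unfolding finite_sum_def by (intro exI[of _ "[(1, p, a, q)]"]) simp

lemma finite_sum_mult:
  assumes "finite_sum P X Q F"
  shows "finite_sum P X Q (\<lambda>h. c * F h)"
proof -
  obtain zs where "set zs \<subseteq> UNIV \<times> pts P \<times> pts X \<times> pts Q"
    "\<And>h. F h = (\<Sum>(c, p, a, q)\<leftarrow>zs. c * h p a q)"
    using assms unfolding finite_sum_def by blast
  then show ?thesis unfolding finite_sum_def
    by (intro exI[of _ "map (\<lambda>(d, r). (c * d, r)) zs"])
      (auto simp: sum_list_const_mult[symmetric] o_def split_beta mult.assoc)
qed

lemma finite_sum_ev:
  assumes "\<And>r s. (r, s) \<in> set xs \<Longrightarrow> finite_sum P X Q (\<lambda>h. F r s h)"
  shows "finite_sum P X Q (\<lambda>h. xs \<rhd> (\<lambda>r s. F r s h))"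
  using assms
proof (induction xs)
  case Nil
  show ?case unfolding finite_sum_def by (intro exI[of _ "[]"]) simp
next
  case (Cons x xs)
  have "finite_sum P X Q (F (fst x) (snd x))" "finite_sum P X Q (\<lambda>h. xs \<rhd> (\<lambda>r s. F r s h))"
    using Cons.IH Cons.prems by simp_all
  then obtain zs zs' where "set zs \<subseteq> UNIV \<times> pts P \<times> pts X \<times> pts Q"
    "\<forall>h. F (fst x) (snd x) h = (\<Sum>(c, p, a, q)\<leftarrow>zs. c * h p a q)"
    "set zs' \<subseteq> UNIV \<times> pts P \<times> pts X \<times> pts Q"
    "\<forall>h. (xs \<rhd> (\<lambda>r s. F r s h)) = (\<Sum>(c, p, a, q)\<leftarrow>zs'. c * h p a q)"
    unfolding finite_sum_def by blast
  then show ?case unfolding finite_sum_def by (intro exI[of _ "zs @ zs'"]) simp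
qed

lemma finite_sum_map:
  assumes F: "finite_sum P X Q F"
    and "\<And>p. p \<in> pts P \<Longrightarrow> f p \<in> pts P'" "\<And>a. a \<in> pts X \<Longrightarrow> g a \<in> pts X'"
    "\<And>q. q \<in> pts Q \<Longrightarrow> k q \<in> pts Q'"
  shows "finite_sum P' X' Q' (\<lambda>h. F (\<lambda>p a q. h (f p) (g a) (k q)))"
proof -
  obtain zs where zs: "set zs \<subseteq> UNIV \<times> pts P \<times> pts X \<times> pts Q"
    "\<And>h. F h = (\<Sum>(c, p, a, q)\<leftarrow>zs. c * h p a q)"
    using F unfolding finite_sum_def by blast
  have "F (\<lambda>p a q. h (f p) (g a) (k q)) =
      (\<Sum>(c, p, a, q)\<leftarrow>map (\<lambda>(c, p, a, q). (c, f p, g a, k q)) zs. c * h p a q)" for h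
    unfolding zs(2) by (induction zs) auto
  then show ?thesis
    unfolding finite_sum_def
    by (intro exI[of _ "map (\<lambda>(c, p, a, q). (c, f p, g a, k q)) zs"]) (use zs(1) assms(2-4) in auto)
qed

lemma finite_sum_swap:
  assumes F: "finite_sum P X Q F"
  shows "finite_sum P Q X (\<lambda>h. F (\<lambda>p a q. h p q a))" "finite_sum X P Q (\<lambda>h. F (\<lambda>p a q. h a p q))"
proof -
  obtain zs where zs: "set zs \<subseteq> UNIV \<times> pts P \<times> pts X \<times> pts Q"
    "\<And>h. F h = (\<Sum>(c, p, a, q)\<leftarrow>zs. c * h p a q)"
    using F unfolding finite_sum_def by blast
  have "F (\<lambda>p a q. h p q a) =
      (\<Sum>(c, p, a, q)\<leftarrow>map (\<lambda>(c, p, a, q). (c, p, q, a)) zs. c * h p a q)" for h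
    unfolding zs(2) by (induction zs) auto
  then show "finite_sum P Q X (\<lambda>h. F (\<lambda>p a q. h p q a))"
    unfolding finite_sum_def
    by (intro exI[of _ "map (\<lambda>(c, p, a, q). (c, p, q, a)) zs"]) (use zs(1) in auto)
  have "F (\<lambda>p a q. h a p q) =
      (\<Sum>(c, p, a, q)\<leftarrow>map (\<lambda>(c, p, a, q). (c, a, p, q)) zs. c * h p a q)" for h
    unfolding zs(2) by (induction zs) auto
  then show "finite_sum X P Q (\<lambda>h. F (\<lambda>p a q. h a p q))"
    unfolding finite_sum_def
    by (intro exI[of _ "map (\<lambda>(c, p, a, q). (c, a, p, q)) zs"]) (use zs(1) in auto)
qed

definition separates :: "('k::field, 'x::ab_group_add) space \<Rightarrow> ('i \<Rightarrow> 'x \<Rightarrow> 'x) \<Rightarrow> bool" where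
  "separates X m \<longleftrightarrow> (\<forall>i. is_linear X X (m i)) \<and> (\<forall>x\<in>pts X. (\<forall>i. m i x = 0) \<longrightarrow> x = 0)"

lemmas finite_sum_intros = finite_sum_base finite_sum_mult finite_sum_ev

text \<open>
  The reason is that \<open>P \<otimes> - \<otimes> Q\<close> is exact and commutes with intersections of subspaces.
  Concretely, contracting the two outer legs with functionals \<open>\<omega>\<close> and \<open>\<psi>\<close> gives a vector \<open>x\<close> that
  is killed by all maps \<open>m i\<close>, so that all values on products of functionals vanish, and by
  \<open>leg_reduce\<close> these suffice.
\<close>

lemma cancel_middle:
  assumes P: "vspace P" and X: "vspace X" and Q: "vspace Q"
    and m: "separates X m"
    and F: "finite_sum P X Q F" and G: "finite_sum P X Q G"
    and eq: "\<And>i h. is_trilinear P X Q h \<Longrightarrow>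
      F (\<lambda>p a q. h p (m i a) q) = G (\<lambda>p a q. h p (m i a) q)"
    and h: "is_trilinear P X Q h"
  shows "F h = G h"
proof -
  obtain xs where xs: "set xs \<subseteq> UNIV \<times> pts P \<times> pts X \<times> pts Q"
    "\<And>h. F h = (\<Sum>(c, p, a, q)\<leftarrow>xs. c * h p a q)"
    using F unfolding finite_sum_def by blast
  obtain ys where ys: "set ys \<subseteq> UNIV \<times> pts P \<times> pts X \<times> pts Q"
    "\<And>h. G h = (\<Sum>(c, p, a, q)\<leftarrow>ys. c * h p a q)"
    using G unfolding finite_sum_def by blast
  define zs where "zs = xs @ map (\<lambda>(c, r). (- c, r)) ys"
  have zs: "set zs \<subseteq> UNIV \<times> pts P \<times> pts X \<times> pts Q" using xs ys by (auto simp: zs_def)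
  have FG: "(\<Sum>(c, p, a, q)\<leftarrow>zs. c * h p a q) = F h - G h" for h
    unfolding xs(2) ys(2) zs_def
    by (simp add: o_def split_beta uminus_sum_list_map)
  define N where "N h = (\<Sum>(c, p, a, q)\<leftarrow>zs. c * h p a q)" for h
  have prod: "(\<Sum>(c, p, a, q)\<leftarrow>zs. c * (\<omega> p * (\<phi> a * \<psi> q))) = 0"
    if w: "is_linear P ground \<omega>" "is_linear X ground \<phi>" "is_linear Q ground \<psi>" for \<omega> \<phi> \<psi>
  proof -
    define x where "x = (map (\<lambda>(c, p, a, q). (c * \<omega> p * \<psi> q, a)) zs \<rhd> scl X)"
    have xin: "x \<in> pts X"
      unfolding x_def by (rule ev_closed[OF X]) (use zs in \<open>auto intro!: vspace_closed(3)[OF X]\<close>)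
    have \<phi>x: "\<phi>' x = (\<Sum>(c, p, a, q)\<leftarrow>zs. c * (\<omega> p * (\<phi>' a * \<psi> q)))"
      if "is_linear X ground \<phi>'" for \<phi>'
    proof -
      have "\<phi>' x = map (\<lambda>(c, p, a, q). (c * \<omega> p * \<psi> q, a)) zs \<rhd> (\<lambda>c a. \<phi>' (scl X c a))"
        unfolding x_def by (rule ev_linear[OF X that]) (use zs in \<open>auto intro!: vspace_closed(3)[OF X]\<close>)
      also have "\<dots> = map (\<lambda>(c, p, a, q). (c * \<omega> p * \<psi> q, a)) zs \<rhd> (\<lambda>c a. c * \<phi>' a)"
        by (rule ev_cong) (use zs that in \<open>auto simp: is_linear_def\<close>)
      also have "\<dots> = (\<Sum>(c, p, a, q)\<leftarrow>zs. c * (\<omega> p * (\<phi>' a * \<psi> q)))"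
        by (induction zs) (auto simp: mult_ac)
      finally show ?thesis .
    qed
    have lin: "is_linear X X (m i)" for i using m by (simp add: separates_def)
    have "m i x = 0" for i
    proof (rule functionals_separate[OF X _ vspace_closed(1)[OF X]])
      show "m i x \<in> pts X" using lin[of i] xin by (simp add: is_linear_def)
      fix \<phi>' assume \<phi>': "is_linear X ground \<phi>'"
      have "\<phi>' (m i x) = (\<Sum>(c, p, a, q)\<leftarrow>zs. c * (\<omega> p * (\<phi>' (m i a) * \<psi> q)))"
        by (rule \<phi>x[OF is_linear_comp[OF lin[of i] \<phi>']])
      also have "\<dots> = 0"
      proof -
        have "is_trilinear P X Q (\<lambda>p a q. \<omega> p * (\<phi>' a * \<psi> q))"
          using w \<phi>' by (simp add: is_trilinear_def is_linear_def algebra_simps)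
        from eq[OF this, of i] FG[of "\<lambda>p a q. \<omega> p * (\<phi>' (m i a) * \<psi> q)"] show ?thesis by simp
      qed
      finally show "\<phi>' (m i x) = \<phi>' 0" using is_linear_0[OF X \<phi>'] by simp
    qed
    then have "x = 0" using m xin by (auto simp: separates_def)
    then show ?thesis using \<phi>x[OF w(2)] is_linear_0[OF X w(2)] by simp
  qed
  have "(\<Sum>(c, p, a, q)\<leftarrow>zs. c * h p a q) = 0"
  proof -
    let ?z1 = "map (\<lambda>(c, p, a, q). (p, (c, a, q))) zs"
    have "(\<Sum>(p, w)\<leftarrow>?z1. (case w of (c, a, q) \<Rightarrow> c * h p a q)) = 0"
    proof (rule leg_reduce[OF P])
      show "p \<in> pts P" if "(p, w) \<in> set ?z1" for p w using that zs by auto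
      show "is_linear P ground (\<lambda>p. case w of (c, a, q) \<Rightarrow> c * h p a q)" if "(p, w) \<in> set ?z1" for p w
        using that zs h by (auto simp: is_trilinear_def is_linear_def algebra_simps)
      fix \<omega> b assume w: "is_linear P ground \<omega>" and b: "b \<in> pts P"
      let ?z2 = "map (\<lambda>(c, p, a, q). (a, (c * \<omega> p, q))) zs"
      have perm1: "(\<Sum>(a, w)\<leftarrow>?z2. \<phi> a * (case w of (c, q) \<Rightarrow> c * \<psi> q)) =
          (\<Sum>(c, p, a, q)\<leftarrow>zs. c * (\<omega> p * (\<phi> a * \<psi> q)))" for \<phi> \<psi>
        by (induction zs) (auto simp: mult_ac)
      have perm2: "(\<Sum>(p, w)\<leftarrow>?z1. \<omega> p * (case w of (c, a, q) \<Rightarrow> c * h b a q)) =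
          (\<Sum>(a, w)\<leftarrow>?z2. (case w of (c, q) \<Rightarrow> c * h b a q))"
        by (induction zs) (auto simp: mult_ac)
      have "(\<Sum>(a, w)\<leftarrow>?z2. (case w of (c, q) \<Rightarrow> c * h b a q)) = 0"
      proof (rule leg_reduce[OF X])
        show "a \<in> pts X" if "(a, w) \<in> set ?z2" for a w using that zs by auto
        show "is_linear X ground (\<lambda>a. case w of (c, q) \<Rightarrow> c * h b a q)" if "(a, w) \<in> set ?z2" for a w
          using that zs h b by (auto simp: is_trilinear_def is_linear_def algebra_simps)
        fix \<phi> b' assume \<phi>: "is_linear X ground \<phi>" and b': "b' \<in> pts X"
        have "is_linear Q ground (h b b')" using h b b' by (simp add: is_trilinear_def)
        from prod[OF w \<phi> this] show "(\<Sum>(a, w)\<leftarrow>?z2. \<phi> a * (case w of (c, q) \<Rightarrow> c * h b b' q)) = 0"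
          unfolding perm1 by simp
      qed
      then show "(\<Sum>(p, w)\<leftarrow>?z1. \<omega> p * (case w of (c, a, q) \<Rightarrow> c * h b a q)) = 0"
        unfolding perm2 .
    qed
    moreover have "(\<Sum>(p, w)\<leftarrow>?z1. (case w of (c, a, q) \<Rightarrow> c * h p a q)) =
        (\<Sum>(c, p, a, q)\<leftarrow>zs. c * h p a q)"
      by (induction zs) auto
    ultimately show ?thesis by simp
  qed
  then show ?thesis using FG[of h] by simp
qed

lemma cancel_last:
  assumes "vspace P" "vspace X" "vspace Q" and m: "separates Q m"
    and F: "finite_sum P X Q F" and G: "finite_sum P X Q G"
    and eq: "\<And>i h. is_trilinear P X Q h \<Longrightarrow>
      F (\<lambda>p a q. h p a (m i q)) = G (\<lambda>p a q. h p a (m i q))"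
    and h: "is_trilinear P X Q h"
  shows "F h = G h"
  by (rule cancel_middle[OF assms(1,3,2) m finite_sum_swap(1)[OF F] finite_sum_swap(1)[OF G]
        eq[OF is_trilinear_perm(2)] is_trilinear_perm(2)[OF h]])

lemma cancel_first:
  assumes "vspace P" "vspace X" "vspace Q" and m: "separates P m"
    and F: "finite_sum P X Q F" and G: "finite_sum P X Q G"
    and eq: "\<And>i h. is_trilinear P X Q h \<Longrightarrow>
      F (\<lambda>p a q. h (m i p) a q) = G (\<lambda>p a q. h (m i p) a q)"
    and h: "is_trilinear P X Q h"
  shows "F h = G h"
  by (rule cancel_middle[OF assms(2,1,3) m finite_sum_swap(2)[OF F] finite_sum_swap(2)[OF G]
        eq[OF is_trilinear_perm(3)] is_trilinear_perm(3)[OF h]])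

lemma cancel_last_two:
  assumes P: "vspace P" and X: "vspace X" and Q: "vspace Q"
    and m: "separates X m" and n: "separates Q n"
    and F: "finite_sum P X Q F" and G: "finite_sum P X Q G"
    and eq: "\<And>i j h. is_trilinear P X Q h \<Longrightarrow>
      F (\<lambda>p a q. h p (m i a) (n j q)) = G (\<lambda>p a q. h p (m i a) (n j q))"
    and h: "is_trilinear P X Q h"
  shows "F h = G h"
proof (rule cancel_middle[OF P X Q m F G _ h])
  fix i h assume h: "is_trilinear P X Q h"
  have mX: "m i a \<in> pts X" if "a \<in> pts X" for a
    using m that by (simp add: separates_def is_linear_def)
  have "finite_sum P X Q (\<lambda>h. F (\<lambda>p a q. h p (m i a) q))" "finite_sum P X Q (\<lambda>h. G (\<lambda>p a q. h p (m i a) q))"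
    using finite_sum_map[OF F, of "\<lambda>p. p" P "m i" X "\<lambda>q. q" Q]
      finite_sum_map[OF G, of "\<lambda>p. p" P "m i" X "\<lambda>q. q" Q] mX by blast+
  from cancel_last[OF P X Q n this eq h]
  show "F (\<lambda>p a q. h p (m i a) q) = G (\<lambda>p a q. h p (m i a) q)" .
qed

section \<open>Sweedler calculus for a regular weak multiplier bialgebra\<close>

text \<open>
  The predicates \<open>lin1\<close>, \<open>lin2\<close>, \<open>lin3\<close> and \<open>linop\<close> specialize linearity and multilinearity to
  \<open>A\<close>, where membership conditions are vacuous. In the form of simplification rules they let the
  simplifier discharge the linearity of nested sums.
\<close>

context wmb
begin

definition lin1 :: "('a \<Rightarrow> 'k) \<Rightarrow> bool" where
  "lin1 \<phi> \<longleftrightarrow> is_linear A ground \<phi>"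

definition lin2 :: "('a \<Rightarrow> 'a \<Rightarrow> 'k) \<Rightarrow> bool" where
  "lin2 \<beta> \<longleftrightarrow> (\<forall>x. lin1 (\<beta> x)) \<and> (\<forall>y. lin1 (\<lambda>x. \<beta> x y))"

definition lin3 :: "('a \<Rightarrow> 'a \<Rightarrow> 'a \<Rightarrow> 'k) \<Rightarrow> bool" where
  "lin3 h \<longleftrightarrow> (\<forall>x y. lin1 (h x y)) \<and> (\<forall>x z. lin1 (\<lambda>y. h x y z)) \<and> (\<forall>y z. lin1 (\<lambda>x. h x y z))"

definition linop :: "('a \<Rightarrow> 'a) \<Rightarrow> bool" where
  "linop f \<longleftrightarrow> is_linear A A f"

text \<open>
  The Sweedler sum of \<open>F(a \<otimes> b)\<close>. In these terms \<open>t1 a b\<close> stands for \<open>a\<^sub>1 \<otimes> a\<^sub>2 b\<close>, \<open>t2 a b\<close> for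
  \<open>a b\<^sub>1 \<otimes> b\<^sub>2\<close>, \<open>t3 a b\<close> for \<open>a\<^sub>1 \<otimes> b a\<^sub>2\<close>, \<open>t4 a b\<close> for \<open>b\<^sub>1 a \<otimes> b\<^sub>2\<close>, \<open>e1 a b\<close> for \<open>E(a \<otimes> b)\<close>,
  and \<open>e2 a b\<close> for \<open>(a \<otimes> b)E\<close>.
\<close>

definition sw :: "(('k, 'a, 'a) tensor \<Rightarrow> ('k, 'a, 'a) tensor) \<Rightarrow> 'a \<Rightarrow> 'a \<Rightarrow> ('a \<times> 'a) list" where
  "sw F a b = tlist A A (F (a \<otimes> b))"

abbreviation "t1 \<equiv> sw (T1 H)"
abbreviation "t2 \<equiv> sw (T2 H)"
abbreviation "t3 \<equiv> sw (T3 H)"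
abbreviation "t4 \<equiv> sw (T4 H)"
abbreviation "e1 \<equiv> sw (E1 H)"
abbreviation "e2 \<equiv> sw (E2 H)"
abbreviation counit (\<open>\<epsilon>\<close>) where "\<epsilon> \<equiv> eps H"
abbreviation "endo \<equiv> Lin (A \<odot> A) (A \<odot> A)"

text \<open>Sums in \<open>A \<otimes> A\<close> are treated as sums in \<open>k \<otimes> A \<otimes> A\<close>.\<close>

definition fin2 :: "(('a \<Rightarrow> 'a \<Rightarrow> 'k) \<Rightarrow> 'k) \<Rightarrow> bool" where
  "fin2 F \<longleftrightarrow> finite_sum ground A A (\<lambda>h. F (h 1))"

definition fin3 :: "(('a \<Rightarrow> 'a \<Rightarrow> 'a \<Rightarrow> 'k) \<Rightarrow> 'k) \<Rightarrow> bool" where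
  "fin3 F \<longleftrightarrow> finite_sum A A A F"

abbreviation "separating \<equiv> separates A"

end

context regular_wmb
begin

declare alg_pts [simp] alg_vspace [simp] linear_maps [simp]

lemma lin1_iff: "lin1 \<phi> \<longleftrightarrow> (\<forall>x y. \<phi> (x + y) = \<phi> x + \<phi> y) \<and> (\<forall>c x. \<phi> (scl A c x) = c * \<phi> x)"
  by (simp add: lin1_def is_linear_def)

lemma linop_iff: "linop f \<longleftrightarrow> (\<forall>x y. f (x + y) = f x + f y) \<and> (\<forall>c x. f (scl A c x) = scl A c (f x))"
  by (simp add: linop_def is_linear_def)

lemma lin2_iff: "lin2 \<beta> \<longleftrightarrow> is_bilinear A A ground \<beta>"
  by (simp add: lin2_def lin1_def is_bilinear_def)

lemma lin3_iff: "lin3 h \<longleftrightarrow> is_trilinear A A A h"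
  by (simp add: lin3_def lin1_def is_trilinear_def)

lemma lin1_eq_0: "lin1 \<phi> \<Longrightarrow> \<phi> 0 = 0"
  using is_linear_0[OF alg_vspace] by (simp add: lin1_def)

lemma lin1_ev_eq: "lin1 \<phi> \<Longrightarrow> \<phi> (xs \<rhd> h) = xs \<rhd> (\<lambda>p q. \<phi> (h p q))"
  by (rule ev_hom) (auto simp: lin1_eq_0 lin1_iff)

lemma eqI_functional:
  assumes "\<And>\<phi>. lin1 \<phi> \<Longrightarrow> \<phi> x = \<phi> y"
  shows "x = y"
  by (rule functionals_separate[OF alg_vspace]) (simp_all add: assms lin1_def)

lemma sw_closed: "F \<in> endo \<Longrightarrow> F (a \<otimes> b) \<in> pts (A \<odot> A)"
  by (rule Lin_pure_closed) simp_all

lemma sw_eval: "F \<in> endo \<Longrightarrow> lin2 \<beta> \<Longrightarrow> F (a \<otimes> b) \<beta> = (sw F a b \<rhd> \<beta>)"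
  unfolding sw_def lin2_iff by (rule tensor_eval[OF alg_vspace sw_closed])

lemma linop_id: "linop (\<lambda>z. z)"
  by (simp add: linop_def)

lemma linop_mult: "linop f \<Longrightarrow> linop (\<lambda>z. a * f z)" "linop f \<Longrightarrow> linop (\<lambda>z. f z * a)"
  by (simp_all add: linop_iff algebra_simps alg_scl[symmetric])

lemma linop_mult_id: "linop ((*) a)" "linop (\<lambda>z. z * a)"
  by (simp_all add: linop_iff algebra_simps alg_scl[symmetric])

lemma lin1_comp: "lin1 \<phi> \<Longrightarrow> linop f \<Longrightarrow> lin1 (\<lambda>z. \<phi> (f z))"
  by (simp add: lin1_iff linop_iff)

lemma lin1_ev: "(\<And>p q. lin1 (h p q)) \<Longrightarrow> lin1 (\<lambda>z. xs \<rhd> (\<lambda>p q. h p q z))"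
  by (simp add: lin1_iff ev_add ev_mult_left)

lemma lin1_mult: "lin1 \<phi> \<Longrightarrow> lin1 (\<lambda>z. c * \<phi> z)" "lin1 \<phi> \<Longrightarrow> lin1 (\<lambda>z. \<phi> z * c)"
  by (simp_all add: lin1_iff algebra_simps)

lemma lin1_sw:
  assumes F: "F \<in> endo" and f: "linop f" and \<beta>: "lin2 \<beta>"
  shows "lin1 (\<lambda>z. sw F (f z) b \<rhd> \<beta>)" "lin1 (\<lambda>z. sw F b (f z) \<rhd> \<beta>)"
proof -
  have l: "is_linear (A \<odot> A) ground (\<lambda>t. F t \<beta>)"
    using LinD[OF F] by (simp add: is_linear_def tscale_def)
  have f': "is_linear A A f" using f by (simp add: linop_def)
  show "lin1 (\<lambda>z. sw F (f z) b \<rhd> \<beta>)"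
    unfolding sw_eval[OF F \<beta>, symmetric] lin1_def
    by (rule is_linear_comp[OF is_linear_comp[OF f' is_linear_pure1[of b A]] l]) simp
  show "lin1 (\<lambda>z. sw F b (f z) \<rhd> \<beta>)"
    unfolding sw_eval[OF F \<beta>, symmetric] lin1_def
    by (rule is_linear_comp[OF is_linear_comp[OF f' is_linear_pure2[of b A]] l]) simp
qed

lemma lin1_eps: "lin1 \<epsilon>"
  using linear_maps(7) by (simp add: lin1_def Lin_def)

lemmas mlin = linop_id linop_mult linop_mult_id lin1_ev lin1_mult lin1_sw lin1_eps
  lin1_comp[OF lin1_eps] lin2_def lin3_def

lemma lin2_D:
  assumes "lin2 \<beta>"
  shows "lin1 (\<beta> x)" "lin1 (\<lambda>z. \<beta> z y)"
    "linop f \<Longrightarrow> lin1 (\<lambda>z. \<beta> (f z) y)" "linop f \<Longrightarrow> lin1 (\<lambda>z. \<beta> x (f z))"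
  using assms lin1_comp[of "\<lambda>x. \<beta> x y" f] lin1_comp[of "\<beta> x" f] by (simp_all add: lin2_def)

lemma lin3_D:
  assumes "lin3 h"
  shows "lin1 (h x y)" "lin1 (\<lambda>z. h x z y)" "lin1 (\<lambda>z. h z x y)"
    "linop f \<Longrightarrow> lin1 (\<lambda>z. h (f z) x y)" "linop f \<Longrightarrow> lin1 (\<lambda>z. h x (f z) y)"
    "linop f \<Longrightarrow> lin1 (\<lambda>z. h x y (f z))"
  using assms lin1_comp[of "\<lambda>z. h z x y" f] lin1_comp[of "\<lambda>z. h x z y" f] lin1_comp[of "h x y" f]
  by (simp_all add: lin3_def)

subsection \<open>Cancellation in powers of the algebra\<close>

lemma fin2_intros:
  "fin2 (\<lambda>\<beta>. \<beta> a q)" "fin2 F \<Longrightarrow> fin2 (\<lambda>\<beta>. c * F \<beta>)" "fin2 F \<Longrightarrow> fin2 (\<lambda>\<beta>. F \<beta> * c)"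
  "(\<And>r s. fin2 (F' r s)) \<Longrightarrow> fin2 (\<lambda>\<beta>. xs \<rhd> (\<lambda>r s. F' r s \<beta>))"
  unfolding fin2_def using finite_sum_mult[of ground A A "\<lambda>h. F (h 1)" c]
  by (auto intro!: finite_sum_intros simp: mult.commute)

lemma fin3_intros:
  "fin3 (\<lambda>h. h a b c)" "fin3 F \<Longrightarrow> fin3 (\<lambda>h. d * F h)" "fin3 F \<Longrightarrow> fin3 (\<lambda>h. F h * d)"
  "(\<And>r s. fin3 (F' r s)) \<Longrightarrow> fin3 (\<lambda>h. xs \<rhd> (\<lambda>r s. F' r s h))"
  unfolding fin3_def using finite_sum_mult[of A A A F d]
  by (auto intro!: finite_sum_intros simp: mult.commute)

lemma lin2_slice: "is_trilinear ground A A h \<Longrightarrow> lin2 (h 1)"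
  by (simp add: is_trilinear_def lin2_def lin1_def)

lemma trilinear_of_lin2: "lin2 \<beta> \<Longrightarrow> is_trilinear ground A A (\<lambda>c p q. c * \<beta> p q)"
  by (simp add: is_trilinear_def lin2_def lin1_def is_linear_def algebra_simps)

lemma cancel2_1:
  assumes "separating m" "fin2 F" "fin2 G"
    and eq: "\<And>i \<beta>. lin2 \<beta> \<Longrightarrow> F (\<lambda>p q. \<beta> (m i p) q) = G (\<lambda>p q. \<beta> (m i p) q)"
  shows "\<forall>\<beta>. lin2 \<beta> \<longrightarrow> F \<beta> = G \<beta>"
proof (intro allI impI)
  fix \<beta> assume \<beta>: "lin2 \<beta>"
  have "F (\<lambda>p q. 1 * \<beta> p q) = G (\<lambda>p q. 1 * \<beta> p q)"
    by (rule cancel_middle[OF vspace_ground alg_vspace alg_vspace assms(1-3)[unfolded fin2_def] _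
          trilinear_of_lin2[OF \<beta>]]) (erule eq[OF lin2_slice])
  then show "F \<beta> = G \<beta>" by simp
qed

lemma cancel2_2:
  assumes "separating m" "fin2 F" "fin2 G"
    and eq: "\<And>i \<beta>. lin2 \<beta> \<Longrightarrow> F (\<lambda>p q. \<beta> p (m i q)) = G (\<lambda>p q. \<beta> p (m i q))"
  shows "\<forall>\<beta>. lin2 \<beta> \<longrightarrow> F \<beta> = G \<beta>"
proof (intro allI impI)
  fix \<beta> assume \<beta>: "lin2 \<beta>"
  have "F (\<lambda>p q. 1 * \<beta> p q) = G (\<lambda>p q. 1 * \<beta> p q)"
    by (rule cancel_last[OF vspace_ground alg_vspace alg_vspace assms(1-3)[unfolded fin2_def] _
          trilinear_of_lin2[OF \<beta>]]) (erule eq[OF lin2_slice])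
  then show "F \<beta> = G \<beta>" by simp
qed

lemma cancel2_12:
  assumes "separating m" "separating m'" "fin2 F" "fin2 G"
    and eq: "\<And>i j \<beta>. lin2 \<beta> \<Longrightarrow> F (\<lambda>p q. \<beta> (m i p) (m' j q)) = G (\<lambda>p q. \<beta> (m i p) (m' j q))"
  shows "\<forall>\<beta>. lin2 \<beta> \<longrightarrow> F \<beta> = G \<beta>"
proof (intro allI impI)
  fix \<beta> assume \<beta>: "lin2 \<beta>"
  have "F (\<lambda>p q. 1 * \<beta> p q) = G (\<lambda>p q. 1 * \<beta> p q)"
    by (rule cancel_last_two[OF vspace_ground alg_vspace alg_vspace assms(1-4)[unfolded fin2_def] _
          trilinear_of_lin2[OF \<beta>]]) (erule eq[OF lin2_slice])
  then show "F \<beta> = G \<beta>" by simp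
qed

lemma cancel3_1:
  assumes "separating m" "fin3 F" "fin3 G"
    and eq: "\<And>i h. lin3 h \<Longrightarrow> F (\<lambda>p q r. h (m i p) q r) = G (\<lambda>p q r. h (m i p) q r)"
  shows "\<forall>h. lin3 h \<longrightarrow> F h = G h"
  using cancel_first[OF alg_vspace alg_vspace alg_vspace assms(1-3)[unfolded fin3_def],
      OF eq[unfolded lin3_iff]] by (simp add: lin3_iff)

lemma cancel3_2:
  assumes "separating m" "fin3 F" "fin3 G"
    and eq: "\<And>i h. lin3 h \<Longrightarrow> F (\<lambda>p q r. h p (m i q) r) = G (\<lambda>p q r. h p (m i q) r)"
  shows "\<forall>h. lin3 h \<longrightarrow> F h = G h"
  using cancel_middle[OF alg_vspace alg_vspace alg_vspace assms(1-3)[unfolded fin3_def],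
      OF eq[unfolded lin3_iff]] by (simp add: lin3_iff)

lemma cancel3_3:
  assumes "separating m" "fin3 F" "fin3 G"
    and eq: "\<And>i h. lin3 h \<Longrightarrow> F (\<lambda>p q r. h p q (m i r)) = G (\<lambda>p q r. h p q (m i r))"
  shows "\<forall>h. lin3 h \<longrightarrow> F h = G h"
  using cancel_last[OF alg_vspace alg_vspace alg_vspace assms(1-3)[unfolded fin3_def],
      OF eq[unfolded lin3_iff]] by (simp add: lin3_iff)

lemma cancel3_23:
  assumes "separating m" "separating m'" "fin3 F" "fin3 G"
    and eq: "\<And>i j h. lin3 h \<Longrightarrow>
      F (\<lambda>p q r. h p (m i q) (m' j r)) = G (\<lambda>p q r. h p (m i q) (m' j r))"
  shows "\<forall>h. lin3 h \<longrightarrow> F h = G h"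
  using cancel_last_two[OF alg_vspace alg_vspace alg_vspace assms(1-4)[unfolded fin3_def],
      OF eq[unfolded lin3_iff]] by (simp add: lin3_iff)

lemma separating_iff: "separating m \<longleftrightarrow> (\<forall>i. linop (m i)) \<and> (\<forall>x. (\<forall>i. m i x = 0) \<longrightarrow> x = 0)"
  by (simp add: separates_def linop_def)

lemma separating_left: "separating (\<lambda>x y. x * y)"
  by (auto simp: separating_iff mlin intro: nondegenerate(2))

lemma separating_right: "separating (\<lambda>x y. y * x)"
  by (auto simp: separating_iff mlin intro: nondegenerate(1))

lemmas fin_intros = fin2_intros fin3_intros

subsection \<open>The axioms in Sweedler notation\<close>

lemma eval_ext: "s = t \<Longrightarrow> s \<beta> = t \<beta>"
  by simp

lemma tt_closed: "F \<in> endo \<Longrightarrow> linop f \<Longrightarrow> linop g \<Longrightarrow> tt f g (F (a \<otimes> b)) \<in> pts (A \<odot> A)"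
  using LinD[OF tmap_Lin[of A A f A A g]] sw_closed[of F a b] by (simp add: linop_def is_linear_def)

lemma tt_eval:
  "F \<in> endo \<Longrightarrow> linop f \<Longrightarrow> linop g \<Longrightarrow> lin2 \<beta> \<Longrightarrow>
    tt f g (F (a \<otimes> b)) \<beta> = (sw F a b \<rhd> (\<lambda>p q. \<beta> (f p) (g q)))"
  unfolding sw_def lin2_iff linop_def by (rule tmap_eval) (simp_all add: sw_closed)

lemma contr_eval:
  assumes "t \<in> pts (A \<odot> A)" "lin1 \<phi>"
  shows "\<phi> (eps_id t) = t (\<lambda>p q. \<epsilon> p * \<phi> q)" "\<phi> (id_eps t) = t (\<lambda>p q. \<phi> p * \<epsilon> q)"
proof -
  note e = lin1_eps[unfolded lin1_def]
  note l = assms(2)[unfolded lin1_def]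
  have b: "lin2 (\<lambda>p q. \<epsilon> p * \<phi> q)" "lin2 (\<lambda>p q. \<phi> p * \<epsilon> q)"
    using assms(2) by (simp_all add: mlin)
  show "\<phi> (eps_id t) = t (\<lambda>p q. \<epsilon> p * \<phi> q)"
    unfolding contr1_eval(2)[OF alg_vspace alg_vspace e l assms(1)]
    by (rule tensor_eval[OF alg_vspace assms(1) b(1)[unfolded lin2_iff], symmetric])
  show "\<phi> (id_eps t) = t (\<lambda>p q. \<phi> p * \<epsilon> q)"
    unfolding contr2_eval(2)[OF alg_vspace e l assms(1)]
    by (rule tensor_eval[OF alg_vspace assms(1) b(2)[unfolded lin2_iff], symmetric])
qed

lemma eps_id_eval: "F \<in> endo \<Longrightarrow> lin1 \<phi> \<Longrightarrow> \<phi> (eps_id (F (a \<otimes> b))) = (sw F a b \<rhd> (\<lambda>p q. \<epsilon> p * \<phi> q))"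
  by (simp add: contr_eval sw_closed sw_eval mlin)

lemma id_eps_eval: "F \<in> endo \<Longrightarrow> lin1 \<phi> \<Longrightarrow> \<phi> (id_eps (F (a \<otimes> b))) = (sw F a b \<rhd> (\<lambda>p q. \<phi> p * \<epsilon> q))"
  by (simp add: contr_eval sw_closed sw_eval mlin)

lemma eval3_A:
  assumes F: "F \<in> endo" and h: "lin3 h" and u: "u \<in> pts (A \<odot> A \<odot> A)"
  shows "eval3 (leg12 A A A F u) h = eval3 u (\<lambda>x y z. sw F x y \<rhd> (\<lambda>p q. h p q z))"
    "eval3 (leg23 A A A F u) h = eval3 u (\<lambda>x y z. sw F y z \<rhd> (\<lambda>p q. h x p q))"
    "eval3 (leg13 A A A F u) h = eval3 u (\<lambda>x y z. sw F x z \<rhd> (\<lambda>p q. h p y q))"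
  using eval3_leg12[of A A A F h u] eval3_leg23[of A A A F h u] eval3_leg13[of A A A F h u] assms
  by (simp_all add: lin3_iff sw_def)

lemma eval3_pureA: "lin3 h \<Longrightarrow> eval3 ((a \<otimes> b) \<otimes>\<^bsub>A \<odot> A,A\<^esub> c) h = h a b c"
  by (rule eval3_pure) (simp_all add: lin3_iff)

lemma pureA_closed: "(a \<otimes> b) \<otimes>\<^bsub>A \<odot> A,A\<^esub> c \<in> pts (A \<odot> A \<odot> A)"
  by (intro pure_in_tensor_space) simp_all

lemma leg_closedA:
  assumes "F \<in> endo" "u \<in> pts (A \<odot> A \<odot> A)"
  shows "leg12 A A A F u \<in> pts (A \<odot> A \<odot> A)" "leg23 A A A F u \<in> pts (A \<odot> A \<odot> A)"
    "leg13 A A A F u \<in> pts (A \<odot> A \<odot> A)"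
  by (rule leg_closed; simp add: assms)+

lemma sw_comp:
  assumes F: "F \<in> endo" and G: "G \<in> endo" and \<beta>: "lin2 \<beta>"
  shows "F (G (a \<otimes> b)) \<beta> = (sw G a b \<rhd> (\<lambda>p q. sw F p q \<rhd> \<beta>))"
proof -
  have "is_linear (A \<odot> A) ground (\<lambda>t. F t \<beta>)"
    using LinD[OF F] by (simp add: is_linear_def tscale_def)
  from tlist_linear[OF alg_vspace this sw_closed[OF G, of a b]] show ?thesis
    by (simp add: sw_eval[OF F \<beta>] flip: sw_def)
qed

lemma E1_E2:
  "lin2 \<beta> \<Longrightarrow> (e1 c d \<rhd> (\<lambda>p q. \<beta> (a * p) (b * q))) = (e2 a b \<rhd> (\<lambda>p q. \<beta> (p * c) (q * d)))"
  using eval_ext[OF axiom_i[of a b c d], of \<beta>] by (simp add: tt_eval mlin)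

lemma E1_idem: "lin2 \<beta> \<Longrightarrow> (e1 a b \<rhd> (\<lambda>p q. e1 p q \<rhd> \<beta>)) = (e1 a b \<rhd> \<beta>)"
  using eval_ext[OF axiom_ii[of "a \<otimes> b"], of \<beta>]
  by (simp add: sw_comp sw_eval pure_in_tensor_space)

lemma coassoc:
  assumes h: "lin3 h"
  shows "(t1 b c \<rhd> (\<lambda>p q. t2 a p \<rhd> (\<lambda>r s. h r s q))) = (t2 a b \<rhd> (\<lambda>p q. t1 q c \<rhd> (\<lambda>r s. h p r s)))"
  using arg_cong[OF axiom_iii[OF pureA_closed[of a b c]], of "\<lambda>u. eval3 u h"]
  by (simp add: eval3_A eval3_pureA leg_closedA pureA_closed mlin h lin3_D[OF h])

lemma mult_bilinear: "is_bilinear A A A (*)"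
  unfolding is_bilinear_def linop_def[symmetric] by (simp add: mlin)

lemma mult_Lin: "mult \<in> Lin (A \<odot> A) A" and mult_pure: "mult (a \<otimes> b) = a * b"
  using lift[OF alg_vspace mult_bilinear] by (simp_all add: mult_def)

lemma counit1: "lin1 \<phi> \<Longrightarrow> (t1 a b \<rhd> (\<lambda>p q. \<epsilon> p * \<phi> q)) = \<phi> (a * b)"
  using arg_cong[OF axiom_iv(1)[of "a \<otimes> b"], of \<phi>]
  by (simp add: eps_id_eval pure_in_tensor_space mult_pure)

lemma counit2: "lin1 \<phi> \<Longrightarrow> (t2 a b \<rhd> (\<lambda>p q. \<phi> p * \<epsilon> q)) = \<phi> (a * b)"
  using arg_cong[OF axiom_iv(2)[of "a \<otimes> b"], of \<phi>]
  by (simp add: id_eps_eval pure_in_tensor_space mult_pure)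

text \<open>Two linear functionals that agree on products are equal since the algebra is idempotent.\<close>

lemma eq_on_products:
  assumes \<phi>: "lin1 \<phi>" and \<psi>: "lin1 \<psi>" and eq: "\<And>a b. \<phi> (a * b) = \<psi> (a * b)"
  shows "\<phi> x = \<psi> x"
proof -
  obtain t where t: "t \<in> pts (A \<odot> A)" "x = mult t" using idempotent by blast
  have "x = tlist A A t \<rhd> (*)"
    unfolding t(2) mult_def by (rule lift_ev[OF _ _ mult_bilinear t(1)]) simp_all
  then show ?thesis by (simp add: lin1_ev_eq \<phi> \<psi> eq)
qed

lemma eval3_mult_id:
  assumes \<beta>: "lin2 \<beta>" and u: "u \<in> pts (A \<odot> A \<odot> A)"
  shows "mult_id u \<beta> = eval3 u (\<lambda>x y z. \<beta> (x * y) z)"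
proof (rule linear_eqI3[OF alg_vspace _ eval3_linear _ u])
  have m: "is_linear (A \<odot> A \<odot> A) (A \<odot> A) mult_id"
    unfolding mult_id_def by (rule LinD[OF tmap_Lin[OF LinD[OF mult_Lin] is_linear_id]])
  then show "is_linear (A \<odot> A \<odot> A) ground (\<lambda>u. mult_id u \<beta>)"
    by (simp add: is_linear_def tscale_def)
  have h: "lin3 (\<lambda>x y z. \<beta> (x * y) z)" by (simp add: mlin lin2_D[OF \<beta>])
  show "mult_id ((x \<otimes> y) \<otimes>\<^bsub>A \<odot> A,A\<^esub> z) \<beta> =
    eval3 ((x \<otimes> y) \<otimes>\<^bsub>A \<odot> A,A\<^esub> z) (\<lambda>x y z. \<beta> (x * y) z)" for x y z
    unfolding eval3_pureA[OF h] mult_id_def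
    using tmap_pure[OF LinD[OF mult_Lin] is_linear_id[of A], of "x \<otimes> y" z]
    by (simp add: pure_in_tensor_space mult_pure) (use \<beta> in \<open>simp add: pure_def lin2_iff\<close>)
qed

lemma comult_mult1:
  assumes \<beta>: "lin2 \<beta>"
  shows "(t1 b c \<rhd> (\<lambda>p q. t1 a q \<rhd> (\<lambda>r s. \<beta> (r * p) s))) = (t1 (a * b) c \<rhd> \<beta>)"
proof -
  have h: "lin3 (\<lambda>x y z. \<beta> (x * y) z)" by (simp add: mlin lin2_D[OF \<beta>])
  have "mult_id ((a \<otimes> b) \<otimes>\<^bsub>A \<odot> A,A\<^esub> c) = (a * b) \<otimes> c"
    using tmap_pure[OF LinD[OF mult_Lin] is_linear_id[of A], of "a \<otimes> b" c]
    by (simp add: pure_in_tensor_space mult_pure mult_id_def)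
  then show ?thesis
    using eval_ext[OF axiom_v[OF pureA_closed[of a b c]], of \<beta>]
    by (simp add: eval3_mult_id eval3_A eval3_pureA leg_closedA pureA_closed \<beta>
        sw_eval mlin lin2_D[OF \<beta>])
qed

lemma span_eval_eq:
  fixes \<beta> \<gamma> :: 'b
  assumes "ts.span X = ts.span Y"
  shows "(\<forall>t\<in>X. t \<beta> = t \<gamma>) \<longleftrightarrow> (\<forall>t\<in>Y. t \<beta> = t \<gamma>)"
proof -
  have sub: "ts.subspace {t. t \<beta> = t \<gamma>}"
    by (rule ts.subspaceI) (simp_all add: tscale_def)
  have *: "(\<forall>t\<in>Z. t \<beta> = t \<gamma>) \<longleftrightarrow> ts.span Z \<subseteq> {t. t \<beta> = t \<gamma>}" for Z
  proof
    show "ts.span Z \<subseteq> {t. t \<beta> = t \<gamma>}" if "\<forall>t\<in>Z. t \<beta> = t \<gamma>"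
      by (rule ts.span_minimal[OF _ sub]) (use that in auto)
    show "\<forall>t\<in>Z. t \<beta> = t \<gamma>" if "ts.span Z \<subseteq> {t. t \<beta> = t \<gamma>}"
      using that ts.span_superset[of Z] by auto
  qed
  show ?thesis unfolding * assms ..
qed

lemma ball_image2:
  "(\<forall>t\<in>{f a b c | a b c. True}. P t) \<longleftrightarrow> (\<forall>a b c. P (f a b c))"
  "(\<forall>t\<in>{g b c | b c. True}. P t) \<longleftrightarrow> (\<forall>b c. P (g b c))"
  by blast+

text \<open>
  A form on the range of \<open>E\<^sub>1\<close> is determined by its values on the elements \<open>\<Delta>(a)(b \<otimes> c)\<close>, because
  these span the range.
\<close>

lemma E1_range:
  assumes \<beta>: "lin2 \<beta>" and \<gamma>: "lin2 \<gamma>"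
  shows "(\<forall>a b c. (t1 a c \<rhd> (\<lambda>p q. \<beta> (p * b) q)) = (t1 a c \<rhd> (\<lambda>p q. \<gamma> (p * b) q))) \<longleftrightarrow>
    (\<forall>b c. (e1 b c \<rhd> \<beta>) = (e1 b c \<rhd> \<gamma>))"
proof -
  note ev = tt_eval[OF linear_maps(3) _ _ \<beta>] tt_eval[OF linear_maps(3) _ _ \<gamma>]
    sw_eval[OF linear_maps(1) \<beta>] sw_eval[OF linear_maps(1) \<gamma>]
  show ?thesis
    using span_eval_eq[OF axiom_vi(1), of \<beta> \<gamma>]
    by (simp only: ball_image2 ev linop_id linop_mult_id)
qed

text \<open>
  Forms that are invariant under \<open>E\<^sub>1\<close> are determined by their restrictions to the range of \<open>E\<^sub>1\<close>.
\<close>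

lemma eq_if_E1_invariant:
  assumes \<beta>: "lin2 \<beta>" and \<gamma>: "lin2 \<gamma>"
    and inv: "\<And>d b. (e1 d b \<rhd> \<beta>) = \<beta> d b" "\<And>d b. (e1 d b \<rhd> \<gamma>) = \<gamma> d b"
    and eq: "\<And>e d b. (t1 e b \<rhd> (\<lambda>p q. \<beta> (p * d) q)) = (t1 e b \<rhd> (\<lambda>p q. \<gamma> (p * d) q))"
  shows "\<beta> d b = \<gamma> d b"
proof -
  have "(e1 d b \<rhd> \<beta>) = (e1 d b \<rhd> \<gamma>)"
    using E1_range[OF \<beta> \<gamma>] eq by blast
  then show ?thesis by (simp add: inv)
qed

text \<open>Here the spanning elements are \<open>(b \<otimes> c)\<Delta>(a)\<close>.\<close>

lemma E2_range:
  assumes \<beta>: "lin2 \<beta>" and \<gamma>: "lin2 \<gamma>"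
  shows "(\<forall>a b c. (t2 b a \<rhd> (\<lambda>p q. \<beta> p (c * q))) = (t2 b a \<rhd> (\<lambda>p q. \<gamma> p (c * q)))) \<longleftrightarrow>
    (\<forall>b c. (e2 b c \<rhd> \<beta>) = (e2 b c \<rhd> \<gamma>))"
proof -
  note ev = tt_eval[OF linear_maps(4) _ _ \<beta>] tt_eval[OF linear_maps(4) _ _ \<gamma>]
    sw_eval[OF linear_maps(2) \<beta>] sw_eval[OF linear_maps(2) \<gamma>]
  show ?thesis
    using span_eval_eq[OF axiom_vi(2), of \<beta> \<gamma>]
    by (simp only: ball_image2 ev linop_id linop_mult_id)
qed

lemma E1_T1:
  assumes h: "lin3 h"
  shows "(t1 b c \<rhd> (\<lambda>p q. e1 a p \<rhd> (\<lambda>r s. h r s q))) = (e1 a b \<rhd> (\<lambda>p q. t1 q c \<rhd> (\<lambda>r s. h p r s)))"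
  using arg_cong[OF axiom_vii(1)[OF pureA_closed[of a b c]], of "\<lambda>u. eval3 u h"]
  by (simp add: eval3_A eval3_pureA leg_closedA pureA_closed mlin h lin3_D[OF h])

lemma E2_T2:
  assumes h: "lin3 h"
  shows "(t2 b c \<rhd> (\<lambda>p q. e2 a p \<rhd> (\<lambda>r s. h r s q))) = (e2 a c \<rhd> (\<lambda>p q. t2 b q \<rhd> (\<lambda>r s. h p r s)))"
  using arg_cong[OF axiom_vii(2)[OF pureA_closed[of a b c]], of "\<lambda>u. eval3 u h"]
  by (simp add: eval3_A eval3_pureA leg_closedA pureA_closed mlin h lin3_D[OF h])

lemma counit_E1:
  "lin1 \<phi> \<Longrightarrow> (e1 b c \<rhd> (\<lambda>p q. \<epsilon> p * \<phi> (a * q))) = (t1 a c \<rhd> (\<lambda>p q. \<epsilon> (p * b) * \<phi> q))"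
  using arg_cong[OF axiom_viii(1)[of a b c], of \<phi>]
  by (simp add: contr_eval tt_closed tt_eval mlin lin1_comp)

lemma counit_E2:
  "lin1 \<phi> \<Longrightarrow> (e2 a b \<rhd> (\<lambda>p q. \<epsilon> p * \<phi> (q * c))) = (t2 a c \<rhd> (\<lambda>p q. \<epsilon> p * \<phi> (b * q)))"
  using arg_cong[OF axiom_viii(2)[of c a b], of \<phi>]
  by (simp add: contr_eval tt_closed tt_eval mlin lin1_comp)

lemma T1_T3: "lin2 \<beta> \<Longrightarrow> (t1 c b \<rhd> (\<lambda>p q. \<beta> p (a * q))) = (t3 c a \<rhd> (\<lambda>p q. \<beta> p (q * b)))"
  using eval_ext[OF axiom_ix(1)[of a c b], of \<beta>] by (simp add: tt_eval mlin)

lemma T2_T4: "lin2 \<beta> \<Longrightarrow> (t2 a c \<rhd> (\<lambda>p q. \<beta> (p * b) q)) = (t4 b c \<rhd> (\<lambda>p q. \<beta> (a * p) q))"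
  using eval_ext[OF axiom_ix(2)[of b a c], of \<beta>] by (simp add: tt_eval mlin)

section \<open>Consequences of the axioms\<close>

declare mlin [simp]

text \<open>
  Both sides are \<open>(a \<otimes> 1)\<Delta>(b)(1 \<otimes> c)\<close>. This makes \<open>\<Delta>(b)\<close> a multiplier; applying the counit to the
  middle leg of coassociativity proves it.
\<close>

lemma T1_T2:
  assumes \<beta>: "lin2 \<beta>"
  shows "(t1 b c \<rhd> (\<lambda>p q. \<beta> (a * p) q)) = (t2 a b \<rhd> (\<lambda>p q. \<beta> p (q * c)))"
proof -
  note [simp] = lin2_D[OF \<beta>]
  have "(t1 b c \<rhd> (\<lambda>p q. \<beta> (a * p) q)) = (t1 b c \<rhd> (\<lambda>p q. t2 a p \<rhd> (\<lambda>r s. \<beta> r q * \<epsilon> s)))"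
    by (simp add: counit2)
  also have "\<dots> = (t2 a b \<rhd> (\<lambda>p q. t1 q c \<rhd> (\<lambda>r s. \<beta> p s * \<epsilon> r)))"
    by (rule coassoc) simp
  also have "\<dots> = (t2 a b \<rhd> (\<lambda>p q. \<beta> p (q * c)))"
    by (simp add: counit1 flip: mult.commute[of "\<epsilon> r" for r])
  finally show ?thesis .
qed

text \<open>Both sides are \<open>\<Delta>(c)(b \<otimes> k)\<close>.\<close>

lemma T4_T1: "\<forall>\<beta>. lin2 \<beta> \<longrightarrow> (t4 b c \<rhd> (\<lambda>p q. \<beta> p (q * k))) = (t1 c k \<rhd> (\<lambda>p q. \<beta> (p * b) q))"
proof (rule cancel2_1[OF separating_left])
  fix x \<beta> assume \<beta>: "lin2 \<beta>"
  note [simp] = lin2_D[OF \<beta>]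
  show "(t4 b c \<rhd> (\<lambda>p q. \<beta> (x * p) (q * k))) = (t1 c k \<rhd> (\<lambda>p q. \<beta> (x * (p * b)) q))"
    using T1_T2[of "\<lambda>p q. \<beta> (p * b) q" c k x] T2_T4[of "\<lambda>p q. \<beta> p (q * k)" x c b]
    by (simp add: mult.assoc)
qed (intro fin_intros)+

lemma E1_mult1: "\<forall>\<beta>. lin2 \<beta> \<longrightarrow> (e1 (a * b) c \<rhd> \<beta>) = (e1 a c \<rhd> (\<lambda>p q. \<beta> (p * b) q))"
proof (rule cancel2_12[OF separating_left separating_left])
  fix x y \<beta> assume \<beta>: "lin2 \<beta>"
  note [simp] = lin2_D[OF \<beta>]
  show "(e1 (a * b) c \<rhd> (\<lambda>p q. \<beta> (x * p) (y * q))) = (e1 a c \<rhd> (\<lambda>p q. \<beta> (x * (p * b)) (y * q)))"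
    using E1_E2[of \<beta> "a * b" c x y] E1_E2[of "\<lambda>p q. \<beta> (p * b) q" a c x y]
    by (simp add: mult.assoc)
qed (intro fin_intros)+

lemma E1_mult2: "\<forall>\<beta>. lin2 \<beta> \<longrightarrow> (e1 a (c * d) \<rhd> \<beta>) = (e1 a c \<rhd> (\<lambda>p q. \<beta> p (q * d)))"
proof (rule cancel2_12[OF separating_left separating_left])
  fix x y \<beta> assume \<beta>: "lin2 \<beta>"
  note [simp] = lin2_D[OF \<beta>]
  show "(e1 a (c * d) \<rhd> (\<lambda>p q. \<beta> (x * p) (y * q))) = (e1 a c \<rhd> (\<lambda>p q. \<beta> (x * p) (y * (q * d))))"
    using E1_E2[of \<beta> a "c * d" x y] E1_E2[of "\<lambda>p q. \<beta> p (q * d)" a c x y]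
    by (simp add: mult.assoc)
qed (intro fin_intros)+

lemma E2_mult2: "\<forall>\<beta>. lin2 \<beta> \<longrightarrow> (e2 a (b * c) \<rhd> \<beta>) = (e2 a c \<rhd> (\<lambda>p q. \<beta> p (b * q)))"
proof (rule cancel2_12[OF separating_right separating_right])
  fix x y \<beta> assume \<beta>: "lin2 \<beta>"
  note [simp] = lin2_D[OF \<beta>]
  show "(e2 a (b * c) \<rhd> (\<lambda>p q. \<beta> (p * x) (q * y))) = (e2 a c \<rhd> (\<lambda>p q. \<beta> (p * x) (b * q * y)))"
    using E1_E2[of \<beta> x y a "b * c"] E1_E2[of "\<lambda>p q. \<beta> p (b * q)" x y a c]
    by (simp add: mult.assoc)
qed (intro fin_intros)+

lemma E2_idem: "\<forall>\<beta>. lin2 \<beta> \<longrightarrow> (e2 a b \<rhd> (\<lambda>p q. e2 p q \<rhd> \<beta>)) = (e2 a b \<rhd> \<beta>)"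
proof (rule cancel2_12[OF separating_right separating_right])
  fix x y \<beta> assume \<beta>: "lin2 \<beta>"
  note [simp] = lin2_D[OF \<beta>]
  have "(e2 a b \<rhd> (\<lambda>p q. e2 p q \<rhd> (\<lambda>p q. \<beta> (p * x) (q * y)))) =
      (e2 a b \<rhd> (\<lambda>p q. e1 x y \<rhd> (\<lambda>r s. \<beta> (p * r) (q * s))))"
    by (intro ev_cong refl E1_E2[symmetric] \<beta>)
  also have "\<dots> = (e1 x y \<rhd> (\<lambda>r s. e2 a b \<rhd> (\<lambda>p q. \<beta> (p * r) (q * s))))"
    by (rule ev_swap)
  also have "\<dots> = (e1 x y \<rhd> (\<lambda>r s. e1 r s \<rhd> (\<lambda>p q. \<beta> (a * p) (b * q))))"
    by (intro ev_cong refl E1_E2[symmetric] \<beta>)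
  also have "\<dots> = (e1 x y \<rhd> (\<lambda>p q. \<beta> (a * p) (b * q)))"
    by (rule E1_idem) simp
  also have "\<dots> = (e2 a b \<rhd> (\<lambda>p q. \<beta> (p * x) (q * y)))"
    by (rule E1_E2[OF \<beta>])
  finally show "(e2 a b \<rhd> (\<lambda>p q. e2 p q \<rhd> (\<lambda>p q. \<beta> (p * x) (q * y)))) =
    (e2 a b \<rhd> (\<lambda>p q. \<beta> (p * x) (q * y)))" .
qed (intro fin_intros)+

text \<open>\<open>E \<Delta>(a) = \<Delta>(a)\<close>, since \<open>\<Delta>(a)(x \<otimes> c)\<close> lies in the range of the idempotent \<open>E\<^sub>1\<close>.\<close>

lemma T1_E1: "\<forall>\<beta>. lin2 \<beta> \<longrightarrow> (t1 a c \<rhd> (\<lambda>p q. e1 p q \<rhd> \<beta>)) = (t1 a c \<rhd> \<beta>)"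
proof (rule cancel2_1[OF separating_right])
  fix x \<beta> assume \<beta>: "lin2 \<beta>"
  note [simp] = lin2_D[OF \<beta>]
  have "(t1 a c \<rhd> (\<lambda>p q. e1 (p * x) q \<rhd> \<beta>)) = (t1 a c \<rhd> (\<lambda>p q. \<beta> (p * x) q))"
    using E1_range[of "\<lambda>p q. e1 p q \<rhd> \<beta>" \<beta>] by (simp add: E1_idem)
  then show "(t1 a c \<rhd> (\<lambda>p q. e1 p q \<rhd> (\<lambda>p q. \<beta> (p * x) q))) = (t1 a c \<rhd> (\<lambda>p q. \<beta> (p * x) q))"
    using E1_mult1 \<beta> by simp
qed (intro fin_intros)+

lemma T2_E2: "\<forall>\<beta>. lin2 \<beta> \<longrightarrow> (t2 a c \<rhd> (\<lambda>p q. e2 p q \<rhd> \<beta>)) = (t2 a c \<rhd> \<beta>)"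
proof (rule cancel2_2[OF separating_left])
  fix x \<beta> assume \<beta>: "lin2 \<beta>"
  note [simp] = lin2_D[OF \<beta>]
  have "(t2 a c \<rhd> (\<lambda>p q. e2 p (x * q) \<rhd> \<beta>)) = (t2 a c \<rhd> (\<lambda>p q. \<beta> p (x * q)))"
    using E2_range[of "\<lambda>p q. e2 p q \<rhd> \<beta>" \<beta>] E2_idem by simp
  then show "(t2 a c \<rhd> (\<lambda>p q. e2 p q \<rhd> (\<lambda>p q. \<beta> p (x * q)))) = (t2 a c \<rhd> (\<lambda>p q. \<beta> p (x * q)))"
    using E2_mult2 \<beta> by simp
qed (intro fin_intros)+

text \<open>\<open>\<Delta>(a) E = \<Delta>(a)\<close>. To reach \<open>E\<close> from the other side, \<open>T\<^sub>1\<close> is traded for \<open>T\<^sub>2\<close>.\<close>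

lemma comult_E1:
  "\<forall>\<beta>. lin2 \<beta> \<longrightarrow>
    (e1 b c \<rhd> (\<lambda>p q. t1 a q \<rhd> (\<lambda>r s. \<beta> (r * p) s))) = (t1 a c \<rhd> (\<lambda>r s. \<beta> (r * b) s))"
proof (rule cancel2_1[OF separating_left])
  fix x \<beta> assume \<beta>: "lin2 \<beta>"
  note [simp] = lin2_D[OF \<beta>]
  have "(e1 b c \<rhd> (\<lambda>p q. t1 a q \<rhd> (\<lambda>r s. \<beta> (x * (r * p)) s))) =
      (e1 b c \<rhd> (\<lambda>p q. t2 x a \<rhd> (\<lambda>r s. \<beta> (r * p) (s * q))))"
    using T1_T2[of "\<lambda>r s. \<beta> (r * p) s" for p] by (simp add: mult.assoc)
  also have "\<dots> = (t2 x a \<rhd> (\<lambda>r s. e1 b c \<rhd> (\<lambda>p q. \<beta> (r * p) (s * q))))"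
    by (rule ev_swap)
  also have "\<dots> = (t2 x a \<rhd> (\<lambda>r s. e2 r s \<rhd> (\<lambda>p q. \<beta> (p * b) (q * c))))"
    by (intro ev_cong refl E1_E2 \<beta>)
  also have "\<dots> = (t2 x a \<rhd> (\<lambda>p q. \<beta> (p * b) (q * c)))"
    by (rule T2_E2[rule_format]) simp
  also have "\<dots> = (t1 a c \<rhd> (\<lambda>r s. \<beta> (x * (r * b)) s))"
    using T1_T2[of "\<lambda>r s. \<beta> (r * b) s" a c x] by (simp add: mult.assoc)
  finally show "(e1 b c \<rhd> (\<lambda>p q. t1 a q \<rhd> (\<lambda>r s. \<beta> (x * (r * p)) s))) =
    (t1 a c \<rhd> (\<lambda>r s. \<beta> (x * (r * b)) s))" .
qed (intro fin_intros)+

lemma E2_comult: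
  "\<forall>\<beta>. lin2 \<beta> \<longrightarrow>
    (e2 r s \<rhd> (\<lambda>p q. t2 p b \<rhd> (\<lambda>u v. \<beta> u (q * v)))) = (t2 r b \<rhd> (\<lambda>u v. \<beta> u (s * v)))"
proof (rule cancel2_2[OF separating_right])
  fix x \<beta> assume \<beta>: "lin2 \<beta>"
  note [simp] = lin2_D[OF \<beta>]
  have "(e2 r s \<rhd> (\<lambda>p q. t2 p b \<rhd> (\<lambda>u v. \<beta> u (q * v * x)))) =
      (e2 r s \<rhd> (\<lambda>p q. t1 b x \<rhd> (\<lambda>u v. \<beta> (p * u) (q * v))))"
    using T1_T2[of "\<lambda>u v. \<beta> u (q * v)" for q] by (simp add: mult.assoc)
  also have "\<dots> = (t1 b x \<rhd> (\<lambda>u v. e2 r s \<rhd> (\<lambda>p q. \<beta> (p * u) (q * v))))"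
    by (rule ev_swap)
  also have "\<dots> = (t1 b x \<rhd> (\<lambda>u v. e1 u v \<rhd> (\<lambda>p q. \<beta> (r * p) (s * q))))"
    by (intro ev_cong refl E1_E2[symmetric] \<beta>)
  also have "\<dots> = (t1 b x \<rhd> (\<lambda>p q. \<beta> (r * p) (s * q)))"
    by (rule T1_E1[rule_format]) simp
  also have "\<dots> = (t2 r b \<rhd> (\<lambda>u v. \<beta> u (s * v * x)))"
    using T1_T2[of "\<lambda>u v. \<beta> u (s * v)" b x r] by (simp add: mult.assoc)
  finally show "(e2 r s \<rhd> (\<lambda>p q. t2 p b \<rhd> (\<lambda>u v. \<beta> u (q * v * x)))) =
    (t2 r b \<rhd> (\<lambda>u v. \<beta> u (s * v * x)))" .
qed (intro fin_intros)+

text \<open>Both sides are \<open>x a\<^sub>1 b\<^sub>1 \<otimes> a\<^sub>2 b\<^sub>2\<close>.\<close>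

lemma T2_mult2:
  "\<forall>\<beta>. lin2 \<beta> \<longrightarrow> (t2 x (a * b) \<rhd> \<beta>) = (t2 x a \<rhd> (\<lambda>p q. t2 p b \<rhd> (\<lambda>r s. \<beta> r (q * s))))"
proof (rule cancel2_2[OF separating_right])
  fix c \<beta> assume \<beta>: "lin2 \<beta>"
  note [simp] = lin2_D[OF \<beta>]
  have "(t2 x (a * b) \<rhd> (\<lambda>p q. \<beta> p (q * c))) = (t1 (a * b) c \<rhd> (\<lambda>p q. \<beta> (x * p) q))"
    by (rule T1_T2[OF \<beta>, symmetric])
  also have "\<dots> = (t1 b c \<rhd> (\<lambda>p q. t1 a q \<rhd> (\<lambda>r s. \<beta> (x * (r * p)) s)))"
    by (rule comult_mult1[symmetric]) simp
  also have "\<dots> = (t1 b c \<rhd> (\<lambda>p q. t2 x a \<rhd> (\<lambda>r s. \<beta> (r * p) (s * q))))"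
    using T1_T2[of "\<lambda>r s. \<beta> (r * p) s" for p] by (simp add: mult.assoc)
  also have "\<dots> = (t2 x a \<rhd> (\<lambda>r s. t1 b c \<rhd> (\<lambda>p q. \<beta> (r * p) (s * q))))"
    by (rule ev_swap)
  also have "\<dots> = (t2 x a \<rhd> (\<lambda>p q. t2 p b \<rhd> (\<lambda>r s. \<beta> r (q * s * c))))"
    using T1_T2[of "\<lambda>r s. \<beta> r (q * s)" for q] by (simp add: mult.assoc)
  finally show "(t2 x (a * b) \<rhd> (\<lambda>p q. \<beta> p (q * c))) =
    (t2 x a \<rhd> (\<lambda>p q. t2 p b \<rhd> (\<lambda>r s. \<beta> r (q * s * c))))" .
qed (intro fin_intros)+

text \<open>
  \<open>(a \<otimes> \<Delta>(b))(E \<otimes> 1) = (A \<otimes> \<Delta>)((a \<otimes> b) E)\<close>, with the third leg covered from the right. The axiom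
  that relates \<open>E\<^sub>2\<close> and \<open>T\<^sub>2\<close> is the same identity with the second leg covered from the left.
\<close>

lemma E2_T1:
  "\<forall>h. lin3 h \<longrightarrow> (t1 b c \<rhd> (\<lambda>p q. e2 a p \<rhd> (\<lambda>r s. h r s q))) =
    (e2 a b \<rhd> (\<lambda>p q. t1 q c \<rhd> (\<lambda>r s. h p r s)))"
proof (rule cancel3_2[OF separating_left])
  fix y h assume h: "lin3 h"
  note [simp] = lin3_D[OF h]
  have "(t1 b c \<rhd> (\<lambda>p q. e2 a p \<rhd> (\<lambda>r s. h r (y * s) q))) =
      (t1 b c \<rhd> (\<lambda>p q. e2 a (y * p) \<rhd> (\<lambda>r s. h r s q)))"
    by (intro ev_cong refl E2_mult2[rule_format, symmetric]) simp
  also have "\<dots> = (t2 y b \<rhd> (\<lambda>p q. e2 a p \<rhd> (\<lambda>r s. h r s (q * c))))"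
    by (rule T1_T2) simp
  also have "\<dots> = (e2 a b \<rhd> (\<lambda>p q. t2 y q \<rhd> (\<lambda>r s. h p r (s * c))))"
    by (rule E2_T2) simp
  also have "\<dots> = (e2 a b \<rhd> (\<lambda>p q. t1 q c \<rhd> (\<lambda>r s. h p (y * r) s)))"
    by (intro ev_cong refl T1_T2[symmetric]) simp
  finally show "(t1 b c \<rhd> (\<lambda>p q. e2 a p \<rhd> (\<lambda>r s. h r (y * s) q))) =
      (e2 a b \<rhd> (\<lambda>p q. t1 q c \<rhd> (\<lambda>r s. h p (y * r) s)))" .
qed (intro fin_intros)+

text \<open>Both sides are \<open>y p\<^sub>1 b\<^sub>1 \<otimes> p\<^sub>2 b\<^sub>2 \<otimes> p\<^sub>3 c\<close>.\<close>

lemma comult_split: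
  assumes h: "lin3 h"
  shows "(t1 p c \<rhd> (\<lambda>u v. t2 y (u * b) \<rhd> (\<lambda>r s. h r s v))) =
    (t2 y p \<rhd> (\<lambda>u v. t2 u b \<rhd> (\<lambda>r s. t1 v c \<rhd> (\<lambda>m n. h r (m * s) n))))"
proof -
  note [simp] = lin3_D[OF h]
  have "(t1 p c \<rhd> (\<lambda>u v. t2 y (u * b) \<rhd> (\<lambda>r s. h r s v))) =
      (t1 p c \<rhd> (\<lambda>u v. t2 y u \<rhd> (\<lambda>r' s'. t2 r' b \<rhd> (\<lambda>r s. h r (s' * s) v))))"
    by (intro ev_cong refl T2_mult2[rule_format]) simp
  also have "\<dots> = (t2 y p \<rhd> (\<lambda>r' q. t1 q c \<rhd> (\<lambda>s' v. t2 r' b \<rhd> (\<lambda>r s. h r (s' * s) v))))"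
    by (rule coassoc) simp
  also have "\<dots> = (t2 y p \<rhd> (\<lambda>u v. t2 u b \<rhd> (\<lambda>r s. t1 v c \<rhd> (\<lambda>m n. h r (m * s) n))))"
    by (intro ev_cong refl ev_swap)
  finally show ?thesis .
qed

text \<open>
  For \<open>K(y \<otimes> z) = y b\<^sub>1 \<otimes> z\<^sub>1 b\<^sub>2 \<otimes> z\<^sub>2 c\<close> the claim is that replacing \<open>b \<otimes> c\<close> by \<open>E(b \<otimes> c)\<close> does
  not change \<open>K(y \<otimes> z)\<close>. If \<open>y \<otimes> z\<close> is replaced by \<open>(y \<otimes> w)\<Delta>(p)\<close>, then \<open>K\<close> involves \<open>b\<close> and \<open>c\<close>
  only through \<open>\<Delta>(p)(b \<otimes> c)\<close>, and \<open>\<Delta>(p) E = \<Delta>(p)\<close>. These elements span the range of \<open>E\<^sub>2\<close>, and \<open>K\<close>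
  does not distinguish \<open>y \<otimes> z\<close> from \<open>(y \<otimes> z)E\<close>.
\<close>

lemma E1_T2_invariant:
  assumes h: "lin3 h"
  shows "(e1 b c \<rhd> (\<lambda>b' c'. t2 y b' \<rhd> (\<lambda>r s. t1 z c' \<rhd> (\<lambda>m n. h r (m * s) n)))) =
    (t2 y b \<rhd> (\<lambda>r s. t1 z c \<rhd> (\<lambda>m n. h r (m * s) n)))"
proof -
  define K where "K h b c u v = (t2 u b \<rhd> (\<lambda>r s. t1 v c \<rhd> (\<lambda>m n. h r (m * s) n)))"
    for h :: "'a \<Rightarrow> 'a \<Rightarrow> 'a \<Rightarrow> 'k" and b c u v
  have inv: "(t2 y p \<rhd> (\<lambda>u v. e1 b c \<rhd> (\<lambda>b' c'. K h b' c' u v))) = (t2 y p \<rhd> (\<lambda>u v. K h b c u v))"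
    if h: "lin3 h" for h p y
  proof -
    note [simp] = lin3_D[OF h]
    have "(t2 y p \<rhd> (\<lambda>u v. e1 b c \<rhd> (\<lambda>b' c'. K h b' c' u v))) =
        (e1 b c \<rhd> (\<lambda>b' c'. t2 y p \<rhd> (\<lambda>u v. K h b' c' u v)))"
      by (rule ev_swap)
    also have "\<dots> = (e1 b c \<rhd> (\<lambda>b' c'. t1 p c' \<rhd> (\<lambda>u v. t2 y (u * b') \<rhd> (\<lambda>r s. h r s v))))"
      unfolding K_def by (intro ev_cong refl comult_split[symmetric] h)
    also have "\<dots> = (t1 p c \<rhd> (\<lambda>u v. t2 y (u * b) \<rhd> (\<lambda>r s. h r s v)))"
      by (rule comult_E1[rule_format]) simp
    also have "\<dots> = (t2 y p \<rhd> (\<lambda>u v. K h b c u v))"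
      unfolding K_def by (rule comult_split[OF h])
    finally show ?thesis .
  qed
  note [simp] = lin3_D[OF h]
  have K_left: "K h b c u (z * v) = K (\<lambda>r x n. t1 z n \<rhd> (\<lambda>m n. h r (m * x) n)) b c u v" for b c u v z
    unfolding K_def
  proof (rule ev_cong[OF refl])
    fix r s
    show "(t1 (z * v) c \<rhd> (\<lambda>m n. h r (m * s) n)) =
        (t1 v c \<rhd> (\<lambda>m n. t1 z n \<rhd> (\<lambda>m' n. h r (m' * (m * s)) n)))"
      using comult_mult1[of "\<lambda>m n. h r (m * s) n" v c z] by (simp add: mult.assoc)
  qed
  have K_lin: "lin2 (K h b c)" "lin2 (\<lambda>u v. e1 b c \<rhd> (\<lambda>b' c'. K h b' c' u v))" for b c
    by (simp_all add: K_def[abs_def])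
  have "(t2 x p \<rhd> (\<lambda>u v. e1 b c \<rhd> (\<lambda>b' c'. K h b' c' u (w * v)))) =
      (t2 x p \<rhd> (\<lambda>u v. K h b c u (w * v)))" for x p w
    unfolding K_left by (rule inv) simp
  then have "(e2 y z \<rhd> (\<lambda>u v. e1 b c \<rhd> (\<lambda>b' c'. K h b' c' u v))) = (e2 y z \<rhd> K h b c)"
    using E2_range[OF K_lin(2) K_lin(1)] by blast
  moreover have "(e2 y z \<rhd> K h b c) = (t2 y b \<rhd> (\<lambda>r s. t1 z c \<rhd> (\<lambda>m n. h r (m * s) n)))" for b c
  proof -
    have "(e2 y z \<rhd> (\<lambda>u v. t2 u b \<rhd> (\<lambda>r s. t1 v c \<rhd> (\<lambda>m n. h r (m * s) n)))) =
        (e2 y z \<rhd> (\<lambda>u v. t1 v c \<rhd> (\<lambda>m n. t2 u b \<rhd> (\<lambda>r s. h r (m * s) n))))"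
      by (intro ev_cong refl ev_swap)
    also have "\<dots> = (t1 z c \<rhd> (\<lambda>m n. e2 y m \<rhd> (\<lambda>u m'. t2 u b \<rhd> (\<lambda>r s. h r (m' * s) n))))"
      by (rule E2_T1[rule_format, symmetric]) simp
    also have "\<dots> = (t1 z c \<rhd> (\<lambda>m n. t2 y b \<rhd> (\<lambda>r s. h r (m * s) n)))"
      by (intro ev_cong refl E2_comult[rule_format]) simp
    also have "\<dots> = (t2 y b \<rhd> (\<lambda>r s. t1 z c \<rhd> (\<lambda>m n. h r (m * s) n)))"
      by (rule ev_swap)
    finally show ?thesis unfolding K_def[abs_def] .
  qed
  moreover have "(e2 y z \<rhd> (\<lambda>u v. e1 b c \<rhd> (\<lambda>b' c'. K h b' c' u v))) =
      (e1 b c \<rhd> (\<lambda>b' c'. e2 y z \<rhd> K h b' c'))"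
    by (rule ev_swap)
  ultimately show ?thesis by simp
qed

text \<open>
  \<open>(\<Delta> \<otimes> A)(E)(\<Delta>(b) \<otimes> c) = (1 \<otimes> E)(\<Delta>(b) \<otimes> c)\<close>; the axioms contain only the corresponding statement
  for \<open>A \<otimes> \<Delta>\<close>. The two sides are compared with \<open>(1 \<otimes> E)(\<Delta> \<otimes> A)(E(b \<otimes> c))\<close>: the factor \<open>E\<close> on the
  inside may be dropped by \<open>E1_T2_invariant\<close>, the one on the outside because \<open>E \<Delta>(v) = \<Delta>(v)\<close>.
\<close>

lemma E1_T2:
  assumes h: "lin3 h"
  shows "(e1 b c \<rhd> (\<lambda>p q. t2 a p \<rhd> (\<lambda>r s. h r s q))) = (t2 a b \<rhd> (\<lambda>p q. e1 q c \<rhd> (\<lambda>r s. h p r s)))"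
proof -
  have "\<forall>h. lin3 h \<longrightarrow> (t2 a b \<rhd> (\<lambda>r s. e1 s c \<rhd> (\<lambda>m n. h r m n))) =
      (e1 b c \<rhd> (\<lambda>b' c'. t2 a b' \<rhd> (\<lambda>r s. e1 s c' \<rhd> (\<lambda>m n. h r m n))))"
  proof (rule cancel3_23[OF separating_left separating_left])
    fix f g h assume h: "lin3 h"
    note [simp] = lin3_D[OF h]
    let ?\<beta> = "\<lambda>m n. t2 a b \<rhd> (\<lambda>r s. h r (m * s) (n * c))"
    let ?\<gamma> = "\<lambda>m n. e1 b c \<rhd> (\<lambda>b' c'. t2 a b' \<rhd> (\<lambda>r s. h r (m * s) (n * c')))"
    have T: "(t2 f' z \<rhd> (\<lambda>m n. t2 a b \<rhd> (\<lambda>r s. h r (m * s) (g' * n * c)))) =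
        (t2 a b \<rhd> (\<lambda>r s. t1 z c \<rhd> (\<lambda>m n. h r (f' * m * s) (g' * n))))" for f' g' z b c
    proof -
      have "(t2 f' z \<rhd> (\<lambda>m n. t2 a b \<rhd> (\<lambda>r s. h r (m * s) (g' * n * c)))) =
          (t1 z c \<rhd> (\<lambda>m n. t2 a b \<rhd> (\<lambda>r s. h r (f' * m * s) (g' * n))))"
        using T1_T2[of "\<lambda>m n. t2 a b \<rhd> (\<lambda>r s. h r (m * s) (g' * n))" z c f']
        by (simp add: mult.assoc)
      also have "\<dots> = (t2 a b \<rhd> (\<lambda>r s. t1 z c \<rhd> (\<lambda>m n. h r (f' * m * s) (g' * n))))"
        by (rule ev_swap)
      finally show ?thesis .
    qed
    have "(t2 f' z \<rhd> (\<lambda>m n. ?\<beta> m (g' * n))) = (t2 f' z \<rhd> (\<lambda>m n. ?\<gamma> m (g' * n)))" for f' g' z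
    proof -
      have "(t2 f' z \<rhd> (\<lambda>m n. ?\<gamma> m (g' * n))) =
          (e1 b c \<rhd> (\<lambda>b' c'. t2 f' z \<rhd> (\<lambda>m n. t2 a b' \<rhd> (\<lambda>r s. h r (m * s) (g' * n * c')))))"
        by (rule ev_swap)
      also have "\<dots> = (t2 f' z \<rhd> (\<lambda>m n. ?\<beta> m (g' * n)))"
        unfolding T using E1_T2_invariant[of "\<lambda>r x n. h r (f' * x) (g' * n)" b c a z]
        by (simp add: mult.assoc)
      finally show ?thesis ..
    qed
    then have "(e2 f g \<rhd> ?\<beta>) = (e2 f g \<rhd> ?\<gamma>)"
      using E2_range[of ?\<beta> ?\<gamma>] by simp
    moreover have "(e2 f g \<rhd> (\<lambda>m n. t2 a b \<rhd> (\<lambda>r s. h r (m * s) (n * c)))) =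
        (t2 a b \<rhd> (\<lambda>r s. e1 s c \<rhd> (\<lambda>m n. h r (f * m) (g * n))))" for b c
      by (subst ev_swap) (intro ev_cong refl E1_E2[symmetric]; simp)
    moreover have "(e2 f g \<rhd> ?\<gamma>) =
        (e1 b c \<rhd> (\<lambda>b' c'. e2 f g \<rhd> (\<lambda>m n. t2 a b' \<rhd> (\<lambda>r s. h r (m * s) (n * c')))))"
      by (rule ev_swap)
    ultimately show "(t2 a b \<rhd> (\<lambda>r s. e1 s c \<rhd> (\<lambda>m n. h r (f * m) (g * n)))) =
        (e1 b c \<rhd> (\<lambda>b' c'. t2 a b' \<rhd> (\<lambda>r s. e1 s c' \<rhd> (\<lambda>m n. h r (f * m) (g * n)))))"
      by simp
  qed (intro fin_intros)+
  moreover have "(e1 b c \<rhd> (\<lambda>b' c'. t2 a b' \<rhd> (\<lambda>r s. e1 s c' \<rhd> (\<lambda>m n. h r m n)))) =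
      (e1 b c \<rhd> (\<lambda>b' c'. t2 a b' \<rhd> (\<lambda>r s. h r s c')))"
  proof -
    note [simp] = lin3_D[OF h]
    have "(t1 p c \<rhd> (\<lambda>u v. t2 a (u * b) \<rhd> (\<lambda>r s. e1 s v \<rhd> (\<lambda>m n. h r m n)))) =
        (t1 p c \<rhd> (\<lambda>u v. t2 a (u * b) \<rhd> (\<lambda>r s. h r s v)))" for p b c
    proof -
      have "(t1 p c \<rhd> (\<lambda>u v. t2 a (u * b) \<rhd> (\<lambda>r s. e1 s v \<rhd> (\<lambda>m n. h r m n)))) =
          (t2 a p \<rhd> (\<lambda>u v. t2 u b \<rhd> (\<lambda>r s. t1 v c \<rhd> (\<lambda>m n. e1 (m * s) n \<rhd> (\<lambda>m n. h r m n)))))"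
        by (rule comult_split) simp
      also have "\<dots> = (t2 a p \<rhd> (\<lambda>u v. t2 u b \<rhd> (\<lambda>r s. t1 v c \<rhd> (\<lambda>m n. h r (m * s) n))))"
      proof -
        have "(t1 v c \<rhd> (\<lambda>m n. e1 (m * s) n \<rhd> (\<lambda>m n. h r m n))) =
            (t1 v c \<rhd> (\<lambda>m n. h r (m * s) n))" for v r s
        proof -
          have "(t1 v c \<rhd> (\<lambda>m n. e1 (m * s) n \<rhd> (\<lambda>m n. h r m n))) =
              (t1 v c \<rhd> (\<lambda>m n. e1 m n \<rhd> (\<lambda>m n. h r (m * s) n)))"
            by (intro ev_cong refl E1_mult1[rule_format]) simp
          also have "\<dots> = (t1 v c \<rhd> (\<lambda>m n. h r (m * s) n))"
            by (rule T1_E1[rule_format]) simp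
          finally show ?thesis .
        qed
        then show ?thesis by simp
      qed
      also have "\<dots> = (t1 p c \<rhd> (\<lambda>u v. t2 a (u * b) \<rhd> (\<lambda>r s. h r s v)))"
        by (rule comult_split[OF h, symmetric])
      finally show ?thesis .
    qed
    then show ?thesis
      using E1_range[of "\<lambda>b' c'. t2 a b' \<rhd> (\<lambda>r s. e1 s c' \<rhd> (\<lambda>m n. h r m n))"
          "\<lambda>b' c'. t2 a b' \<rhd> (\<lambda>r s. h r s c')"] by simp
  qed
  ultimately show ?thesis using h by simp
qed

lemma nondegenerate_eq:
  "(\<And>b. b * x = b * y) \<Longrightarrow> x = y" "(\<And>b. x * b = y * b) \<Longrightarrow> x = (y :: 'a)"
  using nondegenerate(2)[of "x - y"] nondegenerate(1)[of "x - y"] by (simp_all add: algebra_simps)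

text \<open>The product \<open>\<Sqinter>\<^sup>L(y) b = \<epsilon>(y b\<^sub>1) b\<^sub>2\<close> with the barred \<open>\<Sqinter>\<^sup>L\<close>.\<close>

definition ll :: "'a \<Rightarrow> 'a \<Rightarrow> 'a" where
  "ll y b = eps_id (T2 H (y \<otimes> b))"

lemma ll_eval: "lin1 \<phi> \<Longrightarrow> \<phi> (ll y b) = (t2 y b \<rhd> (\<lambda>p q. \<epsilon> p * \<phi> q))"
  by (simp add: ll_def eps_id_eval)

lemma linop_of_functionals:
  assumes "\<And>\<phi>. lin1 \<phi> \<Longrightarrow> lin1 (\<lambda>z. \<phi> (f z))"
  shows "linop f"
  unfolding linop_iff
proof (intro conjI allI)
  fix x y show "f (x + y) = f x + f y"
  proof (rule eqI_functional)
    fix \<phi> assume \<phi>: "lin1 \<phi>"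
    show "\<phi> (f (x + y)) = \<phi> (f x + f y)" using \<phi> assms[OF \<phi>] by (simp add: lin1_iff)
  qed
next
  fix c x show "f (scl A c x) = scl A c (f x)"
  proof (rule eqI_functional)
    fix \<phi> assume \<phi>: "lin1 \<phi>"
    show "\<phi> (f (scl A c x)) = \<phi> (scl A c (f x))" using \<phi> assms[OF \<phi>] by (simp add: lin1_iff)
  qed
qed

lemma linop_comp: "linop f \<Longrightarrow> linop g \<Longrightarrow> linop (\<lambda>z. f (g z))"
  by (simp add: linop_iff)

lemma linop_ll: "linop (ll y)" "linop (\<lambda>y. ll y b)"
  by (rule linop_of_functionals; simp add: ll_eval lin1_comp)+

lemma ll_mult: "ll y (c * d) = ll y c * d"
proof (rule nondegenerate_eq(1), rule eqI_functional)
  fix b \<phi> assume \<phi>: "lin1 \<phi>"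
  note [simp] = lin1_comp[OF \<phi>] \<phi>
  have "\<phi> (b * ll y (c * d)) = (t2 y (c * d) \<rhd> (\<lambda>p q. \<epsilon> p * \<phi> (b * q)))"
    using ll_eval[of "\<lambda>q. \<phi> (b * q)" y "c * d"] by simp
  also have "\<dots> = (e2 y b \<rhd> (\<lambda>p q. \<epsilon> p * \<phi> (q * (c * d))))"
    by (simp add: counit_E2)
  also have "\<dots> = (t2 y c \<rhd> (\<lambda>p q. \<epsilon> p * \<phi> (b * q * d)))"
    using counit_E2[of "\<lambda>q. \<phi> (q * d)" y b c] by (simp add: mult.assoc)
  also have "\<dots> = \<phi> (b * (ll y c * d))"
    using ll_eval[of "\<lambda>q. \<phi> (b * q * d)" y c] by (simp add: mult.assoc)
  finally show "\<phi> (b * ll y (c * d)) = \<phi> (b * (ll y c * d))" .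
qed

lemma counit_ll: "\<epsilon> (ll y b) = \<epsilon> (y * b)"
  by (simp add: ll_eval counit2)

lemma ll_mult_eval:
  assumes "lin1 \<phi>"
  shows "\<phi> (ll y (b * c)) = (t1 b c \<rhd> (\<lambda>p q. \<epsilon> (y * p) * \<phi> q))"
proof -
  note [simp] = lin1_comp[OF assms] assms
  have "\<phi> (ll y (b * c)) = (t2 y b \<rhd> (\<lambda>p q. \<epsilon> p * \<phi> (q * c)))"
    using ll_eval[of "\<lambda>q. \<phi> (q * c)" y b] by (simp add: ll_mult)
  also have "\<dots> = (t1 b c \<rhd> (\<lambda>p q. \<epsilon> (y * p) * \<phi> q))"
    using T1_T2[of "\<lambda>p q. \<epsilon> p * \<phi> q" b c y] by simp
  finally show ?thesis .
qed

text \<open>Weak multiplicativity \<open>\<epsilon>(a c d) = \<epsilon>(a c\<^sub>1) \<epsilon>(c\<^sub>2 d)\<close> of the counit.\<close>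

lemma counit_mult3: "\<epsilon> (a * (c * d)) = (t1 c d \<rhd> (\<lambda>p q. \<epsilon> (a * p) * \<epsilon> q))"
  using ll_mult_eval[of \<epsilon> a c d] counit_ll[of a "c * d"] by simp

text \<open>Coassociativity with the first leg covered from the right.\<close>

lemma coassoc4:
  "\<forall>h. lin3 h \<longrightarrow> (t4 d z \<rhd> (\<lambda>p q. t1 q b \<rhd> (\<lambda>r s. h p r s))) =
    (t1 z b \<rhd> (\<lambda>p q. t4 d p \<rhd> (\<lambda>r s. h r s q)))"
proof (rule cancel3_1[OF separating_left])
  fix a h assume h: "lin3 h"
  note [simp] = lin3_D[OF h]
  have "(t4 d z \<rhd> (\<lambda>p q. t1 q b \<rhd> (\<lambda>r s. h (a * p) r s))) =
      (t2 a z \<rhd> (\<lambda>p q. t1 q b \<rhd> (\<lambda>r s. h (p * d) r s)))"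
    by (rule T2_T4[symmetric]) simp
  also have "\<dots> = (t1 z b \<rhd> (\<lambda>p q. t2 a p \<rhd> (\<lambda>r s. h (r * d) s q)))"
    by (rule coassoc[symmetric]) simp
  also have "\<dots> = (t1 z b \<rhd> (\<lambda>p q. t4 d p \<rhd> (\<lambda>r s. h (a * r) s q)))"
    by (intro ev_cong refl T2_T4) simp
  finally show "(t4 d z \<rhd> (\<lambda>p q. t1 q b \<rhd> (\<lambda>r s. h (a * p) r s))) =
    (t1 z b \<rhd> (\<lambda>p q. t4 d p \<rhd> (\<lambda>r s. h (a * r) s q)))" .
qed (intro fin_intros)+

text \<open>The counterpart of \<open>E1_T1\<close> with the second leg covered from the right.\<close>

lemma E1_T4:
  "\<forall>h. lin3 h \<longrightarrow> (e1 w f \<rhd> (\<lambda>p q. t4 g q \<rhd> (\<lambda>m n. h p m n))) =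
    (t4 g f \<rhd> (\<lambda>m n. e1 w m \<rhd> (\<lambda>p q. h p q n)))"
proof (rule cancel3_3[OF separating_right])
  fix k h assume h: "lin3 h"
  note [simp] = lin3_D[OF h]
  have "(e1 w f \<rhd> (\<lambda>p q. t4 g q \<rhd> (\<lambda>m n. h p m (n * k)))) =
      (e1 w f \<rhd> (\<lambda>p q. t1 q k \<rhd> (\<lambda>m n. h p (m * g) n)))"
    by (intro ev_cong refl T4_T1[rule_format]) simp
  also have "\<dots> = (t1 f k \<rhd> (\<lambda>m n. e1 w m \<rhd> (\<lambda>p q. h p (q * g) n)))"
    by (rule E1_T1[symmetric]) simp
  also have "\<dots> = (t1 f k \<rhd> (\<lambda>m n. e1 w (m * g) \<rhd> (\<lambda>p q. h p q n)))"
    by (intro ev_cong refl E1_mult2[rule_format, symmetric]) simp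
  also have "\<dots> = (t4 g f \<rhd> (\<lambda>m n. e1 w m \<rhd> (\<lambda>p q. h p q (n * k))))"
    by (rule T4_T1[rule_format, symmetric]) simp
  finally show "(e1 w f \<rhd> (\<lambda>p q. t4 g q \<rhd> (\<lambda>m n. h p m (n * k)))) =
    (t4 g f \<rhd> (\<lambda>m n. e1 w m \<rhd> (\<lambda>p q. h p q (n * k))))" .
qed (intro fin_intros)+

end

section \<open>The antipode\<close>

locale wmb_antipode = regular_wmb H
  for H :: "('k::field, 'a::ring) wmb_data" +
  fixes S :: "'a \<Rightarrow> ('a \<Rightarrow> 'a) \<times> ('a \<Rightarrow> 'a)"
    and R1 R2 G1 G2 :: "('k, 'a, 'a) tensor \<Rightarrow> ('k, 'a, 'a) tensor"
  assumes S_multiplier: "S a \<in> multipliers"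
    and R_endo [simp]: "R1 \<in> endo" "R2 \<in> endo"
    and G1: "is_G1 G1" and G2: "is_G2 G2"
    and R1: "t \<in> pts (A \<odot> A) \<Longrightarrow> R1 (T1 H t) = G1 t" "t \<in> pts (A \<odot> A) \<Longrightarrow> T1 H (R1 t) = E1 H t"
      "t \<in> pts (A \<odot> A) \<Longrightarrow> R1 (T1 H (R1 t)) = R1 t"
    and R2: "t \<in> pts (A \<odot> A) \<Longrightarrow> R2 (T2 H t) = G2 t" "t \<in> pts (A \<odot> A) \<Longrightarrow> T2 H (R2 t) = E2 H t"
      "t \<in> pts (A \<odot> A) \<Longrightarrow> R2 (T2 H (R2 t)) = R2 t"
    and S_R: "lact (S a) b = eps_id (R1 (a \<otimes> b))" "ract b (S a) = id_eps (R2 (b \<otimes> a))"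
begin

abbreviation "r1 \<equiv> sw R1"
abbreviation "r2 \<equiv> sw R2"

text \<open>The products \<open>S(a) b\<close> and \<open>b S(a)\<close>.\<close>

definition sl :: "'a \<Rightarrow> 'a \<Rightarrow> 'a" where "sl a b = lact (S a) b"

definition sr :: "'a \<Rightarrow> 'a \<Rightarrow> 'a" where "sr b a = ract b (S a)"

lemma sl_eval: "lin1 \<phi> \<Longrightarrow> \<phi> (sl a b) = (r1 a b \<rhd> (\<lambda>p q. \<epsilon> p * \<phi> q))"
  by (simp add: sl_def S_R eps_id_eval)

lemma sr_eval: "lin1 \<phi> \<Longrightarrow> \<phi> (sr b a) = (r2 b a \<rhd> (\<lambda>p q. \<phi> p * \<epsilon> q))"
  by (simp add: sr_def S_R id_eps_eval)

lemma linop_S: "linop (sl a)" "linop (\<lambda>a. sl a b)" "linop (sr b)" "linop (\<lambda>b. sr b a)"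
  by (rule linop_of_functionals; simp add: sl_eval sr_eval lin1_comp)+

lemma sr_sl: "sr x a * b = x * sl a b"
  using S_multiplier[of a] by (auto simp: multipliers_def sl_def sr_def lact_def ract_def)

lemma sl_mult: "sl a (b * c) = sl a b * c"
proof (rule nondegenerate_eq(1))
  fix x
  show "x * sl a (b * c) = x * (sl a b * c)"
    using sr_sl[of x a "b * c"] sr_sl[of x a b] by (simp flip: mult.assoc)
qed

lemma sr_mult: "sr (b * c) a = b * sr c a"
proof (rule nondegenerate_eq(2))
  fix x
  show "sr (b * c) a * x = b * sr c a * x"
    by (simp add: sr_sl mult.assoc)
qed

lemmas linop_S_comp = linop_comp[OF linop_S(1)] linop_comp[OF linop_S(2)]
  linop_comp[OF linop_S(3)] linop_comp[OF linop_S(4)] linop_comp[OF linop_ll(1)] linop_comp[OF linop_ll(2)]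

declare linop_S [simp] linop_S_comp [simp] linop_ll [simp] sl_mult [simp] sr_mult [simp]

text \<open>The product \<open>a \<Sqinter>\<^sup>R(x) = a\<^sub>1 \<epsilon>(a\<^sub>2 x)\<close> with the barred \<open>\<Sqinter>\<^sup>R\<close>.\<close>

definition rb :: "'a \<Rightarrow> 'a \<Rightarrow> 'a" where
  "rb a x = id_eps (T1 H (a \<otimes> x))"

lemma rb_eval: "lin1 \<phi> \<Longrightarrow> \<phi> (rb a x) = (t1 a x \<rhd> (\<lambda>p q. \<phi> p * \<epsilon> q))"
  by (simp add: rb_def id_eps_eval)

lemma linop_rb [simp]: "linop (rb y)" "linop (\<lambda>y. rb y b)"
  by (rule linop_of_functionals; simp add: rb_eval lin1_comp)+

lemma flip_eval:
  assumes F: "F \<in> endo" and f: "linop f" and g: "linop g" and \<beta>: "lin2 \<beta>"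
  shows "tt f g (tw (F (a \<otimes> b))) \<beta> = (sw F a b \<rhd> (\<lambda>p q. \<beta> (f q) (g p)))"
proof -
  note t = tmap[OF f[unfolded linop_def] g[unfolded linop_def]]
  have "is_linear (A \<odot> A) ground (\<lambda>t. tt f g (tw t) \<beta>)"
    by (rule is_linear_comp[OF is_linear_comp[OF LinD[OF flip(1)] LinD[OF t(1)]]])
      (simp add: is_linear_def tscale_def)
  from tlist_linear[OF alg_vspace this sw_closed[OF F, of a b]]
  have "tt f g (tw (F (a \<otimes> b))) \<beta> = (sw F a b \<rhd> (\<lambda>p q. tt f g (tw (p \<otimes> q)) \<beta>))"
    by (simp add: sw_def)
  also have "\<dots> = (sw F a b \<rhd> (\<lambda>p q. \<beta> (f q) (g p)))"
    by (simp add: flip(2) t(2)) (simp add: pure_def \<beta>[unfolded lin2_iff])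
  finally show ?thesis .
qed

text \<open>
  \<open>G\<^sub>1\<close> is prescribed on elements \<open>a \<otimes> b c\<close> only. Where a formula for \<open>G\<^sub>1(a \<otimes> x)\<close> has a meaning
  for all \<open>x\<close>, \<open>eq_on_products\<close> extends it.
\<close>

lemma R1_T1_mult:
  assumes \<beta>: "lin2 \<beta>"
  shows "(t1 a (b * c) \<rhd> (\<lambda>p q. r1 p q \<rhd> \<beta>)) = (t4 c b \<rhd> (\<lambda>p q. \<beta> (rb a q) p))"
proof -
  have "(t1 a (b * c) \<rhd> (\<lambda>p q. r1 p q \<rhd> \<beta>)) = R1 (T1 H (a \<otimes> (b * c))) \<beta>"
    by (simp add: sw_comp \<beta> flip: lin2_def)
  also have "\<dots> = tt (rb a) (\<lambda>y. y) (tw (T4 H (c \<otimes> b))) \<beta>"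
    using G1 by (simp add: R1 pure_in_tensor_space is_G1_def ract_def sqcapR_def rb_def[abs_def])
  also have "\<dots> = (t4 c b \<rhd> (\<lambda>p q. \<beta> (rb a q) p))"
    by (rule flip_eval) (simp_all add: \<beta> flip: lin2_def)
  finally show ?thesis .
qed

lemma R2_T2_mult:
  assumes \<beta>: "lin2 \<beta>"
  shows "(t2 (a * b) c \<rhd> (\<lambda>p q. r2 p q \<rhd> \<beta>)) = (t3 b a \<rhd> (\<lambda>p q. \<beta> q (ll p c)))"
proof -
  have "(t2 (a * b) c \<rhd> (\<lambda>p q. r2 p q \<rhd> \<beta>)) = R2 (T2 H ((a * b) \<otimes> c)) \<beta>"
    by (simp add: sw_comp \<beta> flip: lin2_def)
  also have "\<dots> = tt (\<lambda>x. x) (\<lambda>y. ll y c) (tw (T3 H (b \<otimes> a))) \<beta>"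
    using G2 by (simp add: R2 pure_in_tensor_space is_G2_def lact_def sqcapL_def ll_def)
  also have "\<dots> = (t3 b a \<rhd> (\<lambda>p q. \<beta> q (ll p c)))"
    by (rule flip_eval) (simp_all add: \<beta> flip: lin2_def)
  finally show ?thesis .
qed

lemma T1_R1: "lin2 \<beta> \<Longrightarrow> (r1 a b \<rhd> (\<lambda>p q. t1 p q \<rhd> \<beta>)) = (e1 a b \<rhd> \<beta>)"
  using eval_ext[OF R1(2)[of "a \<otimes> b"], of \<beta>] by (simp add: sw_comp sw_eval pure_in_tensor_space del: lin2_def)

lemma T2_R2: "lin2 \<beta> \<Longrightarrow> (r2 a b \<rhd> (\<lambda>p q. t2 p q \<rhd> \<beta>)) = (e2 a b \<rhd> \<beta>)"
  using eval_ext[OF R2(2)[of "a \<otimes> b"], of \<beta>] by (simp add: sw_comp sw_eval pure_in_tensor_space del: lin2_def)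

lemma R1_E1:
  assumes \<beta>: "lin2 \<beta>"
  shows "(e1 a b \<rhd> (\<lambda>p q. r1 p q \<rhd> \<beta>)) = (r1 a b \<rhd> \<beta>)"
proof -
  have "R1 (E1 H (a \<otimes> b)) = R1 (a \<otimes> b)"
    using R1(2,3)[of "a \<otimes> b"] by (simp add: pure_in_tensor_space)
  from eval_ext[OF this, of \<beta>] show ?thesis by (simp add: sw_comp sw_eval \<beta> del: lin2_def)
qed

lemma R2_E2:
  assumes \<beta>: "lin2 \<beta>"
  shows "(e2 a b \<rhd> (\<lambda>p q. r2 p q \<rhd> \<beta>)) = (r2 a b \<rhd> \<beta>)"
proof -
  have "R2 (E2 H (a \<otimes> b)) = R2 (a \<otimes> b)"
    using R2(2,3)[of "a \<otimes> b"] by (simp add: pure_in_tensor_space)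
  from eval_ext[OF this, of \<beta>] show ?thesis by (simp add: sw_comp sw_eval \<beta> del: lin2_def)
qed

lemma R1_T1_R1:
  assumes \<beta>: "lin2 \<beta>"
  shows "(r1 a b \<rhd> (\<lambda>p q. t1 p q \<rhd> (\<lambda>p q. r1 p q \<rhd> \<beta>))) = (r1 a b \<rhd> \<beta>)"
proof -
  note [simp] = lin2_D[OF \<beta>]
  have "(r1 a b \<rhd> (\<lambda>p q. t1 p q \<rhd> (\<lambda>p q. r1 p q \<rhd> \<beta>))) = (e1 a b \<rhd> (\<lambda>p q. r1 p q \<rhd> \<beta>))"
    by (rule T1_R1) simp
  then show ?thesis by (simp only: R1_E1[OF \<beta>])
qed

lemma R2_T2_R2:
  assumes \<beta>: "lin2 \<beta>"
  shows "(r2 a b \<rhd> (\<lambda>p q. t2 p q \<rhd> (\<lambda>p q. r2 p q \<rhd> \<beta>))) = (r2 a b \<rhd> \<beta>)"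
proof -
  note [simp] = lin2_D[OF \<beta>]
  have "(r2 a b \<rhd> (\<lambda>p q. t2 p q \<rhd> (\<lambda>p q. r2 p q \<rhd> \<beta>))) = (e2 a b \<rhd> (\<lambda>p q. r2 p q \<rhd> \<beta>))"
    by (rule T2_R2) simp
  then show ?thesis by (simp only: R2_E2[OF \<beta>])
qed

text \<open>
  Left colinearity of \<open>G\<^sub>1 = R\<^sub>1 T\<^sub>1\<close>: only the counit is applied to the covered leg, so this is
  coassociativity.
\<close>

lemma G1_T2:
  assumes h: "lin3 h"
  shows "(t2 a b \<rhd> (\<lambda>p q. t1 q c \<rhd> (\<lambda>u v. r1 u v \<rhd> (\<lambda>r s. h p r s)))) =
    (t1 b c \<rhd> (\<lambda>u v. r1 u v \<rhd> (\<lambda>p q. t2 a p \<rhd> (\<lambda>r s. h r s q))))"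
proof (rule eq_on_products[where x = c])
  note [simp] = lin3_D[OF h]
  show "lin1 (\<lambda>c. t2 a b \<rhd> (\<lambda>p q. t1 q c \<rhd> (\<lambda>u v. r1 u v \<rhd> (\<lambda>r s. h p r s))))" by simp
  show "lin1 (\<lambda>c. t1 b c \<rhd> (\<lambda>u v. r1 u v \<rhd> (\<lambda>p q. t2 a p \<rhd> (\<lambda>r s. h r s q))))" by simp
  fix c d
  have "(t2 a b \<rhd> (\<lambda>p q. t1 q (c * d) \<rhd> (\<lambda>u v. r1 u v \<rhd> (\<lambda>r s. h p r s)))) =
      (t2 a b \<rhd> (\<lambda>p q. t4 d c \<rhd> (\<lambda>p' q'. h p (rb q q') p')))"
    by (simp add: R1_T1_mult)
  also have "\<dots> = (t2 a b \<rhd> (\<lambda>p q. t4 d c \<rhd> (\<lambda>p' q'. t1 q q' \<rhd> (\<lambda>r s. h p r p' * \<epsilon> s))))"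
    using rb_eval[of "\<lambda>r. h p r p'" for p p'] by simp
  also have "\<dots> = (t4 d c \<rhd> (\<lambda>p' q'. t2 a b \<rhd> (\<lambda>p q. t1 q q' \<rhd> (\<lambda>r s. h p r p' * \<epsilon> s))))"
    by (rule ev_swap)
  also have "\<dots> = (t4 d c \<rhd> (\<lambda>p' q'. t1 b q' \<rhd> (\<lambda>p q. t2 a p \<rhd> (\<lambda>r s. h r s p' * \<epsilon> q))))"
    by (intro ev_cong[OF refl] coassoc[symmetric]) simp
  also have "\<dots> = (t4 d c \<rhd> (\<lambda>p' q'. t2 a (rb b q') \<rhd> (\<lambda>r s. h r s p')))"
    using rb_eval[of "\<lambda>p. t2 a p \<rhd> (\<lambda>r s. h r s p')" for p'] by (simp add: ev_mult_right)
  also have "\<dots> = (t1 b (c * d) \<rhd> (\<lambda>u v. r1 u v \<rhd> (\<lambda>p q. t2 a p \<rhd> (\<lambda>r s. h r s q))))"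
    by (rule R1_T1_mult[symmetric]) simp
  finally show "(t2 a b \<rhd> (\<lambda>p q. t1 q (c * d) \<rhd> (\<lambda>u v. r1 u v \<rhd> (\<lambda>r s. h p r s)))) =
    (t1 b (c * d) \<rhd> (\<lambda>u v. r1 u v \<rhd> (\<lambda>p q. t2 a p \<rhd> (\<lambda>r s. h r s q))))" .
qed

text \<open>
  Left colinearity of \<open>R\<^sub>1\<close>. Since \<open>R\<^sub>1 = R\<^sub>1 E\<^sub>1\<close>, one can first insert \<open>E\<close>, move it past \<open>T\<^sub>2\<close>
  and write it as \<open>T\<^sub>1 R\<^sub>1\<close>; then \<open>T\<^sub>1\<close> and \<open>R\<^sub>1 T\<^sub>1\<close> are moved past \<open>T\<^sub>2\<close>, and \<open>R\<^sub>1 T\<^sub>1 R\<^sub>1\<close>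
  collapses to \<open>R\<^sub>1\<close>.
\<close>

lemma R1_T2:
  assumes h: "lin3 h"
  shows "(t2 a b \<rhd> (\<lambda>p q. r1 q c \<rhd> (\<lambda>r s. h p r s))) = (r1 b c \<rhd> (\<lambda>p q. t2 a p \<rhd> (\<lambda>r s. h r s q)))"
proof -
  note [simp] = lin3_D[OF h]
  have "(t2 a b \<rhd> (\<lambda>p q. r1 q c \<rhd> (\<lambda>r s. h p r s))) =
      (t2 a b \<rhd> (\<lambda>p q. e1 q c \<rhd> (\<lambda>u v. r1 u v \<rhd> (\<lambda>r s. h p r s))))"
    by (simp add: R1_E1)
  also have "\<dots> = (e1 b c \<rhd> (\<lambda>p q. t2 a p \<rhd> (\<lambda>r s. r1 s q \<rhd> (\<lambda>u v. h r u v))))"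
    by (rule E1_T2[symmetric]) simp
  also have "\<dots> = (r1 b c \<rhd> (\<lambda>b' c'. t1 b' c' \<rhd> (\<lambda>p q. t2 a p \<rhd> (\<lambda>r s. r1 s q \<rhd> (\<lambda>u v. h r u v)))))"
    by (rule T1_R1[symmetric]) simp
  also have "\<dots> = (r1 b c \<rhd> (\<lambda>b' c'. t2 a b' \<rhd> (\<lambda>p q. t1 q c' \<rhd> (\<lambda>u v. r1 u v \<rhd> (\<lambda>r s. h p r s)))))"
    by (intro ev_cong[OF refl] coassoc) simp
  also have "\<dots> = (r1 b c \<rhd> (\<lambda>b' c'. t1 b' c' \<rhd> (\<lambda>u v. r1 u v \<rhd> (\<lambda>p q. t2 a p \<rhd> (\<lambda>r s. h r s q)))))"
    by (intro ev_cong[OF refl] G1_T2[OF h])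
  also have "\<dots> = (r1 b c \<rhd> (\<lambda>p q. t2 a p \<rhd> (\<lambda>r s. h r s q)))"
    by (rule R1_T1_R1) simp
  finally show ?thesis .
qed

text \<open>\<open>R\<^sub>1(b \<otimes> c) = b\<^sub>1 \<otimes> S(b\<^sub>2) c\<close>, obtained from colinearity by applying the counit.\<close>

lemma R1_left:
  assumes \<beta>: "lin2 \<beta>"
  shows "(r1 b c \<rhd> (\<lambda>p q. \<beta> (a * p) q)) = (t2 a b \<rhd> (\<lambda>p q. \<beta> p (sl q c)))"
proof -
  note [simp] = lin2_D[OF \<beta>]
  have "(t2 a b \<rhd> (\<lambda>p q. \<beta> p (sl q c))) = (t2 a b \<rhd> (\<lambda>p q. r1 q c \<rhd> (\<lambda>r s. \<epsilon> r * \<beta> p s)))"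
    using sl_eval[of "\<beta> p" for p] by simp
  also have "\<dots> = (r1 b c \<rhd> (\<lambda>p q. t2 a p \<rhd> (\<lambda>r s. \<epsilon> s * \<beta> r q)))"
    by (rule R1_T2) simp
  also have "\<dots> = (r1 b c \<rhd> (\<lambda>p q. \<beta> (a * p) q))"
    using counit2[of "\<lambda>r. \<beta> r q" for q] by (simp add: mult.commute)
  finally show ?thesis ..
qed

lemma G2_T1:
  assumes h: "lin3 h"
  shows "(t1 x c \<rhd> (\<lambda>p q. t2 a p \<rhd> (\<lambda>u v. r2 u v \<rhd> (\<lambda>r s. h r s q)))) =
    (t2 a x \<rhd> (\<lambda>u v. r2 u v \<rhd> (\<lambda>p q. t1 q c \<rhd> (\<lambda>r s. h p r s))))"
proof (rule eq_on_products[where x = a])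
  note [simp] = lin3_D[OF h]
  show "lin1 (\<lambda>a. t1 x c \<rhd> (\<lambda>p q. t2 a p \<rhd> (\<lambda>u v. r2 u v \<rhd> (\<lambda>r s. h r s q))))" by simp
  show "lin1 (\<lambda>a. t2 a x \<rhd> (\<lambda>u v. r2 u v \<rhd> (\<lambda>p q. t1 q c \<rhd> (\<lambda>r s. h p r s))))" by simp
  fix a b
  have "(t1 x c \<rhd> (\<lambda>p q. t2 (a * b) p \<rhd> (\<lambda>u v. r2 u v \<rhd> (\<lambda>r s. h r s q)))) =
      (t1 x c \<rhd> (\<lambda>m n. t3 b a \<rhd> (\<lambda>p q. h q (ll p m) n)))"
    by (simp add: R2_T2_mult)
  also have "\<dots> = (t1 x c \<rhd> (\<lambda>m n. t3 b a \<rhd> (\<lambda>p q. t2 p m \<rhd> (\<lambda>r s. \<epsilon> r * h q s n))))"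
    using ll_eval[of "\<lambda>s. h q s n" for q n] by simp
  also have "\<dots> = (t3 b a \<rhd> (\<lambda>p q. t1 x c \<rhd> (\<lambda>m n. t2 p m \<rhd> (\<lambda>r s. \<epsilon> r * h q s n))))"
    by (rule ev_swap)
  also have "\<dots> = (t3 b a \<rhd> (\<lambda>p q. t2 p x \<rhd> (\<lambda>m n. t1 n c \<rhd> (\<lambda>r s. \<epsilon> m * h q r s))))"
    by (intro ev_cong[OF refl] coassoc) simp
  also have "\<dots> = (t3 b a \<rhd> (\<lambda>p q. t1 (ll p x) c \<rhd> (\<lambda>r s. h q r s)))"
    using ll_eval[of "\<lambda>n. t1 n c \<rhd> (\<lambda>r s. h q r s)" for q] by (simp add: ev_mult_left)
  also have "\<dots> = (t2 (a * b) x \<rhd> (\<lambda>u v. r2 u v \<rhd> (\<lambda>p q. t1 q c \<rhd> (\<lambda>r s. h p r s))))"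
    by (rule R2_T2_mult[symmetric]) simp
  finally show "(t1 x c \<rhd> (\<lambda>p q. t2 (a * b) p \<rhd> (\<lambda>u v. r2 u v \<rhd> (\<lambda>r s. h r s q)))) =
    (t2 (a * b) x \<rhd> (\<lambda>u v. r2 u v \<rhd> (\<lambda>p q. t1 q c \<rhd> (\<lambda>r s. h p r s))))" .
qed

lemma R2_T1:
  assumes h: "lin3 h"
  shows "(t1 b c \<rhd> (\<lambda>p q. r2 a p \<rhd> (\<lambda>r s. h r s q))) = (r2 a b \<rhd> (\<lambda>p q. t1 q c \<rhd> (\<lambda>r s. h p r s)))"
proof -
  note [simp] = lin3_D[OF h]
  have "(t1 b c \<rhd> (\<lambda>p q. r2 a p \<rhd> (\<lambda>r s. h r s q))) =
      (t1 b c \<rhd> (\<lambda>p q. e2 a p \<rhd> (\<lambda>u v. r2 u v \<rhd> (\<lambda>r s. h r s q))))"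
    by (simp add: R2_E2)
  also have "\<dots> = (e2 a b \<rhd> (\<lambda>p q. t1 q c \<rhd> (\<lambda>u v. r2 p u \<rhd> (\<lambda>r s. h r s v))))"
    by (rule E2_T1[rule_format]) simp
  also have "\<dots> = (r2 a b \<rhd> (\<lambda>a' b'. t2 a' b' \<rhd> (\<lambda>p q. t1 q c \<rhd> (\<lambda>u v. r2 p u \<rhd> (\<lambda>r s. h r s v)))))"
    by (rule T2_R2[symmetric]) simp
  also have "\<dots> = (r2 a b \<rhd> (\<lambda>a' b'. t1 b' c \<rhd> (\<lambda>p q. t2 a' p \<rhd> (\<lambda>u v. r2 u v \<rhd> (\<lambda>r s. h r s q)))))"
    by (intro ev_cong[OF refl] coassoc[symmetric]) simp
  also have "\<dots> = (r2 a b \<rhd> (\<lambda>a' b'. t2 a' b' \<rhd> (\<lambda>u v. r2 u v \<rhd> (\<lambda>p q. t1 q c \<rhd> (\<lambda>r s. h p r s)))))"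
    by (intro ev_cong[OF refl] G2_T1[OF h])
  also have "\<dots> = (r2 a b \<rhd> (\<lambda>p q. t1 q c \<rhd> (\<lambda>r s. h p r s)))"
    by (rule R2_T2_R2) simp
  finally show ?thesis .
qed

text \<open>The mirror image of \<open>R1_left\<close>: \<open>R\<^sub>2(a \<otimes> b) = a S(b\<^sub>1) \<otimes> b\<^sub>2\<close>.\<close>

lemma R2_right:
  assumes \<beta>: "lin2 \<beta>"
  shows "(r2 a b \<rhd> (\<lambda>p q. \<beta> p (q * c))) = (t1 b c \<rhd> (\<lambda>p q. \<beta> (sr a p) q))"
proof -
  note [simp] = lin2_D[OF \<beta>]
  have "(t1 b c \<rhd> (\<lambda>p q. \<beta> (sr a p) q)) = (t1 b c \<rhd> (\<lambda>p q. r2 a p \<rhd> (\<lambda>r s. \<beta> r q * \<epsilon> s)))"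
    using sr_eval[of "\<lambda>r. \<beta> r q" for q] by simp
  also have "\<dots> = (r2 a b \<rhd> (\<lambda>p q. t1 q c \<rhd> (\<lambda>r s. \<beta> p s * \<epsilon> r)))"
    by (rule R2_T1) simp
  also have "\<dots> = (r2 a b \<rhd> (\<lambda>p q. \<beta> p (q * c)))"
    using counit1[of "\<beta> p" for p] by (simp add: mult.commute)
  finally show ?thesis ..
qed

text \<open>
  By the formulas for \<open>R\<^sub>1\<close> and \<open>R\<^sub>2\<close> these are \<open>a\<^sub>1 S(a\<^sub>2) d\<close>, \<open>c S(p\<^sub>1) p\<^sub>2\<close>, and
  \<open>S(p\<^sub>1) p\<^sub>2 z\<close>. In the unital Hopf case they would be \<open>\<epsilon>(a) d\<close>, \<open>\<epsilon>(p) c\<close>, and \<open>\<epsilon>(p) z\<close>.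
\<close>

definition pl :: "'a \<Rightarrow> 'a \<Rightarrow> 'a" where "pl a d = (r1 a d \<rhd> (\<lambda>u v. u * v))"
definition pr :: "'a \<Rightarrow> 'a \<Rightarrow> 'a" where "pr c p = (r2 c p \<rhd> (\<lambda>u v. u * v))"
definition rl :: "'a \<Rightarrow> 'a \<Rightarrow> 'a" where "rl p z = (t1 p z \<rhd> (\<lambda>u v. sl u v))"

lemma pl_eval: "lin1 \<phi> \<Longrightarrow> \<phi> (pl a d) = (r1 a d \<rhd> (\<lambda>u v. \<phi> (u * v)))"
  by (simp add: pl_def lin1_ev_eq)

lemma pr_eval: "lin1 \<phi> \<Longrightarrow> \<phi> (pr a d) = (r2 a d \<rhd> (\<lambda>u v. \<phi> (u * v)))"
  by (simp add: pr_def lin1_ev_eq)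

lemma rl_eval: "lin1 \<phi> \<Longrightarrow> \<phi> (rl p z) = (t1 p z \<rhd> (\<lambda>u v. \<phi> (sl u v)))"
  by (simp add: rl_def lin1_ev_eq)

lemma linop_pl: "linop (pl a)" "linop (\<lambda>a. pl a b)" "linop (pr a)" "linop (\<lambda>a. pr a b)"
  "linop (rl a)" "linop (\<lambda>a. rl a b)"
proof -
  have *: "lin2 (\<lambda>u v. \<phi> (u * v))" "lin2 (\<lambda>u v. \<phi> (sl u v))" if "lin1 \<phi>" for \<phi>
    using lin1_comp[OF that] by simp_all
  show "linop (pl a)" "linop (\<lambda>a. pl a b)" "linop (pr a)" "linop (\<lambda>a. pr a b)"
    "linop (rl a)" "linop (\<lambda>a. rl a b)"
    by (rule linop_of_functionals; simp add: pl_eval pr_eval rl_eval * del: lin2_def)+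
qed

lemmas linop_pl_comp = linop_pl[THEN linop_comp]

declare linop_pl [simp] linop_pl_comp [simp]

text \<open>\<open>E(c \<otimes> d) = c\<^sub>1 \<otimes> c\<^sub>2 S(c\<^sub>3) d\<close>, by \<open>E\<^sub>1 = T\<^sub>1 R\<^sub>1\<close>.\<close>

lemma E1_left:
  assumes \<beta>: "lin2 \<beta>"
  shows "(e1 c d \<rhd> (\<lambda>p q. \<beta> (y * p) q)) = (t2 y c \<rhd> (\<lambda>p q. \<beta> p (pl q d)))"
proof -
  note [simp] = lin2_D[OF \<beta>]
  have "(e1 c d \<rhd> (\<lambda>p q. \<beta> (y * p) q)) = (r1 c d \<rhd> (\<lambda>u v. t1 u v \<rhd> (\<lambda>p q. \<beta> (y * p) q)))"
    by (rule T1_R1[symmetric]) simp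
  also have "\<dots> = (r1 c d \<rhd> (\<lambda>u v. t2 y u \<rhd> (\<lambda>p q. \<beta> p (q * v))))"
    by (intro ev_cong[OF refl] T1_T2 \<beta>)
  also have "\<dots> = (t2 y c \<rhd> (\<lambda>p q. r1 q d \<rhd> (\<lambda>r s. \<beta> p (r * s))))"
    by (rule R1_T2[symmetric]) simp
  also have "\<dots> = (t2 y c \<rhd> (\<lambda>p q. \<beta> p (pl q d)))"
    using pl_eval[of "\<beta> p" for p] by simp
  finally show ?thesis .
qed

text \<open>\<open>(c \<otimes> x) E = c S(x\<^sub>1) x\<^sub>2 \<otimes> x\<^sub>3\<close>, by \<open>E\<^sub>2 = T\<^sub>2 R\<^sub>2\<close>.\<close>

lemma E2_right:
  assumes \<beta>: "lin2 \<beta>"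
  shows "(e2 c x \<rhd> (\<lambda>p q. \<beta> p (q * k))) = (t1 x k \<rhd> (\<lambda>p q. \<beta> (pr c p) q))"
proof -
  note [simp] = lin2_D[OF \<beta>]
  have "(e2 c x \<rhd> (\<lambda>p q. \<beta> p (q * k))) = (r2 c x \<rhd> (\<lambda>u v. t2 u v \<rhd> (\<lambda>p q. \<beta> p (q * k))))"
    by (rule T2_R2[symmetric]) simp
  also have "\<dots> = (r2 c x \<rhd> (\<lambda>u v. t1 v k \<rhd> (\<lambda>p q. \<beta> (u * p) q)))"
    by (intro ev_cong[OF refl] T1_T2[symmetric] \<beta>)
  also have "\<dots> = (t1 x k \<rhd> (\<lambda>p q. r2 c p \<rhd> (\<lambda>r s. \<beta> (r * s) q)))"
    by (rule R2_T1[symmetric]) simp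
  also have "\<dots> = (t1 x k \<rhd> (\<lambda>p q. \<beta> (pr c p) q))"
    using pr_eval[of "\<lambda>p. \<beta> p q" for q] by simp
  finally show ?thesis .
qed

lemma mult_pl: "n * pl q d = (t2 n q \<rhd> (\<lambda>p s. sr p s)) * d"
proof (rule eqI_functional)
  fix \<phi> assume \<phi>: "lin1 \<phi>"
  note [simp] = lin1_comp[OF \<phi>] \<phi>
  have "\<phi> (n * pl q d) = (r1 q d \<rhd> (\<lambda>u v. \<phi> (n * u * v)))"
    using pl_eval[of "\<lambda>z. \<phi> (n * z)" q d] by (simp add: mult.assoc)
  also have "\<dots> = (t2 n q \<rhd> (\<lambda>p s. \<phi> (p * sl s d)))"
    by (rule R1_left) simp
  also have "\<dots> = \<phi> ((t2 n q \<rhd> (\<lambda>p s. sr p s)) * d)"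
    using lin1_ev_eq[of "\<lambda>z. \<phi> (z * d)" "t2 n q" "\<lambda>p s. sr p s"] by (simp add: sr_sl)
  finally show "\<phi> (n * pl q d) = \<phi> ((t2 n q \<rhd> (\<lambda>p s. sr p s)) * d)" .
qed

lemma pr_rl: "pr c p * n = c * rl p n"
proof (rule eqI_functional)
  fix \<phi> assume \<phi>: "lin1 \<phi>"
  note [simp] = lin1_comp[OF \<phi>] \<phi>
  have "\<phi> (pr c p * n) = (r2 c p \<rhd> (\<lambda>u v. \<phi> (u * (v * n))))"
    using pr_eval[of "\<lambda>z. \<phi> (z * n)" c p] by (simp add: mult.assoc)
  also have "\<dots> = (t1 p n \<rhd> (\<lambda>p q. \<phi> (sr c p * q)))"
    by (rule R2_right) simp
  also have "\<dots> = \<phi> (c * rl p n)"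
    using rl_eval[of "\<lambda>z. \<phi> (c * z)" p n] by (simp add: sr_sl)
  finally show "\<phi> (pr c p * n) = \<phi> (c * rl p n)" .
qed

lemma rl_mult: "rl y (a * b) = rl y a * b"
  by (rule nondegenerate_eq(1)) (metis pr_rl mult.assoc)

text \<open>
  The elements \<open>a S(b)\<close> span \<open>A\<close>. Inserting \<open>E\<close> between the factors of \<open>(x \<otimes> 1)\<Delta>(a)(c \<otimes> 1)\<close> gives
  \<open>x a\<^sub>1 c\<^sub>1 \<otimes> a\<^sub>2 c\<^sub>2 S(c\<^sub>3)\<close>. So if \<open>\<phi>\<close> vanishes on all \<open>a S(b)\<close>, then
  \<open>(A \<otimes> \<phi>)(T\<^sub>2(x \<otimes> a)) c = 0\<close> for every \<open>c\<close>, hence \<open>(A \<otimes> \<phi>) T\<^sub>2 = 0\<close>, and \<open>\<phi>\<close> vanishes on the span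
  of the second legs of \<open>T\<^sub>2\<close>.
\<close>

lemma sr_total:
  assumes full: left_full and \<phi>: "lin1 \<phi>" and zero: "\<And>a b. \<phi> (sr a b) = 0"
  shows "\<phi> x = 0"
proof -
  note [simp] = lin1_comp[OF \<phi>] \<phi>
  \<comment> \<open>\<open>E\<close> is inserted in front of \<open>c\<close> and written with \<open>E1_left\<close>.\<close>
  have T: "\<forall>\<beta>. lin2 \<beta> \<longrightarrow> (t2 x a \<rhd> (\<lambda>p q. \<beta> (p * c) q)) =
      (t2 x a \<rhd> (\<lambda>m n. t2 m c \<rhd> (\<lambda>p q. t2 n q \<rhd> (\<lambda>r s. \<beta> p (sr r s)))))" for x a c
  proof (rule cancel2_2[OF separating_right])
    fix d \<beta> assume \<beta>: "lin2 \<beta>"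
    note [simp] = lin2_D[OF \<beta>]
    have "(t2 x a \<rhd> (\<lambda>p q. \<beta> (p * c) (q * d))) =
        (t2 x a \<rhd> (\<lambda>m n. e2 m n \<rhd> (\<lambda>p q. \<beta> (p * c) (q * d))))"
      by (rule T2_E2[rule_format, symmetric]) simp
    also have "\<dots> = (t2 x a \<rhd> (\<lambda>m n. e1 c d \<rhd> (\<lambda>p q. \<beta> (m * p) (n * q))))"
      by (intro ev_cong[OF refl] E1_E2[symmetric] \<beta>)
    also have "\<dots> = (t2 x a \<rhd> (\<lambda>m n. t2 m c \<rhd> (\<lambda>p q. \<beta> p (n * pl q d))))"
      by (intro ev_cong[OF refl] E1_left) simp
    also have "\<dots> = (t2 x a \<rhd> (\<lambda>m n. t2 m c \<rhd> (\<lambda>p q. t2 n q \<rhd> (\<lambda>r s. \<beta> p (sr r s * d)))))"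
      using lin1_ev_eq[of "\<lambda>z. \<beta> p (z * d)" "t2 n q" "\<lambda>p s. sr p s" for p n q] by (simp add: mult_pl)
    finally show "(t2 x a \<rhd> (\<lambda>p q. \<beta> (p * c) (q * d))) =
      (t2 x a \<rhd> (\<lambda>m n. t2 m c \<rhd> (\<lambda>p q. t2 n q \<rhd> (\<lambda>r s. \<beta> p (sr r s * d)))))" .
  qed (intro fin_intros)+
  have vanish: "\<phi> (contr1 A A \<omega> (T2 H (a \<otimes> b))) = 0" if \<omega>: "\<omega> \<in> Lin A ground" for a b \<omega>
  proof -
    note t = sw_closed[OF linear_maps(4), of a b]
    define y where "y = contr2 A A \<phi> (T2 H (a \<otimes> b))"
    have y: "\<omega>' y = (t2 a b \<rhd> (\<lambda>p q. \<omega>' p * \<phi> q))" if "lin1 \<omega>'" for \<omega>'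
      unfolding y_def sw_def using contr2_eval(2)[OF alg_vspace _ _ t, of \<phi> \<omega>'] \<phi> that
      by (simp add: lin1_def)
    have "y * c = 0" for c
    proof (rule eqI_functional)
      fix \<omega>' assume \<omega>': "lin1 \<omega>'"
      note [simp] = lin1_comp[OF \<omega>'] \<omega>'
      have "\<omega>' (y * c) = (t2 a b \<rhd> (\<lambda>p q. \<omega>' (p * c) * \<phi> q))"
        by (rule y) simp
      also have "\<dots> = 0"
        using T[rule_format, of "\<lambda>p q. \<omega>' p * \<phi> q" a b c] by (simp add: zero)
      finally show "\<omega>' (y * c) = \<omega>' 0" by (simp add: lin1_eq_0)
    qed
    then have "y = 0" by (rule nondegenerate(1))
    then show ?thesis
      using y[of \<omega>] contr1_eval(2)[OF alg_vspace alg_vspace _ _ t, of \<omega> \<phi>] \<omega> \<phi> lin1_eq_0[of \<omega>]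
      by (simp add: lin1_def sw_def Lin_def)
  qed
  interpret vs: vector_space "scl A" using alg_vspace unfolding vspace_def by blast
  have sub: "vs.subspace {x. \<phi> x = 0}"
    using \<phi> lin1_eq_0[OF \<phi>] by (intro vs.subspaceI) (simp_all add: lin1_iff)
  have "UNIV \<subseteq> {x. \<phi> x = 0}"
    unfolding full[unfolded left_full_def, symmetric]
    by (rule vs.span_minimal[OF _ sub]) (use vanish in blast)
  then show ?thesis by blast
qed

text \<open>The mirror image of \<open>sr_total\<close>: the elements \<open>S(b) a\<close> span \<open>A\<close>.\<close>

lemma sl_total:
  assumes full: right_full and \<phi>: "lin1 \<phi>" and zero: "\<And>a b. \<phi> (sl a b) = 0"
  shows "\<phi> x = 0"
proof -
  note [simp] = lin1_comp[OF \<phi>] \<phi>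
  \<comment> \<open>\<open>E\<close> is inserted after \<open>c\<close> and written with \<open>E2_right\<close>.\<close>
  have T: "\<forall>\<beta>. lin2 \<beta> \<longrightarrow> (t1 a x \<rhd> (\<lambda>p q. \<beta> p (c * q))) =
      (t1 a x \<rhd> (\<lambda>m n. t1 c n \<rhd> (\<lambda>p q. t1 p m \<rhd> (\<lambda>r s. \<beta> (sl r s) q))))" for x a c
  proof (rule cancel2_1[OF separating_left])
    fix d \<beta> assume \<beta>: "lin2 \<beta>"
    note [simp] = lin2_D[OF \<beta>]
    have "(t1 a x \<rhd> (\<lambda>p q. \<beta> (d * p) (c * q))) =
        (t1 a x \<rhd> (\<lambda>m n. e1 m n \<rhd> (\<lambda>p q. \<beta> (d * p) (c * q))))"
      by (rule T1_E1[rule_format, symmetric]) simp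
    also have "\<dots> = (t1 a x \<rhd> (\<lambda>m n. e2 d c \<rhd> (\<lambda>p q. \<beta> (p * m) (q * n))))"
      by (intro ev_cong[OF refl] E1_E2 \<beta>)
    also have "\<dots> = (t1 a x \<rhd> (\<lambda>m n. t1 c n \<rhd> (\<lambda>p q. \<beta> (pr d p * m) q)))"
      by (intro ev_cong[OF refl] E2_right) simp
    also have "\<dots> = (t1 a x \<rhd> (\<lambda>m n. t1 c n \<rhd> (\<lambda>p q. t1 p m \<rhd> (\<lambda>r s. \<beta> (d * sl r s) q))))"
      using rl_eval[of "\<lambda>z. \<beta> (d * z) q" p m for p m q] by (simp add: pr_rl)
    finally show "(t1 a x \<rhd> (\<lambda>p q. \<beta> (d * p) (c * q))) =
      (t1 a x \<rhd> (\<lambda>m n. t1 c n \<rhd> (\<lambda>p q. t1 p m \<rhd> (\<lambda>r s. \<beta> (d * sl r s) q))))" .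
  qed (intro fin_intros)+
  have vanish: "\<phi> (contr2 A A \<omega> (T1 H (a \<otimes> b))) = 0" if \<omega>: "\<omega> \<in> Lin A ground" for a b \<omega>
  proof -
    note t = sw_closed[OF linear_maps(3), of a b]
    define y where "y = contr1 A A \<phi> (T1 H (a \<otimes> b))"
    have y: "\<omega>' y = (t1 a b \<rhd> (\<lambda>p q. \<phi> p * \<omega>' q))" if "lin1 \<omega>'" for \<omega>'
      unfolding y_def sw_def using contr1_eval(2)[OF alg_vspace alg_vspace _ _ t, of \<phi> \<omega>'] \<phi> that
      by (simp add: lin1_def)
    have "c * y = 0" for c
    proof (rule eqI_functional)
      fix \<omega>' assume \<omega>': "lin1 \<omega>'"
      note [simp] = lin1_comp[OF \<omega>'] \<omega>'
      have "\<omega>' (c * y) = (t1 a b \<rhd> (\<lambda>p q. \<phi> p * \<omega>' (c * q)))"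
        by (rule y) simp
      also have "\<dots> = 0"
        using T[rule_format, of "\<lambda>p q. \<phi> p * \<omega>' q" a b c] by (simp add: zero)
      finally show "\<omega>' (c * y) = \<omega>' 0" by (simp add: lin1_eq_0)
    qed
    then have "y = 0" by (rule nondegenerate(2))
    then show ?thesis
      using y[of \<omega>] contr2_eval(2)[OF alg_vspace _ _ t, of \<omega> \<phi>] \<omega> \<phi> lin1_eq_0[of \<omega>]
      by (simp add: lin1_def sw_def Lin_def)
  qed
  interpret vs: vector_space "scl A" using alg_vspace unfolding vspace_def by blast
  have sub: "vs.subspace {x. \<phi> x = 0}"
    using \<phi> lin1_eq_0[OF \<phi>] by (intro vs.subspaceI) (simp_all add: lin1_iff)
  have "UNIV \<subseteq> {x. \<phi> x = 0}"
    unfolding full[unfolded right_full_def, symmetric]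
    by (rule vs.span_minimal[OF _ sub]) (use vanish in blast)
  then show ?thesis by blast
qed

section \<open>The antipode is anti-multiplicative\<close>

lemma counit_rb: "\<epsilon> (rb y q) = \<epsilon> (y * q)"
  using rb_eval[OF lin1_eps, of y q] counit1[OF lin1_eps, of y q] by simp

text \<open>
  \<open>S(y\<^sub>1) y\<^sub>2 d e = d\<^sub>1 \<epsilon>(y d\<^sub>2) e\<close>. The antipode has disappeared from the right-hand side,
  because only \<open>R\<^sub>1 T\<^sub>1 = G\<^sub>1\<close> enters the left-hand side.
\<close>

lemma rl_formula:
  assumes "lin1 \<phi>"
  shows "\<phi> (rl y (d * e)) = (t4 e d \<rhd> (\<lambda>p q. \<phi> p * \<epsilon> (y * q)))"
proof -
  note [simp] = lin1_comp[OF assms] assms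
  have "\<phi> (rl y (d * e)) = (t1 y (d * e) \<rhd> (\<lambda>p q. r1 p q \<rhd> (\<lambda>u v. \<epsilon> u * \<phi> v)))"
    by (simp add: rl_eval sl_eval)
  also have "\<dots> = (t4 e d \<rhd> (\<lambda>p q. \<epsilon> (rb y q) * \<phi> p))"
    by (rule R1_T1_mult) simp
  finally show ?thesis by (simp add: counit_rb mult.commute)
qed

text \<open>
  \<open>(A \<otimes> \<epsilon>)(G\<^sub>2(u \<otimes> c)) d = u (\<epsilon> \<otimes> A)(E(c \<otimes> d))\<close>, which removes the antipode from \<open>R\<^sub>2 T\<^sub>2 = G\<^sub>2\<close>
  after contraction with the counit.
\<close>

lemma G2_formula:
  assumes "lin1 \<phi>"
  shows "(t2 u c \<rhd> (\<lambda>p q. r2 p q \<rhd> (\<lambda>r s. \<phi> (r * d) * \<epsilon> s))) = (e1 c d \<rhd> (\<lambda>p q. \<epsilon> p * \<phi> (u * q)))"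
proof (rule eq_on_products[where x = u])
  note [simp] = lin1_comp[OF assms] assms
  show "lin1 (\<lambda>u. t2 u c \<rhd> (\<lambda>p q. r2 p q \<rhd> (\<lambda>r s. \<phi> (r * d) * \<epsilon> s)))" by simp
  show "lin1 (\<lambda>u. e1 c d \<rhd> (\<lambda>p q. \<epsilon> p * \<phi> (u * q)))" by simp
  fix a b
  have "(t2 (a * b) c \<rhd> (\<lambda>p q. r2 p q \<rhd> (\<lambda>r s. \<phi> (r * d) * \<epsilon> s))) =
      (t3 b a \<rhd> (\<lambda>p q. \<epsilon> (p * c) * \<phi> (q * d)))"
    by (subst R2_T2_mult) (simp_all add: counit_ll mult.commute)
  also have "\<dots> = (t1 b d \<rhd> (\<lambda>p q. \<epsilon> (p * c) * \<phi> (a * q)))"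
    by (rule T1_T3[symmetric]) simp
  also have "\<dots> = (e1 c d \<rhd> (\<lambda>p q. \<epsilon> p * \<phi> (a * (b * q))))"
    by (rule counit_E1[symmetric]) simp
  finally show "(t2 (a * b) c \<rhd> (\<lambda>p q. r2 p q \<rhd> (\<lambda>r s. \<phi> (r * d) * \<epsilon> s))) =
    (e1 c d \<rhd> (\<lambda>p q. \<epsilon> p * \<phi> (a * b * q)))"
    by (simp add: mult.assoc)
qed

text \<open>
  The maps \<open>d \<mapsto> (\<epsilon> \<otimes> A)(E(w \<otimes> d))\<close> and \<open>d \<mapsto> S(y\<^sub>1) y\<^sub>2 d\<close> commute: they multiply by elements of
  the two mutually commuting base algebras.
\<close>

lemma E1_rl:
  assumes "lin1 \<psi>"
  shows "(e1 w d \<rhd> (\<lambda>p q. \<epsilon> p * \<psi> (rl y q))) = (e1 w (rl y d) \<rhd> (\<lambda>p q. \<epsilon> p * \<psi> q))"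
proof (rule eq_on_products[where x = d])
  note [simp] = lin1_comp[OF assms] assms
  show "lin1 (\<lambda>d. e1 w d \<rhd> (\<lambda>p q. \<epsilon> p * \<psi> (rl y q)))" by simp
  show "lin1 (\<lambda>d. e1 w (rl y d) \<rhd> (\<lambda>p q. \<epsilon> p * \<psi> q))" by simp
  fix f g
  have "(e1 w (f * g) \<rhd> (\<lambda>p q. \<epsilon> p * \<psi> (rl y q))) = (e1 w f \<rhd> (\<lambda>p q. \<epsilon> p * \<psi> (rl y (q * g))))"
    by (rule E1_mult2[rule_format]) simp
  also have "\<dots> = (e1 w f \<rhd> (\<lambda>p q. t4 g q \<rhd> (\<lambda>m n. \<epsilon> p * (\<psi> m * \<epsilon> (y * n)))))"
    by (simp add: rl_formula ev_mult_left)
  also have "\<dots> = (t4 g f \<rhd> (\<lambda>m n. e1 w m \<rhd> (\<lambda>p q. \<epsilon> p * (\<psi> q * \<epsilon> (y * n)))))"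
    by (rule E1_T4[rule_format]) simp
  also have "\<dots> = (t4 g f \<rhd> (\<lambda>m n. (e1 w m \<rhd> (\<lambda>p q. \<epsilon> p * \<psi> q)) * \<epsilon> (y * n)))"
    by (simp add: ev_mult_right flip: mult.assoc)
  also have "\<dots> = (e1 w (rl y (f * g)) \<rhd> (\<lambda>p q. \<epsilon> p * \<psi> q))"
    using rl_formula[of "\<lambda>z. e1 w z \<rhd> (\<lambda>p q. \<epsilon> p * \<psi> q)" y f g] by simp
  finally show "(e1 w (f * g) \<rhd> (\<lambda>p q. \<epsilon> p * \<psi> (rl y q))) =
    (e1 w (rl y (f * g)) \<rhd> (\<lambda>p q. \<epsilon> p * \<psi> q))" .
qed

lemma E2_ll: "\<forall>\<gamma>. lin2 \<gamma> \<longrightarrow> (e2 x (ll y b) \<rhd> \<gamma>) = (e2 x b \<rhd> (\<lambda>p q. \<gamma> p (ll y q)))"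
proof (rule cancel2_12[OF separating_right separating_right])
  fix c d \<gamma> assume \<gamma>: "lin2 \<gamma>"
  note [simp] = lin2_D[OF \<gamma>]
  show "(e2 x (ll y b) \<rhd> (\<lambda>p q. \<gamma> (p * c) (q * d))) = (e2 x b \<rhd> (\<lambda>p q. \<gamma> (p * c) (ll y q * d)))"
    using E1_E2[of \<gamma> c d x "ll y b"] E1_E2[of "\<lambda>p q. \<gamma> p (ll y q)" c d x b]
    by (simp add: ll_mult)
qed (intro fin_intros)+

text \<open>
  \<open>z w\<^sub>1 \<otimes> \<Sqinter>\<^sup>L(y) w\<^sub>2 = z S(y\<^sub>1) y\<^sub>2 w\<^sub>1 \<otimes> w\<^sub>2\<close>, both being \<open>z w\<^sub>1 \<epsilon>(y w\<^sub>2) \<otimes> w\<^sub>3\<close> by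
  \<open>ll_mult_eval\<close> and \<open>rl_formula\<close>.
\<close>

lemma T2_ll:
  assumes \<gamma>: "lin2 \<gamma>"
  shows "(t2 z w \<rhd> (\<lambda>p q. \<gamma> p (ll y q))) = (t2 (pr z y) w \<rhd> \<gamma>)"
proof (rule eq_on_products[where x = w])
  note [simp] = lin2_D[OF \<gamma>]
  show "lin1 (\<lambda>w. t2 z w \<rhd> (\<lambda>p q. \<gamma> p (ll y q)))" "lin1 (\<lambda>w. t2 (pr z y) w \<rhd> \<gamma>)"
    by simp_all
  fix w e
  have "\<forall>\<gamma>. lin2 \<gamma> \<longrightarrow> (t2 z (w * e) \<rhd> (\<lambda>p q. \<gamma> p (ll y q))) = (t2 (pr z y) (w * e) \<rhd> \<gamma>)"
  proof (rule cancel2_2[OF separating_right])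
    fix d \<gamma> assume \<gamma>: "lin2 \<gamma>"
    note [simp] = lin2_D[OF \<gamma>]
    have "(t2 z (w * e) \<rhd> (\<lambda>p q. \<gamma> p (ll y q * d))) =
        (t2 z w \<rhd> (\<lambda>p q. t2 p e \<rhd> (\<lambda>r s. \<gamma> r (ll y (q * s) * d))))"
      by (rule T2_mult2[rule_format]) simp
    also have "\<dots> = (t2 z w \<rhd> (\<lambda>p q. t1 e d \<rhd> (\<lambda>r s. \<gamma> (p * r) (ll y q * s))))"
      using T1_T2[of "\<lambda>r s. \<gamma> r (ll y q * s)" e d for q] by (simp add: ll_mult mult.assoc)
    also have "\<dots> = (t2 z w \<rhd> (\<lambda>p q. t1 e d \<rhd> (\<lambda>r s. t1 q s \<rhd> (\<lambda>m n. \<epsilon> (y * m) * \<gamma> (p * r) n))))"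
      using ll_mult_eval[of "\<gamma> x" for x] by (simp flip: ll_mult)
    also have "\<dots> = (t1 e d \<rhd> (\<lambda>r s. t2 z w \<rhd> (\<lambda>p q. t1 q s \<rhd> (\<lambda>m n. \<epsilon> (y * m) * \<gamma> (p * r) n))))"
      by (rule ev_swap)
    also have "\<dots> = (t1 e d \<rhd> (\<lambda>r s. t1 w s \<rhd> (\<lambda>p q. t2 z p \<rhd> (\<lambda>m n. \<epsilon> (y * n) * \<gamma> (m * r) q))))"
      by (intro ev_cong[OF refl] coassoc[symmetric]) simp
    also have "\<dots> = (t1 e d \<rhd> (\<lambda>r s. t1 w s \<rhd> (\<lambda>p q. t4 r p \<rhd> (\<lambda>m n. \<epsilon> (y * n) * \<gamma> (z * m) q))))"
      by (intro ev_cong[OF refl] T2_T4) simp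
    also have "\<dots> = (t1 e d \<rhd> (\<lambda>r s. t1 w s \<rhd> (\<lambda>p q. \<gamma> (z * rl y (p * r)) q)))"
      using rl_formula[of "\<lambda>m. \<gamma> (z * m) q" for q] by (simp add: mult.commute)
    also have "\<dots> = (t1 (w * e) d \<rhd> (\<lambda>p q. \<gamma> (z * rl y p) q))"
      by (rule comult_mult1) simp
    also have "\<dots> = (t2 (pr z y) (w * e) \<rhd> (\<lambda>p q. \<gamma> p (q * d)))"
      using T1_T2[of \<gamma> "w * e" d "pr z y"] by (simp add: pr_rl)
    finally show "(t2 z (w * e) \<rhd> (\<lambda>p q. \<gamma> p (ll y q * d))) =
      (t2 (pr z y) (w * e) \<rhd> (\<lambda>p q. \<gamma> p (q * d)))" .
  qed (intro fin_intros)+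
  then show "(t2 z (w * e) \<rhd> (\<lambda>p q. \<gamma> p (ll y q))) = (t2 (pr z y) (w * e) \<rhd> \<gamma>)"
    using \<gamma> by blast
qed

text \<open>
  Anti-multiplicativity \<open>S(\<Sqinter>\<^sup>L(y) b) = S(b) S(\<Sqinter>\<^sup>L(y))\<close>, where \<open>S(\<Sqinter>\<^sup>L(y)) = S(y\<^sub>1) y\<^sub>2\<close>. The factor
  \<open>\<Sqinter>\<^sup>L(y)\<close> is moved through \<open>E\<^sub>2\<close> and \<open>T\<^sub>2\<close> in \<open>R\<^sub>2 = R\<^sub>2 T\<^sub>2 R\<^sub>2\<close>, turning into \<open>S(y\<^sub>1) y\<^sub>2\<close> on
  the way.
\<close>

lemma sr_ll: "sr x (ll y b) = pr (sr x b) y"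
proof (rule nondegenerate_eq(2), rule eqI_functional)
  fix d \<phi> assume \<phi>: "lin1 \<phi>"
  note [simp] = lin1_comp[OF \<phi>] \<phi>
  have "\<phi> (sr x (ll y b) * d) = (r2 x (ll y b) \<rhd> (\<lambda>p q. \<phi> (p * d) * \<epsilon> q))"
    by (rule sr_eval) simp
  also have "\<dots> = (e2 x (ll y b) \<rhd> (\<lambda>u v. r2 u v \<rhd> (\<lambda>p q. \<phi> (p * d) * \<epsilon> q)))"
    by (rule R2_E2[symmetric]) simp
  also have "\<dots> = (e2 x b \<rhd> (\<lambda>u v. r2 u (ll y v) \<rhd> (\<lambda>p q. \<phi> (p * d) * \<epsilon> q)))"
    by (rule E2_ll[rule_format]) simp
  also have "\<dots> = (r2 x b \<rhd> (\<lambda>z w. t2 z w \<rhd> (\<lambda>u v. r2 u (ll y v) \<rhd> (\<lambda>p q. \<phi> (p * d) * \<epsilon> q))))"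
    by (rule T2_R2[symmetric]) simp
  also have "\<dots> = (r2 x b \<rhd> (\<lambda>z w. t2 (pr z y) w \<rhd> (\<lambda>u v. r2 u v \<rhd> (\<lambda>p q. \<phi> (p * d) * \<epsilon> q))))"
    by (intro ev_cong[OF refl] T2_ll) simp
  also have "\<dots> = (r2 x b \<rhd> (\<lambda>z w. e1 w d \<rhd> (\<lambda>p q. \<epsilon> p * \<phi> (z * rl y q))))"
    by (simp add: G2_formula pr_rl)
  also have "\<dots> = (r2 x b \<rhd> (\<lambda>z w. e1 w (rl y d) \<rhd> (\<lambda>p q. \<epsilon> p * \<phi> (z * q))))"
    by (intro ev_cong[OF refl] E1_rl) simp
  also have "\<dots> = (r2 x b \<rhd> (\<lambda>z w. t2 z w \<rhd> (\<lambda>p q. r2 p q \<rhd> (\<lambda>r s. \<phi> (r * rl y d) * \<epsilon> s))))"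
    by (simp add: G2_formula)
  also have "\<dots> = (r2 x b \<rhd> (\<lambda>r s. \<phi> (r * rl y d) * \<epsilon> s))"
    by (rule R2_T2_R2) simp
  also have "\<dots> = \<phi> (sr x b * rl y d)"
    by (rule sr_eval[symmetric]) simp
  finally show "\<phi> (sr x (ll y b) * d) = \<phi> (pr (sr x b) y * d)"
    by (simp add: pr_rl)
qed

lemma sl_ll: "sl (ll y b) z = sl b (rl y z)"
proof (rule nondegenerate_eq(1))
  fix x
  show "x * sl (ll y b) z = x * sl b (rl y z)"
    by (simp add: sr_sl[symmetric] sr_ll pr_rl)
qed

text \<open>
  \<open>(\<epsilon> \<otimes> A)(G\<^sub>1(y m \<otimes> n)) = (\<epsilon>(y -) \<otimes> A)(G\<^sub>1(m \<otimes> n))\<close>, which rests on the weak multiplicativity of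
  \<open>\<epsilon>\<close>.
\<close>

lemma G1_counit:
  assumes "lin1 \<phi>"
  shows "(t1 (y * m) n \<rhd> (\<lambda>u v. r1 u v \<rhd> (\<lambda>p q. \<epsilon> p * \<phi> q))) =
    (t1 m n \<rhd> (\<lambda>u v. r1 u v \<rhd> (\<lambda>p q. \<epsilon> (y * p) * \<phi> q)))"
proof (rule eq_on_products[where x = n])
  note [simp] = lin1_comp[OF assms] assms
  show "lin1 (\<lambda>n. t1 (y * m) n \<rhd> (\<lambda>u v. r1 u v \<rhd> (\<lambda>p q. \<epsilon> p * \<phi> q)))" by simp
  show "lin1 (\<lambda>n. t1 m n \<rhd> (\<lambda>u v. r1 u v \<rhd> (\<lambda>p q. \<epsilon> (y * p) * \<phi> q)))" by simp
  fix d e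
  have "\<epsilon> (y * rb m q) = \<epsilon> (y * m * q)" for q
    using rb_eval[of "\<lambda>z. \<epsilon> (y * z)" m q] counit_mult3[of y m q] by (simp add: mult.assoc)
  then show "(t1 (y * m) (d * e) \<rhd> (\<lambda>u v. r1 u v \<rhd> (\<lambda>p q. \<epsilon> p * \<phi> q))) =
    (t1 m (d * e) \<rhd> (\<lambda>u v. r1 u v \<rhd> (\<lambda>p q. \<epsilon> (y * p) * \<phi> q)))"
    by (subst (1 2) R1_T1_mult) (simp_all add: counit_rb)
qed

text \<open>
  One has \<open>S(a b) c = (\<epsilon> \<otimes> A) R\<^sub>1 E\<^sub>1(a b \<otimes> c)\<close>. With \<open>y \<otimes> z = R\<^sub>1(a \<otimes> c)\<close> and
  \<open>m \<otimes> n = R\<^sub>1(b \<otimes> z)\<close>, the argument of \<open>R\<^sub>1\<close> is \<open>\<Delta>(y)(b \<otimes> z) = \<Delta>(y) E(b \<otimes> z) = \<Delta>(y m)(1 \<otimes> n)\<close>, so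
  that \<open>R\<^sub>1\<close> is only needed on the range of \<open>T\<^sub>1\<close>. What remains is \<open>S(\<Sqinter>\<^sup>L(y) b) z\<close>, to which
  \<open>sl_ll\<close> applies.
\<close>

lemma sl_antimult: "sl (a * b) c = sl b (sl a c)"
proof (rule eqI_functional)
  fix \<phi> assume \<phi>: "lin1 \<phi>"
  note [simp] = lin1_comp[OF \<phi>] \<phi>
  let ?r = "\<lambda>u v. r1 u v \<rhd> (\<lambda>p q. \<epsilon> p * \<phi> q)"
  have "\<phi> (sl (a * b) c) = (r1 (a * b) c \<rhd> (\<lambda>p q. \<epsilon> p * \<phi> q))"
    by (rule sl_eval[OF \<phi>])
  also have "\<dots> = (e1 (a * b) c \<rhd> ?r)"
    by (rule R1_E1[symmetric]) simp
  also have "\<dots> = (e1 a c \<rhd> (\<lambda>u v. ?r (u * b) v))"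
    by (rule E1_mult1[rule_format]) simp
  also have "\<dots> = (r1 a c \<rhd> (\<lambda>y z. t1 y z \<rhd> (\<lambda>u v. ?r (u * b) v)))"
    by (rule T1_R1[symmetric]) simp
  also have "\<dots> = (r1 a c \<rhd> (\<lambda>y z. e1 b z \<rhd> (\<lambda>m n. t1 y n \<rhd> (\<lambda>u v. ?r (u * m) v))))"
    by (intro ev_cong[OF refl] comult_E1[rule_format, symmetric]) simp
  also have "\<dots> = (r1 a c \<rhd> (\<lambda>y z. r1 b z \<rhd> (\<lambda>m' n'. t1 m' n' \<rhd> (\<lambda>m n. t1 y n \<rhd> (\<lambda>u v. ?r (u * m) v)))))"
    by (intro ev_cong[OF refl] T1_R1[symmetric]) simp
  also have "\<dots> = (r1 a c \<rhd> (\<lambda>y z. r1 b z \<rhd> (\<lambda>m n. t1 (y * m) n \<rhd> ?r)))"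
  proof -
    have "(t1 m' n' \<rhd> (\<lambda>m n. t1 y n \<rhd> (\<lambda>u v. ?r (u * m) v))) = (t1 (y * m') n' \<rhd> ?r)" for m' n' y
      by (rule comult_mult1) simp
    then show ?thesis by simp
  qed
  also have "\<dots> = (r1 a c \<rhd> (\<lambda>y z. r1 b z \<rhd>
      (\<lambda>m n. t1 m n \<rhd> (\<lambda>u v. r1 u v \<rhd> (\<lambda>p q. \<epsilon> (y * p) * \<phi> q)))))"
    by (simp add: G1_counit)
  also have "\<dots> = (r1 a c \<rhd> (\<lambda>y z. r1 b z \<rhd> (\<lambda>p q. \<epsilon> (y * p) * \<phi> q)))"
    by (intro ev_cong[OF refl] R1_T1_R1) simp
  also have "\<dots> = (r1 a c \<rhd> (\<lambda>y z. t2 y b \<rhd> (\<lambda>p q. \<epsilon> p * \<phi> (sl q z))))"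
    by (intro ev_cong[OF refl] R1_left) simp
  also have "\<dots> = (r1 a c \<rhd> (\<lambda>y z. \<phi> (sl b (rl y z))))"
    using ll_eval[of "\<lambda>q. \<phi> (sl q z)" for z] by (simp add: sl_ll)
  also have "\<dots> = (r1 a c \<rhd> (\<lambda>y z. t1 y z \<rhd> (\<lambda>p q. r1 p q \<rhd> (\<lambda>u v. \<epsilon> u * \<phi> (sl b v)))))"
    using rl_eval[of "\<lambda>w. \<phi> (sl b w)"] sl_eval[of "\<lambda>w. \<phi> (sl b w)"] by simp
  also have "\<dots> = (r1 a c \<rhd> (\<lambda>u v. \<epsilon> u * \<phi> (sl b v)))"
    by (rule R1_T1_R1) simp
  also have "\<dots> = \<phi> (sl b (sl a c))"
    by (rule sl_eval[symmetric]) simp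
  finally show "\<phi> (sl (a * b) c) = \<phi> (sl b (sl a c))" .
qed

section \<open>The antipode is anti-comultiplicative\<close>

text \<open>Both sides are \<open>x d\<^sub>1 e\<^sub>1 \<otimes> d\<^sub>2 e\<^sub>2 \<otimes> d\<^sub>3\<close>.\<close>

lemma T4_T2:
  "\<forall>h. lin3 h \<longrightarrow> (t4 e d \<rhd> (\<lambda>p q. t2 x p \<rhd> (\<lambda>r s. h r s q))) =
    (t2 x d \<rhd> (\<lambda>m n. t2 m e \<rhd> (\<lambda>r s. t4 s n \<rhd> (\<lambda>u v. h r u v))))"
proof (rule cancel3_3[OF separating_right])
  fix k h assume h: "lin3 h"
  note [simp] = lin3_D[OF h]
  have "(t4 e d \<rhd> (\<lambda>p q. t2 x p \<rhd> (\<lambda>r s. h r s (q * k)))) =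
      (t1 d k \<rhd> (\<lambda>p q. t2 x (p * e) \<rhd> (\<lambda>r s. h r s q)))"
    by (rule T4_T1[rule_format]) simp
  also have "\<dots> = (t2 x d \<rhd> (\<lambda>u v. t2 u e \<rhd> (\<lambda>r s. t1 v k \<rhd> (\<lambda>m n. h r (m * s) n))))"
    by (rule comult_split[OF h])
  also have "\<dots> = (t2 x d \<rhd> (\<lambda>u v. t2 u e \<rhd> (\<lambda>r s. t4 s v \<rhd> (\<lambda>m n. h r m (n * k)))))"
    by (intro ev_cong[OF refl] T4_T1[rule_format, symmetric]) simp
  finally show "(t4 e d \<rhd> (\<lambda>p q. t2 x p \<rhd> (\<lambda>r s. h r s (q * k)))) =
    (t2 x d \<rhd> (\<lambda>m n. t2 m e \<rhd> (\<lambda>r s. t4 s n \<rhd> (\<lambda>u v. h r u (v * k)))))" .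
qed (intro fin_intros)+

text \<open>
  \<open>\<Delta>(S(a\<^sub>1) a\<^sub>2 z)(1 \<otimes> y) = z\<^sub>1 \<otimes> S(a\<^sub>1) a\<^sub>2 z\<^sub>2 y\<close>: by \<open>rl_formula\<close>, multiplication by
  \<open>S(a\<^sub>1) a\<^sub>2\<close> sends \<open>z\<close> to \<open>z\<^sub>1 \<epsilon>(a z\<^sub>2)\<close>, and coassociativity applies.
\<close>

lemma T1_rl:
  assumes \<beta>: "lin2 \<beta>"
  shows "(t1 (rl a z) y \<rhd> \<beta>) = (t1 z y \<rhd> (\<lambda>p q. \<beta> p (rl a q)))"
proof (rule eq_on_products[where x = z])
  note [simp] = lin2_D[OF \<beta>]
  show "lin1 (\<lambda>z. t1 (rl a z) y \<rhd> \<beta>)" "lin1 (\<lambda>z. t1 z y \<rhd> (\<lambda>p q. \<beta> p (rl a q)))" by simp_all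
  fix d e
  have "\<forall>\<beta>. lin2 \<beta> \<longrightarrow> (t1 (rl a (d * e)) y \<rhd> \<beta>) = (t1 (d * e) y \<rhd> (\<lambda>p q. \<beta> p (rl a q)))"
  proof (rule cancel2_1[OF separating_left])
    fix x \<beta> assume \<beta>: "lin2 \<beta>"
    note [simp] = lin2_D[OF \<beta>]
    have "(t1 (rl a (d * e)) y \<rhd> (\<lambda>p q. \<beta> (x * p) q)) =
        (t2 x (rl a (d * e)) \<rhd> (\<lambda>p q. \<beta> p (q * y)))"
      by (rule T1_T2[OF \<beta>])
    also have "\<dots> = (t4 e d \<rhd> (\<lambda>p q. (t2 x p \<rhd> (\<lambda>p q. \<beta> p (q * y))) * \<epsilon> (a * q)))"
      by (rule rl_formula) simp
    also have "\<dots> = (t4 e d \<rhd> (\<lambda>p q. t2 x p \<rhd> (\<lambda>r s. \<beta> r (s * y) * \<epsilon> (a * q))))"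
      by (simp add: ev_mult_right)
    also have "\<dots> = (t2 x d \<rhd> (\<lambda>m n. t2 m e \<rhd> (\<lambda>r s. t4 s n \<rhd> (\<lambda>u v. \<beta> r (u * y) * \<epsilon> (a * v)))))"
      by (rule T4_T2[rule_format]) simp
    also have "\<dots> = (t2 x d \<rhd> (\<lambda>m n. t2 m e \<rhd> (\<lambda>r s. \<beta> r (rl a (n * s) * y))))"
      using rl_formula[of "\<lambda>u. \<beta> r (u * y)" for r] by simp
    also have "\<dots> = (t2 x (d * e) \<rhd> (\<lambda>r s. \<beta> r (rl a s * y)))"
      by (rule T2_mult2[rule_format, symmetric]) simp
    also have "\<dots> = (t1 (d * e) y \<rhd> (\<lambda>p q. \<beta> (x * p) (rl a q)))"
      using T1_T2[of "\<lambda>r s. \<beta> r (rl a s)" "d * e" y x] by (simp add: rl_mult)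
    finally show "(t1 (rl a (d * e)) y \<rhd> (\<lambda>p q. \<beta> (x * p) q)) =
      (t1 (d * e) y \<rhd> (\<lambda>p q. \<beta> (x * p) (rl a q)))" .
  qed (intro fin_intros)+
  then show "(t1 (rl a (d * e)) y \<rhd> \<beta>) = (t1 (d * e) y \<rhd> (\<lambda>p q. \<beta> p (rl a q)))"
    using \<beta> by blast
qed

text \<open>Both sides are \<open>a\<^sub>1 \<otimes> a\<^sub>2 x\<^sub>1 \<otimes> a\<^sub>3 x\<^sub>2 y\<close>.\<close>

lemma T1_T1:
  "\<forall>h. lin3 h \<longrightarrow> (t1 a x \<rhd> (\<lambda>p q. t1 q y \<rhd> (\<lambda>r s. h p r s))) =
    (t1 x y \<rhd> (\<lambda>p q. t1 a q \<rhd> (\<lambda>r s. t1 r p \<rhd> (\<lambda>u v. h u v s))))"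
proof (rule cancel3_1[OF separating_left])
  fix z h assume h: "lin3 h"
  note [simp] = lin3_D[OF h]
  have "(t1 a x \<rhd> (\<lambda>p q. t1 q y \<rhd> (\<lambda>r s. h (z * p) r s))) =
      (t2 z a \<rhd> (\<lambda>p q. t1 (q * x) y \<rhd> (\<lambda>r s. h p r s)))"
    by (rule T1_T2) simp
  also have "\<dots> = (t2 z a \<rhd> (\<lambda>m n. t1 x y \<rhd> (\<lambda>p q. t1 n q \<rhd> (\<lambda>r s. h m (r * p) s))))"
    by (intro ev_cong[OF refl] comult_mult1[symmetric]) simp
  also have "\<dots> = (t1 x y \<rhd> (\<lambda>p q. t2 z a \<rhd> (\<lambda>m n. t1 n q \<rhd> (\<lambda>r s. h m (r * p) s))))"
    by (rule ev_swap)
  also have "\<dots> = (t1 x y \<rhd> (\<lambda>p q. t1 a q \<rhd> (\<lambda>r s. t2 z r \<rhd> (\<lambda>m n. h m (n * p) s))))"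
    by (intro ev_cong[OF refl] coassoc[symmetric]) simp
  also have "\<dots> = (t1 x y \<rhd> (\<lambda>p q. t1 a q \<rhd> (\<lambda>r s. t1 r p \<rhd> (\<lambda>u v. h (z * u) v s))))"
    by (intro ev_cong[OF refl] T1_T2[symmetric]) simp
  finally show "(t1 a x \<rhd> (\<lambda>p q. t1 q y \<rhd> (\<lambda>r s. h (z * p) r s))) =
    (t1 x y \<rhd> (\<lambda>p q. t1 a q \<rhd> (\<lambda>r s. t1 r p \<rhd> (\<lambda>u v. h (z * u) v s))))" .
qed (intro fin_intros)+

text \<open>
  Anti-comultiplicativity for \<open>a \<otimes> x\<close> in the range of \<open>T\<^sub>1\<close>. There \<open>S(a) x\<close> becomes
  \<open>S(a\<^sub>1) a\<^sub>2 x\<close>, whose coproduct is given by \<open>T1_rl\<close>, and on the other side \<open>R\<^sub>1 T\<^sub>1 = G\<^sub>1\<close> is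
  explicit.
\<close>

lemma T1_sl_on_T1:
  assumes \<beta>: "lin2 \<beta>"
  shows "(t1 a x \<rhd> (\<lambda>a' x'. t1 x' y \<rhd> (\<lambda>p q. r1 a' p \<rhd> (\<lambda>u v. \<beta> v (sl u q))))) =
    (t1 a x \<rhd> (\<lambda>a' x'. t1 (sl a' x') y \<rhd> \<beta>))"
proof (rule eq_on_products[where x = x])
  note [simp] = lin2_D[OF \<beta>]
  show "lin1 (\<lambda>x. t1 a x \<rhd> (\<lambda>a' x'. t1 x' y \<rhd> (\<lambda>p q. r1 a' p \<rhd> (\<lambda>u v. \<beta> v (sl u q)))))" by simp
  show "lin1 (\<lambda>x. t1 a x \<rhd> (\<lambda>a' x'. t1 (sl a' x') y \<rhd> \<beta>))" by simp
  fix d e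
  \<comment> \<open>The left-hand side, rearranged by \<open>T1_T1\<close>.\<close>
  let ?G = "\<lambda>p q. t1 a q \<rhd> (\<lambda>r s. t1 r p \<rhd> (\<lambda>a' p'. r1 a' p' \<rhd> (\<lambda>u v. \<beta> v (sl u s))))"
  have G: "(t1 d q' \<rhd> (\<lambda>p q. ?G (p * p') q)) = (t1 d q' \<rhd> (\<lambda>p q. \<beta> (p * p') (rl a q)))" for p' q'
  proof -
    have "(t1 d q' \<rhd> (\<lambda>p q. ?G (p * p') q)) =
        (t1 d q' \<rhd> (\<lambda>p q. t1 a q \<rhd> (\<lambda>r s. t4 p' p \<rhd> (\<lambda>m n. \<beta> m (sl (rb r n) s)))))"
      by (simp add: R1_T1_mult)
    also have "\<dots> = (t1 d q' \<rhd> (\<lambda>p q. t4 p' p \<rhd> (\<lambda>m n. t1 a q \<rhd> (\<lambda>r s. \<beta> m (sl (rb r n) s)))))"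
      by (intro ev_cong[OF refl] ev_swap)
    also have "\<dots> = (t4 p' d \<rhd> (\<lambda>m n. t1 n q' \<rhd> (\<lambda>n q. t1 a q \<rhd> (\<lambda>r s. \<beta> m (sl (rb r n) s)))))"
      by (rule coassoc4[rule_format, symmetric]) simp
    also have "\<dots> = (t4 p' d \<rhd> (\<lambda>m n. t1 n q' \<rhd> (\<lambda>n q. t1 a q \<rhd>
        (\<lambda>r s. t1 r n \<rhd> (\<lambda>u w. \<epsilon> w * \<beta> m (sl u s))))))"
      using rb_eval[of "\<lambda>u. \<beta> m (sl u s)" for m s] by (simp add: mult.commute)
    also have "\<dots> = (t4 p' d \<rhd> (\<lambda>m n. t1 a n \<rhd> (\<lambda>u w. t1 w q' \<rhd> (\<lambda>w s. \<epsilon> w * \<beta> m (sl u s)))))"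
      by (intro ev_cong[OF refl] T1_T1[rule_format, symmetric]) simp
    also have "\<dots> = (t4 p' d \<rhd> (\<lambda>m n. t1 a n \<rhd> (\<lambda>u w. \<beta> m (sl u w * q'))))"
      using counit1[of "\<lambda>s. \<beta> m (sl u s)" for m u] by simp
    also have "\<dots> = (t4 p' d \<rhd> (\<lambda>m n. \<beta> m (rl a (n * q'))))"
      using rl_eval[of "\<lambda>z. \<beta> m (z * q')" for m] by (simp add: rl_mult)
    also have "\<dots> = (t1 d q' \<rhd> (\<lambda>p q. \<beta> (p * p') (rl a q)))"
      by (rule T4_T1[rule_format]) simp
    finally show ?thesis .
  qed
  have "(t1 a (d * e) \<rhd> (\<lambda>a' x'. t1 x' y \<rhd> (\<lambda>p q. r1 a' p \<rhd> (\<lambda>u v. \<beta> v (sl u q))))) =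
      (t1 (d * e) y \<rhd> ?G)"
    by (rule T1_T1[rule_format]) simp
  also have "\<dots> = (t1 e y \<rhd> (\<lambda>p' q'. t1 d q' \<rhd> (\<lambda>p q. ?G (p * p') q)))"
    by (rule comult_mult1[symmetric]) simp
  also have "\<dots> = (t1 e y \<rhd> (\<lambda>p' q'. t1 d q' \<rhd> (\<lambda>p q. \<beta> (p * p') (rl a q))))"
    by (simp only: G)
  also have "\<dots> = (t1 (d * e) y \<rhd> (\<lambda>p q. \<beta> p (rl a q)))"
    by (rule comult_mult1) simp
  also have "\<dots> = (t1 (rl a (d * e)) y \<rhd> \<beta>)"
    by (rule T1_rl[OF \<beta>, symmetric])
  also have "\<dots> = (t1 a (d * e) \<rhd> (\<lambda>a' x'. t1 (sl a' x') y \<rhd> \<beta>))"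
    by (rule rl_eval) simp
  finally show "(t1 a (d * e) \<rhd> (\<lambda>a' x'. t1 x' y \<rhd> (\<lambda>p q. r1 a' p \<rhd> (\<lambda>u v. \<beta> v (sl u q))))) =
    (t1 a (d * e) \<rhd> (\<lambda>a' x'. t1 (sl a' x') y \<rhd> \<beta>))" .
qed

text \<open>\<open>S(p) q = S(a) b\<close> for \<open>p \<otimes> q = E(a \<otimes> b)\<close>, as \<open>R\<^sub>1 E\<^sub>1 = R\<^sub>1\<close>.\<close>

lemma sl_E1:
  assumes "lin1 \<phi>"
  shows "(e1 a b \<rhd> (\<lambda>p q. \<phi> (sl p q))) = \<phi> (sl a b)"
proof -
  note [simp] = lin1_comp[OF assms] assms
  show ?thesis using R1_E1[of "\<lambda>p q. \<epsilon> p * \<phi> q" a b] by (simp add: sl_eval)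
qed

text \<open>
  \<open>\<Delta>(S(a) x)(1 \<otimes> y) = S(a\<^sub>2) x\<^sub>1 \<otimes> S(a\<^sub>1) x\<^sub>2 y\<close>. Both sides do not change when \<open>a \<otimes> x\<close> is
  replaced by \<open>E(a \<otimes> x)\<close>, which lies in the range of \<open>T\<^sub>1\<close>.
\<close>

lemma T1_sl:
  assumes \<beta>: "lin2 \<beta>"
  shows "(t1 (sl a x) y \<rhd> \<beta>) = (t1 x y \<rhd> (\<lambda>p q. r1 a p \<rhd> (\<lambda>u v. \<beta> v (sl u q))))"
proof -
  note [simp] = lin2_D[OF \<beta>]
  have "(t1 (sl a x) y \<rhd> \<beta>) = (e1 a x \<rhd> (\<lambda>a' x'. t1 (sl a' x') y \<rhd> \<beta>))"
    by (rule sl_E1[symmetric]) simp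
  also have "\<dots> = (r1 a x \<rhd> (\<lambda>a x. t1 a x \<rhd> (\<lambda>a' x'. t1 (sl a' x') y \<rhd> \<beta>)))"
    by (rule T1_R1[symmetric]) simp
  also have "\<dots> = (r1 a x \<rhd> (\<lambda>a x. t1 a x \<rhd>
      (\<lambda>a' x'. t1 x' y \<rhd> (\<lambda>p q. r1 a' p \<rhd> (\<lambda>u v. \<beta> v (sl u q))))))"
    by (simp only: T1_sl_on_T1[OF \<beta>])
  also have "\<dots> = (e1 a x \<rhd> (\<lambda>a' x'. t1 x' y \<rhd> (\<lambda>p q. r1 a' p \<rhd> (\<lambda>u v. \<beta> v (sl u q)))))"
    by (rule T1_R1) simp
  also have "\<dots> = (t1 x y \<rhd> (\<lambda>p q. e1 a p \<rhd> (\<lambda>a' p'. r1 a' p' \<rhd> (\<lambda>u v. \<beta> v (sl u q)))))"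
    by (rule E1_T1[symmetric]) simp
  also have "\<dots> = (t1 x y \<rhd> (\<lambda>p q. r1 a p \<rhd> (\<lambda>u v. \<beta> v (sl u q))))"
    by (intro ev_cong[OF refl] R1_E1) simp
  finally show ?thesis .
qed

text \<open>
  Anti-multiplicativity in the second leg of \<open>R\<^sub>1(z \<otimes> p) = z\<^sub>1 \<otimes> S(z\<^sub>2) p\<close>:
  \<open>z\<^sub>1 \<otimes> S(b) S(z\<^sub>2) p = z\<^sub>1 \<otimes> S(z\<^sub>2 b) p\<close>.
\<close>

lemma R1_sl:
  "\<forall>\<beta>. lin2 \<beta> \<longrightarrow> (r1 z p \<rhd> (\<lambda>u v. \<beta> u (sl b v))) = (t1 z b \<rhd> (\<lambda>u v. \<beta> u (sl v p)))"
proof (rule cancel2_1[OF separating_left])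
  fix a \<beta> assume \<beta>: "lin2 \<beta>"
  note [simp] = lin2_D[OF \<beta>]
  have "(r1 z p \<rhd> (\<lambda>u v. \<beta> (a * u) (sl b v))) = (t2 a z \<rhd> (\<lambda>m n. \<beta> m (sl b (sl n p))))"
    by (rule R1_left) simp
  also have "\<dots> = (t1 z b \<rhd> (\<lambda>u v. \<beta> (a * u) (sl v p)))"
    using T1_T2[of "\<lambda>m n. \<beta> m (sl n p)" z b a] by (simp add: sl_antimult)
  finally show "(r1 z p \<rhd> (\<lambda>u v. \<beta> (a * u) (sl b v))) = (t1 z b \<rhd> (\<lambda>u v. \<beta> (a * u) (sl v p)))" .
qed (intro fin_intros)+

text \<open>
  The form of anti-comultiplicativity used for comodules: multiplication by \<open>c S(b) \<otimes> c' S(d)\<close>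
  from the left makes it possible to write both legs of \<open>\<Delta>(z)\<close> under the antipode.
\<close>

lemma T1_sl_cover:
  assumes \<beta>: "lin2 \<beta>"
  shows "(t1 (sl z x) y \<rhd> (\<lambda>p q. \<beta> (sr c b * p) (sr c' d * q))) =
    (t1 x y \<rhd> (\<lambda>p q. t1 z b \<rhd> (\<lambda>u v. \<beta> (sr c v * p) (sr c' (u * d) * q))))"
proof -
  note [simp] = lin2_D[OF \<beta>]
  have "(t1 (sl z x) y \<rhd> (\<lambda>p q. \<beta> (sr c b * p) (sr c' d * q))) =
      (t1 x y \<rhd> (\<lambda>p q. r1 z p \<rhd> (\<lambda>u v. \<beta> (sr c b * v) (sr c' d * sl u q))))"
    by (rule T1_sl) simp
  also have "\<dots> = (t1 x y \<rhd> (\<lambda>p q. r1 z p \<rhd> (\<lambda>u v. \<beta> (c * sl b v) (c' * sl (u * d) q))))"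
    by (simp add: sr_sl sl_antimult)
  also have "\<dots> = (t1 x y \<rhd> (\<lambda>p q. t1 z b \<rhd> (\<lambda>u v. \<beta> (c * sl v p) (c' * sl (u * d) q))))"
    by (intro ev_cong[OF refl] R1_sl[rule_format]) simp
  finally show ?thesis by (simp add: sr_sl)
qed

lemma E1_counit:
  assumes "lin1 \<phi>"
  shows "(e1 m k \<rhd> (\<lambda>p q. \<epsilon> p * \<phi> q)) = \<phi> (pl m k)"
proof -
  note [simp] = lin1_comp[OF assms] assms
  have "(e1 m k \<rhd> (\<lambda>p q. \<epsilon> p * \<phi> q)) = (r1 m k \<rhd> (\<lambda>u v. t1 u v \<rhd> (\<lambda>p q. \<epsilon> p * \<phi> q)))"
    by (rule T1_R1[symmetric]) simp
  then show ?thesis by (simp add: counit1 pl_eval)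
qed

text \<open>Both sides are \<open>s\<^sub>1 d \<otimes> s\<^sub>2 S(s\<^sub>3) k\<close>.\<close>

lemma E1_T4_pl:
  "\<forall>\<gamma>. lin2 \<gamma> \<longrightarrow> (t4 d s \<rhd> (\<lambda>p q. \<gamma> p (pl q k))) = (e1 s k \<rhd> (\<lambda>p q. \<gamma> (p * d) q))"
proof (rule cancel2_1[OF separating_left])
  fix a \<gamma> assume \<gamma>: "lin2 \<gamma>"
  note [simp] = lin2_D[OF \<gamma>]
  show "(t4 d s \<rhd> (\<lambda>p q. \<gamma> (a * p) (pl q k))) = (e1 s k \<rhd> (\<lambda>p q. \<gamma> (a * (p * d)) q))"
    using T2_T4[of "\<lambda>p q. \<gamma> p (pl q k)" a s d] E1_left[of "\<lambda>p q. \<gamma> (p * d) q" s k a]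
    by (simp add: mult.assoc)
qed (intro fin_intros)+

text \<open>
  For \<open>u \<otimes> v = z\<^sub>1 \<otimes> z\<^sub>2 b\<close> the element \<open>c S(v) \<otimes> x S(u d)\<close> is not changed by multiplication with
  \<open>E\<close> from the right. Writing \<open>E\<close> by \<open>E2_right\<close> puts a factor \<open>\<Sqinter>\<^sup>L\<close> next to \<open>v\<close>, because of
  \<open>sr_ll\<close>. The counit of this factor contracts with \<open>\<Delta>(S(u))\<close> to an element \<open>m\<^sub>1 S(m\<^sub>2)\<close>, which is
  absorbed by \<open>S(u)\<close> thanks to \<open>S(p) q = S(a) b\<close> for \<open>p \<otimes> q = E(a \<otimes> b)\<close>.
\<close>

lemma S_op_E2:
  "\<forall>\<beta>. lin2 \<beta> \<longrightarrow> (t1 z b \<rhd> (\<lambda>u v. e2 (sr c v) (sr x (u * d)) \<rhd> \<beta>)) =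
    (t1 z b \<rhd> (\<lambda>u v. \<beta> (sr c v) (sr x (u * d))))"
proof (rule cancel2_2[OF separating_right])
  fix k \<beta> assume \<beta>: "lin2 \<beta>"
  note [simp] = lin2_D[OF \<beta>]
  have "(t1 z b \<rhd> (\<lambda>u v. e2 (sr c v) (sr x (u * d)) \<rhd> (\<lambda>p q. \<beta> p (q * k)))) =
      (t1 z b \<rhd> (\<lambda>u v. t1 (sr x (u * d)) k \<rhd> (\<lambda>p q. \<beta> (sr c (ll p v)) q)))"
    by (simp add: E2_right sr_ll)
  also have "\<dots> = (t4 d z \<rhd> (\<lambda>u s. t1 (sr x u) k \<rhd> (\<lambda>p q. \<beta> (sr c (ll p (s * b))) q)))"
    by (rule T4_T1[rule_format, symmetric]) simp
  also have "\<dots> = (t4 d z \<rhd> (\<lambda>u s. t1 (sr x u) k \<rhd> (\<lambda>p q. t1 s b \<rhd> (\<lambda>m n. \<epsilon> (p * m) * \<beta> (sr c n) q))))"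
    using ll_mult_eval[of "\<lambda>n. \<beta> (sr c n) q" for q] by simp
  also have "\<dots> = (t4 d z \<rhd> (\<lambda>u s. t1 s b \<rhd> (\<lambda>m n. t1 (sr x u) k \<rhd> (\<lambda>p q. \<epsilon> (p * m) * \<beta> (sr c n) q))))"
    by (intro ev_cong[OF refl] ev_swap)
  also have "\<dots> = (t4 d z \<rhd> (\<lambda>u s. t1 s b \<rhd> (\<lambda>m n. \<beta> (sr c n) (sr x u * pl m k))))"
    using counit_E1[of "\<beta> (sr c n)" for n] E1_counit[of "\<lambda>q. \<beta> (sr c n) (sr x u * q)" for n u]
    by simp
  also have "\<dots> = (t1 z b \<rhd> (\<lambda>s n. t4 d s \<rhd> (\<lambda>u m. \<beta> (sr c n) (sr x u * pl m k))))"
    by (rule coassoc4[rule_format]) simp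
  also have "\<dots> = (t1 z b \<rhd> (\<lambda>s n. e1 s k \<rhd> (\<lambda>p q. \<beta> (sr c n) (sr x (p * d) * q))))"
    by (intro ev_cong[OF refl] E1_T4_pl[rule_format]) simp
  also have "\<dots> = (t1 z b \<rhd> (\<lambda>s n. e1 (s * d) k \<rhd> (\<lambda>p q. \<beta> (sr c n) (sr x p * q))))"
    by (intro ev_cong[OF refl] E1_mult1[rule_format, symmetric]) simp
  also have "\<dots> = (t1 z b \<rhd> (\<lambda>u v. \<beta> (sr c v) (sr x (u * d) * k)))"
    using sl_E1[of "\<lambda>q. \<beta> (sr c n) (x * q)" for n] by (simp add: sr_sl)
  finally show "(t1 z b \<rhd> (\<lambda>u v. e2 (sr c v) (sr x (u * d)) \<rhd> (\<lambda>p q. \<beta> p (q * k)))) =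
    (t1 z b \<rhd> (\<lambda>u v. \<beta> (sr c v) (sr x (u * d) * k)))" .
qed (intro fin_intros)+

end

section \<open>Linear maps determined on a spanning set\<close>

text \<open>
  A basis of \<open>U\<close> is extended by \<open>x\<close> and then to a basis of the space; the coordinate of \<open>x\<close>
  separates.
\<close>

lemma subspace_separate:
  assumes X: "vspace X" and U: "module.subspace (scl X) U"
    and sep: "\<And>\<phi>. is_linear X ground \<phi> \<Longrightarrow> (\<forall>u\<in>U. \<phi> u = 0) \<Longrightarrow> \<phi> x = 0"
  shows "x \<in> U"
proof (rule ccontr)
  assume x: "x \<notin> U"
  interpret vector_space "scl X" using X by (simp add: vspace_def)
  obtain B where B: "B \<subseteq> U" "independent B" "U \<subseteq> span B"
    using maximal_independent_subset by blast
  have BU: "span B = U" using B U by (simp add: span_minimal subset_antisym)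
  have ind: "independent (insert x B)"
    using B(2) x BU by (simp add: independent_insert)
  define C where "C = extend_basis (insert x B)"
  have C: "independent C" "span C = UNIV" "insert x B \<subseteq> C"
    using independent_extend_basis[OF ind] span_extend_basis[OF ind]
      extend_basis_superset[OF ind] by (auto simp: C_def)
  define \<phi> where "\<phi> = (\<lambda>y. representation C y x)"
  have "is_linear X ground \<phi>"
    using C by (auto simp: is_linear_def \<phi>_def representation_add representation_scale)
  moreover have "\<forall>u\<in>U. \<phi> u = 0"
  proof
    fix u assume "u \<in> U"
    then have "u \<in> span B" using BU by simp
    then have "representation C u = representation B u"
      using C by (intro representation_extend) auto
    moreover have "x \<notin> B" using x B(1) by auto
    ultimately show "\<phi> u = 0" using representation_ne_zero[of B u x] by (auto simp: \<phi>_def)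
  qed
  moreover have "\<phi> x = 1" using C by (simp add: \<phi>_def representation_basis)
  ultimately show False using sep by fastforce
qed

text \<open>
  A linear map on \<open>V \<otimes> X\<close> is prescribed on the elements \<open>v \<otimes> g i\<close>, where the \<open>g i\<close> only span \<open>X\<close>.
  The prescription is consistent as soon as jointly injective tests \<open>m j\<close> turn it into the values
  of bilinear maps \<open>B j\<close>: the test values then determine, for every \<open>v\<close> and \<open>x\<close>, at most one
  element of \<open>W\<close>, and the pairs for which there is one form a linear relation.
\<close>

lemma extend_from_spanning:
  fixes g :: "'i \<Rightarrow> 'x::ab_group_add" and V :: "('k::field, 'v::ab_group_add) space"
    and X :: "('k, 'x) space" and W :: "('k, 'w::ab_group_add) space" and W' :: "('k, 'u::ab_group_add) space"
  assumes V: "vspace V" and X: "vspace X" and ptsX: "pts X = UNIV" and W: "vspace W"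
    and span: "module.span (scl X) (range g) = UNIV"
    and m: "\<And>j. is_linear W W' (m j)"
    and inj: "\<And>s t. s \<in> pts W \<Longrightarrow> t \<in> pts W \<Longrightarrow> (\<And>j. m j s = m j t) \<Longrightarrow> s = t"
    and B: "\<And>j. is_bilinear V X W' (B j)"
    and t: "\<And>v i. v \<in> pts V \<Longrightarrow> t v i \<in> pts W"
      "\<And>v i j. v \<in> pts V \<Longrightarrow> m j (t v i) = B j v (g i)"
  shows "\<exists>L\<in>Lin (V \<odot> X) W. (\<forall>v\<in>pts V. \<forall>i. L (v \<otimes>\<^bsub>V,X\<^esub> g i) = t v i) \<and>
    (\<forall>v\<in>pts V. \<forall>x j. m j (L (v \<otimes>\<^bsub>V,X\<^esub> x)) = B j v x)"
proof -
  interpret vs: vector_space "scl X" using X by (simp add: vspace_def)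
  interpret ws: vector_space "scl W" using W by (simp add: vspace_def)
  define R where "R v x s \<longleftrightarrow> s \<in> pts W \<and> (\<forall>j. m j s = B j v x)" for v x s
  have m': "m j (s + s') = m j s + m j s'" "m j (scl W c s) = scl W' c (m j s)"
    if "s \<in> pts W" "s' \<in> pts W" for j s s' c
    using m[of j] that by (auto simp: is_linear_def)
  have B': "B j v (x + x') = B j v x + B j v x'" "B j v (scl X c x) = scl W' c (B j v x)"
    "B j (v + v') x = B j v x + B j v' x" "B j (scl V c v) x = scl W' c (B j v x)"
    if "v \<in> pts V" "v' \<in> pts V" for j v v' x x' c
    using B[of j] that ptsX by (auto simp: is_bilinear_def is_linear_def)
  have R_unique: "s = s'" if "R v x s" "R v x s'" for v x s s'
    using that by (intro inj) (auto simp: R_def)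
  have R_add: "R v (x + x') (s + s')" if "R v x s" "R v x' s'" "v \<in> pts V" for v x x' s s'
    using that by (auto simp: R_def m' B' vspace_closed[OF W])
  have R_scl: "R v (scl X c x) (scl W c s)" if "R v x s" "v \<in> pts V" for v x s c
    using that by (auto simp: R_def m' B' vspace_closed[OF W])
  have R_addV: "R (v + v') x (s + s')" if "R v x s" "R v' x s'" "v \<in> pts V" "v' \<in> pts V" for v v' x s s'
    using that by (auto simp: R_def m' B' vspace_closed[OF W])
  have R_sclV: "R (scl V c v) x (scl W c s)" if "R v x s" "v \<in> pts V" for v x s c
    using that by (auto simp: R_def m' B' vspace_closed[OF W])
  have R_g: "R v (g i) (t v i)" if "v \<in> pts V" for v i
    using that t by (simp add: R_def)
  \<comment> \<open>The index type is inhabited, so some prescribed value can be scaled by zero.\<close>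
  have R_0: "R v 0 0" if v: "v \<in> pts V" for v
    using R_scl[OF R_g[OF v] v, of 0 undefined] by simp
  have R_ex: "\<exists>s. R v x s" if v: "v \<in> pts V" for v x
  proof -
    have sub: "vs.subspace {x. \<exists>s. R v x s}"
    proof (rule vs.subspaceI)
      show "0 \<in> {x. \<exists>s. R v x s}" using R_0[OF v] by auto
      show "x + y \<in> {x. \<exists>s. R v x s}" if "x \<in> {x. \<exists>s. R v x s}" "y \<in> {x. \<exists>s. R v x s}" for x y
        using that by (auto intro: R_add[OF _ _ v])
      show "scl X c x \<in> {x. \<exists>s. R v x s}" if "x \<in> {x. \<exists>s. R v x s}" for x c
        using that by (auto intro: R_scl[OF _ v])
    qed
    have "vs.span (range g) \<subseteq> {x. \<exists>s. R v x s}"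
      by (rule vs.span_minimal[OF _ sub]) (use R_g[OF v] in auto)
    then show ?thesis using span by auto
  qed
  define f where "f v x = (THE s. R v x s)" for v x
  have Rf: "R v x (f v x)" if v: "v \<in> pts V" for v x
  proof -
    obtain s where s: "R v x s" using R_ex[OF v] by auto
    show ?thesis unfolding f_def by (rule theI[of "R v x", OF s]) (rule R_unique[OF _ s])
  qed
  have f: "f v x = s" if "v \<in> pts V" "R v x s" for v x s
    by (rule R_unique[OF Rf[OF that(1)] that(2)])
  have fW: "f v x \<in> pts W" if "v \<in> pts V" for v x using Rf[OF that] by (simp add: R_def)
  have bil: "is_bilinear V X W f"
    unfolding is_bilinear_def is_linear_def
  proof (intro conjI ballI allI)
    fix v x y c assume v: "v \<in> pts V"
    show "f v x \<in> pts W" by (rule fW[OF v])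
    show "f v (x + y) = f v x + f v y" by (rule f[OF v R_add[OF Rf[OF v] Rf[OF v] v]])
    show "f v (scl X c x) = scl W c (f v x)" by (rule f[OF v R_scl[OF Rf[OF v] v]])
    show "f (scl V c v) x = scl W c (f v x)"
      by (rule f[OF vspace_closed(3)[OF V v] R_sclV[OF Rf[OF v] v]])
    fix v' assume v': "v' \<in> pts V"
    show "f (v + v') x = f v x + f v' x"
      by (rule f[OF vspace_closed(2)[OF V v v'] R_addV[OF Rf[OF v] Rf[OF v'] v v']])
  qed (rule fW)
  note L = lift[OF W bil]
  show ?thesis
  proof (intro bexI[OF _ L(1)] conjI ballI allI)
    fix v x j assume v: "v \<in> pts V"
    show "lift V X W f (v \<otimes>\<^bsub>V,X\<^esub> g i) = t v i" for i
      using L(2)[OF v, of "g i"] f[OF v R_g[OF v]] ptsX by simp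
    show "m j (lift V X W f (v \<otimes>\<^bsub>V,X\<^esub> x)) = B j v x"
      using L(2)[OF v, of x] Rf[OF v, of x] ptsX by (simp add: R_def)
  qed
qed

lemma Lin_unique_on_spanning:
  assumes V: "vspace V" and X: "vspace X" and ptsX: "pts X = UNIV"
    and span: "module.span (scl X) (range g) = UNIV"
    and L: "L \<in> Lin (V \<odot> X) W" "L' \<in> Lin (V \<odot> X) W"
    and eq: "\<And>v i. v \<in> pts V \<Longrightarrow> L (v \<otimes>\<^bsub>V,X\<^esub> g i) = L' (v \<otimes>\<^bsub>V,X\<^esub> g i)"
  shows "L = L'"
proof
  fix t
  interpret vs: vector_space "scl X" using X by (simp add: vspace_def)
  show "L t = L' t"
  proof (cases "t \<in> pts (V \<odot> X)")
    case True
    show ?thesis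
    proof (rule linear_eqI[OF V LinD[OF L(1)] LinD[OF L(2)] _ True])
      fix v x assume v: "v \<in> pts V"
      note l = is_linear_comp[OF is_linear_pure2[OF v] LinD[OF L(1)]]
        is_linear_comp[OF is_linear_pure2[OF v] LinD[OF L(2)]]
      have sub: "vs.subspace {x. L (v \<otimes>\<^bsub>V,X\<^esub> x) = L' (v \<otimes>\<^bsub>V,X\<^esub> x)}"
        using l is_linear_0[OF X l(1)] is_linear_0[OF X l(2)]
        by (intro vs.subspaceI) (simp_all add: is_linear_def ptsX)
      have "vs.span (range g) \<subseteq> {x. L (v \<otimes>\<^bsub>V,X\<^esub> x) = L' (v \<otimes>\<^bsub>V,X\<^esub> x)}"
        by (rule vs.span_minimal[OF _ sub]) (use eq[OF v] in auto)
      then show "L (v \<otimes>\<^bsub>V,X\<^esub> x) = L' (v \<otimes>\<^bsub>V,X\<^esub> x)" using span by blast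
    qed
  next
    case False
    then show ?thesis using L by (auto simp: Lin_def extensional_def)
  qed
qed

section \<open>Twisting a comodule by the antipode\<close>

locale full_antipode = wmb_antipode H S R1 R2 G1 G2
  for H :: "('k::field, 'a::ring) wmb_data" and S R1 R2 G1 G2 +
  assumes left_full: left_full and right_full: right_full
begin

lemma span_total:
  assumes "\<And>\<phi> x. lin1 \<phi> \<Longrightarrow> (\<And>i. \<phi> (g i) = 0) \<Longrightarrow> \<phi> x = 0"
  shows "module.span (scl A) (range g) = UNIV"
proof -
  interpret vs: vector_space "scl A" using alg_vspace unfolding vspace_def by blast
  have "x \<in> vs.span (range g)" for x
  proof (rule subspace_separate[OF alg_vspace vs.subspace_span])
    fix \<phi> assume \<phi>: "is_linear A ground \<phi>" "\<forall>u\<in>vs.span (range g). \<phi> u = 0"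
    show "\<phi> x = 0"
    proof (rule assms)
      show "lin1 \<phi>" using \<phi>(1) by (simp add: lin1_def)
      show "\<phi> (g i) = 0" for i using \<phi>(2) vs.span_base[of "g i" "range g"] by simp
    qed
  qed
  then show ?thesis by blast
qed

lemma sl_span: "module.span (scl A) (range (\<lambda>(b, a). sl b a)) = UNIV"
proof (rule span_total)
  fix \<phi> x assume \<phi>: "lin1 \<phi>" "\<And>i. \<phi> (case i of (b, a) \<Rightarrow> sl b a) = 0"
  show "\<phi> x = 0" by (rule sl_total[OF right_full \<phi>(1)]) (use \<phi>(2)[of "(a, b)" for a b] in simp)
qed

lemma sr_span: "module.span (scl A) (range (\<lambda>(a, b). sr a b)) = UNIV"
proof (rule span_total)
  fix \<phi> x assume \<phi>: "lin1 \<phi>" "\<And>i. \<phi> (case i of (a, b) \<Rightarrow> sr a b) = 0"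
  show "\<phi> x = 0" by (rule sr_total[OF left_full \<phi>(1)]) (use \<phi>(2)[of "(a, b)" for a b] in simp)
qed

lemma eq_on_sr:
  assumes "lin1 \<phi>" "lin1 \<psi>" "\<And>a b. \<phi> (sr a b) = \<psi> (sr a b)"
  shows "\<phi> x = \<psi> x"
  using sr_total[OF left_full, of "\<lambda>x. \<phi> x - \<psi> x" x] assms
  by (simp add: lin1_iff algebra_simps)

lemma eq_on_sl:
  assumes "lin1 \<phi>" "lin1 \<psi>" "\<And>a b. \<phi> (sl a b) = \<psi> (sl a b)"
  shows "\<phi> x = \<psi> x"
  using sl_total[OF right_full, of "\<lambda>x. \<phi> x - \<psi> x" x] assms
  by (simp add: lin1_iff algebra_simps)

lemma sr_faithful:
  assumes "\<And>c d. sr c d * x = 0"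
  shows "x = 0"
proof (rule nondegenerate(2), rule eqI_functional)
  fix b \<phi> assume \<phi>: "lin1 \<phi>"
  note [simp] = lin1_comp[OF \<phi>] \<phi>
  show "\<phi> (b * x) = \<phi> 0"
    by (rule eq_on_sr[where x = b]) (simp_all add: assms lin1_eq_0, simp add: lin1_iff)
qed

lemma sl_faithful:
  assumes "\<And>c d. x * sl c d = 0"
  shows "x = 0"
proof (rule nondegenerate(1), rule eqI_functional)
  fix b \<phi> assume \<phi>: "lin1 \<phi>"
  note [simp] = lin1_comp[OF \<phi>] \<phi>
  show "\<phi> (x * b) = \<phi> 0"
    by (rule eq_on_sl[where x = b]) (simp_all add: assms lin1_eq_0, simp add: lin1_iff)
qed

text \<open>
  For \<open>d' \<otimes> b' = E(d \<otimes> b)\<close> the claim is \<open>(c S(b') \<otimes> c' S(d'))\<Delta>(z) = (c S(b) \<otimes> c' S(d))\<Delta>(z)\<close>. It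
  suffices to consider \<open>z = S(a) x\<close>; there \<open>T1_sl_cover\<close> turns it into \<open>\<Delta>(a) E = \<Delta>(a)\<close>.
\<close>

lemma E1_S_T1:
  assumes \<beta>: "lin2 \<beta>"
  shows "(e1 d b \<rhd> (\<lambda>d' b'. t1 z y \<rhd> (\<lambda>p q. \<beta> (sr c b' * p) (sr c' d' * q)))) =
    (t1 z y \<rhd> (\<lambda>p q. \<beta> (sr c b * p) (sr c' d * q)))"
proof (rule eq_on_sl[where x = z])
  note [simp] = lin2_D[OF \<beta>]
  show "lin1 (\<lambda>z. e1 d b \<rhd> (\<lambda>d' b'. t1 z y \<rhd> (\<lambda>p q. \<beta> (sr c b' * p) (sr c' d' * q))))" by simp
  show "lin1 (\<lambda>z. t1 z y \<rhd> (\<lambda>p q. \<beta> (sr c b * p) (sr c' d * q)))" by simp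
  fix a x
  have "(e1 d b \<rhd> (\<lambda>d' b'. t1 (sl a x) y \<rhd> (\<lambda>p q. \<beta> (sr c b' * p) (sr c' d' * q)))) =
      (e1 d b \<rhd> (\<lambda>d' b'. t1 x y \<rhd> (\<lambda>p q. t1 a b' \<rhd> (\<lambda>u v. \<beta> (sr c v * p) (sr c' (u * d') * q)))))"
    by (simp only: T1_sl_cover[OF \<beta>])
  also have "\<dots> = (t1 x y \<rhd> (\<lambda>p q. e1 d b \<rhd> (\<lambda>d' b'. t1 a b' \<rhd> (\<lambda>u v. \<beta> (sr c v * p) (sr c' (u * d') * q)))))"
    by (rule ev_swap)
  also have "\<dots> = (t1 x y \<rhd> (\<lambda>p q. t1 a b \<rhd> (\<lambda>u v. \<beta> (sr c v * p) (sr c' (u * d) * q))))"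
    by (intro ev_cong[OF refl] comult_E1[rule_format]) simp
  also have "\<dots> = (t1 (sl a x) y \<rhd> (\<lambda>p q. \<beta> (sr c b * p) (sr c' d * q)))"
    by (rule T1_sl_cover[OF \<beta>, symmetric])
  finally show "(e1 d b \<rhd> (\<lambda>d' b'. t1 (sl a x) y \<rhd> (\<lambda>p q. \<beta> (sr c b' * p) (sr c' d' * q)))) =
    (t1 (sl a x) y \<rhd> (\<lambda>p q. \<beta> (sr c b * p) (sr c' d * q)))" .
qed

lemma separating_sr: "separating (\<lambda>(c, d) y. sr c d * y)"
  unfolding separating_iff
proof (intro conjI allI impI)
  show "linop (case i of (c, d) \<Rightarrow> \<lambda>y. sr c d * y)" for i
    by (cases i) (simp add: linop_mult_id)
  fix x assume "\<forall>i. (case i of (c, d) \<Rightarrow> \<lambda>y. sr c d * y) x = 0"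
  then have "sr c d * x = 0" for c d by (auto dest: spec[of _ "(c, d)"])
  then show "x = 0" by (rule sr_faithful)
qed

lemma separating_sl: "separating (\<lambda>(c, d) y. y * sl c d)"
  unfolding separating_iff
proof (intro conjI allI impI)
  show "linop (case i of (c, d) \<Rightarrow> \<lambda>y. y * sl c d)" for i
    by (cases i) (simp add: linop_mult_id)
  fix x assume "\<forall>i. (case i of (c, d) \<Rightarrow> \<lambda>y. y * sl c d) x = 0"
  then have "x * sl c d = 0" for c d by (auto dest: spec[of _ "(c, d)"])
  then show "x = 0" by (rule sl_faithful)
qed

text \<open>Separating families remain separating on \<open>V \<otimes> A\<close>.\<close>

lemma leg_faithful:
  fixes V :: "('k, 'v::ab_group_add) space"
  assumes V: "vspace V" and n: "separating n"
    and s: "s \<in> pts (V \<odot> A)" and t: "t \<in> pts (V \<odot> A)"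
    and eq: "\<And>j. tmap V A V A (\<lambda>w. w) (n j) s = tmap V A V A (\<lambda>w. w) (n j) t"
  shows "s = t"
proof (rule tensor_eqI[OF s t])
  fix \<beta> assume \<beta>: "is_bilinear V A ground \<beta>"
  have op: "is_linear A A (n j)" for j using n by (simp add: separating_iff linop_def)
  have "tlist V A s \<rhd> (\<lambda>w z. \<beta> w z * 1) = tlist V A t \<rhd> (\<lambda>w z. \<beta> w z * 1)"
  proof (rule cancel_middle[OF V alg_vspace vspace_ground n, where F = "\<lambda>h. tlist V A s \<rhd> (\<lambda>w z. h w z 1)"
        and G = "\<lambda>h. tlist V A t \<rhd> (\<lambda>w z. h w z 1)" and h = "\<lambda>w z c. \<beta> w z * c"])
    show "finite_sum V A ground (\<lambda>h. tlist V A s \<rhd> (\<lambda>w z. h w z 1))"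
      "finite_sum V A ground (\<lambda>h. tlist V A t \<rhd> (\<lambda>w z. h w z 1))"
      by (intro finite_sum_intros; use tlist_mem[OF V s] tlist_mem[OF V t] in simp)+
    show "is_trilinear V A ground (\<lambda>w z c. \<beta> w z * c)"
      using \<beta> by (simp add: is_bilinear_def is_trilinear_def is_linear_def algebra_simps)
    fix j h assume h: "is_trilinear V A ground h"
    have b: "is_bilinear V A ground (\<lambda>w z. h w z 1)"
      using h by (simp add: is_bilinear_def is_trilinear_def)
    show "tlist V A s \<rhd> (\<lambda>w z. h w (n j z) 1) = tlist V A t \<rhd> (\<lambda>w z. h w (n j z) 1)"
      using eval_ext[OF eq[of j], of "\<lambda>w z. h w z 1"]
      by (simp add: tmap_eval[OF V V is_linear_id op s b] tmap_eval[OF V V is_linear_id op t b])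
  qed
  then show "s \<beta> = t \<beta>" by (simp add: tensor_eval[OF V s \<beta>] tensor_eval[OF V t \<beta>])
qed

lemma swap_tmap:
  fixes V :: "('k, 'v::ab_group_add) space"
  assumes V: "vspace V" and F: "F \<in> Lin (A \<odot> V) (A \<odot> V)" and f: "linop f" and v: "v \<in> pts V"
  shows "tmap V A V A (\<lambda>w. w) f (swap21 A V F (v \<otimes>\<^bsub>V,A\<^esub> b)) =
    tlist A V (F (b \<otimes>\<^bsub>A,V\<^esub> v)) \<rhd> (\<lambda>u w. w \<otimes>\<^bsub>V,A\<^esub> f u)"
proof -
  note t = tmap[OF is_linear_id[of V] f[unfolded linop_def]]
  note l = is_linear_comp[OF LinD[OF flip(1)] LinD[OF t(1)]]
  have cl: "F (b \<otimes>\<^bsub>A,V\<^esub> v) \<in> pts (A \<odot> V)" using Lin_pure_closed[OF F, of b v] v by simp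
  have "tmap V A V A (\<lambda>w. w) f (swap21 A V F (v \<otimes>\<^bsub>V,A\<^esub> b)) =
      tmap V A V A (\<lambda>w. w) f (flip A V (F (b \<otimes>\<^bsub>A,V\<^esub> v)))"
    using v by (simp add: swap21_def flip(2))
  also have "\<dots> = tlist A V (F (b \<otimes>\<^bsub>A,V\<^esub> v)) \<rhd> (\<lambda>u w. w \<otimes>\<^bsub>V,A\<^esub> f u)"
    unfolding tlist_linear[OF alg_vspace l cl]
    by (rule ev_cong[OF refl]) (simp add: flip(2) t(2) tlist_mem[OF alg_vspace cl])
  finally show ?thesis .
qed

end

locale comodule_over_antipode = full_antipode H S R1 R2 G1 G2
  for H :: "('k::field, 'a::ring) wmb_data" and S R1 R2 G1 G2 +
  fixes V :: "('k, 'v::ab_group_add) space" and lam rho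
  assumes comodule: "left_comodule V lam rho"
begin

lemma V [simp]: "vspace V" and lam: "lam \<in> Lin (A \<odot> V) (A \<odot> V)" and rho: "rho \<in> Lin (A \<odot> V) (A \<odot> V)"
  using comodule by (simp_all add: left_comodule_def)

abbreviation pureAV (infixl \<open>\<otimes>\<^sub>V\<close> 70) where "a \<otimes>\<^sub>V v \<equiv> a \<otimes>\<^bsub>A,V\<^esub> v"
abbreviation pureVA (infixl \<open>\<otimes>\<^sub>A\<close> 70) where "v \<otimes>\<^sub>A a \<equiv> v \<otimes>\<^bsub>V,A\<^esub> a"

text \<open>Sums for \<open>\<lambda>(a \<otimes> v)\<close> and \<open>\<rho>(a \<otimes> v)\<close>, the first leg in \<open>A\<close> and the second one in \<open>V\<close>.\<close>

definition lv :: "'a \<Rightarrow> 'v \<Rightarrow> ('a \<times> 'v) list" where "lv a v = tlist A V (lam (a \<otimes>\<^sub>V v))"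

definition rv :: "'a \<Rightarrow> 'v \<Rightarrow> ('a \<times> 'v) list" where "rv a v = tlist A V (rho (a \<otimes>\<^sub>V v))"

lemma lam_closed: "v \<in> pts V \<Longrightarrow> lam (a \<otimes>\<^sub>V v) \<in> pts (A \<odot> V)"
  by (rule Lin_pure_closed[OF lam]) simp_all

lemma rho_closed: "v \<in> pts V \<Longrightarrow> rho (a \<otimes>\<^sub>V v) \<in> pts (A \<odot> V)"
  by (rule Lin_pure_closed[OF rho]) simp_all

lemma lv_mem: "v \<in> pts V \<Longrightarrow> (u, w) \<in> set (lv a v) \<Longrightarrow> w \<in> pts V"
  unfolding lv_def by (rule tlist_mem(2)[OF alg_vspace lam_closed])

lemma rv_mem: "v \<in> pts V \<Longrightarrow> (u, w) \<in> set (rv a v) \<Longrightarrow> w \<in> pts V"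
  unfolding rv_def by (rule tlist_mem(2)[OF alg_vspace rho_closed])

lemma lam_rho:
  assumes v: "v \<in> pts V" and h: "is_bilinear A V ground h"
  shows "lv b v \<rhd> (\<lambda>u w. h (a * u) w) = rv a v \<rhd> (\<lambda>u w. h (u * b) w)"
proof -
  have "tmap A V A V ((*) a) (\<lambda>x. x) (lam (b \<otimes>\<^sub>V v)) h = tmap A V A V (\<lambda>y. y * b) (\<lambda>x. x) (rho (a \<otimes>\<^sub>V v)) h"
    using comodule v by (simp add: left_comodule_def)
  moreover have "is_linear A A ((*) a)" "is_linear A A (\<lambda>y. y * b)"
    by (simp_all flip: linop_def)
  ultimately show ?thesis
    unfolding lv_def rv_def
    by (simp add: tmap_eval[OF alg_vspace alg_vspace _ is_linear_id _ h] lam_closed[OF v] rho_closed[OF v])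
qed

lemma bilinear_leg:
  assumes "is_bilinear A V ground h" "linop f"
  shows "is_bilinear A V ground (\<lambda>u w. h (f u) w)"
  unfolding is_bilinear_def
proof (intro conjI ballI)
  show "is_linear V ground (h (f u))" for u using assms(1) by (simp add: is_bilinear_def)
  show "is_linear A ground (\<lambda>u. h (f u) w)" if w: "w \<in> pts V" for w
    by (rule is_linear_comp[OF assms(2)[unfolded linop_def]])
      (use assms(1) w in \<open>simp add: is_bilinear_def\<close>)
qed

text \<open>Right \<open>A\<close>-linearity of \<open>\<lambda>\<close>, forced by its compatibility with \<open>\<rho>\<close> and non-degeneracy.\<close>

lemma lam_mult:
  assumes v: "v \<in> pts V" and h: "is_bilinear A V ground h"
  shows "lv (a * b) v \<rhd> h = lv a v \<rhd> (\<lambda>u w. h (u * b) w)"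
proof -
  have "(\<lambda>h. lv (a * b) v \<rhd> (\<lambda>u w. h 1 u w)) (\<lambda>c u w. c * h u w) =
      (\<lambda>h. lv a v \<rhd> (\<lambda>u w. h 1 (u * b) w)) (\<lambda>c u w. c * h u w)"
  proof (rule cancel_middle[OF vspace_ground alg_vspace V separating_left,
        where F = "\<lambda>h. lv (a * b) v \<rhd> (\<lambda>u w. h 1 u w)" and G = "\<lambda>h. lv a v \<rhd> (\<lambda>u w. h 1 (u * b) w)"])
    show "finite_sum ground A V (\<lambda>h. lv (a * b) v \<rhd> (\<lambda>u w. h 1 u w))"
      "finite_sum ground A V (\<lambda>h. lv a v \<rhd> (\<lambda>u w. h 1 (u * b) w))"
      by (intro finite_sum_intros; use lv_mem[OF v] in simp)+
    show "is_trilinear ground A V (\<lambda>c u w. c * h u w)"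
      using h by (simp add: is_bilinear_def is_trilinear_def is_linear_def algebra_simps)
    fix c h assume h: "is_trilinear ground A V h"
    have b: "is_bilinear A V ground (h 1)"
      using h by (simp add: is_bilinear_def is_trilinear_def)
    show "lv (a * b) v \<rhd> (\<lambda>u w. h 1 (c * u) w) = lv a v \<rhd> (\<lambda>u w. h 1 (c * (u * b)) w)"
      using lam_rho[OF v b, of "a * b" c] lam_rho[OF v bilinear_leg[OF b linop_mult_id(2)[of b]], of a c]
      by (simp add: mult.assoc)
  qed
  then show ?thesis by simp
qed

lemma pure3_closed: "v \<in> pts V \<Longrightarrow> (a \<otimes> b) \<otimes>\<^bsub>A \<odot> A,V\<^esub> v \<in> pts (A \<odot> A \<odot> V)"
  by (intro pure_in_tensor_space) simp_all

lemma lam_E1: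
  assumes v: "v \<in> pts V" and G: "is_trilinear A A V G"
  shows "e1 d b \<rhd> (\<lambda>d' b'. lv d' v \<rhd> (\<lambda>u w. lv b' w \<rhd> (\<lambda>u' w'. G u u' w'))) =
    lv d v \<rhd> (\<lambda>u w. lv b w \<rhd> (\<lambda>u' w'. G u u' w'))"
proof -
  note va = alg_vspace
  note G1 = is_trilinear_leg23[OF va va V lam G]
  note G2 = is_trilinear_leg13[OF va va V lam G1]
  note G3 = is_trilinear_leg12[OF va va V linear_maps(1) G2]
  note u = pure3_closed[OF v, of d b]
  note c = leg_closed(1)[OF va linear_maps(1) u]
  have "leg23 A A V lam (leg13 A A V lam (leg12 A A V (E1 H) ((d \<otimes> b) \<otimes>\<^bsub>A \<odot> A,V\<^esub> v))) =
      leg23 A A V lam (leg13 A A V lam ((d \<otimes> b) \<otimes>\<^bsub>A \<odot> A,V\<^esub> v))"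
    using comodule u by (simp add: left_comodule_def)
  from arg_cong[OF this, of "\<lambda>t. eval3 t G"] show ?thesis
    using eval3_leg23[OF va va V lam G leg_closed(3)[OF va va V lam c(1)]]
      eval3_leg13[OF va va V lam G1 c(1)] eval3_leg12[OF va va V linear_maps(1) G2 u]
      eval3_leg23[OF va va V lam G leg_closed(3)[OF va va V lam u]]
      eval3_leg13[OF va va V lam G1 u]
      eval3_pure[OF va V G3, of d b v] eval3_pure[OF va V G2, of d b v] v
    by (simp add: lv_def sw_def)
qed

lemma lam_T1:
  assumes v: "v \<in> pts V" and G: "is_trilinear A A V G"
  shows "t1 d b \<rhd> (\<lambda>d' b'. lv d' v \<rhd> (\<lambda>u w. lv b' w \<rhd> (\<lambda>u' w'. G u u' w'))) =
    lv d v \<rhd> (\<lambda>u w. t1 u b \<rhd> (\<lambda>p q. G p q w))"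
proof -
  note va = alg_vspace
  note G1 = is_trilinear_leg23[OF va va V lam G]
  note G2 = is_trilinear_leg13[OF va va V lam G1]
  note G3 = is_trilinear_leg12[OF va va V linear_maps(3) G2]
  note G4 = is_trilinear_leg12[OF va va V linear_maps(3) G]
  note G5 = is_trilinear_leg13[OF va va V lam G4]
  note u = pure3_closed[OF v, of d b]
  note c = leg_closed(1)[OF va linear_maps(3) u] leg_closed(3)[OF va va V lam u]
  have "leg23 A A V lam (leg13 A A V lam (leg12 A A V (T1 H) ((d \<otimes> b) \<otimes>\<^bsub>A \<odot> A,V\<^esub> v))) =
      leg12 A A V (T1 H) (leg13 A A V lam ((d \<otimes> b) \<otimes>\<^bsub>A \<odot> A,V\<^esub> v))"
    using comodule u by (simp add: left_comodule_def)
  from arg_cong[OF this, of "\<lambda>t. eval3 t G"] show ?thesis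
    using eval3_leg23[OF va va V lam G leg_closed(3)[OF va va V lam c(1)]]
      eval3_leg13[OF va va V lam G1 c(1)] eval3_leg12[OF va va V linear_maps(3) G2 u]
      eval3_leg12[OF va va V linear_maps(3) G c(2)] eval3_leg13[OF va va V lam G4 u]
      eval3_pure[OF va V G3, of d b v] eval3_pure[OF va V G5, of d b v] v
    by (simp add: lv_def sw_def)
qed

lemma eval_ev_pure:
  "is_bilinear V A ground \<beta> \<Longrightarrow> (xs \<rhd> (\<lambda>u w. w \<otimes>\<^sub>A f u)) \<beta> = xs \<rhd> (\<lambda>u w. \<beta> w (f u))"
  by (simp add: ev_apply pure_def)

lemma pure_bilinear_leg:
  assumes "linop f"
  shows "is_bilinear A V (V \<odot> A) (\<lambda>u w. w \<otimes>\<^sub>A f u)"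
  unfolding is_bilinear_def
proof (intro conjI ballI)
  show "is_linear V (V \<odot> A) (\<lambda>w. w \<otimes>\<^sub>A f u)" for u by (rule is_linear_pure1) simp
  show "is_linear A (V \<odot> A) (\<lambda>u. w \<otimes>\<^sub>A f u)" if "w \<in> pts V" for w
    by (rule is_linear_comp[OF assms[unfolded linop_def] is_linear_pure2[OF that]])
qed

lemma tmap_ev:
  assumes f: "linop f" and g: "linop g" and xs: "\<And>u w. (u, w) \<in> set xs \<Longrightarrow> w \<in> pts V"
  shows "tmap V A V A (\<lambda>w. w) f (xs \<rhd> (\<lambda>u w. w \<otimes>\<^sub>A g u)) = xs \<rhd> (\<lambda>u w. w \<otimes>\<^sub>A f (g u))"
proof -
  note t = tmap[OF is_linear_id[of V] f[unfolded linop_def]]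
  have "tmap V A V A (\<lambda>w. w) f (xs \<rhd> (\<lambda>u w. w \<otimes>\<^sub>A g u)) =
      xs \<rhd> (\<lambda>u w. tmap V A V A (\<lambda>w. w) f (w \<otimes>\<^sub>A g u))"
    by (rule ev_linear[OF vspace_tensor_space LinD[OF t(1)]]) (simp add: pure_in_tensor_space xs)
  also have "\<dots> = xs \<rhd> (\<lambda>u w. w \<otimes>\<^sub>A f (g u))"
    by (rule ev_cong[OF refl]) (simp add: t(2) xs)
  finally show ?thesis .
qed

lemma ev_pure_closed:
  "(\<And>u w. (u, w) \<in> set xs \<Longrightarrow> w \<in> pts V) \<Longrightarrow> (xs \<rhd> (\<lambda>u w. w \<otimes>\<^sub>A f u)) \<in> pts (V \<odot> A)"
  by (rule ev_closed) (simp_all add: pure_in_tensor_space)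

lemma bilinear_of_lv:
  assumes f: "\<And>x. linop (f x)" and f': "\<And>u. linop (\<lambda>x. f x u)"
  shows "is_bilinear V A (V \<odot> A) (\<lambda>v x. lv d v \<rhd> (\<lambda>u w. w \<otimes>\<^sub>A f x u))"
    "is_bilinear V A (V \<odot> A) (\<lambda>v x. rv d v \<rhd> (\<lambda>u w. w \<otimes>\<^sub>A f x u))"
proof -
  have l: "is_linear A (V \<odot> A) (\<lambda>x. w \<otimes>\<^sub>A f x u)" if "w \<in> pts V" for u w
    by (rule is_linear_comp[OF f'[unfolded linop_def] is_linear_pure2[OF that]])
  show "is_bilinear V A (V \<odot> A) (\<lambda>v x. lv d v \<rhd> (\<lambda>u w. w \<otimes>\<^sub>A f x u))"
    unfolding is_bilinear_def lv_def
  proof (intro conjI ballI)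
    fix v assume v: "v \<in> pts V"
    show "is_linear A (V \<odot> A) (\<lambda>x. tlist A V (lam (d \<otimes>\<^sub>V v)) \<rhd> (\<lambda>u w. w \<otimes>\<^sub>A f x u))"
      by (rule is_linear_tlist[OF alg_vspace alg_vspace vspace_tensor_space lam_closed[OF v] l])
  next
    fix x
    show "is_linear V (V \<odot> A) (\<lambda>v. tlist A V (lam (d \<otimes>\<^sub>V v)) \<rhd> (\<lambda>u w. w \<otimes>\<^sub>A f x u))"
      by (rule is_linear_tlist_pure(1)[OF alg_vspace V alg_vspace vspace_tensor_space lam
            pure_bilinear_leg[OF f]]) simp
  qed
  show "is_bilinear V A (V \<odot> A) (\<lambda>v x. rv d v \<rhd> (\<lambda>u w. w \<otimes>\<^sub>A f x u))"
    unfolding is_bilinear_def rv_def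
  proof (intro conjI ballI)
    fix v assume v: "v \<in> pts V"
    show "is_linear A (V \<odot> A) (\<lambda>x. tlist A V (rho (d \<otimes>\<^sub>V v)) \<rhd> (\<lambda>u w. w \<otimes>\<^sub>A f x u))"
      by (rule is_linear_tlist[OF alg_vspace alg_vspace vspace_tensor_space rho_closed[OF v] l])
  next
    fix x
    show "is_linear V (V \<odot> A) (\<lambda>v. tlist A V (rho (d \<otimes>\<^sub>V v)) \<rhd> (\<lambda>u w. w \<otimes>\<^sub>A f x u))"
      by (rule is_linear_tlist_pure(1)[OF alg_vspace V alg_vspace vspace_tensor_space rho
            pure_bilinear_leg[OF f]]) simp
  qed
qed

text \<open>
  The computation behind well-definedness of \<open>\<lambda>\<^sup>S\<close> and \<open>\<rho>\<^sup>S\<close>. Both sides come from applying the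
  antipode to the first leg of \<open>(b \<otimes> 1) \<lambda>(d \<otimes> v) = \<rho>(b \<otimes> v) (d \<otimes> 1)\<close>, which it turns around.
\<close>

lemma S_lam_rho:
  assumes v: "v \<in> pts V" and \<beta>: "is_bilinear V A ground \<beta>"
  shows "rv b v \<rhd> (\<lambda>u w. \<beta> w (sr c d * sl u a)) = lv d v \<rhd> (\<lambda>u w. \<beta> w (sr c u * sl b a))"
proof -
  have op: "linop (\<lambda>u. c * sl u a)" by simp
  have "is_bilinear A V ground (\<lambda>u w. \<beta> w u)"
    using \<beta> by (simp add: is_bilinear_def)
  from bilinear_leg[OF this op] have "is_bilinear A V ground (\<lambda>u w. \<beta> w (c * sl u a))" .
  from lam_rho[OF v this, of d b] show ?thesis
    by (simp add: sl_antimult sr_sl)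
qed

lemma tmap_mult_linear:
  "is_linear (V \<odot> A) (V \<odot> A) (tmap V A V A (\<lambda>w. w) ((*) a))"
  "is_linear (V \<odot> A) (V \<odot> A) (tmap V A V A (\<lambda>w. w) (\<lambda>y. y * a))"
  by (rule LinD[OF tmap_Lin[OF is_linear_id linop_mult_id(1)[unfolded linop_def]]]
      LinD[OF tmap_Lin[OF is_linear_id linop_mult_id(2)[unfolded linop_def]]])+

text \<open>
  \<open>\<lambda>\<^sup>S\<close> is obtained from \<open>extend_from_spanning\<close> with the spanning elements \<open>S(b) a\<close> and the tests
  \<open>1 \<otimes> c S(d)\<close>. By \<open>S_lam_rho\<close> the tests turn the prescription at \<open>x = S(b) a\<close> into \<open>w \<otimes> c S(u) x\<close>
  for \<open>u \<otimes> w = \<lambda>(d \<otimes> v)\<close>, which is bilinear in \<open>v\<close> and \<open>x\<close>.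
\<close>

lemma lamS_exists:
  "\<exists>L. is_lamS S V rho L \<and> (\<forall>v\<in>pts V. \<forall>x c d. tmap V A V A (\<lambda>w. w) (\<lambda>y. sr c d * y) (L (v \<otimes>\<^sub>A x)) =
    (lv d v \<rhd> (\<lambda>u w. w \<otimes>\<^sub>A (sr c u * x))))"
proof -
  have "\<exists>L\<in>Lin (V \<odot> A) (V \<odot> A).
      (\<forall>v\<in>pts V. \<forall>i. L (v \<otimes>\<^sub>A (\<lambda>(b, a). sl b a) i) = (\<lambda>v (b, a). rv b v \<rhd> (\<lambda>u w. w \<otimes>\<^sub>A sl u a)) v i) \<and>
      (\<forall>v\<in>pts V. \<forall>x j. (\<lambda>(c, d). tmap V A V A (\<lambda>w. w) (\<lambda>y. sr c d * y)) j (L (v \<otimes>\<^sub>A x)) =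
        (\<lambda>(c, d) v x. lv d v \<rhd> (\<lambda>u w. w \<otimes>\<^sub>A (sr c u * x))) j v x)"
  proof (rule extend_from_spanning[OF V alg_vspace alg_pts vspace_tensor_space sl_span])
    show "is_linear (V \<odot> A) (V \<odot> A) (case j of (c, d) \<Rightarrow> tmap V A V A (\<lambda>w. w) (\<lambda>y. sr c d * y))" for j
      by (cases j) (simp add: tmap_mult_linear)
    show "s = t" if st: "s \<in> pts (V \<odot> A)" "t \<in> pts (V \<odot> A)"
      and eq: "\<And>j. (case j of (c, d) \<Rightarrow> tmap V A V A (\<lambda>w. w) (\<lambda>y. sr c d * y)) s =
        (case j of (c, d) \<Rightarrow> tmap V A V A (\<lambda>w. w) (\<lambda>y. sr c d * y)) t" for s t
    proof (rule leg_faithful[OF V separating_sr st])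
      fix j show "tmap V A V A (\<lambda>w. w) (case j of (c, d) \<Rightarrow> \<lambda>y. sr c d * y) s =
          tmap V A V A (\<lambda>w. w) (case j of (c, d) \<Rightarrow> \<lambda>y. sr c d * y) t"
        using eq[of j] by (cases j) simp
    qed
    show "is_bilinear V A (V \<odot> A) (case j of (c, d) \<Rightarrow> \<lambda>v x. lv d v \<rhd> (\<lambda>u w. w \<otimes>\<^sub>A (sr c u * x)))" for j
      using bilinear_of_lv(1)[of "\<lambda>x u. sr (fst j) u * x" "snd j"] by (cases j) simp
    fix v and i :: "'a \<times> 'a" assume v: "v \<in> pts V"
    obtain b a where i: "i = (b, a)" by (cases i)
    show "(case i of (b, a) \<Rightarrow> rv b v \<rhd> (\<lambda>u w. w \<otimes>\<^sub>A sl u a)) \<in> pts (V \<odot> A)"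
      unfolding i by (simp add: ev_pure_closed rv_mem[OF v])
    fix j :: "'a \<times> 'a"
    obtain c d where j: "j = (c, d)" by (cases j)
    have "tmap V A V A (\<lambda>w. w) ((*) (sr c d)) (rv b v \<rhd> (\<lambda>u w. w \<otimes>\<^sub>A sl u a)) =
        (rv b v \<rhd> (\<lambda>u w. w \<otimes>\<^sub>A (sr c d * sl u a)))"
      by (rule tmap_ev) (simp_all add: rv_mem[OF v])
    also have "\<dots> = (lv d v \<rhd> (\<lambda>u w. w \<otimes>\<^sub>A (sr c u * sl b a)))"
    proof (rule tensor_eqI)
      show "(rv b v \<rhd> (\<lambda>u w. w \<otimes>\<^sub>A (sr c d * sl u a))) \<in> pts (V \<odot> A)"
        "(lv d v \<rhd> (\<lambda>u w. w \<otimes>\<^sub>A (sr c u * sl b a))) \<in> pts (V \<odot> A)"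
        by (simp_all add: ev_pure_closed rv_mem[OF v] lv_mem[OF v])
      fix \<beta> assume \<beta>: "is_bilinear V A ground \<beta>"
      show "(rv b v \<rhd> (\<lambda>u w. w \<otimes>\<^sub>A (sr c d * sl u a))) \<beta> = (lv d v \<rhd> (\<lambda>u w. w \<otimes>\<^sub>A (sr c u * sl b a))) \<beta>"
        by (simp only: eval_ev_pure[OF \<beta>] S_lam_rho[OF v \<beta>])
    qed
    finally show "(case j of (c, d) \<Rightarrow> tmap V A V A (\<lambda>w. w) (\<lambda>y. sr c d * y))
        (case i of (b, a) \<Rightarrow> rv b v \<rhd> (\<lambda>u w. w \<otimes>\<^sub>A sl u a)) =
      (case j of (c, d) \<Rightarrow> \<lambda>v x. lv d v \<rhd> (\<lambda>u w. w \<otimes>\<^sub>A (sr c u * x))) v (case i of (b, a) \<Rightarrow> sl b a)"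
      unfolding i j by simp
  qed
  then obtain L where L: "L \<in> Lin (V \<odot> A) (V \<odot> A)"
    "\<And>v b a. v \<in> pts V \<Longrightarrow> L (v \<otimes>\<^sub>A sl b a) = (rv b v \<rhd> (\<lambda>u w. w \<otimes>\<^sub>A sl u a))"
    "\<And>v x c d. v \<in> pts V \<Longrightarrow> tmap V A V A (\<lambda>w. w) (\<lambda>y. sr c d * y) (L (v \<otimes>\<^sub>A x)) =
      (lv d v \<rhd> (\<lambda>u w. w \<otimes>\<^sub>A (sr c u * x)))"
    by auto
  have "is_lamS S V rho L"
    unfolding is_lamS_def sl_def[symmetric]
    using L(1,2) swap_tmap[OF V rho linop_S(2)] by (simp add: rv_def)
  with L(3) show ?thesis by blast
qed

text \<open>
  Here the spanning elements are \<open>c S(d)\<close>, and the tests are multiplications by \<open>S(b) a\<close> from the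
  right.
\<close>

lemma rhoS_exists: "\<exists>R. is_rhoS S V lam R"
proof -
  have "\<exists>L\<in>Lin (V \<odot> A) (V \<odot> A).
      (\<forall>v\<in>pts V. \<forall>i. L (v \<otimes>\<^sub>A (\<lambda>(c, d). sr c d) i) = (\<lambda>v (c, d). lv d v \<rhd> (\<lambda>u w. w \<otimes>\<^sub>A sr c u)) v i) \<and>
      (\<forall>v\<in>pts V. \<forall>x j. (\<lambda>(b, a). tmap V A V A (\<lambda>w. w) (\<lambda>y. y * sl b a)) j (L (v \<otimes>\<^sub>A x)) =
        (\<lambda>(b, a) v x. rv b v \<rhd> (\<lambda>u w. w \<otimes>\<^sub>A (x * sl u a))) j v x)"
  proof (rule extend_from_spanning[OF V alg_vspace alg_pts vspace_tensor_space sr_span])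
    show "is_linear (V \<odot> A) (V \<odot> A) (case j of (b, a) \<Rightarrow> tmap V A V A (\<lambda>w. w) (\<lambda>y. y * sl b a))" for j
      by (cases j) (simp add: tmap_mult_linear)
    show "s = t" if st: "s \<in> pts (V \<odot> A)" "t \<in> pts (V \<odot> A)"
      and eq: "\<And>j. (case j of (b, a) \<Rightarrow> tmap V A V A (\<lambda>w. w) (\<lambda>y. y * sl b a)) s =
        (case j of (b, a) \<Rightarrow> tmap V A V A (\<lambda>w. w) (\<lambda>y. y * sl b a)) t" for s t
    proof (rule leg_faithful[OF V separating_sl st])
      fix j show "tmap V A V A (\<lambda>w. w) (case j of (c, d) \<Rightarrow> \<lambda>y. y * sl c d) s =
          tmap V A V A (\<lambda>w. w) (case j of (c, d) \<Rightarrow> \<lambda>y. y * sl c d) t"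
        using eq[of j] by (cases j) simp
    qed
    show "is_bilinear V A (V \<odot> A) (case j of (b, a) \<Rightarrow> \<lambda>v x. rv b v \<rhd> (\<lambda>u w. w \<otimes>\<^sub>A (x * sl u a)))" for j
      using bilinear_of_lv(2)[of "\<lambda>x u. x * sl u (snd j)" "fst j"] by (cases j) simp
    fix v and i :: "'a \<times> 'a" assume v: "v \<in> pts V"
    obtain c d where i: "i = (c, d)" by (cases i)
    show "(case i of (c, d) \<Rightarrow> lv d v \<rhd> (\<lambda>u w. w \<otimes>\<^sub>A sr c u)) \<in> pts (V \<odot> A)"
      unfolding i by (simp add: ev_pure_closed lv_mem[OF v])
    fix j :: "'a \<times> 'a"
    obtain b a where j: "j = (b, a)" by (cases j)
    have "tmap V A V A (\<lambda>w. w) (\<lambda>y. y * sl b a) (lv d v \<rhd> (\<lambda>u w. w \<otimes>\<^sub>A sr c u)) =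
        (lv d v \<rhd> (\<lambda>u w. w \<otimes>\<^sub>A (sr c u * sl b a)))"
      by (rule tmap_ev) (simp_all add: lv_mem[OF v])
    also have "\<dots> = (rv b v \<rhd> (\<lambda>u w. w \<otimes>\<^sub>A (sr c d * sl u a)))"
    proof (rule tensor_eqI)
      show "(rv b v \<rhd> (\<lambda>u w. w \<otimes>\<^sub>A (sr c d * sl u a))) \<in> pts (V \<odot> A)"
        "(lv d v \<rhd> (\<lambda>u w. w \<otimes>\<^sub>A (sr c u * sl b a))) \<in> pts (V \<odot> A)"
        by (simp_all add: ev_pure_closed rv_mem[OF v] lv_mem[OF v])
      fix \<beta> assume \<beta>: "is_bilinear V A ground \<beta>"
      show "(lv d v \<rhd> (\<lambda>u w. w \<otimes>\<^sub>A (sr c u * sl b a))) \<beta> = (rv b v \<rhd> (\<lambda>u w. w \<otimes>\<^sub>A (sr c d * sl u a))) \<beta>"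
        by (simp only: eval_ev_pure[OF \<beta>] S_lam_rho[OF v \<beta>])
    qed
    finally show "(case j of (b, a) \<Rightarrow> tmap V A V A (\<lambda>w. w) (\<lambda>y. y * sl b a))
        (case i of (c, d) \<Rightarrow> lv d v \<rhd> (\<lambda>u w. w \<otimes>\<^sub>A sr c u)) =
      (case j of (b, a) \<Rightarrow> \<lambda>v x. rv b v \<rhd> (\<lambda>u w. w \<otimes>\<^sub>A (x * sl u a))) v (case i of (c, d) \<Rightarrow> sr c d)"
      unfolding i j by simp
  qed
  then obtain R where R: "R \<in> Lin (V \<odot> A) (V \<odot> A)"
    "\<And>v c d. v \<in> pts V \<Longrightarrow> R (v \<otimes>\<^sub>A sr c d) = (lv d v \<rhd> (\<lambda>u w. w \<otimes>\<^sub>A sr c u))"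
    by auto
  have "is_rhoS S V lam R"
    unfolding is_rhoS_def sr_def[symmetric]
    using R swap_tmap[OF V lam linop_S(3)] by (simp add: lv_def)
  then show ?thesis by blast
qed

lemma is_lamS_unique: "is_lamS S V rho L \<Longrightarrow> is_lamS S V rho L' \<Longrightarrow> L = L'"
  by (rule Lin_unique_on_spanning[OF V alg_vspace alg_pts sl_span])
    (auto simp: is_lamS_def sl_def)

lemma is_rhoS_unique: "is_rhoS S V lam R \<Longrightarrow> is_rhoS S V lam R' \<Longrightarrow> R = R'"
  by (rule Lin_unique_on_spanning[OF V alg_vspace alg_pts sr_span])
    (auto simp: is_rhoS_def sr_def)

lemma ex1_lamS: "\<exists>!L. is_lamS S V rho L" and ex1_rhoS: "\<exists>!R. is_rhoS S V lam R"
  using lamS_exists rhoS_exists is_lamS_unique is_rhoS_unique by blast+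

abbreviation "L \<equiv> lamS S V rho"
abbreviation "R \<equiv> rhoS S V lam"

lemma lamS: "is_lamS S V rho L" and rhoS: "is_rhoS S V lam R"
  unfolding lamS_def rhoS_def by (rule theI'[OF ex1_lamS] theI'[OF ex1_rhoS])+

lemma L_Lin: "L \<in> Lin (V \<odot> A) (V \<odot> A)" and R_Lin: "R \<in> Lin (V \<odot> A) (V \<odot> A)"
  using lamS rhoS by (simp_all add: is_lamS_def is_rhoS_def)

lemma L_test:
  assumes "v \<in> pts V"
  shows "tmap V A V A (\<lambda>w. w) (\<lambda>y. sr c d * y) (L (v \<otimes>\<^sub>A x)) = (lv d v \<rhd> (\<lambda>u w. w \<otimes>\<^sub>A (sr c u * x)))"
  using lamS_exists is_lamS_unique[OF lamS] assms by blast

lemma R_sr: "v \<in> pts V \<Longrightarrow> R (v \<otimes>\<^sub>A sr c d) = (lv d v \<rhd> (\<lambda>u w. w \<otimes>\<^sub>A sr c u))"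
  using rhoS swap_tmap[OF V lam linop_S(3)]
  unfolding is_rhoS_def sr_def[symmetric] by (simp add: lv_def)

text \<open>A sum for \<open>\<lambda>\<^sup>S(v \<otimes> a)\<close>.\<close>

definition ls :: "'v \<Rightarrow> 'a \<Rightarrow> ('v \<times> 'a) list" where "ls v a = tlist V A (L (v \<otimes>\<^sub>A a))"

lemma L_closed: "v \<in> pts V \<Longrightarrow> L (v \<otimes>\<^sub>A a) \<in> pts (V \<odot> A)"
  by (rule Lin_pure_closed[OF L_Lin]) simp_all

lemma R_closed: "v \<in> pts V \<Longrightarrow> R (v \<otimes>\<^sub>A a) \<in> pts (V \<odot> A)"
  by (rule Lin_pure_closed[OF R_Lin]) simp_all

lemma ls_mem: "v \<in> pts V \<Longrightarrow> (w, z) \<in> set (ls v a) \<Longrightarrow> w \<in> pts V"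
  unfolding ls_def by (rule tlist_mem(1)[OF V L_closed])

lemma ls_left:
  assumes v: "v \<in> pts V" and h: "is_bilinear V A ground h"
  shows "ls v x \<rhd> (\<lambda>w z. h w (sr c d * z)) = lv d v \<rhd> (\<lambda>u w. h w (sr c u * x))"
  using eval_ext[OF L_test[OF v, of c d x], of h]
  unfolding eval_ev_pure[OF h] ls_def
  by (simp add: tmap_eval[OF V V is_linear_id linop_mult_id(1)[unfolded linop_def] L_closed[OF v] h])

text \<open>
  This is \<open>L_test\<close> without the factor \<open>c\<close>: \<open>V \<otimes> S(e)\<close> may be applied to \<open>\<lambda>\<^sup>S(v \<otimes> x)\<close> itself.
\<close>

lemma ls_sl:
  assumes v: "v \<in> pts V" and h: "is_bilinear V A ground h"
  shows "ls v x \<rhd> (\<lambda>w z. h w (sl e z)) = lv e v \<rhd> (\<lambda>u w. h w (sl u x))"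
proof -
  have "ls v x \<rhd> (\<lambda>w z. h w (sl e z) * 1) = lv e v \<rhd> (\<lambda>u w. h w (sl u x) * 1)"
  proof (rule cancel_middle[OF V alg_vspace vspace_ground separating_left,
        where F = "\<lambda>h. ls v x \<rhd> (\<lambda>w z. h w (sl e z) 1)" and G = "\<lambda>h. lv e v \<rhd> (\<lambda>u w. h w (sl u x) 1)"
        and h = "\<lambda>w z c. h w z * c"])
    show "finite_sum V A ground (\<lambda>h. ls v x \<rhd> (\<lambda>w z. h w (sl e z) 1))"
      "finite_sum V A ground (\<lambda>h. lv e v \<rhd> (\<lambda>u w. h w (sl u x) 1))"
      by (intro finite_sum_intros; use ls_mem[OF v] lv_mem[OF v] in simp)+
    show "is_trilinear V A ground (\<lambda>w z c. h w z * c)"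
      using h by (simp add: is_bilinear_def is_trilinear_def is_linear_def algebra_simps)
    fix c h assume h: "is_trilinear V A ground h"
    have b: "is_bilinear V A ground (\<lambda>w z. h w z 1)"
      using h by (simp add: is_bilinear_def is_trilinear_def)
    show "ls v x \<rhd> (\<lambda>w z. h w (c * sl e z) 1) = lv e v \<rhd> (\<lambda>u w. h w (c * sl u x) 1)"
      using ls_left[OF v b, of x c e] by (simp add: sr_sl)
  qed
  then show ?thesis by simp
qed

text \<open>
  It suffices to take \<open>a = c S(d)\<close>; then the left-hand side is given by \<open>L_test\<close> and the
  right-hand side by the definition of \<open>\<rho>\<^sup>S\<close>.
\<close>

lemma L_R_compatible:
  assumes v: "v \<in> pts V"
  shows "tmap V A V A (\<lambda>w. w) ((*) a) (L (v \<otimes>\<^sub>A b)) = tmap V A V A (\<lambda>w. w) (\<lambda>y. y * b) (R (v \<otimes>\<^sub>A a))"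
proof (rule tensor_eqI)
  note l = linop_mult_id[unfolded linop_def]
  note t = tmap_Lin[OF is_linear_id[of V] l(1)] tmap_Lin[OF is_linear_id[of V] l(2)]
  show "tmap V A V A (\<lambda>w. w) ((*) a) (L (v \<otimes>\<^sub>A b)) \<in> pts (V \<odot> A)"
    using LinD[OF t(1)] L_closed[OF v] by (simp add: is_linear_def)
  show "tmap V A V A (\<lambda>w. w) (\<lambda>y. y * b) (R (v \<otimes>\<^sub>A a)) \<in> pts (V \<odot> A)"
    using LinD[OF t(2)] R_closed[OF v] by (simp add: is_linear_def)
  fix \<beta> assume \<beta>: "is_bilinear V A ground \<beta>"
  show "tmap V A V A (\<lambda>w. w) ((*) a) (L (v \<otimes>\<^sub>A b)) \<beta> =
    tmap V A V A (\<lambda>w. w) (\<lambda>y. y * b) (R (v \<otimes>\<^sub>A a)) \<beta>"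
  proof (rule eq_on_sr[where x = a])
    have "is_linear A ground (\<lambda>a. \<beta> w (a * z))" if "w \<in> pts V" for w z
      by (rule is_linear_comp[OF l(2)]) (use \<beta> that in \<open>simp add: is_bilinear_def\<close>)
    from is_linear_tlist[OF V alg_vspace vspace_ground L_closed[OF v] this]
    show "lin1 (\<lambda>a. tmap V A V A (\<lambda>w. w) ((*) a) (L (v \<otimes>\<^sub>A b)) \<beta>)"
      unfolding lin1_def tmap_eval[OF V V is_linear_id l(1) L_closed[OF v] \<beta>] .
    have "is_linear (V \<odot> A) ground (\<lambda>t. t \<beta>)" by (simp add: is_linear_def tscale_def)
    from is_linear_comp[OF is_linear_comp[OF is_linear_comp[OF is_linear_pure2[OF v] LinD[OF R_Lin]] LinD[OF t(2)]] this]
    show "lin1 (\<lambda>a. tmap V A V A (\<lambda>w. w) (\<lambda>y. y * b) (R (v \<otimes>\<^sub>A a)) \<beta>)"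
      unfolding lin1_def .
    fix c d
    have "tmap V A V A (\<lambda>w. w) (\<lambda>y. y * b) (R (v \<otimes>\<^sub>A sr c d)) = (lv d v \<rhd> (\<lambda>u w. w \<otimes>\<^sub>A (sr c u * b)))"
      unfolding R_sr[OF v] by (rule tmap_ev) (simp_all add: lv_mem[OF v])
    then show "tmap V A V A (\<lambda>w. w) ((*) (sr c d)) (L (v \<otimes>\<^sub>A b)) \<beta> =
      tmap V A V A (\<lambda>w. w) (\<lambda>y. y * b) (R (v \<otimes>\<^sub>A sr c d)) \<beta>"
      using L_test[OF v, of c d b] by simp
  qed
qed

section \<open>The comodule axioms for the twisted coaction\<close>

lemma bilinear_lv:
  assumes G: "is_trilinear A A V G"
  shows "is_bilinear A V ground (\<lambda>u w. lv b w \<rhd> G u)"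
proof -
  have "is_trilinear A A V (\<lambda>u b w. lv b w \<rhd> G u)"
    using is_trilinear_leg23[OF alg_vspace alg_vspace V lam G] by (simp add: lv_def)
  then show ?thesis by (simp add: is_trilinear_def is_bilinear_def)
qed

lemma lin2_lv_lv:
  assumes v: "v \<in> pts V" and G: "is_trilinear A A V G"
  shows "lin2 (\<lambda>d b. lv d v \<rhd> (\<lambda>u w. lv b w \<rhd> G u))"
proof -
  have "is_trilinear A A V (\<lambda>d b v. lv d v \<rhd> (\<lambda>u w. lv b w \<rhd> G u))"
    using is_trilinear_leg13[OF alg_vspace alg_vspace V lam
        is_trilinear_leg23[OF alg_vspace alg_vspace V lam G]] by (simp add: lv_def)
  then show ?thesis using v by (simp add: is_trilinear_def lin1_def)
qed

text \<open>Two coactions applied to \<open>\<Delta>(e)(d \<otimes> b)\<close> are one coaction followed by \<open>\<Delta>\<close>.\<close>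

lemma lv_lv_T1:
  assumes v: "v \<in> pts V" and G: "is_trilinear A A V G"
  shows "t1 e b \<rhd> (\<lambda>d' b'. lv (d' * d) v \<rhd> (\<lambda>u w. lv b' w \<rhd> G u)) =
    lv e v \<rhd> (\<lambda>z w. t1 z b \<rhd> (\<lambda>u u'. G (u * d) u' w))"
proof -
  have Gd: "is_trilinear A A V (\<lambda>u. G (u * d))"
    unfolding is_trilinear_def
  proof (intro conjI ballI)
    fix u x show "is_linear V ground (G (u * d) x)" using G by (simp add: is_trilinear_def)
  next
    fix u w assume "w \<in> pts V"
    then show "is_linear A ground (\<lambda>x. G (u * d) x w)" using G by (simp add: is_trilinear_def)
  next
    fix x w assume "w \<in> pts V"
    then show "is_linear A ground (\<lambda>u. G (u * d) x w)"
      using is_linear_comp[OF linop_mult_id(2)[unfolded linop_def, of d], of ground "\<lambda>u. G u x w"] G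
      by (simp add: is_trilinear_def)
  qed
  have "t1 e b \<rhd> (\<lambda>d' b'. lv (d' * d) v \<rhd> (\<lambda>u w. lv b' w \<rhd> G u)) =
      t1 e b \<rhd> (\<lambda>d' b'. lv d' v \<rhd> (\<lambda>u w. lv b' w \<rhd> G (u * d)))"
    by (intro ev_cong[OF refl] lam_mult[OF v] bilinear_lv[OF G])
  also have "\<dots> = lv e v \<rhd> (\<lambda>z w. t1 z b \<rhd> (\<lambda>u u'. G (u * d) u' w))"
    by (rule lam_T1[OF v Gd])
  finally show ?thesis .
qed

lemma trilinear_S:
  assumes h: "is_trilinear V A A h"
  shows "is_trilinear A A V (\<lambda>u u' w. h w (sr c u' * x) (sr c' u * y))"
  unfolding is_trilinear_def
proof (intro conjI ballI)
  fix u u'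
  show "is_linear V ground (\<lambda>w. h w (sr c u' * x) (sr c' u * y))"
    using h by (simp add: is_trilinear_def)
next
  have op: "is_linear A A (\<lambda>u. sr c u * x)" for c x
    unfolding linop_def[symmetric] by simp
  fix u w assume w: "w \<in> pts V"
  show "is_linear A ground (\<lambda>u'. h w (sr c u' * x) (sr c' u * y))"
    by (rule is_linear_comp[OF op]) (use h w in \<open>simp add: is_trilinear_def\<close>)
  show "is_linear A ground (\<lambda>u'. h w (sr c u * x) (sr c' u' * y))"
    by (rule is_linear_comp[OF op]) (use h w in \<open>simp add: is_trilinear_def\<close>)
qed

text \<open>
  After multiplication by \<open>c S(b) \<otimes> c' S(d)\<close>, the iterated coaction \<open>\<lambda>\<^sup>S\<close> on \<open>v \<otimes> x \<otimes> y\<close> is the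
  iterated coaction \<open>\<lambda>\<close> on \<open>d \<otimes> b \<otimes> v\<close>, with \<open>x\<close> and \<open>y\<close> as mere factors.
\<close>

lemma ls_ls_cover:
  assumes v: "v \<in> pts V" and h: "is_trilinear V A A h"
  shows "ls v y \<rhd> (\<lambda>w z. ls w x \<rhd> (\<lambda>w' z'. h w' (sr c b * z') (sr c' d * z))) =
    lv d v \<rhd> (\<lambda>u w. lv b w \<rhd> (\<lambda>u' w'. h w' (sr c u' * x) (sr c' u * y)))"
proof -
  have op: "is_linear A A (\<lambda>u. sr c u * x)"
    unfolding linop_def[symmetric] by simp
  have "ls v y \<rhd> (\<lambda>w z. ls w x \<rhd> (\<lambda>w' z'. h w' (sr c b * z') (sr c' d * z))) =
      ls v y \<rhd> (\<lambda>w z. lv b w \<rhd> (\<lambda>u' w'. h w' (sr c u' * x) (sr c' d * z)))"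
  proof (rule ev_cong[OF refl])
    fix w z assume "(w, z) \<in> set (ls v y)"
    then have w: "w \<in> pts V" by (rule ls_mem[OF v])
    have "is_bilinear V A ground (\<lambda>w' z'. h w' z' (sr c' d * z))"
      using h by (simp add: is_trilinear_def is_bilinear_def)
    from ls_left[OF w this]
    show "ls w x \<rhd> (\<lambda>w' z'. h w' (sr c b * z') (sr c' d * z)) =
      lv b w \<rhd> (\<lambda>u' w'. h w' (sr c u' * x) (sr c' d * z))" .
  qed
  also have "\<dots> = lv d v \<rhd> (\<lambda>u w. lv b w \<rhd> (\<lambda>u' w'. h w' (sr c u' * x) (sr c' u * y)))"
  proof -
    have "is_trilinear A A V (\<lambda>z u' w. h w (sr c u' * x) z)"
      unfolding is_trilinear_def
    proof (intro conjI ballI)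
      show "is_linear V ground (\<lambda>w. h w (sr c u' * x) z)" for z u'
        using h by (simp add: is_trilinear_def)
      show "is_linear A ground (\<lambda>z. h w (sr c u' * x) z)" if "w \<in> pts V" for u' w
        using h that by (simp add: is_trilinear_def)
      show "is_linear A ground (\<lambda>u'. h w (sr c u' * x) z)" if "w \<in> pts V" for z w
        by (rule is_linear_comp[OF op]) (use h that in \<open>simp add: is_trilinear_def\<close>)
    qed
    from bilinear_lv[OF this]
    have "is_bilinear V A ground (\<lambda>w z. lv b w \<rhd> (\<lambda>u' w'. h w' (sr c u' * x) z))"
      by (simp add: is_bilinear_def)
    from ls_left[OF v this] show ?thesis .
  qed
  finally show ?thesis .
qed

lemma lin2_leg: "is_trilinear V A A h \<Longrightarrow> w \<in> pts V \<Longrightarrow> lin2 (h w)"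
  by (simp add: is_trilinear_def lin1_def)

lemma cancel_cover:
  assumes F: "finite_sum V A A F" and G: "finite_sum V A A G"
    and eq: "\<And>c b c' d h. is_trilinear V A A h \<Longrightarrow>
      F (\<lambda>w p q. h w (sr c b * p) (sr c' d * q)) = G (\<lambda>w p q. h w (sr c b * p) (sr c' d * q))"
    and h: "is_trilinear V A A h"
  shows "F h = G h"
proof (rule cancel_last_two[OF V alg_vspace alg_vspace separating_sr separating_sr F G _ h])
  fix i j :: "'a \<times> 'a" and h assume h: "is_trilinear V A A h"
  show "F (\<lambda>w p q. h w ((case i of (c, d) \<Rightarrow> \<lambda>y. sr c d * y) p) ((case j of (c, d) \<Rightarrow> \<lambda>y. sr c d * y) q)) =
      G (\<lambda>w p q. h w ((case i of (c, d) \<Rightarrow> \<lambda>y. sr c d * y) p) ((case j of (c, d) \<Rightarrow> \<lambda>y. sr c d * y) q))"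
    using eq[OF h] by (cases i; cases j) simp
qed

lemma finite_sum_ls_ls:
  assumes v: "v \<in> pts V"
  shows "finite_sum V A A (\<lambda>h. ls v y \<rhd> (\<lambda>w z. ls w x \<rhd> (\<lambda>w' z'. h w' z' z)))"
proof (intro finite_sum_ev)
  fix w z w' z' assume "(w, z) \<in> set (ls v y)" "(w', z') \<in> set (ls w x)"
  then have "w' \<in> pts V" using ls_mem[OF ls_mem[OF v]] by blast
  then show "finite_sum V A A (\<lambda>h. h w' z' z)" by (intro finite_sum_base) simp_all
qed

text \<open>
  The covered iterated coaction \<open>\<Gamma> x y d b\<close> depends on \<open>d \<otimes> b\<close> through \<open>E(d \<otimes> b)\<close>, by \<open>lam_E1\<close>, so
  \<open>d \<otimes> b\<close> may be taken of the form \<open>\<Delta>(e)(d \<otimes> b)\<close>. Then the left factors of \<open>x \<otimes> y\<close> are of the form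
  treated in \<open>S_op_E2\<close> and absorb \<open>E\<close>.
\<close>

lemma L_E1:
  assumes v: "v \<in> pts V" and h: "is_trilinear V A A h"
  shows "e1 x y \<rhd> (\<lambda>x' y'. ls v y' \<rhd> (\<lambda>w z. ls w x' \<rhd> (\<lambda>w' z'. h w' z' z))) =
    ls v y \<rhd> (\<lambda>w z. ls w x \<rhd> (\<lambda>w' z'. h w' z' z))"
proof (rule cancel_cover[OF _ finite_sum_ls_ls[OF v] _ h])
  show "finite_sum V A A (\<lambda>h. e1 x y \<rhd> (\<lambda>x' y'. ls v y' \<rhd> (\<lambda>w z. ls w x' \<rhd> (\<lambda>w' z'. h w' z' z))))"
    by (intro finite_sum_ev[of "e1 x y"] finite_sum_ls_ls[OF v])
  fix c b c' d h assume h: "is_trilinear V A A h"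
  define G where "G x y = (\<lambda>u u' w. h w (sr c u' * x) (sr c' u * y))" for x y
  have G: "is_trilinear A A V (G x y)" for x y unfolding G_def by (rule trilinear_S[OF h])
  \<comment> \<open>By \<open>ls_ls_cover\<close>, the covered iterated coaction as a form in \<open>d \<otimes> b\<close>.\<close>
  define \<Gamma> where "\<Gamma> x y d b = (lv d v \<rhd> (\<lambda>u w. lv b w \<rhd> G x y u))" for x y d b
  have \<Gamma>: "lin2 (\<Gamma> x y)" for x y unfolding \<Gamma>_def by (rule lin2_lv_lv[OF v G])
  have \<Gamma>_inv: "(e1 d b \<rhd> \<Gamma> x y) = \<Gamma> x y d b" for d b x y
    unfolding \<Gamma>_def using lam_E1[OF v G] by simp
  have \<Gamma>_T1: "(t1 e b \<rhd> (\<lambda>d' b'. \<Gamma> x y (d' * d) b')) =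
      (lv e v \<rhd> (\<lambda>z w. t1 z b \<rhd> (\<lambda>u u'. G x y (u * d) u' w)))" for e d b x y
    unfolding \<Gamma>_def by (rule lv_lv_T1[OF v G])
  have "(\<lambda>d b. e1 x y \<rhd> (\<lambda>x' y'. \<Gamma> x' y' d b)) d b = \<Gamma> x y d b"
  proof (rule eq_if_E1_invariant)
    show "lin2 (\<lambda>d b. e1 x y \<rhd> (\<lambda>x' y'. \<Gamma> x' y' d b))" using lin2_D[OF \<Gamma>] by simp
    show "lin2 (\<Gamma> x y)" by (rule \<Gamma>)
    show "(e1 d b \<rhd> (\<lambda>d b. e1 x y \<rhd> (\<lambda>x' y'. \<Gamma> x' y' d b))) = (e1 x y \<rhd> (\<lambda>x' y'. \<Gamma> x' y' d b))" for d b
      by (subst ev_swap) (simp only: \<Gamma>_inv)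
    show "(e1 d b \<rhd> \<Gamma> x y) = \<Gamma> x y d b" for d b by (rule \<Gamma>_inv)
    fix e d b
    have "(t1 e b \<rhd> (\<lambda>p q. e1 x y \<rhd> (\<lambda>x' y'. \<Gamma> x' y' (p * d) q))) =
        (e1 x y \<rhd> (\<lambda>x' y'. lv e v \<rhd> (\<lambda>z w. t1 z b \<rhd> (\<lambda>u u'. G x' y' (u * d) u' w))))"
      by (subst ev_swap) (simp only: \<Gamma>_T1)
    also have "\<dots> = (lv e v \<rhd> (\<lambda>z w. e1 x y \<rhd> (\<lambda>x' y'. t1 z b \<rhd> (\<lambda>u u'. G x' y' (u * d) u' w))))"
      by (rule ev_swap)
    also have "\<dots> = (lv e v \<rhd> (\<lambda>z w. t1 z b \<rhd> (\<lambda>u u'. G x y (u * d) u' w)))"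
    proof (rule ev_cong[OF refl])
      fix z w assume "(z, w) \<in> set (lv e v)"
      then have w: "w \<in> pts V" by (rule lv_mem[OF v])
      note hw = lin2_leg[OF h w]
      note [simp] = lin2_D[OF hw]
      have "(e1 x y \<rhd> (\<lambda>x' y'. t1 z b \<rhd> (\<lambda>u u'. G x' y' (u * d) u' w))) =
          (t1 z b \<rhd> (\<lambda>u u'. e1 x y \<rhd> (\<lambda>x' y'. h w (sr c u' * x') (sr c' (u * d) * y'))))"
        unfolding G_def by (rule ev_swap)
      also have "\<dots> = (t1 z b \<rhd> (\<lambda>u u'. e2 (sr c u') (sr c' (u * d)) \<rhd> (\<lambda>p q. h w (p * x) (q * y))))"
        by (intro ev_cong[OF refl] E1_E2 hw)
      also have "\<dots> = (t1 z b \<rhd> (\<lambda>u u'. h w (sr c u' * x) (sr c' (u * d) * y)))"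
        by (rule S_op_E2[rule_format]) simp
      finally show "(e1 x y \<rhd> (\<lambda>x' y'. t1 z b \<rhd> (\<lambda>u u'. G x' y' (u * d) u' w))) =
          (t1 z b \<rhd> (\<lambda>u u'. G x y (u * d) u' w))"
        unfolding G_def .
    qed
    finally show "(t1 e b \<rhd> (\<lambda>p q. e1 x y \<rhd> (\<lambda>x' y'. \<Gamma> x' y' (p * d) q))) =
        (t1 e b \<rhd> (\<lambda>p q. \<Gamma> x y (p * d) q))"
      by (simp only: \<Gamma>_T1)
  qed
  then show "e1 x y \<rhd> (\<lambda>x' y'. ls v y' \<rhd> (\<lambda>w z. ls w x' \<rhd> (\<lambda>w' z'. h w' (sr c b * z') (sr c' d * z)))) =
    ls v y \<rhd> (\<lambda>w z. ls w x \<rhd> (\<lambda>w' z'. h w' (sr c b * z') (sr c' d * z)))"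
    unfolding ls_ls_cover[OF v h] \<Gamma>_def G_def .
qed

text \<open>
  The same reduction to \<open>\<Delta>(e)(d \<otimes> b)\<close> as in \<open>L_E1\<close>. For the side with a single \<open>\<lambda>\<^sup>S\<close>, invariance
  under \<open>E\<close> is \<open>E1_S_T1\<close>. The left-hand side involves \<open>\<Delta>(x)\<close> under the factors \<open>S(z\<^sub>2 b)\<close> and
  \<open>S(z\<^sub>1 d)\<close>, which combine to \<open>\<Delta>(S(z) x)\<close> by anti-comultiplicativity. Then \<open>ls_sl\<close> trades \<open>\<lambda>\<close> for
  \<open>\<lambda>\<^sup>S\<close>, and anti-comultiplicativity is used backwards.
\<close>

lemma L_T1:
  assumes v: "v \<in> pts V" and h: "is_trilinear V A A h"
  shows "t1 x y \<rhd> (\<lambda>x' y'. ls v y' \<rhd> (\<lambda>w z. ls w x' \<rhd> (\<lambda>w' z'. h w' z' z))) =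
    ls v x \<rhd> (\<lambda>w z. t1 z y \<rhd> (\<lambda>p q. h w p q))"
proof (rule cancel_cover[OF _ _ _ h])
  show "finite_sum V A A (\<lambda>h. t1 x y \<rhd> (\<lambda>x' y'. ls v y' \<rhd> (\<lambda>w z. ls w x' \<rhd> (\<lambda>w' z'. h w' z' z))))"
    by (intro finite_sum_ev[of "t1 x y"] finite_sum_ls_ls[OF v])
  show "finite_sum V A A (\<lambda>h. ls v x \<rhd> (\<lambda>w z. t1 z y \<rhd> (\<lambda>p q. h w p q)))"
    by (intro finite_sum_ev finite_sum_base) (simp_all add: ls_mem[OF v])
  fix c b c' d h assume h: "is_trilinear V A A h"
  define G where "G x y = (\<lambda>u u' w. h w (sr c u' * x) (sr c' u * y))" for x y
  have G: "is_trilinear A A V (G x y)" for x y unfolding G_def by (rule trilinear_S[OF h])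
  \<comment> \<open>The covered left-hand side as a form in \<open>d \<otimes> b\<close>, for each value of \<open>x \<otimes> y\<close>.\<close>
  define \<Gamma> where "\<Gamma> x y d b = (lv d v \<rhd> (\<lambda>u w. lv b w \<rhd> G x y u))" for x y d b
  have \<Gamma>: "lin2 (\<Gamma> x y)" for x y unfolding \<Gamma>_def by (rule lin2_lv_lv[OF v G])
  have \<Gamma>_inv: "(e1 d b \<rhd> \<Gamma> x y) = \<Gamma> x y d b" for d b x y
    unfolding \<Gamma>_def using lam_E1[OF v G] by simp
  have \<Gamma>_T1: "(t1 e b \<rhd> (\<lambda>d' b'. \<Gamma> x y (d' * d) b')) =
      (lv e v \<rhd> (\<lambda>z w. t1 z b \<rhd> (\<lambda>u u'. G x y (u * d) u' w)))" for e d b x y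
    unfolding \<Gamma>_def by (rule lv_lv_T1[OF v G])
  \<comment> \<open>\<open>\<Delta>(z)\<close> as it is covered on the right-hand side.\<close>
  define P where "P z d b w = (t1 z y \<rhd> (\<lambda>p q. h w (sr c b * p) (sr c' d * q)))" for z d b w
  have P_lin: "is_linear A ground (\<lambda>d. P z d b w)" "is_linear A ground (\<lambda>b. P z d b w)"
    "is_linear A ground (\<lambda>z. P z d b w)" if w: "w \<in> pts V" for z d b w
    unfolding P_def lin1_def[symmetric] using lin2_D[OF lin2_leg[OF h w]] by simp_all
  have P_V: "is_linear V ground (\<lambda>w. P z d b w)" for z d b
  proof -
    have "is_linear V ground (\<lambda>w. h w p q)" for p q using h by (simp add: is_trilinear_def)
    from is_linear_tlist[OF alg_vspace V vspace_ground sw_closed[OF linear_maps(3)] this]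
    show ?thesis unfolding P_def sw_def .
  qed
  define \<Theta> where "\<Theta> d b = (ls v x \<rhd> (\<lambda>w z. P z d b w))" for d b
  have "(\<lambda>d b. t1 x y \<rhd> (\<lambda>x' y'. \<Gamma> x' y' d b)) d b = \<Theta> d b"
  proof (rule eq_if_E1_invariant)
    show "lin2 (\<lambda>d b. t1 x y \<rhd> (\<lambda>x' y'. \<Gamma> x' y' d b))" using lin2_D[OF \<Gamma>] by simp
    have "lin1 (\<Theta> d)" for d
      unfolding lin1_def \<Theta>_def ls_def
      by (rule is_linear_tlist[OF V alg_vspace vspace_ground L_closed[OF v] P_lin(2)])
    moreover have "lin1 (\<lambda>d. \<Theta> d b)" for b
      unfolding lin1_def \<Theta>_def ls_def
      by (rule is_linear_tlist[OF V alg_vspace vspace_ground L_closed[OF v] P_lin(1)])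
    ultimately show "lin2 \<Theta>" by simp
    show "(e1 d b \<rhd> (\<lambda>d b. t1 x y \<rhd> (\<lambda>x' y'. \<Gamma> x' y' d b))) = (t1 x y \<rhd> (\<lambda>x' y'. \<Gamma> x' y' d b))" for d b
      by (subst ev_swap) (simp only: \<Gamma>_inv)
    show "(e1 d b \<rhd> \<Theta>) = \<Theta> d b" for d b
    proof -
      have "(e1 d b \<rhd> \<Theta>) = (ls v x \<rhd> (\<lambda>w z. e1 d b \<rhd> (\<lambda>d b. P z d b w)))"
        unfolding \<Theta>_def by (rule ev_swap)
      also have "\<dots> = (ls v x \<rhd> (\<lambda>w z. P z d b w))"
        unfolding P_def
        by (intro ev_cong[OF refl] E1_S_T1 lin2_leg[OF h]) (rule ls_mem[OF v])
      finally show ?thesis unfolding \<Theta>_def .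
    qed
    fix e d b
    have "(t1 e b \<rhd> (\<lambda>p q. t1 x y \<rhd> (\<lambda>x' y'. \<Gamma> x' y' (p * d) q))) =
        (t1 x y \<rhd> (\<lambda>x' y'. lv e v \<rhd> (\<lambda>z w. t1 z b \<rhd> (\<lambda>u u'. G x' y' (u * d) u' w))))"
      by (subst ev_swap) (simp only: \<Gamma>_T1)
    also have "\<dots> = (lv e v \<rhd> (\<lambda>z w. t1 x y \<rhd> (\<lambda>x' y'. t1 z b \<rhd> (\<lambda>u u'. G x' y' (u * d) u' w))))"
      by (rule ev_swap)
    also have "\<dots> = (lv e v \<rhd> (\<lambda>z w. P (sl z x) d b w))"
      unfolding G_def P_def
      by (intro ev_cong[OF refl] T1_sl_cover[symmetric] lin2_leg[OF h]) (rule lv_mem[OF v])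
    also have "\<dots> = (ls v x \<rhd> (\<lambda>w z. P (sl e z) d b w))"
    proof (rule ls_sl[symmetric, OF v])
      show "is_bilinear V A ground (\<lambda>w z. P z d b w)"
        unfolding is_bilinear_def using P_lin(3) P_V by simp
    qed
    also have "\<dots> = (ls v x \<rhd> (\<lambda>w z. t1 e b \<rhd> (\<lambda>p q. P z (p * d) q w)))"
    proof (rule ev_cong[OF refl])
      fix w z assume "(w, z) \<in> set (ls v x)"
      then have hw: "lin2 (h w)" using lin2_leg[OF h] ls_mem[OF v] by blast
      have "P (sl e z) d b w =
          (t1 z y \<rhd> (\<lambda>p q. t1 e b \<rhd> (\<lambda>u u'. h w (sr c u' * p) (sr c' (u * d) * q))))"
        unfolding P_def by (rule T1_sl_cover[OF hw])
      also have "\<dots> = (t1 e b \<rhd> (\<lambda>p q. P z (p * d) q w))"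
        unfolding P_def by (rule ev_swap)
      finally show "P (sl e z) d b w = (t1 e b \<rhd> (\<lambda>p q. P z (p * d) q w))" .
    qed
    also have "\<dots> = (t1 e b \<rhd> (\<lambda>p q. \<Theta> (p * d) q))"
      unfolding \<Theta>_def by (rule ev_swap)
    finally show "(t1 e b \<rhd> (\<lambda>p q. t1 x y \<rhd> (\<lambda>x' y'. \<Gamma> x' y' (p * d) q))) =
        (t1 e b \<rhd> (\<lambda>p q. \<Theta> (p * d) q))" .
  qed
  then show "t1 x y \<rhd> (\<lambda>x' y'. ls v y' \<rhd> (\<lambda>w z. ls w x' \<rhd> (\<lambda>w' z'. h w' (sr c b * z') (sr c' d * z)))) =
    ls v x \<rhd> (\<lambda>w z. t1 z y \<rhd> (\<lambda>p q. h w (sr c b * p) (sr c' d * q)))"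
    unfolding ls_ls_cover[OF v h] \<Gamma>_def G_def \<Theta>_def P_def .
qed

lemma right_comodule: "right_comodule V L R"
  unfolding right_comodule_def
proof (intro conjI ballI allI)
  show "vspace V" "L \<in> Lin (V \<odot> A) (V \<odot> A)" "R \<in> Lin (V \<odot> A) (V \<odot> A)"
    by (simp_all add: L_Lin R_Lin)
  show "tmap V A V A (\<lambda>x. x) ((*) a) (L (v \<otimes>\<^sub>A b)) = tmap V A V A (\<lambda>x. x) (\<lambda>y. y * b) (R (v \<otimes>\<^sub>A a))"
    if "v \<in> pts V" for v a b by (rule L_R_compatible[OF that])
  note va = alg_vspace
  note c1 = leg_closed(1)[OF V L_Lin] and c2 = leg_closed(2)[OF V va va]
    and c3 = leg_closed(3)[OF V va va L_Lin]
  fix t assume t: "t \<in> pts (V \<odot> A \<odot> A)"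
  have LL: "eval3 (leg12 V A A L (leg13 V A A L u)) h =
      eval3 u (\<lambda>v x y. ls v y \<rhd> (\<lambda>w z. ls w x \<rhd> (\<lambda>w' z'. h w' z' z)))"
    if h: "is_trilinear V A A h" and u: "u \<in> pts (V \<odot> A \<odot> A)" for h u
    using eval3_leg12[OF V va va L_Lin h c3[OF u]]
      eval3_leg13[OF V va va L_Lin is_trilinear_leg12[OF V va va L_Lin h] u]
    by (simp add: ls_def)
  have LL_tri: "is_trilinear V A A (\<lambda>v x y. ls v y \<rhd> (\<lambda>w z. ls w x \<rhd> (\<lambda>w' z'. h w' z' z)))"
    if h: "is_trilinear V A A h" for h
    using is_trilinear_leg13[OF V va va L_Lin is_trilinear_leg12[OF V va va L_Lin h]]
    by (simp add: ls_def)
  show "leg12 V A A L (leg13 V A A L (leg23 V A A (E1 H) t)) = leg12 V A A L (leg13 V A A L t)"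
  proof (rule eval3_eqI[OF V va])
    show "leg12 V A A L (leg13 V A A L (leg23 V A A (E1 H) t)) \<in> pts (V \<odot> A \<odot> A)"
      "leg12 V A A L (leg13 V A A L t) \<in> pts (V \<odot> A \<odot> A)"
      by (intro c1 c3 c2 linear_maps t)+
    fix h assume h: "is_trilinear V A A h"
    note tri = is_trilinear_leg23[OF V va va linear_maps(1) LL_tri[OF h], folded sw_def]
    have "eval3 (leg12 V A A L (leg13 V A A L (leg23 V A A (E1 H) t))) h =
        eval3 t (\<lambda>v x y. e1 x y \<rhd> (\<lambda>x y. ls v y \<rhd> (\<lambda>w z. ls w x \<rhd> (\<lambda>w' z'. h w' z' z))))"
      unfolding LL[OF h c2[OF linear_maps(1) t]]
      by (rule eval3_leg23[OF V va va linear_maps(1) LL_tri[OF h] t, folded sw_def])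
    also have "\<dots> = eval3 t (\<lambda>v x y. ls v y \<rhd> (\<lambda>w z. ls w x \<rhd> (\<lambda>w' z'. h w' z' z)))"
      by (rule eval3_cong[OF V va tri LL_tri[OF h] L_E1[OF _ h] t])
    finally show "eval3 (leg12 V A A L (leg13 V A A L (leg23 V A A (E1 H) t))) h =
        eval3 (leg12 V A A L (leg13 V A A L t)) h"
      unfolding LL[OF h t] .
  qed
  show "leg12 V A A L (leg13 V A A L (leg23 V A A (T1 H) t)) = leg23 V A A (T1 H) (leg12 V A A L t)"
  proof (rule eval3_eqI[OF V va])
    show "leg12 V A A L (leg13 V A A L (leg23 V A A (T1 H) t)) \<in> pts (V \<odot> A \<odot> A)"
      "leg23 V A A (T1 H) (leg12 V A A L t) \<in> pts (V \<odot> A \<odot> A)"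
      by (intro c1 c3 c2 linear_maps t)+
    fix h assume h: "is_trilinear V A A h"
    note tri = is_trilinear_leg23[OF V va va linear_maps(3) LL_tri[OF h], folded sw_def]
    note tri' = is_trilinear_leg23[OF V va va linear_maps(3) h, folded sw_def]
    note tri'' = is_trilinear_leg12[OF V va va L_Lin tri', folded ls_def]
    have "eval3 (leg12 V A A L (leg13 V A A L (leg23 V A A (T1 H) t))) h =
        eval3 t (\<lambda>v x y. t1 x y \<rhd> (\<lambda>x y. ls v y \<rhd> (\<lambda>w z. ls w x \<rhd> (\<lambda>w' z'. h w' z' z))))"
      unfolding LL[OF h c2[OF linear_maps(3) t]]
      by (rule eval3_leg23[OF V va va linear_maps(3) LL_tri[OF h] t, folded sw_def])
    also have "\<dots> = eval3 t (\<lambda>v x y. ls v x \<rhd> (\<lambda>w z. t1 z y \<rhd> (\<lambda>p q. h w p q)))"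
      by (rule eval3_cong[OF V va tri tri'' L_T1[OF _ h] t])
    also have "\<dots> = eval3 (leg12 V A A L t) (\<lambda>v x y. t1 x y \<rhd> (\<lambda>p q. h v p q))"
      by (rule eval3_leg12[OF V va va L_Lin tri' t, folded ls_def, symmetric])
    also have "\<dots> = eval3 (leg23 V A A (T1 H) (leg12 V A A L t)) h"
      by (rule eval3_leg23[OF V va va linear_maps(3) h c1[OF t], folded sw_def, symmetric])
    finally show "eval3 (leg12 V A A L (leg13 V A A L (leg23 V A A (T1 H) t))) h =
        eval3 (leg23 V A A (T1 H) (leg12 V A A L t)) h" .
  qed
qed

end

section \<open>Functoriality\<close>

lemma tmap_comp:
  assumes X: "vspace X" and f: "is_linear X X' f" "is_linear X' X'' f'"
    and g: "is_linear Y Y' g" "is_linear Y' Y'' g'"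
    and k: "is_linear X X'' k" "\<And>x. x \<in> pts X \<Longrightarrow> k x = f' (f x)"
    and l: "is_linear Y Y'' l" "\<And>y. y \<in> pts Y \<Longrightarrow> l y = g' (g y)"
    and t: "t \<in> pts (X \<odot> Y)"
  shows "tmap X Y X'' Y'' k l t = tmap X' Y' X'' Y'' f' g' (tmap X Y X' Y' f g t)"
proof (rule linear_eqI[OF X LinD[OF tmap_Lin[OF k(1) l(1)]] _ _ t])
  show "is_linear (X \<odot> Y) (X'' \<odot> Y'') (\<lambda>t. tmap X' Y' X'' Y'' f' g' (tmap X Y X' Y' f g t))"
    by (rule is_linear_comp[OF LinD[OF tmap_Lin[OF f(1) g(1)]] LinD[OF tmap_Lin[OF f(2) g(2)]]])
  show "tmap X Y X'' Y'' k l (x \<otimes>\<^bsub>X,Y\<^esub> y) = tmap X' Y' X'' Y'' f' g' (tmap X Y X' Y' f g (x \<otimes>\<^bsub>X,Y\<^esub> y))"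
    if "x \<in> pts X" "y \<in> pts Y" for x y
    using that f g by (simp add: tmap_pure[OF k(1) l(1)] tmap_pure[OF f(1) g(1)]
        tmap_pure[OF f(2) g(2)] k(2) l(2) is_linear_def)
qed

lemma tmap_id:
  assumes X: "vspace X" and k: "is_linear X X k" "\<And>x. x \<in> pts X \<Longrightarrow> k x = x"
    and l: "is_linear Y Y l" "\<And>y. y \<in> pts Y \<Longrightarrow> l y = y"
    and t: "t \<in> pts (X \<odot> Y)"
  shows "tmap X Y X Y k l t = t"
  by (rule linear_eqI[OF X LinD[OF tmap_Lin[OF k(1) l(1)]] is_linear_id _ t])
    (simp add: tmap_pure[OF k(1) l(1)] k(2) l(2))

lemma restrict_Lin: "vspace X \<Longrightarrow> restrict (\<lambda>x. x) (pts X) \<in> Lin X X"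
  by (simp add: Lin_def is_linear_def vspace_closed)

lemma compose_Lin: "vspace X \<Longrightarrow> f \<in> Lin X Y \<Longrightarrow> g \<in> Lin Y Z \<Longrightarrow> compose (pts X) g f \<in> Lin X Z"
  by (simp add: Lin_def is_linear_def vspace_closed compose_def)

text \<open>
  Left and right comodules are both vector spaces with an endomorphism \<open>act X\<close> of a space \<open>D X\<close>
  that depends functorially on the vector space, through \<open>T\<close>; morphisms are the linear maps
  compatible with it.
\<close>

lemma is_category_linear:
  assumes Hom: "\<And>X Y. Hom C X Y =
      {f \<in> Lin (sp X) (sp Y). \<forall>t\<in>D X. act Y (T X Y f t) = T X Y f (act X t)}"
    and Ident: "\<And>X. Ident C X = restrict (\<lambda>x. x) (pts (sp X))"
    and Comp: "\<And>X Y Z g f. Comp C X Y Z g f = compose (pts (sp X)) g f"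
    and V: "\<And>X. X \<in> Ob C \<Longrightarrow> vspace (sp X)"
    and act: "\<And>X t. X \<in> Ob C \<Longrightarrow> t \<in> D X \<Longrightarrow> act X t \<in> D X"
    and T: "\<And>X Y f t. f \<in> Lin (sp X) (sp Y) \<Longrightarrow> t \<in> D X \<Longrightarrow> T X Y f t \<in> D Y"
    and T_id: "\<And>X t. X \<in> Ob C \<Longrightarrow> t \<in> D X \<Longrightarrow> T X X (restrict (\<lambda>x. x) (pts (sp X))) t = t"
    and T_comp: "\<And>X Y Z f g t. X \<in> Ob C \<Longrightarrow> f \<in> Lin (sp X) (sp Y) \<Longrightarrow> g \<in> Lin (sp Y) (sp Z) \<Longrightarrow>
      t \<in> D X \<Longrightarrow> T X Z (compose (pts (sp X)) g f) t = T Y Z g (T X Y f t)"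
  shows "is_category C"
  unfolding is_category_def Hom Ident Comp
proof (intro conjI ballI)
  fix X assume X: "X \<in> Ob C"
  show "restrict (\<lambda>x. x) (pts (sp X)) \<in>
      {f \<in> Lin (sp X) (sp X). \<forall>t\<in>D X. act X (T X X f t) = T X X f (act X t)}"
    using restrict_Lin[OF V[OF X]] T_id[OF X] act[OF X] by simp
  fix Y f assume Y: "Y \<in> Ob C"
    and f: "f \<in> {f \<in> Lin (sp X) (sp Y). \<forall>t\<in>D X. act Y (T X Y f t) = T X Y f (act X t)}"
  have f': "x \<in> pts (sp X) \<Longrightarrow> f x \<in> pts (sp Y)" "x \<notin> pts (sp X) \<Longrightarrow> f x = undefined" for x
    using f by (auto simp: Lin_def is_linear_def extensional_def)
  show "compose (pts (sp X)) f (restrict (\<lambda>x. x) (pts (sp X))) = f"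
    "compose (pts (sp X)) (restrict (\<lambda>x. x) (pts (sp Y))) f = f"
    using f' by (auto simp: compose_def fun_eq_iff)
next
  fix X Y Z f g assume X: "X \<in> Ob C"
    and "f \<in> {f \<in> Lin (sp X) (sp Y). \<forall>t\<in>D X. act Y (T X Y f t) = T X Y f (act X t)}"
    and "g \<in> {f \<in> Lin (sp Y) (sp Z). \<forall>t\<in>D Y. act Z (T Y Z f t) = T Y Z f (act Y t)}"
  then have fg: "f \<in> Lin (sp X) (sp Y)" "g \<in> Lin (sp Y) (sp Z)"
    and f: "\<And>t. t \<in> D X \<Longrightarrow> act Y (T X Y f t) = T X Y f (act X t)"
    and g: "\<And>t. t \<in> D Y \<Longrightarrow> act Z (T Y Z g t) = T Y Z g (act Y t)"
    by simp_all
  show "compose (pts (sp X)) g f \<in>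
      {f \<in> Lin (sp X) (sp Z). \<forall>t\<in>D X. act Z (T X Z f t) = T X Z f (act X t)}"
    using compose_Lin[OF V[OF X] fg]
    by (simp add: T_comp[OF X fg] act[OF X] f g T[OF fg(1)])
next
  fix W X Y Z f g h
  assume "f \<in> {f \<in> Lin (sp W) (sp X). \<forall>t\<in>D W. act X (T W X f t) = T W X f (act W t)}"
  then have "x \<in> pts (sp W) \<Longrightarrow> f x \<in> pts (sp X)" for x
    by (auto simp: Lin_def is_linear_def)
  then show "compose (pts (sp W)) (compose (pts (sp X)) h g) f =
      compose (pts (sp W)) h (compose (pts (sp W)) g f)"
    by (auto simp: compose_def fun_eq_iff)
qed

context regular_wmb
begin

lemma is_category_left: "is_category (left_comodules :: (('k, 'v::ab_group_add) space \<times> _ \<times> _, 'v \<Rightarrow> 'v) cat)"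
proof (rule is_category_linear[where sp = fst and D = "\<lambda>X. pts (A \<odot> fst X)" and act = "\<lambda>X. fst (snd X)"
      and T = "\<lambda>X Y. tmap A (fst X) A (fst Y) (\<lambda>y. y)"])
  fix X Y Z :: "('k, 'v::ab_group_add) space \<times> (('k, 'a, 'v) tensor \<Rightarrow> ('k, 'a, 'v) tensor) \<times>
     (('k, 'a, 'v) tensor \<Rightarrow> ('k, 'a, 'v) tensor)"
  fix f g
  show "Hom left_comodules X Y = {f \<in> Lin (fst X) (fst Y). \<forall>t\<in>pts (A \<odot> fst X).
        fst (snd Y) (tmap A (fst X) A (fst Y) (\<lambda>y. y) f t) = tmap A (fst X) A (fst Y) (\<lambda>y. y) f (fst (snd X) t)}"
    "Ident left_comodules X = restrict (\<lambda>x. x) (pts (fst X))"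
    "Comp left_comodules X Y Z g f = compose (pts (fst X)) g f"
    by (simp_all add: left_comodules_def split_beta)
  fix t assume t: "t \<in> pts (A \<odot> fst X)"
  show "tmap A (fst X) A (fst Y) (\<lambda>y. y) f t \<in> pts (A \<odot> fst Y)" if f: "f \<in> Lin (fst X) (fst Y)"
    using LinD[OF tmap_Lin[OF is_linear_id[of A] LinD[OF f]]] t by (simp add: is_linear_def)
  assume "X \<in> Ob left_comodules"
  then have X: "vspace (fst X)" and lam: "fst (snd X) \<in> Lin (A \<odot> fst X) (A \<odot> fst X)"
    by (auto simp: left_comodules_def left_comodule_def)
  show "fst (snd X) t \<in> pts (A \<odot> fst X)"
    using LinD[OF lam] t by (simp add: is_linear_def)
  show "tmap A (fst X) A (fst X) (\<lambda>y. y) (restrict (\<lambda>x. x) (pts (fst X))) t = t"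
    by (rule tmap_id[OF alg_vspace is_linear_id refl LinD[OF restrict_Lin[OF X]] restrict_apply' t])
  assume f: "f \<in> Lin (fst X) (fst Y)" and g: "g \<in> Lin (fst Y) (fst Z)"
  show "tmap A (fst X) A (fst Z) (\<lambda>y. y) (compose (pts (fst X)) g f) t =
      tmap A (fst Y) A (fst Z) (\<lambda>y. y) g (tmap A (fst X) A (fst Y) (\<lambda>y. y) f t)"
    by (rule tmap_comp[OF alg_vspace is_linear_id is_linear_id LinD[OF f] LinD[OF g] is_linear_id refl
          LinD[OF compose_Lin[OF X f g]] compose_eq t])
qed (auto simp: left_comodules_def left_comodule_def)

lemma is_category_right: "is_category (right_comodules :: (('k, 'v::ab_group_add) space \<times> _ \<times> _, 'v \<Rightarrow> 'v) cat)"
proof (rule is_category_linear[where sp = fst and D = "\<lambda>X. pts (fst X \<odot> A)" and act = "\<lambda>X. fst (snd X)"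
      and T = "\<lambda>X Y f. tmap (fst X) A (fst Y) A f (\<lambda>y. y)"])
  fix X Y Z :: "('k, 'v::ab_group_add) space \<times> (('k, 'v, 'a) tensor \<Rightarrow> ('k, 'v, 'a) tensor) \<times>
     (('k, 'v, 'a) tensor \<Rightarrow> ('k, 'v, 'a) tensor)"
  fix f g
  show "Hom right_comodules X Y = {f \<in> Lin (fst X) (fst Y). \<forall>t\<in>pts (fst X \<odot> A).
        fst (snd Y) (tmap (fst X) A (fst Y) A f (\<lambda>y. y) t) = tmap (fst X) A (fst Y) A f (\<lambda>y. y) (fst (snd X) t)}"
    "Ident right_comodules X = restrict (\<lambda>x. x) (pts (fst X))"
    "Comp right_comodules X Y Z g f = compose (pts (fst X)) g f"
    by (simp_all add: right_comodules_def split_beta)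
  fix t assume t: "t \<in> pts (fst X \<odot> A)"
  show "tmap (fst X) A (fst Y) A f (\<lambda>y. y) t \<in> pts (fst Y \<odot> A)" if f: "f \<in> Lin (fst X) (fst Y)"
    using LinD[OF tmap_Lin[OF LinD[OF f] is_linear_id[of A]]] t by (simp add: is_linear_def)
  assume "X \<in> Ob right_comodules"
  then have X: "vspace (fst X)" and lam: "fst (snd X) \<in> Lin (fst X \<odot> A) (fst X \<odot> A)"
    by (auto simp: right_comodules_def right_comodule_def)
  show "fst (snd X) t \<in> pts (fst X \<odot> A)"
    using LinD[OF lam] t by (simp add: is_linear_def)
  show "tmap (fst X) A (fst X) A (restrict (\<lambda>x. x) (pts (fst X))) (\<lambda>y. y) t = t"
    by (rule tmap_id[OF X LinD[OF restrict_Lin[OF X]] restrict_apply' is_linear_id refl t])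
  assume f: "f \<in> Lin (fst X) (fst Y)" and g: "g \<in> Lin (fst Y) (fst Z)"
  show "tmap (fst X) A (fst Z) A (compose (pts (fst X)) g f) (\<lambda>y. y) t =
      tmap (fst Y) A (fst Z) A g (\<lambda>y. y) (tmap (fst X) A (fst Y) A f (\<lambda>y. y) t)"
    by (rule tmap_comp[OF X LinD[OF f] LinD[OF g] is_linear_id is_linear_id
          LinD[OF compose_Lin[OF X f g]] compose_eq is_linear_id refl t])
qed (auto simp: right_comodules_def right_comodule_def)

end

context full_antipode
begin

text \<open>
  By \<open>leg_faithful\<close> the tests \<open>1 \<otimes> c S(d)\<close> decide, and they express \<open>\<lambda>\<^sup>S\<close> through \<open>\<lambda>\<close>, with which
  \<open>f\<close> commutes.
\<close>

lemma lamS_morphism: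
  fixes V V' :: "('k, 'v::ab_group_add) space"
  assumes C: "left_comodule V lam rho" and C': "left_comodule V' lam' rho'"
    and f: "is_linear V V' f"
    and mor: "\<forall>t\<in>pts (A \<odot> V). lam' (tmap A V A V' (\<lambda>y. y) f t) = tmap A V A V' (\<lambda>y. y) f (lam t)"
    and t: "t \<in> pts (V \<odot> A)"
  shows "lamS S V' rho' (tmap V A V' A f (\<lambda>y. y) t) = tmap V A V' A f (\<lambda>y. y) (lamS S V rho t)"
proof -
  interpret C: comodule_over_antipode H S R1 R2 G1 G2 V lam rho
    by unfold_locales (rule C)
  interpret C': comodule_over_antipode H S R1 R2 G1 G2 V' lam' rho'
    by unfold_locales (rule C')
  note tf = tmap[OF f is_linear_id[of A]]
  show ?thesis
  proof (rule linear_eqI[OF C.V is_linear_comp[OF LinD[OF tf(1)] LinD[OF C'.L_Lin]]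
        is_linear_comp[OF LinD[OF C.L_Lin] LinD[OF tf(1)]] _ t])
    fix v x assume v: "v \<in> pts V"
    have fV: "w \<in> pts V \<Longrightarrow> f w \<in> pts V'" for w using f by (simp add: is_linear_def)
    note fv = fV[OF v]
    show "lamS S V' rho' (tmap V A V' A f (\<lambda>y. y) (v \<otimes>\<^bsub>V,A\<^esub> x)) =
      tmap V A V' A f (\<lambda>y. y) (lamS S V rho (v \<otimes>\<^bsub>V,A\<^esub> x))"
    proof (rule leg_faithful[OF C'.V separating_sr])
      show "lamS S V' rho' (tmap V A V' A f (\<lambda>y. y) (v \<otimes>\<^bsub>V,A\<^esub> x)) \<in> pts (V' \<odot> A)"
        using C'.L_closed[OF fv] v by (simp add: tf(2))
      show "tmap V A V' A f (\<lambda>y. y) (lamS S V rho (v \<otimes>\<^bsub>V,A\<^esub> x)) \<in> pts (V' \<odot> A)"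
        using LinD[OF tf(1)] C.L_closed[OF v] by (simp add: is_linear_def)
      fix j :: "'a \<times> 'a"
      obtain c d where j: "j = (c, d)" by (cases j)
      note op = linop_mult_id(1)[of "sr c d", unfolded linop_def]
      have "tmap V' A V' A (\<lambda>w. w) ((*) (sr c d)) (tmap V A V' A f (\<lambda>y. y) (lamS S V rho (v \<otimes>\<^bsub>V,A\<^esub> x))) =
          tmap V A V' A f ((*) (sr c d)) (lamS S V rho (v \<otimes>\<^bsub>V,A\<^esub> x))"
        by (rule tmap_comp[symmetric, OF C.V f is_linear_id is_linear_id op f refl op refl C.L_closed[OF v]])
      also have "\<dots> = tmap V A V' A f (\<lambda>y. y) (tmap V A V A (\<lambda>w. w) ((*) (sr c d)) (lamS S V rho (v \<otimes>\<^bsub>V,A\<^esub> x)))"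
        by (rule tmap_comp[OF C.V is_linear_id f op is_linear_id f refl op refl C.L_closed[OF v]])
      also have "\<dots> = tmap V A V' A f (\<lambda>y. y) (C.lv d v \<rhd> (\<lambda>u w. w \<otimes>\<^bsub>V,A\<^esub> (sr c u * x)))"
        using C.L_test[OF v] by simp
      also have "\<dots> = (C.lv d v \<rhd> (\<lambda>u w. f w \<otimes>\<^bsub>V',A\<^esub> (sr c u * x)))"
      proof -
        have "tmap V A V' A f (\<lambda>y. y) (C.lv d v \<rhd> (\<lambda>u w. w \<otimes>\<^bsub>V,A\<^esub> (sr c u * x))) =
            C.lv d v \<rhd> (\<lambda>u w. tmap V A V' A f (\<lambda>y. y) (w \<otimes>\<^bsub>V,A\<^esub> (sr c u * x)))"
          by (rule ev_linear[OF vspace_tensor_space LinD[OF tf(1)]])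
            (simp add: pure_in_tensor_space C.lv_mem[OF v])
        also have "\<dots> = (C.lv d v \<rhd> (\<lambda>u w. f w \<otimes>\<^bsub>V',A\<^esub> (sr c u * x)))"
          by (rule ev_cong[OF refl]) (simp add: tf(2) C.lv_mem[OF v])
        finally show ?thesis .
      qed
      also have "\<dots> = (C'.lv d (f v) \<rhd> (\<lambda>u w. w \<otimes>\<^bsub>V',A\<^esub> (sr c u * x)))"
      proof (rule tensor_eqI)
        show "(C.lv d v \<rhd> (\<lambda>u w. f w \<otimes>\<^bsub>V',A\<^esub> (sr c u * x))) \<in> pts (V' \<odot> A)"
          "(C'.lv d (f v) \<rhd> (\<lambda>u w. w \<otimes>\<^bsub>V',A\<^esub> (sr c u * x))) \<in> pts (V' \<odot> A)"
          by (rule ev_closed; simp add: pure_in_tensor_space fV C.lv_mem[OF v] C'.lv_mem[OF fv])+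
        fix \<beta> assume \<beta>: "is_bilinear V' A ground \<beta>"
        have "is_bilinear A V' ground (\<lambda>u w. \<beta> w u)" using \<beta> by (simp add: is_bilinear_def)
        then have b: "is_bilinear A V' ground (\<lambda>u w. \<beta> w (sr c u * x))"
          by (rule C'.bilinear_leg) simp
        have "tmap A V A V' (\<lambda>y. y) f (lam (d \<otimes>\<^bsub>A,V\<^esub> v)) = lam' (d \<otimes>\<^bsub>A,V'\<^esub> f v)"
          using mor[rule_format, of "d \<otimes>\<^bsub>A,V\<^esub> v"] v
          by (simp add: tmap_pure[OF is_linear_id f] pure_in_tensor_space)
        from eval_ext[OF this, of "\<lambda>u w. \<beta> w (sr c u * x)"]
        have "C.lv d v \<rhd> (\<lambda>u w. \<beta> (f w) (sr c u * x)) = C'.lv d (f v) \<rhd> (\<lambda>u w. \<beta> w (sr c u * x))"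
          unfolding C.lv_def C'.lv_def
          by (simp add: tmap_eval[OF alg_vspace alg_vspace is_linear_id f C.lam_closed[OF v] b]
              tensor_eval[OF alg_vspace C'.lam_closed[OF fv] b])
        then show "(C.lv d v \<rhd> (\<lambda>u w. f w \<otimes>\<^bsub>V',A\<^esub> (sr c u * x))) \<beta> =
            (C'.lv d (f v) \<rhd> (\<lambda>u w. w \<otimes>\<^bsub>V',A\<^esub> (sr c u * x))) \<beta>"
          using \<beta> by (simp add: ev_apply pure_def)
      qed
      also have "\<dots> = tmap V' A V' A (\<lambda>w. w) ((*) (sr c d)) (lamS S V' rho' (f v \<otimes>\<^bsub>V',A\<^esub> x))"
        using C'.L_test[OF fv] by simp
      finally show "tmap V' A V' A (\<lambda>w. w) (case j of (c, d) \<Rightarrow> \<lambda>y. sr c d * y)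
          (lamS S V' rho' (tmap V A V' A f (\<lambda>y. y) (v \<otimes>\<^bsub>V,A\<^esub> x))) =
        tmap V' A V' A (\<lambda>w. w) (case j of (c, d) \<Rightarrow> \<lambda>y. sr c d * y)
          (tmap V A V' A f (\<lambda>y. y) (lamS S V rho (v \<otimes>\<^bsub>V,A\<^esub> x)))"
        using v unfolding j by (simp add: tf(2))
    qed
  qed
qed

lemma twist_comodule:
  fixes V :: "('k, 'v::ab_group_add) space"
  assumes "left_comodule V lam rho"
  shows "\<exists>!L. is_lamS S V rho L" "\<exists>!R. is_rhoS S V lam R"
    "right_comodule V (lamS S V rho) (rhoS S V lam)"
proof -
  interpret C: comodule_over_antipode H S R1 R2 G1 G2 V lam rho
    by unfold_locales (rule assms)
  show "\<exists>!L. is_lamS S V rho L" "\<exists>!R. is_rhoS S V lam R"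
    "right_comodule V (lamS S V rho) (rhoS S V lam)"
    by (rule C.ex1_lamS C.ex1_rhoS C.right_comodule)+
qed

lemma twist_functor:
  "is_functor (left_comodules :: (('k, 'v::ab_group_add) space \<times> _ \<times> _, 'v \<Rightarrow> 'v) cat) right_comodules
    (\<lambda>(V, lam, rho). (V, lamS S V rho, rhoS S V lam)) (\<lambda>_ _ f. f)"
  unfolding is_functor_def
proof (intro conjI ballI is_category_left is_category_right)
  let ?F = "\<lambda>(V, lam, rho). (V, lamS S V rho, rhoS S V lam)"
  fix X :: "('k, 'v) space \<times> (('k, 'a, 'v) tensor \<Rightarrow> ('k, 'a, 'v) tensor) \<times>
     (('k, 'a, 'v) tensor \<Rightarrow> ('k, 'a, 'v) tensor)"
  assume X: "X \<in> Ob left_comodules"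
  obtain V lam rho where X': "X = (V, lam, rho)" by (cases X)
  have C: "left_comodule V lam rho" using X by (simp add: X' left_comodules_def)
  show "?F X \<in> Ob right_comodules"
    using twist_comodule(3)[OF C] by (simp add: X' right_comodules_def)
  show "Ident left_comodules X = Ident right_comodules (?F X)"
    by (simp add: X' left_comodules_def right_comodules_def)
  fix Y :: "('k, 'v) space \<times> (('k, 'a, 'v) tensor \<Rightarrow> ('k, 'a, 'v) tensor) \<times>
     (('k, 'a, 'v) tensor \<Rightarrow> ('k, 'a, 'v) tensor)"
  assume Y: "Y \<in> Ob left_comodules"
  obtain V' lam' rho' where Y': "Y = (V', lam', rho')" by (cases Y)
  have C': "left_comodule V' lam' rho'" using Y by (simp add: Y' left_comodules_def)
  show "f \<in> Hom right_comodules (?F X) (?F Y)" if "f \<in> Hom left_comodules X Y" for f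
  proof -
    have f: "f \<in> Lin V V'" and
      mor: "\<forall>t\<in>pts (A \<odot> V). lam' (tmap A V A V' (\<lambda>y. y) f t) = tmap A V A V' (\<lambda>y. y) f (lam t)"
      using that by (simp_all add: X' Y' left_comodules_def)
    show ?thesis
      using f lamS_morphism[OF C C' LinD[OF f] mor] by (simp add: X' Y' right_comodules_def)
  qed
next
  let ?F = "\<lambda>(V, lam, rho). (V, lamS S V rho, rhoS S V lam)"
  fix X Y Z :: "('k, 'v) space \<times> (('k, 'a, 'v) tensor \<Rightarrow> ('k, 'a, 'v) tensor) \<times>
     (('k, 'a, 'v) tensor \<Rightarrow> ('k, 'a, 'v) tensor)" and f g
  show "Comp left_comodules X Y Z g f = Comp right_comodules (?F X) (?F Y) (?F Z) g f"
    by (simp add: left_comodules_def right_comodules_def split_beta)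
qed

end

theorem theorem6p3:
  fixes H :: "('k::field, 'a::ring) wmb_data"
    and S :: "'a \<Rightarrow> ('a \<Rightarrow> 'a) \<times> ('a \<Rightarrow> 'a)"
  assumes "regular_wmb H"
    and "wmb.right_full H" and "wmb.left_full H"
    and "wmb.antipode H S"
  shows "(\<forall>(V :: ('k, 'v::ab_group_add) space) lam rho. wmb.left_comodule H V lam rho \<longrightarrow>
            (\<exists>!L. wmb.is_lamS H S V rho L) \<and> (\<exists>!R. wmb.is_rhoS H S V lam R) \<and>
            wmb.right_comodule H V (wmb.lamS H S V rho) (wmb.rhoS H S V lam)) \<and>
         is_functor
           (wmb.left_comodules H :: (('k, 'v) space \<times> _ \<times> _, 'v \<Rightarrow> 'v) cat)
           (wmb.right_comodules H)
           (\<lambda>(V, lam, rho). (V, wmb.lamS H S V rho, wmb.rhoS H S V lam))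
           (\<lambda>_ _ f. f)"
proof -
  interpret regular_wmb H by (rule assms(1))
  obtain R1 R2 G1 G2 where R: "\<forall>a. S a \<in> multipliers" "R1 \<in> endo" "R2 \<in> endo" "is_G1 G1" "is_G2 G2"
    "\<forall>t\<in>pts (A \<odot> A).
       R1 (T1 H t) = G1 t \<and> T1 H (R1 t) = E1 H t \<and> R1 (T1 H (R1 t)) = R1 t \<and>
       R2 (T2 H t) = G2 t \<and> T2 H (R2 t) = E2 H t \<and> R2 (T2 H (R2 t)) = R2 t"
    "\<forall>a b. lact (S a) b = eps_id (R1 (a \<otimes> b)) \<and> ract b (S a) = id_eps (R2 (b \<otimes> a))"
    using assms(4) unfolding antipode_def by blast
  interpret full_antipode H S R1 R2 G1 G2
  proof unfold_locales
    fix t :: "('k, 'a, 'a) tensor"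
    assume t: "t \<in> pts (A \<odot> A)"
    note * = R(6)[rule_format, OF t]
    show "R1 (T1 H t) = G1 t" "T1 H (R1 t) = E1 H t" "R1 (T1 H (R1 t)) = R1 t"
      "R2 (T2 H t) = G2 t" "T2 H (R2 t) = E2 H t" "R2 (T2 H (R2 t)) = R2 t"
      using * by blast+
  qed (use R assms(2,3) in blast)+
  show ?thesis
    using twist_comodule twist_functor by blast
qed

end
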